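(* Let $W$ be a graphon such that $W$ and $x\mapsto W(x,x)$ are Riemann integrable and $\int_{[0,1]^2}W(x,y)\,dx\,dy>0$. Fix $0<\beta<1/\|W\|_{\mathrm{op}}$. Let $\theta_N\in(0,1)$ and $G_N\sim G(N,\theta_N,W)$, with (random) partition function $Z_N(\beta)$. Then, as $N\to\infty$: (1) If $\theta_N\gg N^{-1/2}$ and $\theta_N\to\theta\in[0,1]$, then $$\sqrt{N\theta_N}\left(\log Z_N(\beta)-\log\mathbb EZ_N(\beta)\right)\xrightarrow{D}\mathcal N\left(0,\frac{\beta^2}{4}\int_0^1W(x,x)(1-\theta W(x,x))\,dx\right).$$ (2) If $\theta_N\sim cN^{-1/2}$ for some $c\in(0,\infty)$, then $$N\theta_N^{3/2}\left(\log Z_N(\beta)-\log\mathbb EZ_N(\beta)\right)\xrightarrow{D}\mathcal N\left(0,\frac{\beta^4}{8}\int_{[0,1]^2}W(x,y)\,dx\,dy+\frac{\beta^2c^2}{4}\int_0^1W(x,x)\,dx\right).$$ (3) If $N^{-2/3}\ll\theta_N\ll N^{-1/2}$, then $$N\theta_N^{3/2}\left(\log Z_N(\beta)-\log\mathbb EZ_N(\beta)\right)\xrightarrow{D}\mathcal N\left(0,\frac{\beta^4}{8}\int_{[0,1]^2}W(x,y)\,dx\,dy\right).$$ (4) If $\theta_N\sim cN^{-2/3}$ for some $c\in(0,\infty)$, then $$\log Z_N(\beta)-\frac{\beta^2}{4N^2\theta_N}\sum_{1\le i,j\le N}W\left(\frac iN,\frac jN\right)\xrightarrow{D}\mathcal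 N\left(\mu_W,\frac{\beta^4}{8c^3}\int_{[0,1]^2}W(x,y)\,dx\,dy\right),$$ with $$\mu_W:=\frac\beta2\int_0^1W(x,x)\,dx-\frac{\beta^2}{4}\int_{[0,1]^2}W(x,y)\left(\frac{\beta^2}{6c^3}+W(x,y)\right)dx\,dy-\frac12\sum_{\lambda\in\mathrm{Spec}(W)}\left(\log(1-\beta\lambda)+\beta\lambda\right).$$ Consequently, if $W$ is $\alpha$-Hölder continuous with $\alpha>\frac23$, then $$\log Z_N(\beta)-\frac{\beta^2}{4\theta_N}\int_{[0,1]^2}W(x,y)\,dx\,dy\xrightarrow{D}\mathcal N\left(\mu_W,\frac{\beta^4}{8c^3}\int_{[0,1]^2}W(x,y)\,dx\,dy\right).$$ (5) If $N^{-1}\ll\theta_N\ll N^{-2/3}$, then $$N\theta_N^{3/2}\left(\log Z_N(\beta)-\theta_N\log\cosh\left(\frac{\beta}{N\theta_N}\right)\sum_{1\le i<j\le N}W\left(\frac iN,\frac jN\right)\right)\xrightarrow{D}\mathcal N\left(0,\frac{\beta^4}{8}\int_{[0,1]^2}W(x,y)\,dx\,dy\right).$$ Consequently, if $W$ is $\alpha$-Hölder continuous with $\alpha\ge\frac23$, then $$N\theta_N^{3/2}\left(\log Z_N(\beta)-\frac{N^2\theta_N}{2}\log\cosh\left(\frac{\beta}{N\theta_N}\right)\int_{[0,1]^2}W(x,y)\,dx\,dy\right)\xrightarrow{D}\mathcal N\left(0,\frac{\beta^4}{8}\int_{[0,1]^2}W(x,y)\,dx\,dy\right).$$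
   Context: A graphon is a symmetric measurable function $W:[0,1]^2\to[0,1]$. $T_W:L^2[0,1]\to L^2[0,1]$ is the operator $(T_Wf)(x)=\int_0^1W(x,y)f(y)\,dy$; $\|W\|_{\mathrm{op}}$ is its operator norm; $\mathrm{Spec}(W)$ is the countable multiset of its non-zero eigenvalues (with multiplicity). $W$ is $\alpha$-Hölder continuous, $\alpha\in(0,1]$, if there is $C>0$ with $|W(x,y)-W(x',y')|\le C\left(\sqrt{(x-x')^2+(y-y')^2}\right)^\alpha$ for all $(x,y),(x',y')\in[0,1]^2$. $G_N\sim G(N,\theta_N,W)$ is the random graph (self-loops allowed) on $\{1,\dots,N\}$ with symmetric adjacency matrix $A_{G_N}$ whose entries $A_{G_N}(i,j)$, $1\le i\le j\le N$, are independent Bernoulli with parameters $\theta_NW(\frac iN,\frac jN)$. The partition function is $$Z_N(\beta)=\frac{1}{2^N}\sum_{\vec\sigma\in\{-1,1\}^N}\exp\left(\frac{\beta}{2N\theta_N}\sum_{1\le i,j\le N}A_{G_N}(i,j)\sigma_i\sigma_j\right),$$ and $\mathbb EZ_N(\beta)$ is its expectation over $G_N$. $a_N\ll b_N$ (equivalently $b_N\gg a_N$) means $a_N/b_N\to0$, and $a_N\sim b_N$ means $a_N/b_N\to1$. $\xrightarrow{D}$ denotes convergence in distribution; a normal law with zero variance is a point mass. *)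

theory Defs
  imports "HOL-Probability.Probability"
begin

section \<open>Graphons\<close>

abbreviation unit_square :: "(real \<times> real) set" where
  "unit_square \<equiv> {0..1} \<times> {0..1}"

text \<open>Values of \<open>W\<close> outside the unit square are unconstrained and never used.
  Measurability is Lebesgue measurability on the square, which covers Borel graphons.\<close>

definition graphon :: "(real \<times> real \<Rightarrow> real) \<Rightarrow> bool" where
  "graphon W \<longleftrightarrow>
     W \<in> borel_measurable (lebesgue_on unit_square) \<and>
     (\<forall>x\<in>{0..1}. \<forall>y\<in>{0..1}. W (x, y) = W (y, x)) \<and>
     (\<forall>p\<in>unit_square. W p \<in> {0..1})"

text \<open>The library's \<^term>\<open>f integrable_on cbox a b\<close> is the Henstock--Kurzweil notion. Riemann
  integrability demands that the gauge be constant: all Riemann sums whose cells are small enough,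
  uniformly, are close to the integral.\<close>

definition riemann_integrable_on ::
    "('a::euclidean_space \<Rightarrow> real) \<Rightarrow> 'a set \<Rightarrow> bool" (infixr "riemann'_integrable'_on" 46) where
  "f riemann_integrable_on S \<longleftrightarrow>
     (\<exists>I. \<forall>e>0. \<exists>d>0. \<forall>p. p tagged_division_of S \<and> (\<lambda>x. ball x d) fine p \<longrightarrow>
        \<bar>(\<Sum>(x, K)\<in>p. measure lborel K * f x) - I\<bar> < e)"

definition holder_graphon :: "real \<Rightarrow> (real \<times> real \<Rightarrow> real) \<Rightarrow> bool" where
  "holder_graphon \<alpha> W \<longleftrightarrow> 0 < \<alpha> \<and> \<alpha> \<le> 1 \<and>
     (\<exists>C>0. \<forall>x\<in>{0..1}. \<forall>y\<in>{0..1}. \<forall>x'\<in>{0..1}. \<forall>y'\<in>{0..1}.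
        \<bar>W (x, y) - W (x', y')\<bar> \<le> C * sqrt ((x - x')\<^sup>2 + (y - y')\<^sup>2) powr \<alpha>)"

section \<open>The integral operator of a graphon\<close>

text \<open>Elements of $L^2[0,1]$ are represented by square-integrable functions; equality in $L^2$ is
  equality almost everywhere.\<close>

definition L2_unit :: "(real \<Rightarrow> real) set" where
  "L2_unit = {f \<in> borel_measurable (lebesgue_on {0..1}).
                integrable (lebesgue_on {0..1}) (\<lambda>x. (f x)\<^sup>2)}"

definition L2_unit_norm :: "(real \<Rightarrow> real) \<Rightarrow> real" where
  "L2_unit_norm f = sqrt (\<integral>x. (f x)\<^sup>2 \<partial>lebesgue_on {0..1})"

definition graphon_op :: "(real \<times> real \<Rightarrow> real) \<Rightarrow> (real \<Rightarrow> real) \<Rightarrow> real \<Rightarrow> real" where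
  "graphon_op W f x = (\<integral>y. W (x, y) * f y \<partial>lebesgue_on {0..1})"

definition graphon_op_norm :: "(real \<times> real \<Rightarrow> real) \<Rightarrow> real" where
  "graphon_op_norm W = (SUP f\<in>{f \<in> L2_unit. L2_unit_norm f \<le> 1}. L2_unit_norm (graphon_op W f))"

definition eigenspace :: "(real \<times> real \<Rightarrow> real) \<Rightarrow> real \<Rightarrow> (real \<Rightarrow> real) set" where
  "eigenspace W l = {f \<in> L2_unit. AE x in lebesgue_on {0..1}. graphon_op W f x = l * f x}"

text \<open>The dimension of the eigenspace as a subspace of $L^2[0,1]$: the supremum of the lengths of
  families that are linearly independent modulo almost-everywhere equality. It is positive exactly
  if \<open>l\<close> is an eigenvalue.\<close>

definition eigen_multiplicity :: "(real \<times> real \<Rightarrow> real) \<Rightarrow> real \<Rightarrow> enat" where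
  "eigen_multiplicity W l =
     (SUP n\<in>{n. \<exists>f :: nat \<Rightarrow> real \<Rightarrow> real. (\<forall>i<n. f i \<in> eigenspace W l) \<and>
                (\<forall>c :: nat \<Rightarrow> real. (AE x in lebesgue_on {0..1}. (\<Sum>i<n. c i * f i x) = 0) \<longrightarrow>
                       (\<forall>i<n. c i = 0))}. enat n)"

text \<open>The multiset of non-zero eigenvalues may be infinite, so it is encoded as a set of pairs
  \<open>(l, k)\<close>, with \<open>k\<close> numbering the copies of \<open>l\<close>. As \<^const>\<open>graphon_op\<close> of a graphon is
  self-adjoint, all its eigenvalues are real.\<close>

definition graphon_spec :: "(real \<times> real \<Rightarrow> real) \<Rightarrow> (real \<times> nat) set" where
  "graphon_spec W = {(l, k). l \<noteq> 0 \<and> enat k < eigen_multiplicity W l}"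

section \<open>Random graphs and the partition function\<close>

text \<open>\<open>A i j \<omega>\<close> tells whether \<open>{i, j}\<close> is an edge (a loop if \<open>i = j\<close>); the 0/1 entry of the
  adjacency matrix is \<^term>\<open>of_bool (A i j \<omega>)\<close>.\<close>

definition random_graph ::
    "'a measure \<Rightarrow> nat \<Rightarrow> real \<Rightarrow> (real \<times> real \<Rightarrow> real) \<Rightarrow> (nat \<Rightarrow> nat \<Rightarrow> 'a \<Rightarrow> bool) \<Rightarrow> bool" where
  "random_graph M N t W A \<longleftrightarrow>
     prob_space M \<and>
     (\<forall>\<omega>\<in>space M. \<forall>i\<in>{1..N}. \<forall>j\<in>{1..N}. A i j \<omega> = A j i \<omega>) \<and>
     prob_space.indep_vars M (\<lambda>_. count_space UNIV) (\<lambda>(i, j). A i j)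
       {(i, j). 1 \<le> i \<and> i \<le> j \<and> j \<le> N} \<and>
     (\<forall>i j. 1 \<le> i \<and> i \<le> j \<and> j \<le> N \<longrightarrow>
        distr M (count_space UNIV) (A i j) =
        measure_pmf (bernoulli_pmf (t * W (real i / real N, real j / real N))))"

definition partition_fun ::
    "real \<Rightarrow> nat \<Rightarrow> real \<Rightarrow> (nat \<Rightarrow> nat \<Rightarrow> 'a \<Rightarrow> bool) \<Rightarrow> 'a \<Rightarrow> real" where
  "partition_fun \<beta> N t A \<omega> =
     1 / 2 ^ N * (\<Sum>\<sigma> \<in> {1..N} \<rightarrow>\<^sub>E {-1, 1 :: real}.
        exp (\<beta> / (2 * real N * t) * (\<Sum>i=1..N. \<Sum>j=1..N. of_bool (A i j \<omega>) * \<sigma> i * \<sigma> j)))"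

section \<open>Convergence in distribution to a normal law\<close>

text \<open>The second parameter is the variance, whereas \<^const>\<open>normal_density\<close> takes the standard
  deviation.\<close>

definition normal_law :: "real \<Rightarrow> real \<Rightarrow> real measure" where
  "normal_law m v =
     (if v = 0 then return borel m else density lborel (\<lambda>x. ennreal (normal_density m (sqrt v) x)))"

text \<open>The variables \<open>X N\<close> may live on different probability spaces.\<close>

definition converges_to_normal ::
    "(nat \<Rightarrow> 'a measure) \<Rightarrow> (nat \<Rightarrow> 'a \<Rightarrow> real) \<Rightarrow> real \<Rightarrow> real \<Rightarrow> bool" where
  "converges_to_normal M X m v \<longleftrightarrow> weak_conv_m (\<lambda>N. distr (M N) borel (X N)) (normal_law m v)"

definition much_less :: "(nat \<Rightarrow> real) \<Rightarrow> (nat \<Rightarrow> real) \<Rightarrow> bool" (infix "\<lless>" 50) where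
  "a \<lless> b \<longleftrightarrow> (\<lambda>N. a N / b N) \<longlonglongrightarrow> 0"

definition asymp_equal :: "(nat \<Rightarrow> real) \<Rightarrow> (nat \<Rightarrow> real) \<Rightarrow> bool" (infix "\<simeq>" 50) where
  "a \<simeq> b \<longleftrightarrow> (\<lambda>N. a N / b N) \<longlonglongrightarrow> 1"

section \<open>The limiting mean at the critical sparsity\<close>

definition limit_mean :: "(real \<times> real \<Rightarrow> real) \<Rightarrow> real \<Rightarrow> real \<Rightarrow> real" where
  "limit_mean W \<beta> c =
     \<beta> / 2 * (\<integral>x. W (x, x) \<partial>lebesgue_on {0..1})
     - \<beta>\<^sup>2 / 4 * (\<integral>p. W p * (\<beta>\<^sup>2 / (6 * c ^ 3) + W p) \<partial>lebesgue_on unit_square)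
     - 1 / 2 * (\<Sum>\<^sub>\<infinity>(l, k)\<in>graphon_spec W. ln (1 - \<beta> * l) + \<beta> * l)"

end

theory Submission
  imports Defs "HOL-Real_Asymp.Real_Asymp"
begin

text \<open>
Put \<open>b = \<beta>/(N\<theta>)\<close>. As \<open>exp (b a e) = cosh b^a (1 + a tanh b e)\<close> for \<open>a \<in> {0,1}\<close>, \<open>e = \<plusminus>1\<close>, the partition
function is a product \<open>Z = Y \<cdot> Zh\<close> (\<open>partition_factor\<close>). Here \<open>ln Y\<close> is a weighted sum of the independent edge
indicators, with weight \<open>b/2\<close> on loops and \<open>ln (cosh b)\<close> on other edges, and \<open>Zh\<close> is the average over spins of
the product of the \<open>1 + tanh b A\<^sub>i\<^sub>j \<sigma>\<^sub>i \<sigma>\<^sub>j\<close> with \<open>i < j\<close>.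

All fluctuations come from \<open>ln Y\<close>: loops contribute variance of order \<open>1/(N\<theta>)\<close>, the other edges of order
\<open>1/(N\<^sup>2\<theta>\<^sup>3)\<close>. The two are comparable at \<open>\<theta> \<sim> N\<^sup>-\<^sup>1\<^sup>/\<^sup>2\<close>, the second becomes of order one at \<open>\<theta> \<sim> N\<^sup>-\<^sup>2\<^sup>/\<^sup>3\<close>.
The same \<open>1/(N\<^sup>2\<theta>\<^sup>3)\<close> bounds the gap between \<open>ln E Y\<close> and \<open>E ln Y\<close>, so that \<open>ln E Z\<close> is a good centring only
above \<open>N\<^sup>-\<^sup>2\<^sup>/\<^sup>3\<close>.

The factor \<open>Zh\<close> concentrates: its relative variance is of order \<open>(N\<theta>)\<^sup>-\<^sup>2\<close> (\<open>second_moment\<close>), which is negligible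
on every scale used. Two replicas of the spins express the second moment as a sum over sets of edges; single
edges are controlled by the correlations of a ferromagnetic Ising model whose coupling matrix is close to
\<open>\<beta>W/N\<close>, hence of operator norm below one, and the larger sets by an exponential moment.

The mean of \<open>Zh\<close> is computed from the partition function of that Ising model (\<open>psi_limit\<close>). The derivative
of its logarithm in the coupling is a sum of correlations. Griffiths' inequalities and \<open>tanh x \<le> x\<close> show that
the correlation matrix nearly solves a linear equation; its Neumann series produces the traces of the powers
of the matrix \<open>W/N\<close>. These converge to power sums of eigenvalues of the graphon operator because
Riemann integrability makes the step kernels converge to \<open>W\<close> in mean square. Summing the series gives the
logarithms of \<open>1 - \<beta>\<lambda>\<close>.
\<close>

section \<open>Correlation inequalities for ferromagnetic spins\<close>

abbreviation (input) seq_lim (infixr "---->" 60) where "X ----> L \<equiv> X \<longlonglongrightarrow> L"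
abbreviation (input) Ev (binder "EV " 10) where "Ev P \<equiv> eventually P sequentially"

definition spins :: "'i set => ('i => real) set" where
 "spins V = V \<rightarrow>\<^sub>E {-1, 1}"

text \<open>Nonnegative Fourier coefficients on the cube; only the parities of the exponents matter.\<close>

definition pos_fourier :: "'i set => (('i => real) => real) => bool" where
 "pos_fourier V F \<longleftrightarrow> (\<forall>m :: 'i => nat. 0 <= (\<Sum>s\<in>spins V. (\<Prod>k\<in>V. s k^m k) * F s))"

text \<open>A cone closed under sums, products and limits. It contains each single spin, hence the Gibbs weight of
every ferromagnet, which is how Griffiths' inequalities enter.\<close>

definition pos_mult :: "'i set => (('i => real) => real) => bool" where
 "pos_mult V P \<longleftrightarrow> (\<forall>F. pos_fourier V F --> pos_fourier V (%s. P s * F s))"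

lemma finite_spins: "finite V ==> finite (spins V)"
 unfolding spins_def by (intro finite_PiE) auto

lemma spins_sq: "s \<in> spins V ==> k \<in> V ==> s k * s k = 1"
 unfolding spins_def by (auto simp: PiE_iff)

lemma spins_nonempty: "spins V ~= {}"
 unfolding spins_def by (auto simp: PiE_eq_empty_iff)

lemma card_spins: "finite V ==> card (spins V) = 2^card V"
 unfolding spins_def by (subst card_PiE) (auto simp: numeral_2_eq_2)

lemma pos_fourier_1: assumes "finite V" shows "pos_fourier V (%_. 1)"
 unfolding pos_fourier_def
proof
 fix m :: "'a => nat"
 have "(\<Sum>s\<in>spins V. (\<Prod>k\<in>V. s k^m k)*1) = (\<Prod>k\<in>V. \<Sum>s\<in>{-1,1::real}. s^m k)"
  unfolding spins_def mult_1_right using assms by (subst prod_sum_PiE) auto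
 also have "\<dots> >= 0" by (intro prod_nonneg) (auto simp: minus_one_power_iff)
 finally show "0 <= (\<Sum>s\<in>spins V. (\<Prod>k\<in>V. s k^m k)*1)" .
qed

lemma pos_mult_sum_nonneg:
 assumes "finite V" "pos_mult V P" shows "0 <= (\<Sum>s\<in>spins V. P s)"
proof -
 have "pos_fourier V (%s. P s*1)"
  using assms(2) pos_fourier_1[OF assms(1)] unfolding pos_mult_def by (elim allE impE)
 then have "0 <= (\<Sum>s\<in>spins V. (\<Prod>k\<in>V. s k^((%_. 0::nat) k))*(P s*1))"
  unfolding pos_fourier_def by (elim allE)
 then show ?thesis by simp
qed

lemma pos_mult_const: "0 <= c ==> pos_mult V (%_. c)"
 unfolding pos_mult_def pos_fourier_def
 by (auto simp: mult.left_commute sum_distrib_left[symmetric] intro: mult_nonneg_nonneg)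

lemma pos_mult_add: "pos_mult V P ==> pos_mult V Q ==> pos_mult V (%s. P s + Q s)"
 unfolding pos_mult_def pos_fourier_def
 by (auto simp: algebra_simps sum.distrib intro!: add_nonneg_nonneg)

lemma pos_mult_mult: "pos_mult V P ==> pos_mult V Q ==> pos_mult V (%s. P s * Q s)"
 unfolding pos_mult_def by (auto simp: mult.assoc)

lemma pos_mult_sum: "(!!i. i \<in> I ==> pos_mult V (P i)) ==> pos_mult V (%s. \<Sum>i\<in>I. P i s)"
 by (induction I rule: infinite_finite_induct) (auto intro: pos_mult_add pos_mult_const)

lemma pos_mult_power: "pos_mult V P ==> pos_mult V (%s. P s^n)"
 by (induction n) (auto intro: pos_mult_mult pos_mult_const)

lemma pos_mult_spin: assumes "finite V" "k \<in> V" shows "pos_mult V (%s. s k)"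
 unfolding pos_mult_def pos_fourier_def
proof (intro allI impI)
 fix F and m :: "'a => nat"
 assume F: "\<forall>m :: 'a => nat. 0 <= (\<Sum>s\<in>spins V. (\<Prod>k\<in>V. s k^m k) * F s)"
 have eq: "(\<Prod>i\<in>V. s i^m i)*(s k * F s) = (\<Prod>i\<in>V. s i^(m(k := Suc (m k))) i) * F s" for s :: "'a => real"
  using assms by (simp add: prod.remove[of V k])
 show "0 <= (\<Sum>s\<in>spins V. (\<Prod>i\<in>V. s i^m i)*(s k * F s))"
  unfolding eq using F by blast
qed

lemma pos_mult_limit:
 assumes "finite V" and "!!n. pos_mult V (P n)" and "!!s. (%n. P n s) \<longlonglongrightarrow> Q s"
 shows "pos_mult V Q"
 unfolding pos_mult_def pos_fourier_def
proof (intro allI impI)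
 fix F and m :: "'a => nat"
 assume "\<forall>m :: 'a => nat. 0 <= (\<Sum>s\<in>spins V. (\<Prod>k\<in>V. s k^m k) * F s)"
 then have "0 <= (\<Sum>s\<in>spins V. (\<Prod>k\<in>V. s k^m k)*(P n s * F s))" for n
  using assms(2)[of n] unfolding pos_mult_def pos_fourier_def by blast
 moreover have "(%n. \<Sum>s\<in>spins V. (\<Prod>k\<in>V. s k^m k)*(P n s * F s))
  \<longlonglongrightarrow> (\<Sum>s\<in>spins V. (\<Prod>k\<in>V. s k^m k)*(Q s * F s))"
  by (intro tendsto_intros assms(3))
 ultimately show "0 <= (\<Sum>s\<in>spins V. (\<Prod>k\<in>V. s k^m k)*(Q s * F s))"
  using LIMSEQ_le_const by blast
qed

lemma pos_mult_power_series:
 assumes "finite V" "pos_mult V P" "!!n. 0 <= a n" "!!x. (%n. a n * x^n) sums f x"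
 shows "pos_mult V (%s. f (P s))"
proof (rule pos_mult_limit[OF assms(1)])
 show "pos_mult V (%s. \<Sum>i<n. a i * P s^i)" for n
  by (intro pos_mult_sum pos_mult_mult pos_mult_const pos_mult_power assms)
 show "(%n. \<Sum>i<n. a i * P s^i) \<longlonglongrightarrow> f (P s)" for s
  using assms(4)[of "P s"] unfolding sums_def .
qed

lemma pos_mult_exp:
 assumes "finite V" "pos_mult V P" shows "pos_mult V (%s. exp (P s))"
 by (rule pos_mult_power_series[OF assms, of "%n. inverse (fact n)"])
  (use exp_converges[where 'a=real] in \<open>auto simp: scaleR_conv_of_real\<close>)

text \<open>The power series \<open>x cosh x - sinh x\<close> has nonnegative coefficients. This is the positive form of
\<open>tanh x \<le> x\<close> for a random field \<open>x\<close>.\<close>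

lemma pos_mult_excess:
 assumes "finite V" "pos_mult V P" shows "pos_mult V (%s. P s * cosh (P s) - sinh (P s))"
proof (rule pos_mult_power_series[OF assms, of "%n. if even n then 0 else inverse (fact (n-1)) - inverse (fact n)"])
 fix x :: real
 have "(%n. if even n then 0 else x^n /\<^sub>R fact n) sums sinh x" by (rule sinh_converges)
 moreover have "(%n. if even n then x^n /\<^sub>R fact n else 0) sums cosh x" by (rule cosh_converges)
 then have "(%n. x*(if even n then x^n /\<^sub>R fact n else 0)) sums (x * cosh x)" by (rule sums_mult)
 then have "(%n. (case n of 0 => 0 | Suc m => x*(if even m then x^m /\<^sub>R fact m else 0))) sums (x * cosh x)"
  using sums_Suc[of "%n. (case n of 0 => 0 | Suc m => x*(if even m then x^m /\<^sub>R fact m else 0))" "x * cosh x"]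
  by simp
 ultimately have "(%n. (case n of 0 => 0 | Suc m => x*(if even m then x^m /\<^sub>R fact m else 0))
  - (if even n then 0 else x^n /\<^sub>R fact n)) sums (x * cosh x - sinh x)"
  by (intro sums_diff)
 also have "(%n. (case n of 0 => 0 | Suc m => x*(if even m then x^m /\<^sub>R fact m else 0))
  - (if even n then 0 else x^n /\<^sub>R fact n)) = (%n. (if even n then 0 else inverse (fact (n-1)) - inverse (fact n)) * x^n)"
  by (rule ext) (auto split: nat.split simp: field_simps)
 finally show "\<dots> sums (x * cosh x - sinh x)" .
qed (auto simp: fact_mono intro!: le_imp_inverse_le)

lemma sum_spins_flip:
 assumes "k \<in> V" shows "(\<Sum>s\<in>spins V. F s) = (\<Sum>s\<in>spins V. F (s(k := - s k)))"
 by (rule sum.reindex_bij_witness[of _ "%s. s(k := - s k)" "%s. s(k := - s k)"])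
  (use assms in \<open>auto simp: spins_def PiE_iff extensional_def\<close>)

locale ising =
 fixes V :: "'i set" and b :: "'i => 'i => real"
 assumes fin: "finite V"
  and b_nonneg: "!!i j. i \<in> V ==> j \<in> V ==> 0 <= b i j"
  and b_sym: "!!i j. i \<in> V ==> j \<in> V ==> b i j = b j i"
  and b_diag: "!!i. i \<in> V ==> b i i = 0"
begin

definition energy :: "('i => real) => real" where
 "energy s = (\<Sum>i\<in>V. \<Sum>j\<in>V. b i j * s i * s j)/2"

definition field :: "'i => ('i => real) => real" where
 "field k s = (\<Sum>l\<in>V. b k l * s l)"

definition total :: "(('i => real) => real) => real" where
 "total F = (\<Sum>s\<in>spins V. F s * exp (energy s))"

definition gibbs :: "(('i => real) => real) => real" where
 "gibbs F = total F/total (%_. 1)"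

lemma total_1_pos: "0 < total (%_. 1)"
 unfolding total_def using finite_spins[OF fin] spins_nonempty by (auto intro!: sum_pos)

lemma field_pos: "k \<in> V ==> pos_mult V (field k)"
 unfolding field_def by (intro pos_mult_sum pos_mult_mult pos_mult_const pos_mult_spin fin b_nonneg)

lemma energy_pos: "pos_mult V energy"
proof -
 have "pos_mult V (%s. (\<Sum>i\<in>V. \<Sum>j\<in>V. b i j * s i * s j)*(1/2))"
  by (intro pos_mult_sum pos_mult_mult pos_mult_const pos_mult_spin fin b_nonneg) auto
 then show ?thesis unfolding energy_def by simp
qed

lemma gibbs_nonneg: assumes "pos_mult V F" shows "0 <= gibbs F"
proof -
 have "0 <= total F"
  unfolding total_def
  by (rule pos_mult_sum_nonneg[OF fin pos_mult_mult[OF assms pos_mult_exp[OF fin energy_pos]]])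
 then show ?thesis unfolding gibbs_def using total_1_pos by simp
qed

lemma gibbs_add: "gibbs (%s. F s + G s) = gibbs F + gibbs G"
 unfolding gibbs_def total_def by (simp add: algebra_simps sum.distrib add_divide_distrib)

lemma gibbs_diff: "gibbs (%s. F s - G s) = gibbs F - gibbs G"
 unfolding gibbs_def total_def by (simp add: algebra_simps sum_subtractf diff_divide_distrib)

lemma gibbs_cmult: "gibbs (%s. c * F s) = c * gibbs F"
 unfolding gibbs_def total_def by (simp add: mult.assoc sum_distrib_left[symmetric])

lemma gibbs_sum: "gibbs (%s. \<Sum>i\<in>I. F i s) = (\<Sum>i\<in>I. gibbs (F i))"
proof (induction I rule: infinite_finite_induct)
 case (insert x F)
 then show ?case by (simp add: gibbs_add)
qed (auto simp: gibbs_def total_def)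

lemma gibbs_cong: "(!!s. s \<in> spins V ==> F s = G s) ==> gibbs F = gibbs G"
 unfolding gibbs_def total_def by (auto intro!: sum.cong arg_cong2[where f="(/)"])

lemma gibbs_mono: "(!!s. s \<in> spins V ==> F s <= G s) ==> gibbs F <= gibbs G"
 unfolding gibbs_def using total_1_pos
 by (intro divide_right_mono) (auto simp: total_def intro!: sum_mono mult_right_mono)

lemma gibbs_const: "gibbs (%_. c) = c"
 using gibbs_cmult[of c "%_. 1"] total_1_pos unfolding gibbs_def by simp

lemma energy_split:
 assumes "k \<in> V" "s k * s k = 1"
 defines "R \<equiv> (%s. (\<Sum>i\<in>V - {k}. \<Sum>j\<in>V - {k}. b i j * s i * s j)/2)"
 shows "energy s = s k * field k s + R s"
proof -
 let ?F = "s k * field k s"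
 have row: "(\<Sum>j\<in>V. b k j * s k * s j) = ?F"
  unfolding field_def sum_distrib_left by (intro sum.cong) (auto simp: mult_ac)
 have "(\<Sum>i\<in>V - {k}. b i k * s i * s k) = (\<Sum>j\<in>V - {k}. b k j * s k * s j)"
  using b_sym[OF _ assms(1)] by (intro sum.cong) (auto simp: mult_ac)
 also have "\<dots> = (\<Sum>j\<in>V. b k j * s k * s j)"
  by (subst sum.remove[OF fin assms(1)]) (simp add: b_diag[OF assms(1)])
 finally have col: "(\<Sum>i\<in>V - {k}. b i k * s i * s k) = ?F" unfolding row .
 have "(\<Sum>i\<in>V. \<Sum>j\<in>V. b i j * s i * s j)
  = ?F + (\<Sum>i\<in>V-{k}. (\<Sum>j\<in>V. b i j * s i * s j))"
  by (subst sum.remove[OF fin assms(1)]) (simp only: row)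
 also have "(\<Sum>i\<in>V-{k}. (\<Sum>j\<in>V. b i j * s i * s j))
  = (\<Sum>i\<in>V-{k}. b i k * s i * s k + (\<Sum>j\<in>V-{k}. b i j * s i * s j))"
  by (intro sum.cong refl sum.remove[OF fin assms(1)])
 also have "\<dots> = ?F + 2 * R s"
  unfolding sum.distrib col R_def by simp
 finally show ?thesis unfolding energy_def by simp
qed

text \<open>Pairing a configuration with the one flipped at \<open>k\<close> replaces the spin by the hyperbolic sine of its field.\<close>

lemma total_flip:
 assumes k: "k \<in> V" and g: "!!s x. g (s(k := x)) = g s"
 defines "R \<equiv> (%s. (\<Sum>i\<in>V - {k}. \<Sum>j\<in>V - {k}. b i j * s i * s j)/2)"
 shows "total (%s. s k * g s) = (\<Sum>s\<in>spins V. sinh (field k s) * g s * exp (R s))"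
  and "total g = (\<Sum>s\<in>spins V. cosh (field k s) * g s * exp (R s))"
proof -
 have f: "field k (s(k := x)) = field k s" for s x
  unfolding field_def using b_diag[OF k] by (intro sum.cong) auto
 have R: "R (s(k := x)) = R s" for s x unfolding R_def by (auto intro!: sum.cong)
 have e1: "energy s = s k * field k s + R s" if "s \<in> spins V" for s
  using energy_split[OF k, of s] spins_sq[OF that k] unfolding R_def by simp
 have e2: "energy (s(k := - s k)) = - s k * field k s + R s" if "s \<in> spins V" for s
  using energy_split[OF k, of "s(k := - s k)"] spins_sq[OF that k] f R unfolding R_def by simp
 have s: "s k = 1 \<or> s k = -1" if "s \<in> spins V" for s using that k unfolding spins_def by (auto simp: PiE_iff)
 have "total (%s. s k * g s) = (\<Sum>s\<in>spins V. (s k * g s * exp (energy s) + - s k * g s * exp (energy (s(k := - s k))))/2)"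
 proof -
  have "total (%s. s k * g s) = (\<Sum>s\<in>spins V. - s k * g s * exp (energy (s(k := - s k))))"
   unfolding total_def by (subst sum_spins_flip[OF k]) (simp add: g)
  then show ?thesis unfolding sum_divide_distrib[symmetric] sum.distrib by (simp add: total_def)
 qed
 also have "\<dots> = (\<Sum>s\<in>spins V. sinh (field k s) * g s * exp (R s))"
 proof (rule sum.cong[OF refl])
  show "(s k * g s * exp (energy s) + - s k * g s * exp (energy (s(k := - s k))))/2 = sinh (field k s) * g s * exp (R s)" if "s \<in> spins V" for s
   unfolding e1[OF that] e2[OF that] using s[OF that] by (auto simp: sinh_def exp_add exp_diff exp_minus field_simps)
 qed
 finally show "total (%s. s k * g s) = (\<Sum>s\<in>spins V. sinh (field k s) * g s * exp (R s))" .
 have "total g = (\<Sum>s\<in>spins V. (g s * exp (energy s) + g s * exp (energy (s(k := - s k))))/2)"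
 proof -
  have "total g = (\<Sum>s\<in>spins V. g s * exp (energy (s(k := - s k))))"
   unfolding total_def by (subst sum_spins_flip[OF k]) (simp add: g)
  then show ?thesis unfolding sum_divide_distrib[symmetric] sum.distrib by (simp add: total_def)
 qed
 also have "\<dots> = (\<Sum>s\<in>spins V. cosh (field k s) * g s * exp (R s))"
 proof (rule sum.cong[OF refl])
  show "(g s * exp (energy s) + g s * exp (energy (s(k := - s k))))/2 = cosh (field k s) * g s * exp (R s)" if "s \<in> spins V" for s
   unfolding e1[OF that] e2[OF that] using s[OF that] by (auto simp: cosh_def exp_add exp_diff exp_minus field_simps)
 qed
 finally show "total g = (\<Sum>s\<in>spins V. cosh (field k s) * g s * exp (R s))" .
qed

lemma field_update: "k \<in> V ==> field k (s(k := x)) = field k s"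
 unfolding field_def using b_diag[of k] by (intro sum.cong) auto

lemma gibbs_tanh:
 assumes k: "k \<in> V" and g: "!!s x. g (s(k := x)) = g s"
 shows "gibbs (%s. s k * g s) = gibbs (%s. tanh (field k s) * g s)"
proof -
 have "total (%s. tanh (field k s) * g s) = total (%s. s k * g s)"
  unfolding total_flip(1)[where g=g and k=k, OF k g]
  by (subst total_flip(2)[where k=k and g="%s. tanh (field k s) * g s"])
   (auto simp: k g field_update[OF k] tanh_def intro!: sum.cong)
 then show ?thesis unfolding gibbs_def by simp
qed

text \<open>After summing out \<open>\<sigma>\<^sub>k\<close> the difference of the two sides is the average of \<open>g\<close> against
\<open>field cosh field - sinh field\<close>.\<close>

lemma gibbs_spin_le_field:
 assumes k: "k \<in> V" and g: "!!s x. g (s(k := x)) = g s" and pos: "pos_mult V g"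
 shows "gibbs (%s. s k * g s) <= gibbs (%s. field k s * g s)"
proof -
 define R where "R \<equiv> (%s. (\<Sum>i\<in>V - {k}. \<Sum>j\<in>V - {k}. b i j * s i * s j)/2)"
 have "pos_mult V (%s. (\<Sum>i\<in>V - {k}. \<Sum>j\<in>V - {k}. b i j * s i * s j)*(1/2))"
  by (intro pos_mult_sum pos_mult_mult pos_mult_const pos_mult_spin fin b_nonneg) auto
 then have Rpos: "pos_mult V R" unfolding R_def by simp
 have "0 <= (\<Sum>s\<in>spins V. (field k s * cosh (field k s) - sinh (field k s)) * g s * exp (R s))"
  by (rule pos_mult_sum_nonneg[OF fin pos_mult_mult[OF pos_mult_mult[OF
     pos_mult_excess[OF fin field_pos[OF k]] pos] pos_mult_exp[OF fin Rpos]]])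
 also have "\<dots> = total (%s. field k s * g s) - total (%s. s k * g s)"
  unfolding total_flip(1)[where g=g and k=k, OF k g]
  by (subst total_flip(2)[where k=k and g="%s. field k s * g s"])
   (auto simp: k g field_update[OF k] R_def sum_subtractf algebra_simps)
 finally show ?thesis unfolding gibbs_def using total_1_pos by (intro divide_right_mono) auto
qed

end

lemma sum_mult_le_L2_set: "(\<Sum>i\<in>A. f i * g i) <= L2_set f A * L2_set g A"
proof -
 have "(\<Sum>i\<in>A. f i * g i) <= (\<Sum>i\<in>A. \<bar>f i\<bar>*\<bar>g i\<bar>)"
  by (intro sum_mono) (metis abs_ge_self abs_mult)
 also have "\<dots> <= L2_set f A * L2_set g A" by (rule L2_set_mult_ineq)
 finally show ?thesis .
qed

lemma L2_set_sq: "(L2_set f A)^2 = (\<Sum>i\<in>A. (f i)^2)"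
 unfolding L2_set_def by (simp add: sum_nonneg)

definition frob :: "'i set => ('i => 'i => real) => real" where
 "frob V f = L2_set (%j. L2_set (%i. f i j) V) V"

lemma frob_nonneg: "0 <= frob V f" unfolding frob_def by (rule L2_set_nonneg)

lemma frob_sq: "(frob V f)^2 = (\<Sum>j\<in>V. \<Sum>i\<in>V. (f i j)^2)"
 unfolding frob_def L2_set_sq ..

lemma frob_inner: "(\<Sum>j\<in>V. \<Sum>i\<in>V. f i j * g i j) <= frob V f * frob V g"
proof -
 have "(\<Sum>j\<in>V. \<Sum>i\<in>V. f i j * g i j) <= (\<Sum>j\<in>V. L2_set (%i. f i j) V * L2_set (%i. g i j) V)"
  by (intro sum_mono sum_mult_le_L2_set)
 also have "\<dots> <= frob V f * frob V g" unfolding frob_def by (rule sum_mult_le_L2_set)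
 finally show ?thesis .
qed

lemma frob_quadratic: "(\<Sum>j\<in>V. \<Sum>i\<in>V. f i j*(a i * a j)) <= frob V f*(\<Sum>i\<in>V. (a i)^2)"
proof -
 have "(frob V (%i j. a i * a j))^2 = (\<Sum>i\<in>V. (a i)^2)^2"
  unfolding frob_sq by (simp add: sum_product power2_eq_square mult_ac)
 then have "frob V (%i j. a i * a j) = (\<Sum>i\<in>V. (a i)^2)"
  using frob_nonneg by (metis power2_eq_imp_eq sum_nonneg zero_le_power2)
 then show ?thesis using frob_inner[of f "%i j. a i * a j" V] by simp
qed

context ising begin

definition corr :: "'i => 'i => real" where
 "corr i j = gibbs (%s. s i * s j)"

definition offcorr :: "'i => 'i => real" where
 "offcorr i j = (if i = j then 0 else corr i j)"

lemma corr_self: "i \<in> V ==> corr i i = 1"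
 unfolding corr_def using gibbs_cong[of "%s. s i * s i" "%_. 1"] by (simp add: spins_sq gibbs_const)

lemma corr_nonneg: "i \<in> V ==> j \<in> V ==> 0 <= corr i j"
 unfolding corr_def by (rule gibbs_nonneg[OF pos_mult_mult[OF pos_mult_spin[OF fin] pos_mult_spin[OF fin]]])

lemma offcorr_nonneg: "i \<in> V ==> j \<in> V ==> 0 <= offcorr i j"
 unfolding offcorr_def using corr_nonneg by auto

lemma corr_sym: "corr i j = corr j i"
 unfolding corr_def by (simp add: mult.commute)

lemma gibbs_sum_spins: "gibbs (%s. (\<Sum>l\<in>I. a l * s l) * F s) = (\<Sum>l\<in>I. a l * gibbs (%s. s l * F s))"
 unfolding sum_distrib_right gibbs_sum mult.assoc gibbs_cmult ..

lemma gibbs_field: "gibbs (%s. field i s * F s) = (\<Sum>l\<in>V. b i l * gibbs (%s. s l * F s))"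
 unfolding field_def by (rule gibbs_sum_spins)

lemma corr_le:
 assumes "i \<in> V" "j \<in> V" "i ~= j"
 shows "corr i j <= b i j + (\<Sum>l\<in>V. b i l * offcorr l j)"
proof -
 have "corr i j <= gibbs (%s. field i s * s j)"
  unfolding corr_def
  by (rule gibbs_spin_le_field[where g="%s. s j"]) (use assms in \<open>auto intro: pos_mult_spin[OF fin]\<close>)
 also have "\<dots> = (\<Sum>l\<in>V. b i l * corr l j)" unfolding gibbs_field corr_def ..
 also have "\<dots> = b i j * corr j j + (\<Sum>l\<in>V-{j}. b i l * corr l j)"
  by (rule sum.remove[OF fin assms(2)])
 also have "(\<Sum>l\<in>V-{j}. b i l * corr l j) = (\<Sum>l\<in>V-{j}. b i l * offcorr l j)"
  by (intro sum.cong) (auto simp: offcorr_def)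
 also have "\<dots> = (\<Sum>l\<in>V. b i l * offcorr l j)"
  by (subst sum.remove[OF fin assms(2)]) (simp add: offcorr_def)
 finally show ?thesis by (simp add: corr_self[OF assms(2)])
qed

lemma gibbs_square_sum:
 "gibbs (%s. (\<Sum>i\<in>V. a i * s i)^2) = (\<Sum>j\<in>V. \<Sum>i\<in>V. offcorr i j*(a i * a j)) + (\<Sum>i\<in>V. (a i)^2)"
proof -
 have "gibbs (%s. (\<Sum>i\<in>V. a i * s i)^2) = (\<Sum>j\<in>V. a j*(\<Sum>i\<in>V. a i * corr i j))"
  unfolding power2_eq_square gibbs_sum_spins corr_def
  by (intro sum.cong refl arg_cong2[where f="(*)"])
   (subst mult.commute, unfold gibbs_sum_spins, simp)
 also have "\<dots> = (\<Sum>j\<in>V. (\<Sum>i\<in>V. offcorr i j*(a i * a j)) + (a j)^2)"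
 proof (rule sum.cong[OF refl])
  fix j assume j: "j \<in> V"
  have "(\<Sum>i\<in>V. a i * corr i j) = a j + (\<Sum>i\<in>V-{j}. a i * corr i j)"
   by (subst sum.remove[OF fin j]) (simp add: corr_self[OF j])
  also have "(\<Sum>i\<in>V-{j}. a i * corr i j) = (\<Sum>i\<in>V-{j}. a i * offcorr i j)"
   by (intro sum.cong) (auto simp: offcorr_def)
  also have "\<dots> = (\<Sum>i\<in>V. a i * offcorr i j)"
   by (subst sum.remove[OF fin j]) (simp add: offcorr_def)
  finally show "a j*(\<Sum>i\<in>V. a i * corr i j) = (\<Sum>i\<in>V. offcorr i j*(a i * a j)) + (a j)^2"
   by (simp add: distrib_left sum_distrib_left power2_eq_square mult_ac)
 qed
 finally show ?thesis by (simp add: sum.distrib)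
qed

text \<open>Bessel's inequality for the nearly orthogonal spins: their Gram matrix is the identity plus \<open>offcorr\<close>.\<close>

lemma gibbs_bessel:
 "(\<Sum>j\<in>V. (gibbs (%s. s j * g s))^2) <= (1 + frob V offcorr) * gibbs (%s. (g s)^2)"
proof -
 define a where "a j = gibbs (%s. s j * g s)" for j
 define S where "S = (\<Sum>j\<in>V. (a j)^2)"
 define c where "c = 1 + frob V offcorr"
 define X where "X s = (\<Sum>j\<in>V. a j * s j)" for s
 have c: "1 <= c" unfolding c_def using frob_nonneg[of V offcorr] by simp
 have XX: "gibbs (%s. (X s)^2) <= c * S"
  unfolding X_def gibbs_square_sum c_def S_def
  using frob_quadratic[of offcorr a V] by (simp add: algebra_simps)
 have Xg: "gibbs (%s. X s * g s) = S"
  unfolding X_def gibbs_sum_spins S_def a_def power2_eq_square ..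
 have "0 <= gibbs (%s. (c * g s - X s)^2)"
  using gibbs_mono[of "%_. 0" "%s. (c * g s - X s)^2"] by (simp add: gibbs_const)
 also have "(%s. (c * g s - X s)^2) = (%s. (c^2*(g s)^2 - (2 * c)*(X s * g s)) + (X s)^2)"
  by (auto simp: power2_eq_square algebra_simps)
 also have "gibbs \<dots> = c^2 * gibbs (%s. (g s)^2) - 2 * c * S + gibbs (%s. (X s)^2)"
  unfolding gibbs_add gibbs_diff gibbs_cmult Xg ..
 finally have "0 <= c^2 * gibbs (%s. (g s)^2) - 2 * c * S + c * S" using XX by linarith
 then have "c * S <= c*(c * gibbs (%s. (g s)^2))" by (simp add: power2_eq_square algebra_simps)
 then have "S <= c * gibbs (%s. (g s)^2)" using c by (simp add: mult_le_cancel_left)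
 then show ?thesis unfolding S_def a_def c_def .
qed

text \<open>The error in \<open>corr = 1 + b corr\<close>, the equation that correlations would satisfy if \<open>tanh\<close> were the identity.\<close>

definition resid :: "'i => 'i => real" where
 "resid i j = (if i = j then 1 else 0) + (\<Sum>l\<in>V. b i l * corr l j) - corr i j"

end

lemma tanh_le_self: fixes x :: real assumes "0 <= x" shows "tanh x <= x"
proof -
 have "(%x. x - tanh x) 0 <= (%x. x - tanh x) x"
 proof (rule DERIV_nonneg_imp_nondecreasing[OF assms])
  fix y :: real
  show "\<exists>z. ((%x. x - tanh x) has_real_derivative z) (at y) \<and> 0 <= z"
   by (intro exI[of _ "1 - (1 - (tanh y)^2)"] conjI derivative_eq_intros refl) auto
 qed
 then show ?thesis by simp
qed

lemma tanh_excess_le: "(x - tanh x)^2 <= (x::real)^4"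
proof -
 have *: "\<bar>x - tanh x\<bar> <= x^2" if "0 <= x" for x :: real
 proof -
  have "tanh x <= x" by (rule tanh_le_self[OF that])
  moreover have "x - x^2 <= tanh x"
  proof -
   have "(%x. tanh x - x + x^2) 0 <= (%x. tanh x - x + x^2) x"
   proof (rule DERIV_nonneg_imp_nondecreasing[OF that], intro exI conjI)
    fix y :: real assume y: "0 <= y" "y <= x"
    show "((%x. tanh x - x + x^2) has_real_derivative (1 - (tanh y)^2) - 1 + 2 * y) (at y)"
     by (auto intro!: derivative_eq_intros simp: cosh_real_pos[THEN less_imp_neq, symmetric])
    have "tanh y <= y" using y by (intro tanh_le_self) simp
    moreover have "0 <= tanh y" "tanh y <= 1" using y tanh_real_lt_1[of y] by auto
    then have "tanh y * tanh y <= tanh y*1" by (intro mult_left_mono)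
    ultimately show "0 <= (1 - (tanh y)^2) - 1 + 2 * y" using y by (simp add: power2_eq_square)
   qed
   then show ?thesis by simp
  qed
  ultimately show ?thesis by auto
 qed
 have "\<bar>x - tanh x\<bar> <= x^2" using *[of x] *[of "-x"] by (cases "0 <= x") auto
 then have "\<bar>x - tanh x\<bar>\<^sup>2 <= (x^2)^2" by (intro power_mono) auto
 then show ?thesis by simp
qed

locale ising_sub = ising +
 fixes r :: real
 assumes r: "0 <= r" "r < 1"
  and op: "!!v. (!!i. i \<in> V ==> 0 <= v i) ==> L2_set (%i. \<Sum>l\<in>V. b i l * v l) V <= r * L2_set v V"
begin

lemma subcritical:
 assumes "!!i. i \<in> V ==> 0 <= v i" "!!i. i \<in> V ==> v i <= u i + (\<Sum>l\<in>V. b i l * v l)"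
 shows "L2_set v V <= L2_set u V/(1-r)"
proof -
 have "L2_set v V <= L2_set (%i. u i + (\<Sum>l\<in>V. b i l * v l)) V"
  by (intro L2_set_mono assms)
 also have "\<dots> <= L2_set u V + L2_set (%i. \<Sum>l\<in>V. b i l * v l) V" by (rule L2_set_triangle_ineq)
 also have "\<dots> <= L2_set u V + r * L2_set v V" using op[of v] assms(1) by simp
 finally show ?thesis using r by (simp add: field_simps)
qed

lemma offcorr_column: assumes "j \<in> V"
 shows "L2_set (%i. offcorr i j) V <= L2_set (%i. b i j) V/(1-r)"
proof (rule subcritical)
 fix i assume i: "i \<in> V"
 show "0 <= offcorr i j" by (rule offcorr_nonneg[OF i assms])
 show "offcorr i j <= b i j + (\<Sum>l\<in>V. b i l * offcorr l j)"
 proof (cases "i = j")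
  case True
  then show ?thesis using i assms by (auto simp: offcorr_def intro!: add_nonneg_nonneg sum_nonneg mult_nonneg_nonneg b_nonneg corr_nonneg)
 next
  case False
  then show ?thesis using corr_le[OF i assms False] by (simp add: offcorr_def)
 qed
qed

lemma frob_offcorr: "frob V offcorr <= frob V b/(1-r)"
proof -
 have "frob V offcorr <= L2_set (%j. (1/(1-r)) * L2_set (%i. b i j) V) V"
  unfolding frob_def by (intro L2_set_mono L2_set_nonneg) (use offcorr_column in auto)
 also have "\<dots> = (1/(1-r)) * frob V b"
  unfolding frob_def using r by (subst L2_set_right_distrib) auto
 finally show ?thesis by simp
qed

text \<open>Split \<open>Y\<close> at a site, apply \<open>gibbs_spin_le_field\<close> to the part free of that spin, and restore the
omitted terms, which are nonnegative. The vectors \<open>\<langle>\<sigma>\<^sub>k Y\<rangle>\<close> and \<open>\<langle>\<sigma>\<^sub>k Y\<^sup>3\<rangle>\<close> thus satisfy \<open>v \<le> u + b v\<close> with \<open>u\<close>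
proportional to \<open>y\<close>.\<close>

lemma gibbs_linear_moments:
 assumes y: "!!i. i \<in> V ==> 0 <= y i"
 defines "Y \<equiv> %s. \<Sum>i\<in>V. y i * s i"
 shows "gibbs (%s. (Y s)^2) <= (\<Sum>i\<in>V. (y i)^2)/(1-r)"
  and "gibbs (%s. (Y s)^4) <= 3*((\<Sum>i\<in>V. (y i)^2)/(1-r))^2"
proof -
 define Y' where "Y' k s = (\<Sum>i\<in>V-{k}. y i * s i)" for k s
 have Ypos: "pos_mult V Y" unfolding Y_def by (intro pos_mult_sum pos_mult_mult pos_mult_const pos_mult_spin fin y)
 have Y'pos: "pos_mult V (Y' k)" for k unfolding Y'_def
  by (intro pos_mult_sum pos_mult_mult pos_mult_const pos_mult_spin fin y) auto
 have Y'upd: "Y' k (s(k := x)) = Y' k s" for k s x unfolding Y'_def by (intro sum.cong) auto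
 have Ysplit: "Y s = Y' k s + y k * s k" if "k \<in> V" for k s
  unfolding Y_def Y'_def by (subst sum.remove[OF fin that]) simp
 have sp: "pos_mult V (%s. s k)" if "k \<in> V" for k by (rule pos_mult_spin[OF fin that])
 define n where "n = L2_set y V"
 have n2: "n^2 = (\<Sum>i\<in>V. (y i)^2)" unfolding n_def by (rule L2_set_sq)
 have n0: "0 <= n" unfolding n_def by (rule L2_set_nonneg)
 define T where "T k = gibbs (%s. s k * Y s)" for k
 have T: "L2_set T V <= n/(1-r)" unfolding n_def
 proof (rule subcritical)
  fix k assume k: "k \<in> V"
  show "0 <= T k" unfolding T_def by (rule gibbs_nonneg[OF pos_mult_mult[OF sp[OF k] Ypos]])
  have "T k = gibbs (%s. s k * Y' k s + y k)" unfolding T_def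
  proof (rule gibbs_cong)
   fix s assume "s \<in> spins V"
   from spins_sq[OF this k] show "s k * Y s = s k * Y' k s + y k"
    unfolding Ysplit[OF k] by (simp add: algebra_simps)
  qed
  also have "\<dots> <= gibbs (%s. field k s * Y' k s) + y k"
   unfolding gibbs_add gibbs_const
   using gibbs_spin_le_field[where k=k and g="Y' k", OF k Y'upd Y'pos] by simp
  also have "\<dots> <= gibbs (%s. field k s * Y' k s) + y k + gibbs (%s. y k*(field k s * s k))"
   using gibbs_nonneg[OF pos_mult_mult[OF pos_mult_const[OF y[OF k]] pos_mult_mult[OF field_pos[OF k] sp[OF k]]]] by simp
  also have "\<dots> = y k + gibbs (%s. field k s * Y' k s + y k*(field k s * s k))"
   by (simp add: gibbs_add)
  also have "(%s. field k s * Y' k s + y k*(field k s * s k)) = (%s. field k s * Y s)"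
   unfolding Ysplit[OF k] by (auto simp: algebra_simps)
  also have "gibbs \<dots> = (\<Sum>l\<in>V. b k l * T l)" unfolding gibbs_field T_def ..
  finally show "T k <= y k + (\<Sum>l\<in>V. b k l * T l)" .
 qed
 have "gibbs (%s. (Y s)^2) = (\<Sum>l\<in>V. y l * T l)"
  unfolding power2_eq_square T_def by (subst (1) Y_def) (rule gibbs_sum_spins)
 also have "\<dots> <= n * L2_set T V" unfolding n_def by (rule sum_mult_le_L2_set)
 also have "\<dots> <= n*(n/(1-r))" by (rule mult_left_mono[OF T n0])
 finally have Y2: "gibbs (%s. (Y s)^2) <= n^2/(1-r)" by (simp add: power2_eq_square)
 then show "gibbs (%s. (Y s)^2) <= (\<Sum>i\<in>V. (y i)^2)/(1-r)" unfolding n2 .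
 define q where "q = gibbs (%s. (Y s)^2)"
 have q0: "0 <= q" unfolding q_def by (rule gibbs_nonneg[OF pos_mult_power[OF Ypos]])
 define U where "U k = gibbs (%s. s k * Y s^3)" for k
 have U: "L2_set U V <= L2_set (%k. 3 * q * y k) V/(1-r)"
 proof (rule subcritical)
  fix k assume k: "k \<in> V"
  note pm = pos_mult_mult pos_mult_const pos_mult_add pos_mult_power
  show "0 <= U k" unfolding U_def by (rule gibbs_nonneg[OF pos_mult_mult[OF sp[OF k] pos_mult_power[OF Ypos]]])
  let ?G = "%s. Y' k s^3 + (3*(y k)^2) * Y' k s"
  let ?R = "%s. (3 * y k)*(Y' k s)^2 + y k^3"
  have Gpos: "pos_mult V ?G"
   by (rule pos_mult_add[OF pos_mult_power[OF Y'pos] pos_mult_mult[OF pos_mult_const Y'pos]]) simp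
  have Rpos: "pos_mult V ?R"
   by (rule pos_mult_add[OF pos_mult_mult[OF pos_mult_const pos_mult_power[OF Y'pos]] pos_mult_const]) (use y[OF k] in auto)
  have "Y s^3 = ?G s + ?R s * s k" if "s k * s k = 1" for s
  proof -
   have "(Y' k s + y k * s k)^3 = Y' k s^3 + 3*(Y' k s)^2 * y k * s k + 3 * Y' k s*(y k)^2*(s k * s k) + y k^3 * s k*(s k * s k)"
    by (simp add: power3_eq_cube power2_eq_square algebra_simps)
   then show ?thesis unfolding Ysplit[OF k] that by (simp add: algebra_simps)
  qed
  then have Y3: "Y s^3 = ?G s + ?R s * s k" if "s \<in> spins V" for s
   using spins_sq[OF that k] by blast
  have "U k = gibbs (%s. s k * ?G s + ?R s)" unfolding U_def
  proof (rule gibbs_cong)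
   fix s assume s: "s \<in> spins V"
   have "s k * Y s^3 = s k * ?G s + ?R s*(s k * s k)" unfolding Y3[OF s] by (simp add: algebra_simps)
   then show "s k * Y s^3 = s k * ?G s + ?R s" using spins_sq[OF s k] by simp
  qed
  also have "\<dots> = gibbs (%s. s k * ?G s) + gibbs ?R" by (rule gibbs_add)
  also have "gibbs (%s. s k * ?G s) <= gibbs (%s. field k s * ?G s)"
   by (rule gibbs_spin_le_field[where g="?G", OF k _ Gpos]) (simp add: Y'upd)
  also have "\<dots> <= gibbs (%s. field k s * ?G s) + gibbs (%s. field k s*(?R s * s k))"
   using gibbs_nonneg[OF pos_mult_mult[OF field_pos[OF k] pos_mult_mult[OF Rpos sp[OF k]]]] by simp
  also have "\<dots> = gibbs (%s. field k s * Y s^3)"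
   unfolding gibbs_add[symmetric]
   by (rule gibbs_cong) (simp add: Y3 distrib_left)
  also have "\<dots> = (\<Sum>l\<in>V. b k l * U l)" unfolding gibbs_field U_def ..
  finally have 1: "U k <= (\<Sum>l\<in>V. b k l * U l) + gibbs ?R" by simp
  have "gibbs ?R <= 3 * q * y k"
  proof -
   have "q = gibbs (%s. ((Y' k s)^2 + (y k)^2) + (2 * y k)*(Y' k s * s k))"
    unfolding q_def
   proof (rule gibbs_cong)
    fix s assume s: "s \<in> spins V"
    have "(Y s)^2 = (Y' k s)^2 + (y k)^2*(s k * s k) + 2 * y k*(Y' k s * s k)"
     unfolding Ysplit[OF k] by (simp add: power2_eq_square algebra_simps)
    then show "(Y s)^2 = ((Y' k s)^2 + (y k)^2) + (2 * y k)*(Y' k s * s k)" using spins_sq[OF s k] by simp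
   qed
   also have "\<dots> = gibbs (%s. (Y' k s)^2) + (y k)^2 + 2 * y k * gibbs (%s. Y' k s * s k)"
    by (simp only: gibbs_add gibbs_cmult gibbs_const)
   also have "\<dots> >= gibbs (%s. (Y' k s)^2) + (y k)^2"
    using gibbs_nonneg[OF pos_mult_mult[OF Y'pos[of k] sp[OF k]]] y[OF k] by simp
   finally have qq: "gibbs (%s. (Y' k s)^2) + (y k)^2 <= q" .
   have "gibbs ?R = 3 * y k * gibbs (%s. (Y' k s)^2) + y k*(y k)^2"
    by (simp only: gibbs_add gibbs_cmult gibbs_const) (simp add: power2_eq_square power3_eq_cube)
   also have "\<dots> <= 3 * y k*(gibbs (%s. (Y' k s)^2) + (y k)^2)"
    using y[OF k] by (simp add: distrib_left mult_right_mono)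
   also have "\<dots> <= 3 * y k * q" using y[OF k] qq by (intro mult_left_mono) auto
   finally show ?thesis by (simp add: mult_ac)
  qed
  with 1 show "U k <= 3 * q * y k + (\<Sum>l\<in>V. b k l * U l)" by simp
 qed
 have "L2_set (%k. 3 * q * y k) V = 3 * q * n" unfolding n_def using q0 by (subst L2_set_right_distrib) auto
 with U have U': "L2_set U V <= 3 * q * n/(1-r)" by simp
 have "gibbs (%s. (Y s)^4) = gibbs (%s. Y s * Y s^3)" by (simp add: power4_eq_xxxx power3_eq_cube mult.assoc)
 also have "\<dots> = (\<Sum>l\<in>V. y l * U l)"
  unfolding U_def by (subst (1) Y_def) (rule gibbs_sum_spins)
 also have "\<dots> <= n * L2_set U V" unfolding n_def by (rule sum_mult_le_L2_set)
 also have "\<dots> <= n*(3 * q * n/(1-r))" by (rule mult_left_mono[OF U' n0])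
 also have "\<dots> = 3 * q*(n^2/(1-r))" by (simp add: power2_eq_square)
 also have "\<dots> <= 3*(n^2/(1-r))*(n^2/(1-r))"
  using Y2 r unfolding q_def by (intro mult_right_mono) auto
 finally show "gibbs (%s. (Y s)^4) <= 3*((\<Sum>i\<in>V. (y i)^2)/(1-r))^2"
  unfolding n2 by (simp add: power2_eq_square)
qed

text \<open>Off the diagonal the residual is \<open>\<langle>\<sigma>\<^sub>j (h - tanh h)\<rangle>\<close> for the field \<open>h\<close> at \<open>i\<close>; sum over \<open>j\<close> by Bessel and
use \<open>(h - tanh h)\<^sup>2 \<le> h\<^sup>4\<close>.\<close>

lemma resid_row:
 assumes i: "i \<in> V"
 shows "(\<Sum>j\<in>V. (resid i j)^2) <= (4 + 3 * frob V offcorr)*((\<Sum>l\<in>V. (b i l)^2)/(1-r))^2"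
proof -
 define Q where "Q = (\<Sum>l\<in>V. (b i l)^2)/(1-r)"
 define g where "g s = field i s - tanh (field i s)" for s
 have m2: "gibbs (%s. (field i s)^2) <= Q" and m4: "gibbs (%s. field i s^4) <= 3 * Q^2"
  unfolding field_def Q_def using gibbs_linear_moments[of "b i"] b_nonneg[OF i] by auto
 have off: "resid i j = gibbs (%s. s j * g s)" if "j \<in> V" "j ~= i" for j
 proof -
  have "resid i j = gibbs (%s. field i s * s j) - gibbs (%s. s i * s j)"
   unfolding resid_def gibbs_field corr_def using that by simp
  also have "gibbs (%s. s i * s j) = gibbs (%s. tanh (field i s) * s j)"
   using that by (intro gibbs_tanh[where g="%s. s j", OF i]) auto
  also have "gibbs (%s. field i s * s j) - \<dots> = gibbs (%s. field i s * s j - tanh (field i s) * s j)"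
   by (rule gibbs_diff[symmetric])
  also have "(%s. field i s * s j - tanh (field i s) * s j) = (%s. s j * g s)"
   unfolding g_def by (auto simp: algebra_simps)
  finally show ?thesis .
 qed
 have diag: "(resid i i)^2 <= Q^2"
 proof -
  have "resid i i = gibbs (%s. field i s * s i)"
   unfolding resid_def gibbs_field using corr_self[OF i] by (simp add: corr_def)
  also have "\<dots> = gibbs (%s. s i * field i s)" by (simp add: mult.commute)
  also have "\<dots> = gibbs (%s. tanh (field i s) * field i s)"
   by (rule gibbs_tanh[where g="field i", OF i field_update[OF i]])
  finally have eq: "resid i i = gibbs (%s. tanh (field i s) * field i s)" .
  have t: "0 <= tanh x * x \<and> tanh x * x <= x^2" for x :: real
  proof -
   have "\<bar>tanh x\<bar> <= \<bar>x\<bar>"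
   proof -
    have *: "tanh x <= x" if "0 <= x" for x :: real by (rule tanh_le_self[OF that])
    show ?thesis using *[of x] *[of "-x"] by (cases "0 <= x") auto
   qed
   then have "\<bar>tanh x\<bar>*\<bar>x\<bar> <= \<bar>x\<bar>*\<bar>x\<bar>" by (intro mult_right_mono) auto
   moreover have "0 <= tanh x * x" by (cases "0 <= x") (auto intro: mult_nonpos_nonpos)
   ultimately show ?thesis by (simp add: power2_eq_square abs_mult[symmetric])
  qed
  have "0 <= resid i i" unfolding eq
   using gibbs_mono[of "%_. 0" "%s. tanh (field i s) * field i s"] t by (simp add: gibbs_const)
  moreover have "resid i i <= Q" unfolding eq
   using gibbs_mono[of "%s. tanh (field i s) * field i s" "%s. (field i s)^2"] t m2 by force
  ultimately show ?thesis by (intro power_mono)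
 qed
 have "(\<Sum>j\<in>V-{i}. (resid i j)^2) = (\<Sum>j\<in>V-{i}. (gibbs (%s. s j * g s))^2)"
  by (intro sum.cong) (auto simp: off)
 also have "\<dots> <= (\<Sum>j\<in>V. (gibbs (%s. s j * g s))^2)"
  using fin by (intro sum_mono2) auto
 also have "\<dots> <= (1 + frob V offcorr) * gibbs (%s. (g s)^2)" by (rule gibbs_bessel)
 also have "gibbs (%s. (g s)^2) <= gibbs (%s. field i s^4)"
  unfolding g_def by (intro gibbs_mono tanh_excess_le)
 also have "\<dots> <= 3 * Q^2" by (rule m4)
 finally have "(\<Sum>j\<in>V-{i}. (resid i j)^2) <= (1 + frob V offcorr)*(3 * Q^2)"
  using frob_nonneg[of V offcorr] by (auto simp: mult_left_mono)
 with diag have "(\<Sum>j\<in>V. (resid i j)^2) <= Q^2 + (1 + frob V offcorr)*(3 * Q^2)"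
  by (subst sum.remove[OF fin i]) simp
 then show ?thesis unfolding Q_def[symmetric] by (simp add: algebra_simps)
qed

end

context ising begin

lemma gibbs_quadratic:
 assumes "!!i. i \<in> V ==> c i i = 0"
 shows "gibbs (%s. (\<Sum>i\<in>V. \<Sum>j\<in>V. c i j * s i * s j)/2) = (\<Sum>j\<in>V. \<Sum>i\<in>V. c i j * offcorr i j)/2"
proof -
 have "(%s. (\<Sum>i\<in>V. \<Sum>j\<in>V. c i j * s i * s j)/2) = (%s. (1/2)*(\<Sum>i\<in>V. \<Sum>j\<in>V. c i j*(s i * s j)))"
  by (auto simp: mult.assoc)
 then have "gibbs (%s. (\<Sum>i\<in>V. \<Sum>j\<in>V. c i j * s i * s j)/2) = (1/2)*(\<Sum>i\<in>V. \<Sum>j\<in>V. c i j * corr i j)"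
  by (simp only: gibbs_cmult gibbs_sum corr_def)
 also have "(\<Sum>i\<in>V. \<Sum>j\<in>V. c i j * corr i j) = (\<Sum>i\<in>V. \<Sum>j\<in>V. c i j * offcorr i j)"
  by (intro sum.cong refl) (auto simp: offcorr_def assms)
 also have "\<dots> = (\<Sum>j\<in>V. \<Sum>i\<in>V. c i j * offcorr i j)" by (rule sum.swap)
 finally show ?thesis by simp
qed

lemma scaled: "0 <= \<mu> ==> ising V (%i j. \<mu> * b i j)"
 by unfold_locales (auto simp: fin b_nonneg b_sym b_diag)

lemma energy_scaled: "0 <= \<mu> ==> ising.energy V (%i j. \<mu> * b i j) s = \<mu> * energy s"
 unfolding ising.energy_def[OF scaled] energy_def by (simp add: sum_distrib_left mult.assoc)

definition part :: "real => real" where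
 "part \<mu> = (\<Sum>s\<in>spins V. exp (\<mu> * energy s))/2^card V"

lemma part_pos: "0 < part \<mu>"
 unfolding part_def using finite_spins[OF fin] spins_nonempty by (auto intro!: divide_pos_pos sum_pos)

lemma part_0: "part 0 = 1"
 unfolding part_def by (simp add: card_spins[OF fin])

lemma ln_part_deriv:
 assumes "0 <= \<mu>"
 shows "((%\<mu>. ln (part \<mu>)) has_real_derivative
  (\<Sum>j\<in>V. \<Sum>i\<in>V. b i j * ising.offcorr V (%i j. \<mu> * b i j) i j)/2) (at \<mu>)"
proof -
 interpret M: ising V "%i j. \<mu> * b i j" by (rule scaled[OF assms])
 have en: "M.energy s = \<mu> * energy s" for s by (rule energy_scaled[OF assms])
 have "((%\<mu>. ln (part \<mu>)) has_real_derivative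
  (\<Sum>s\<in>spins V. energy s * exp (\<mu> * energy s))/2^card V/part \<mu>) (at \<mu>)"
  using part_pos[of \<mu>] unfolding part_def
  by (auto intro!: derivative_eq_intros sum.cong simp: field_simps)
 also have "(\<Sum>s\<in>spins V. energy s * exp (\<mu> * energy s))/2^card V/part \<mu> = M.gibbs energy"
  unfolding M.gibbs_def M.total_def en part_def by simp
 also have "\<dots> = (\<Sum>j\<in>V. \<Sum>i\<in>V. b i j * M.offcorr i j)/2"
  unfolding energy_def by (rule M.gibbs_quadratic) (rule b_diag)
 finally show ?thesis .
qed

end

context ising_sub begin

lemma scaled_sub: "0 <= \<mu> ==> \<mu> <= 1 ==> ising_sub V (%i j. \<mu> * b i j) r"
proof (intro ising_sub.intro scaled ising_sub_axioms.intro r)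
 fix v :: "'a => real" assume \<mu>: "0 <= \<mu>" "\<mu> <= 1" and v: "!!i. i \<in> V ==> 0 <= v i"
 have "L2_set (%i. \<Sum>l\<in>V. \<mu> * b i l * v l) V <= L2_set (%i. \<Sum>l\<in>V. b i l * v l) V"
  by (intro L2_set_mono sum_mono sum_nonneg mult_nonneg_nonneg v \<mu> b_nonneg)
   (use \<mu> v b_nonneg in \<open>auto intro!: mult_left_le_one_le mult_nonneg_nonneg simp: mult.assoc\<close>)
 also have "\<dots> <= r * L2_set v V" by (rule op[OF v])
 finally show "L2_set (%i. \<Sum>l\<in>V. \<mu> * b i l * v l) V <= r * L2_set v V" .
qed

lemma frob_scaled: "0 <= \<mu> ==> frob V (%i j. \<mu> * b i j) = \<mu> * frob V b"
 unfolding frob_def by (simp add: L2_set_right_distrib[symmetric] L2_set_nonneg)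

lemma frob_offcorr_scaled:
 assumes "0 <= \<mu>" "\<mu> <= 1"
 shows "frob V (ising.offcorr V (%i j. \<mu> * b i j)) <= \<mu> * frob V b/(1-r)"
 using ising_sub.frob_offcorr[OF scaled_sub[OF assms]] frob_scaled[OF assms(1)] by simp

lemma part_deriv_bound:
 assumes "0 <= \<mu>" "\<mu> <= 1"
 shows "(\<Sum>j\<in>V. \<Sum>i\<in>V. b i j * ising.offcorr V (%i j. \<mu> * b i j) i j)/2 <= \<mu>*(frob V b)^2/(2*(1-r))"
proof -
 have "(\<Sum>j\<in>V. \<Sum>i\<in>V. b i j * ising.offcorr V (%i j. \<mu> * b i j) i j) <= frob V b * frob V (ising.offcorr V (%i j. \<mu> * b i j))"
  by (rule frob_inner)
 also have "\<dots> <= frob V b*(\<mu> * frob V b/(1-r))"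
  by (intro mult_left_mono frob_offcorr_scaled assms frob_nonneg)
 finally show ?thesis using r by (simp add: power2_eq_square field_simps)
qed

text \<open>Integrate the logarithmic derivative: at coupling \<open>\<mu> b\<close> the correlations are at most
\<open>\<mu> frob b/(1-r)\<close> in Frobenius norm.\<close>

theorem part_le: "part 1 <= exp ((frob V b)^2/(4*(1-r)))"
proof -
 define k where "k = (frob V b)^2/(4*(1-r))"
 have k2: "2*\<mu> * k = \<mu>*(frob V b)^2/(2*(1-r))" for \<mu>
  unfolding k_def using r by (simp add: divide_simps)
 have "(%\<mu>. ln (part \<mu>) - \<mu>^2 * k) 1 <= (%\<mu>. ln (part \<mu>) - \<mu>^2 * k) 0"
 proof (rule DERIV_nonpos_imp_nonincreasing, simp, intro exI conjI)
  fix \<mu> :: real assume \<mu>: "0 <= \<mu>" "\<mu> <= 1"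
  show "((%\<mu>. ln (part \<mu>) - \<mu>^2 * k) has_real_derivative
   (\<Sum>j\<in>V. \<Sum>i\<in>V. b i j * ising.offcorr V (%i j. \<mu> * b i j) i j)/2 - 2*\<mu> * k) (at \<mu>)"
   by (rule DERIV_diff[OF ln_part_deriv[OF \<mu>(1)]]) (auto intro!: derivative_eq_intros)
  show "(\<Sum>j\<in>V. \<Sum>i\<in>V. b i j * ising.offcorr V (%i j. \<mu> * b i j) i j)/2 - 2*\<mu> * k <= 0"
   using part_deriv_bound[OF \<mu>] unfolding k2 by simp
 qed
 then have "ln (part 1) <= k" by (simp add: part_0)
 then have "exp (ln (part 1)) <= exp k" by simp
 then show ?thesis using part_pos[of 1] unfolding k_def by simp
qed

end

section \<open>The high-temperature polynomial and its two-replica version\<close>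

definition savg :: "'i set => (('i => real) => real) => real" where
 "savg V F = (\<Sum>s\<in>spins V. F s)/2^card V"

lemma savg_add: "savg V (%s. F s + G s) = savg V F + savg V G"
 unfolding savg_def by (simp add: sum.distrib add_divide_distrib)

lemma savg_cmult: "savg V (%s. c * F s) = c * savg V F"
 unfolding savg_def by (simp add: sum_distrib_left[symmetric])

lemma savg_cmult_right: "savg V (%s. F s * c) = savg V F * c"
 unfolding savg_def by (simp add: sum_distrib_right[symmetric])

lemma savg_sum: "savg V (%s. \<Sum>i\<in>I. F i s) = (\<Sum>i\<in>I. savg V (F i))"
 unfolding savg_def by (subst sum.swap) (simp add: sum_divide_distrib)

lemma savg_mono: "(!!s. s \<in> spins V ==> F s <= G s) ==> savg V F <= savg V G"
 unfolding savg_def by (intro divide_right_mono sum_mono) auto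

lemma savg_cong: "(!!s. s \<in> spins V ==> F s = G s) ==> savg V F = savg V G"
 unfolding savg_def by (intro arg_cong2[where f="(/)"] sum.cong) auto

lemma savg_const: "finite V ==> savg V (%_. c) = c"
 unfolding savg_def by (simp add: card_spins)

lemma savg_pos_mult: "finite V ==> pos_mult V F ==> 0 <= savg V F"
 unfolding savg_def by (simp add: pos_mult_sum_nonneg)

lemma spins_val: "s \<in> spins V ==> k \<in> V ==> s k = -1 \<or> s k = 1"
 unfolding spins_def by (auto simp: PiE_iff)

lemma savg_shift:
 assumes "\<tau> \<in> spins V"
 shows "savg V (%s. F (%i. if i \<in> V then s i*\<tau> i else undefined)) = savg V F"
 unfolding savg_def
proof (rule arg_cong2[where f="(/)"], rule sum.reindex_bij_witness[where i="%s i. if i \<in> V then s i*\<tau> i else undefined" and j="%s i. if i \<in> V then s i*\<tau> i else undefined"])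
 fix s assume s: "s \<in> spins V"
 show *: "(%i. if i \<in> V then (if i \<in> V then s i*\<tau> i else undefined)*\<tau> i else undefined) = s"
 proof
  fix i
  show "(if i \<in> V then (if i \<in> V then s i*\<tau> i else undefined)*\<tau> i else undefined) = s i"
   using spins_sq[OF assms, of i] s by (auto simp: spins_def PiE_iff extensional_def mult.assoc)
 qed
 then show "(%i. if i \<in> V then (if i \<in> V then s i*\<tau> i else undefined)*\<tau> i else undefined) = s" .
 show "(%i. if i \<in> V then s i*\<tau> i else undefined) \<in> spins V"
  unfolding spins_def
 proof (rule PiE_I)
  fix i assume i: "i \<in> V"
  show "(if i \<in> V then s i*\<tau> i else undefined) \<in> {-1, 1}"
   using spins_val[OF s i] spins_val[OF assms i] i by auto
 qed simp
 then show "(%i. if i \<in> V then s i*\<tau> i else undefined) \<in> spins V" .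
qed auto

definition edges :: "'i::linorder set => ('i \<times> 'i) set" where "edges V = {(i, j). i \<in> V \<and> j \<in> V \<and> i < j}"

lemma finite_edges: "finite V ==> finite (edges V)"
 by (rule finite_subset[of _ "V \<times> V"]) (auto simp: edges_def)

abbreviation eps :: "('i => real) => 'i \<times> 'i => real" where "eps s e \<equiv> s (fst e) * s (snd e)"

lemma eps_spin: "s \<in> spins V ==> e \<in> edges V ==> eps s e = 1 \<or> eps s e = -1"
proof -
 assume s: "s \<in> spins V" and e: "e \<in> edges V"
 have V: "fst e \<in> V" "snd e \<in> V" using e unfolding edges_def by auto
 have "s (fst e) = -1 \<or> s (fst e) = 1" "s (snd e) = -1 \<or> s (snd e) = 1"
  by (rule spins_val[OF s V(1)], rule spins_val[OF s V(2)])
 then show ?thesis by auto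
qed

lemma sum_edges:
 fixes c :: "'i::linorder => 'i => real"
 assumes fin: "finite V" and sym: "!!i j. i \<in> V ==> j \<in> V ==> c i j = c j i" and d: "!!i. i \<in> V ==> c i i = 0"
 shows "(\<Sum>i\<in>V. \<Sum>j\<in>V. c i j) = 2*(\<Sum>e\<in>edges V. c (fst e) (snd e))"
proof -
 let ?c = "%e. c (fst e) (snd e)"
 let ?L = "{(i, j). i \<in> V \<and> j \<in> V \<and> j < i}" and ?D = "{(i, j). i \<in> V \<and> j \<in> V \<and> i = j}"
 have fL: "finite ?L" and fD: "finite ?D" by (auto intro: finite_subset[of _ "V \<times> V"] simp: fin)
 have "(\<Sum>i\<in>V. \<Sum>j\<in>V. c i j) = (\<Sum>e\<in>V \<times> V. ?c e)" by (simp add: sum.cartesian_product case_prod_unfold)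
 also have "V \<times> V = (edges V \<union> ?L) \<union> ?D" unfolding edges_def by auto
 also have "(\<Sum>e\<in>(edges V \<union> ?L) \<union> ?D. ?c e) = (\<Sum>e\<in>edges V. ?c e) + (\<Sum>e\<in>?L. ?c e) + (\<Sum>e\<in>?D. ?c e)"
  by (subst sum.union_disjoint, use fL fD finite_edges[OF fin] in \<open>auto simp: edges_def\<close>)
   (subst sum.union_disjoint, use fL fD finite_edges[OF fin] in \<open>auto simp: edges_def\<close>)
 also have "(\<Sum>e\<in>?D. ?c e) = 0" using d by (intro sum.neutral) auto
 also have "(\<Sum>e\<in>?L. ?c e) = (\<Sum>e\<in>edges V. ?c e)"
  by (rule sum.reindex_bij_witness[of _ prod.swap prod.swap]) (auto simp: edges_def intro: sym)
 finally show ?thesis by simp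
qed

context
 fixes V :: "'i::linorder set" and b :: "'i => 'i => real"
 assumes I: "ising V b"
begin

interpretation ising V b by (rule I)

lemma energy_edges: "energy s = (\<Sum>e\<in>edges V. b (fst e) (snd e) * eps s e)"
 unfolding energy_def
 by (subst sum_edges[OF fin]) (auto simp: b_diag b_sym mult_ac)

lemma part_edges: "part \<mu> = savg V (%s. exp (\<mu>*(\<Sum>e\<in>edges V. b (fst e) (snd e) * eps s e)))"
 unfolding part_def savg_def energy_edges ..

lemma offcorr_edges: "(frob V offcorr)^2 = 2*(\<Sum>e\<in>edges V. (corr (fst e) (snd e))^2)"
proof -
 have "(frob V offcorr)^2 = (\<Sum>i\<in>V. \<Sum>j\<in>V. (offcorr i j)^2)" unfolding frob_sq by (rule sum.swap)
 also have "\<dots> = 2*(\<Sum>e\<in>edges V. (offcorr (fst e) (snd e))^2)"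
  by (rule sum_edges[OF fin]) (auto simp: offcorr_def corr_sym)
 also have "(\<Sum>e\<in>edges V. (offcorr (fst e) (snd e))^2) = (\<Sum>e\<in>edges V. (corr (fst e) (snd e))^2)"
  by (intro sum.cong) (auto simp: offcorr_def edges_def)
 finally show ?thesis .
qed

end

lemma one_plus_spin:
 fixes x e :: real
 assumes "0 <= x" "x < 1" "e = 1 \<or> e = -1"
 shows "1 + x * e = sqrt (1-x^2) * exp (artanh x * e)"
proof -
 have "exp (artanh x) = sqrt ((1 + x)/(1-x))"
 proof -
  have p: "0 < (1 + x)/(1-x)" using assms by auto
  have "exp (artanh x) = ((1 + x)/(1-x)) powr (1/2)" unfolding artanh_def powr_def using p assms by simp
  then show ?thesis using p by (simp add: powr_half_sqrt)
 qed
 moreover have "1 - x^2 = (1 + x)*(1-x)" by (simp add: power2_eq_square algebra_simps)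
 moreover have "sqrt ((1 + x)*(1-x)) * sqrt ((1 + x)/(1-x)) = 1 + x"
 proof -
  have "(1 + x)*(1-x)*((1 + x)/(1-x)) = (1 + x)^2" using assms by (simp add: power2_eq_square)
  then show ?thesis using assms by (simp only: real_sqrt_mult[symmetric]) simp
 qed
 moreover have "sqrt ((1 + x)*(1-x)) * inverse (sqrt ((1 + x)/(1-x))) = 1 - x"
 proof -
  have "(1 + x)*(1-x) * inverse ((1 + x)/(1-x)) = (1-x)^2" using assms by (simp add: power2_eq_square)
  then show ?thesis using assms by (simp only: real_sqrt_inverse[symmetric] real_sqrt_mult[symmetric]) simp
 qed
 ultimately show ?thesis using assms(3) by (auto simp: exp_minus)
qed

text \<open>The high-temperature polynomial with edge weights \<open>x\<close>.\<close>

definition htp :: "'i::linorder set => ('i => 'i => real) => real" where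
 "htp V x = savg V (%s. \<Prod>e\<in>edges V. 1 + x (fst e) (snd e) * eps s e)"

text \<open>The second moment of the polynomial with independent random weights of mean \<open>x\<close> and variance \<open>\<kappa>\<close>, written
with two copies of the spins.\<close>

definition htp2 :: "'i::linorder set => ('i => 'i => real) => ('i => 'i => real) => real" where
 "htp2 V x \<kappa> = savg V (%s. savg V (%\<tau>. \<Prod>e\<in>edges V.
  \<kappa> (fst e) (snd e)*(eps s e * eps \<tau> e) + (1 + x (fst e) (snd e) * eps s e)*(1 + x (fst e) (snd e) * eps \<tau> e)))"

lemma pos_mult_eps: "finite V ==> e \<in> edges V ==> pos_mult V (%s. eps s e)"
 by (intro pos_mult_mult pos_mult_spin) (auto simp: edges_def)

lemma pos_mult_prod: "(!!i. i \<in> I ==> pos_mult V (P i)) ==> pos_mult V (%s. \<Prod>i\<in>I. P i s)"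
 by (induction I rule: infinite_finite_induct) (auto intro: pos_mult_mult pos_mult_const)

lemma htp_ge_1:
 assumes fin: "finite V" and x: "!!i j. i \<in> V ==> j \<in> V ==> 0 <= x i j"
 shows "1 <= htp V x"
proof -
 have xe: "0 <= x (fst e) (snd e)" if "e \<in> edges V" for e using that x unfolding edges_def by auto
 have "savg V (%s. 1) <= htp V x"
 proof -
  have ex: "(\<Prod>e\<in>edges V. 1 + f e) = (\<Sum>K\<in>Pow (edges V). (\<Prod>e\<in>K. f e))" for f :: "'a \<times> 'a => real"
   using prod_add[OF finite_edges[OF fin], of f "%_. 1"] by (simp add: add.commute)
  have "htp V x = (\<Sum>K\<in>Pow (edges V). savg V (%s. \<Prod>e\<in>K. x (fst e) (snd e) * eps s e))"
   unfolding htp_def ex savg_sum ..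
  also have "\<dots> >= savg V (%s. \<Prod>e\<in>{}. x (fst e) (snd e) * eps s e)"
  proof (rule member_le_sum)
   fix K assume "K \<in> Pow (edges V) - {{}}"
   then show "0 <= savg V (%s. \<Prod>e\<in>K. x (fst e) (snd e) * eps s e)"
    by (intro savg_pos_mult fin pos_mult_prod pos_mult_mult[OF pos_mult_const pos_mult_eps] xe) auto
  qed (use finite_edges[OF fin] in auto)
  finally show ?thesis by simp
 qed
 then show ?thesis by (simp add: savg_const[OF fin])
qed

text \<open>Choosing for each edge the \<open>\<kappa>\<close> term or the product term decouples the two replicas and leaves squares.\<close>

lemma htp2_expand:
 assumes fin: "finite V"
 shows "htp2 V x (%i j. u*\<kappa> i j) = (\<Sum>K\<in>Pow (edges V). u^card K*((\<Prod>e\<in>K. \<kappa> (fst e) (snd e)) *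
  (savg V (%s. (\<Prod>e\<in>K. eps s e)*(\<Prod>e\<in>edges V - K. 1 + x (fst e) (snd e) * eps s e)))^2))"
proof -
 let ?k = "%e. \<kappa> (fst e) (snd e)" and ?x = "%e. x (fst e) (snd e)"
 have "htp2 V x (%i j. u*\<kappa> i j) = savg V (%s. savg V (%\<tau>. \<Sum>K\<in>Pow (edges V).
   (u^card K*(\<Prod>e\<in>K. ?k e))*(((\<Prod>e\<in>K. eps s e)*(\<Prod>e\<in>edges V - K. 1 + ?x e * eps s e))*((\<Prod>e\<in>K. eps \<tau> e)*(\<Prod>e\<in>edges V - K. 1 + ?x e * eps \<tau> e)))))"
  unfolding htp2_def prod_add[OF finite_edges[OF fin]] by (simp add: prod.distrib mult_ac)
 also have "\<dots> = (\<Sum>K\<in>Pow (edges V). (u^card K*(\<Prod>e\<in>K. ?k e))*(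
  (savg V (%s. (\<Prod>e\<in>K. eps s e)*(\<Prod>e\<in>edges V - K. 1 + ?x e * eps s e))) *
  (savg V (%s. (\<Prod>e\<in>K. eps s e)*(\<Prod>e\<in>edges V - K. 1 + ?x e * eps s e)))))"
  unfolding savg_sum savg_cmult savg_cmult_right ..
 finally show ?thesis by (simp add: power2_eq_square mult.assoc)
qed

text \<open>The sets with at least two \<open>\<kappa>\<close> edges gain a factor \<open>L\<^sup>2\<close> when \<open>\<kappa>\<close> is multiplied by \<open>L\<close>.\<close>

lemma htp2_bound:
 assumes fin: "finite V" and \<kappa>: "!!i j. i \<in> V ==> j \<in> V ==> 0 <= \<kappa> i j" and L: "1 <= L"
 shows "htp2 V x \<kappa> <= (htp V x)^2 + (\<Sum>e\<in>edges V. \<kappa> (fst e) (snd e)*(savg V (%s. eps s e*(\<Prod>e'\<in>edges V - {e}. 1 + x (fst e') (snd e') * eps s e')))^2)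
  + htp2 V x (%i j. L*\<kappa> i j)/L^2"
proof -
 define c where "c K = (\<Prod>e\<in>K. \<kappa> (fst e) (snd e)) *
  (savg V (%s. (\<Prod>e\<in>K. eps s e)*(\<Prod>e\<in>edges V - K. 1 + x (fst e) (snd e) * eps s e)))^2" for K
 have c0: "0 <= c K" if "K \<subseteq> edges V" for K
  unfolding c_def by (intro mult_nonneg_nonneg prod_nonneg \<kappa>) (use that in \<open>auto simp: edges_def\<close>)
 have ex: "htp2 V x (%i j. u*\<kappa> i j) = (\<Sum>K\<in>Pow (edges V). u^card K * c K)" for u
  unfolding c_def by (rule htp2_expand[OF fin])
 have fe: "finite (edges V)" by (rule finite_edges[OF fin])
 have fK: "finite K" if "K \<in> Pow (edges V)" for K using that fe by (auto intro: finite_subset)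
 define P1 where "P1 = (%e. {e}) ` edges V"
 define P2 where "P2 = {K \<in> Pow (edges V). 2 <= card K}"
 have P2D: "K \<subseteq> edges V" "2 <= card K" if "K \<in> P2" for K using that unfolding P2_def by auto
 have P1D: "card K = 1" if "K \<in> P1" for K using that unfolding P1_def by auto
 have fP: "finite P1" "finite P2" unfolding P1_def P2_def using fe by auto
 have split: "Pow (edges V) = ({{}} \<union> P1) \<union> P2"
 proof (intro subset_antisym subsetI)
  fix K assume K: "K \<in> Pow (edges V)"
  consider "card K = 0" | "card K = 1" | "2 <= card K" by linarith
  then show "K \<in> ({{}} \<union> P1) \<union> P2"
  proof cases
   case 1 then show ?thesis using fK[OF K] by simp
  next
   case 2 then obtain e where "K = {e}" by (auto simp: card_1_singleton_iff)
   then show ?thesis using K unfolding P1_def by auto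
  next
   case 3 then show ?thesis using K unfolding P2_def by auto
  qed
 next
  fix K assume "K \<in> ({{}} \<union> P1) \<union> P2"
  then show "K \<in> Pow (edges V)" unfolding P1_def P2_def by auto
 qed
 have dis: "{{}} \<inter> P1 = {}" "({{}} \<union> P1) \<inter> P2 = {}" using P1D P2D by fastforce+
 have "htp2 V x \<kappa> = (\<Sum>K\<in>Pow (edges V). c K)" using ex[of 1] by simp
 also have "\<dots> = sum c (({{}} \<union> P1) \<union> P2)" by (rule arg_cong[OF split])
 also have "\<dots> = sum c ({{}} \<union> P1) + sum c P2" by (rule sum.union_disjoint) (use fP dis in auto)
 also have "sum c ({{}} \<union> P1) = sum c {{}} + sum c P1" by (rule sum.union_disjoint) (use fP dis in auto)
 also have "sum c {{}} = c {}" by simp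
 also have "sum c P1 = (\<Sum>e\<in>edges V. c {e})"
  unfolding P1_def by (subst sum.reindex) (auto simp: inj_on_def)
 also have "sum c P2 <= (\<Sum>K\<in>P2. L^card K * c K/L^2)"
 proof (rule sum_mono)
  fix K assume K: "K \<in> P2"
  have "L^2 <= L^card K" using P2D[OF K] L by (intro power_increasing) auto
  then have "1 <= L^card K/L^2" using L by simp
  then have "1 * c K <= (L^card K/L^2) * c K" using c0[OF P2D(1)[OF K]] by (rule mult_right_mono)
  then show "c K <= L^card K * c K/L^2" by simp
 qed
 also have "\<dots> = (\<Sum>K\<in>P2. L^card K * c K)/L^2" by (simp add: sum_divide_distrib)
 also have "\<dots> <= (\<Sum>K\<in>Pow (edges V). L^card K * c K)/L^2"
 proof (intro divide_right_mono sum_mono2)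
  show "0 <= L^card K * c K" if "K \<in> Pow (edges V) - P2" for K
   using that c0[of K] L by (intro mult_nonneg_nonneg) auto
 qed (use fe in \<open>auto simp: P2_def\<close>)
 also have "(\<Sum>K\<in>Pow (edges V). L^card K * c K) = htp2 V x (%i j. L*\<kappa> i j)" unfolding ex ..
 also have "c {} = (htp V x)^2" unfolding c_def htp_def by simp
 finally show ?thesis unfolding c_def by simp
qed

lemma exp_convex_young:
 fixes p :: real assumes "1 < p"
 shows "exp (a + c) <= exp (p * a)/p + exp (p/(p-1) * c)*(1-1/p)"
proof -
 define t where "t = 1/p"
 have t: "0 < t" "t < 1" unfolding t_def using assms by auto
 have cv: "convex_on UNIV (exp :: real => real)" by (rule exp_convex)
 have "exp ((1 - (1-t)) *\<^sub>R (p * a) + (1-t) *\<^sub>R (p/(p-1) * c)) <= (1 - (1-t)) * exp (p * a) + (1-t) * exp (p/(p-1) * c)"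
  by (rule convex_onD[OF cv]) (use t in auto)
 moreover have "(1 - (1-t)) *\<^sub>R (p * a) + (1-t) *\<^sub>R (p/(p-1) * c) = a + c"
 proof -
  have B: "(1-t)*(p/(p-1)) = 1" unfolding t_def using assms by (simp add: field_simps)
  have A: "t * p = 1" unfolding t_def using assms by simp
  have "t*(p * a) = a" by (simp only: mult.assoc[symmetric] A mult_1)
  moreover have "(1-t)*(p/(p-1) * c) = c" by (simp only: mult.assoc[symmetric] B mult_1)
  moreover have "1 - (1-t) = t" by simp
  ultimately show ?thesis by (simp only: real_scaleR_def)
 qed
 ultimately show ?thesis unfolding t_def by (simp add: mult.commute)
qed

text \<open>Bound each factor by an exponential. Young's inequality then separates the two replicas from their
overlap \<open>\<sigma>\<tau>\<close>, which is again uniformly distributed by the shift \<open>savg_shift\<close>.\<close>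

lemma htp2_exp_bound:
 assumes Ix: "ising V x" and Iy: "ising V y" and p: "1 < p"
  and y: "!!i j. i \<in> V ==> j \<in> V ==> y i j = \<kappa> i j + (x i j)^2"
  and small: "!!i j. i \<in> V ==> j \<in> V ==> 2 * x i j + y i j <= 1"
 shows "htp2 V x \<kappa> <= (ising.part V x p)^2 + ising.part V y (p/(p-1))"
proof -
 interpret X: ising V x by (rule Ix)
 interpret Y: ising V y by (rule Iy)
 define q where "q = p/(p-1)"
 define Hx where "Hx s = (\<Sum>e\<in>edges V. x (fst e) (snd e) * eps s e)" for s
 define Hy where "Hy s = (\<Sum>e\<in>edges V. y (fst e) (snd e) * eps s e)" for s
 define m where "m s \<tau> = (%i. if i \<in> V then s i*\<tau> i else undefined)" for s \<tau> :: "'a => real"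
 have px: "X.part \<mu> = savg V (%s. exp (\<mu> * Hx s))" for \<mu> unfolding Hx_def by (rule part_edges[OF Ix])
 have py: "Y.part \<mu> = savg V (%s. exp (\<mu> * Hy s))" for \<mu> unfolding Hy_def by (rule part_edges[OF Iy])
 have "htp2 V x \<kappa> <= savg V (%s. savg V (%\<tau>. exp (Hx s + Hx \<tau> + Hy (m \<tau> s))))"
  unfolding htp2_def
 proof (intro savg_mono)
  fix s \<tau> assume st: "s \<in> spins V" "\<tau> \<in> spins V"
  let ?f = "%e. \<kappa> (fst e) (snd e)*(eps s e * eps \<tau> e) + (1 + x (fst e) (snd e) * eps s e)*(1 + x (fst e) (snd e) * eps \<tau> e)"
  let ?g = "%e. x (fst e) (snd e) * eps s e + x (fst e) (snd e) * eps \<tau> e + y (fst e) (snd e)*(eps s e * eps \<tau> e)"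
  have fg: "?f e = 1 + ?g e" if "e \<in> edges V" for e
  proof -
   have "y (fst e) (snd e) = \<kappa> (fst e) (snd e) + (x (fst e) (snd e))^2" using y that unfolding edges_def by auto
   then show ?thesis by (simp add: power2_eq_square algebra_simps)
  qed
  have g1: "-1 <= ?g e" if e: "e \<in> edges V" for e
  proof -
   have V: "fst e \<in> V" "snd e \<in> V" using e unfolding edges_def by auto
   have x0: "0 <= x (fst e) (snd e)" "0 <= y (fst e) (snd e)" using X.b_nonneg[OF V] Y.b_nonneg[OF V] by auto
   have "eps s e = 1 \<or> eps s e = -1" "eps \<tau> e = 1 \<or> eps \<tau> e = -1" using eps_spin[OF st(1) e] eps_spin[OF st(2) e] by blast+
   then show ?thesis using small[OF V] x0 by (auto simp del: mult_eq_1_iff)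
  qed
  have "(\<Prod>e\<in>edges V. ?f e) <= (\<Prod>e\<in>edges V. exp (?g e))"
  proof (rule prod_mono)
   fix e assume e: "e \<in> edges V"
   show "0 <= ?f e \<and> ?f e <= exp (?g e)" unfolding fg[OF e] using g1[OF e] exp_ge_add_one_self[of "?g e"] by auto
  qed
  also have "\<dots> = exp (\<Sum>e\<in>edges V. ?g e)" using finite_edges[OF X.fin] by (simp add: exp_sum)
  also have "(\<Sum>e\<in>edges V. ?g e) = Hx s + Hx \<tau> + Hy (m \<tau> s)"
  proof -
   have "Hy (m \<tau> s) = (\<Sum>e\<in>edges V. y (fst e) (snd e)*(eps s e * eps \<tau> e))"
    unfolding Hy_def m_def by (intro sum.cong refl) (auto simp: edges_def)
   then show ?thesis unfolding Hx_def by (simp add: sum.distrib)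
  qed
  finally show "(\<Prod>e\<in>edges V. ?f e) <= exp (Hx s + Hx \<tau> + Hy (m \<tau> s))" .
 qed
 also have "\<dots> <= savg V (%s. savg V (%\<tau>. exp (p * Hx s)*(exp (p * Hx \<tau>)*(1/p)) + (1-1/p) * exp (q * Hy (m \<tau> s))))"
 proof (intro savg_mono)
  fix s \<tau>
  show "exp (Hx s + Hx \<tau> + Hy (m \<tau> s)) <= exp (p * Hx s)*(exp (p * Hx \<tau>)*(1/p)) + (1-1/p) * exp (q * Hy (m \<tau> s))"
   using exp_convex_young[OF p, of "Hx s + Hx \<tau>" "Hy (m \<tau> s)"] unfolding q_def
   by (simp add: distrib_left exp_add mult_ac)
 qed
 also have "\<dots> = savg V (%s. exp (p * Hx s)*(X.part p*(1/p)) + (1-1/p) * Y.part q)"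
 proof (rule savg_cong)
  fix s assume s: "s \<in> spins V"
  have "savg V (%\<tau>. exp (q * Hy (m \<tau> s))) = Y.part q" unfolding py m_def by (rule savg_shift[OF s, of "%s. exp (q * Hy s)"])
  then show "savg V (%\<tau>. exp (p * Hx s)*(exp (p * Hx \<tau>)*(1/p)) + (1-1/p) * exp (q * Hy (m \<tau> s)))
   = exp (p * Hx s)*(X.part p*(1/p)) + (1-1/p) * Y.part q"
   unfolding savg_add savg_cmult savg_cmult_right px by simp
 qed
 also have "\<dots> = (X.part p)^2*(1/p) + (1-1/p) * Y.part q"
  unfolding savg_add savg_cmult_right px[symmetric] savg_const[OF X.fin] by (simp add: power2_eq_square)
 also have "\<dots> <= (X.part p)^2*1 + 1 * Y.part q"
 proof (intro add_mono mult_left_mono mult_right_mono)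
  show "0 <= Y.part q" using Y.part_pos[of q] by simp
 qed (use p in auto)
 finally show ?thesis unfolding q_def by simp
qed

text \<open>\<open>1 + x e = sqrt (1 - x\<^sup>2) exp (artanh x e)\<close> turns the polynomial into an Ising partition function.\<close>

lemma htp_part:
 assumes Ix: "ising V x" and x1: "!!i j. i \<in> V ==> j \<in> V ==> x i j < 1"
 shows "htp V x = (\<Prod>e\<in>edges V. sqrt (1 - (x (fst e) (snd e))^2)) * ising.part V (%i j. artanh (x i j)) 1"
  and "ising V (%i j. artanh (x i j))"
  and "e \<in> edges V ==> savg V (%s. eps s e*(\<Prod>e'\<in>edges V. 1 + x (fst e') (snd e') * eps s e'))
   = htp V x * ising.corr V (%i j. artanh (x i j)) (fst e) (snd e)"
proof -
 interpret X: ising V x by (rule Ix)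
 have art0: "0 <= artanh (x i j)" if "i \<in> V" "j \<in> V" for i j
 proof -
  have "1 <= (1 + x i j)/(1-x i j)" using X.b_nonneg[OF that] x1[OF that] by simp
  then show ?thesis unfolding artanh_def by simp
 qed
 show IA: "ising V (%i j. artanh (x i j))"
  by unfold_locales (auto simp: X.fin art0 X.b_sym X.b_diag)
 interpret A: ising V "%i j. artanh (x i j)" by (rule IA)
 define c where "c = (\<Prod>e\<in>edges V. sqrt (1 - (x (fst e) (snd e))^2))"
 have c0: "0 < c" unfolding c_def
 proof (rule prod_pos)
  fix e assume "e \<in> edges V"
  then have "0 <= x (fst e) (snd e)" "x (fst e) (snd e) < 1" using X.b_nonneg x1 unfolding edges_def by auto
  then have "(x (fst e) (snd e))^2 < 1" by (simp add: abs_square_less_1)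
  then show "0 < sqrt (1 - (x (fst e) (snd e))^2)" by simp
 qed
 have key: "(\<Prod>e\<in>edges V. 1 + x (fst e) (snd e) * eps s e) = c * exp (A.energy s)" if "s \<in> spins V" for s
 proof -
  have "(\<Prod>e\<in>edges V. 1 + x (fst e) (snd e) * eps s e) = (\<Prod>e\<in>edges V. sqrt (1 - (x (fst e) (snd e))^2) * exp (artanh (x (fst e) (snd e)) * eps s e))"
  proof (rule prod.cong[OF refl])
   fix e assume e: "e \<in> edges V"
   then have "0 <= x (fst e) (snd e)" "x (fst e) (snd e) < 1" using X.b_nonneg x1 unfolding edges_def by auto
   then show "1 + x (fst e) (snd e) * eps s e = sqrt (1 - (x (fst e) (snd e))^2) * exp (artanh (x (fst e) (snd e)) * eps s e)"
    using eps_spin[OF that e] by (rule one_plus_spin)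
  qed
  also have "\<dots> = c * exp (A.energy s)"
   unfolding c_def energy_edges[OF IA] prod.distrib using finite_edges[OF X.fin] by (simp add: exp_sum)
  finally show ?thesis .
 qed
 have hp: "htp V x = c * A.part 1"
 proof -
  have "htp V x = savg V (%s. c * exp (A.energy s))" unfolding htp_def by (rule savg_cong) (rule key)
  then show ?thesis unfolding savg_cmult A.part_def savg_def by simp
 qed
 then show "htp V x = (\<Prod>e\<in>edges V. sqrt (1 - (x (fst e) (snd e))^2)) * A.part 1" unfolding c_def .
 show "savg V (%s. eps s e*(\<Prod>e'\<in>edges V. 1 + x (fst e') (snd e') * eps s e')) = htp V x * A.corr (fst e) (snd e)" if "e \<in> edges V"
 proof -
  have "savg V (%s. eps s e*(\<Prod>e'\<in>edges V. 1 + x (fst e') (snd e') * eps s e')) = savg V (%s. c*(eps s e * exp (A.energy s)))"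
   by (rule savg_cong) (simp add: key)
  also have "\<dots> = c*(A.part 1 * A.corr (fst e) (snd e))"
   unfolding savg_cmult A.corr_def A.gibbs_def A.total_def A.part_def savg_def using A.total_1_pos unfolding A.total_def by simp
  finally show ?thesis unfolding hp by simp
 qed
qed

text \<open>By positivity, restoring the factor of the marked edge only increases the average, and what results is
the mean times a correlation.\<close>

theorem htp2_variance:
 assumes Ix: "ising V x" and x1: "!!i j. i \<in> V ==> j \<in> V ==> x i j < 1"
  and \<kappa>: "!!i j. i \<in> V ==> j \<in> V ==> 0 <= \<kappa> i j \<and> \<kappa> i j <= k" and L: "1 <= L"
 shows "htp2 V x \<kappa> <= (htp V x)^2*(1 + k*(frob V (ising.offcorr V (%i j. artanh (x i j))))^2/2) + htp2 V x (%i j. L*\<kappa> i j)/L^2"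
proof -
 interpret X: ising V x by (rule Ix)
 have IA: "ising V (%i j. artanh (x i j))" by (rule htp_part(2)[OF Ix x1])
 interpret A: ising V "%i j. artanh (x i j)" by (rule IA)
 let ?x = "%e. x (fst e) (snd e)"
 have fe: "finite (edges V)" by (rule finite_edges[OF X.fin])
 have VV: "fst e \<in> V" "snd e \<in> V" if "e \<in> edges V" for e using that unfolding edges_def by auto
 have "(savg V (%s. eps s e*(\<Prod>e'\<in>edges V - {e}. 1 + ?x e' * eps s e')))^2 <= (htp V x * A.corr (fst e) (snd e))^2" (is "?l\<^sup>2 <= _")
  if e: "e \<in> edges V" for e
 proof (rule power_mono)
  have pp: "pos_mult V (%s. \<Prod>e'\<in>edges V - {e}. 1 + ?x e' * eps s e')"
   by (rule pos_mult_prod, rule pos_mult_add[OF pos_mult_const pos_mult_mult[OF pos_mult_const pos_mult_eps[OF X.fin]]])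
    (use X.b_nonneg VV in auto)
  show "0 <= ?l" by (rule savg_pos_mult[OF X.fin pos_mult_mult[OF pos_mult_eps[OF X.fin e] pp]])
  have "?l <= ?l + ?x e * savg V (%s. \<Prod>e'\<in>edges V - {e}. 1 + ?x e' * eps s e')"
   using savg_pos_mult[OF X.fin pp] X.b_nonneg[OF VV[OF e]] by simp
  also have "\<dots> = savg V (%s. eps s e*(\<Prod>e'\<in>edges V. 1 + ?x e' * eps s e'))"
   unfolding savg_cmult[symmetric] savg_add[symmetric]
  proof (rule savg_cong)
   fix s assume s: "s \<in> spins V"
   have "eps s e * eps s e = 1" using eps_spin[OF s e] by auto
   then have "eps s e*(1 + ?x e * eps s e) = eps s e + ?x e" by (simp add: distrib_left)
   then show "eps s e*(\<Prod>e'\<in>edges V - {e}. 1 + ?x e' * eps s e') + ?x e*(\<Prod>e'\<in>edges V - {e}. 1 + ?x e' * eps s e')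
    = eps s e*(\<Prod>e'\<in>edges V. 1 + ?x e' * eps s e')"
    unfolding prod.remove[OF fe e] by (simp add: distrib_right[symmetric] mult.assoc[symmetric])
  qed
  also have "\<dots> = htp V x * A.corr (fst e) (snd e)" by (rule htp_part(3)[OF Ix x1 e])
  finally show "?l <= htp V x * A.corr (fst e) (snd e)" .
 qed
 then have "(\<Sum>e\<in>edges V. \<kappa> (fst e) (snd e)*(savg V (%s. eps s e*(\<Prod>e'\<in>edges V - {e}. 1 + ?x e' * eps s e')))^2)
  <= (\<Sum>e\<in>edges V. k*(htp V x * A.corr (fst e) (snd e))^2)"
 proof (intro sum_mono)
  fix e assume e: "e \<in> edges V" and *: "!!e. e \<in> edges V ==> (savg V (%s. eps s e*(\<Prod>e'\<in>edges V - {e}. 1 + ?x e' * eps s e')))^2 <= (htp V x * A.corr (fst e) (snd e))^2"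
  have k: "0 <= \<kappa> (fst e) (snd e)" "\<kappa> (fst e) (snd e) <= k" using \<kappa>[OF VV[OF e]] by auto
  then have "0 <= k" by linarith
  then show "\<kappa> (fst e) (snd e)*(savg V (%s. eps s e*(\<Prod>e'\<in>edges V - {e}. 1 + ?x e' * eps s e')))^2
   <= k*(htp V x * A.corr (fst e) (snd e))^2"
   by (rule mult_mono[OF k(2) *[OF e]]) simp
 qed
 also have "\<dots> = (htp V x)^2*(k*(frob V A.offcorr)^2/2)"
  unfolding offcorr_edges[OF IA] by (simp add: power_mult_distrib sum_distrib_left mult_ac)
 finally show ?thesis
  using htp2_bound[OF X.fin, of \<kappa> L x] \<kappa> L by (auto simp: distrib_left)
qed

section \<open>The Hilbert space of square-integrable functions\<close>

abbreviation U :: "real measure" where "U \<equiv> lebesgue_on {0..1}"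

abbreviation U2 :: "(real \<times> real) measure" where "U2 \<equiv> lebesgue_on unit_square"

lemma prob_space_U: "prob_space U"
 by (rule prob_spaceI) (simp add: emeasure_restrict_space)

interpretation U: prob_space U by (rule prob_space_U)

lemma L2_unitD:
 assumes "f \<in> L2_unit"
 shows "f \<in> borel_measurable U" "integrable U (%x. (f x)^2)"
 using assms unfolding L2_unit_def by auto

lemma L2_unit_mult_integrable:
 assumes "f \<in> L2_unit" "g \<in> L2_unit" shows "integrable U (%x. f x * g x)"
proof (rule Bochner_Integration.integrable_bound)
 show "integrable U (%x. (f x)^2 + (g x)^2)" using assms by (intro Bochner_Integration.integrable_add L2_unitD)
 show "(%x. f x * g x) \<in> borel_measurable U" using assms by (intro borel_measurable_times L2_unitD)
 have "\<bar>a * b\<bar> <= a^2 + b^2" for a b :: real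
 proof -
  have "0 <= (\<bar>a\<bar> - \<bar>b\<bar>)^2" by simp
  then have "2*\<bar>a * b\<bar> <= a^2 + b^2" by (simp add: power2_diff abs_mult)
  then show ?thesis by simp
 qed
 then show "AE x in U. norm (f x * g x) <= norm ((f x)^2 + (g x)^2)" by auto
qed

lemma L2_unit_add: assumes "f \<in> L2_unit" "g \<in> L2_unit" shows "(%x. f x + g x) \<in> L2_unit"
proof -
 have "(%x. (f x + g x)^2) = (%x. (f x)^2 + (g x)^2 + 2*(f x * g x))" by (auto simp: power2_sum)
 moreover have "integrable U (%x. (f x)^2 + (g x)^2 + 2*(f x * g x))"
  using assms by (intro Bochner_Integration.integrable_add integrable_mult_right L2_unitD L2_unit_mult_integrable)
 ultimately show ?thesis unfolding L2_unit_def using assms by (auto intro: borel_measurable_add L2_unitD)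
qed

lemma L2_unit_scale: "f \<in> L2_unit ==> (%x. c * f x) \<in> L2_unit"
 unfolding L2_unit_def by (auto simp: power_mult_distrib)

lemma L2_unit_bounded:
 assumes "f \<in> borel_measurable U" "!!x. x \<in> {0..1} ==> \<bar>f x\<bar> <= B"
 shows "f \<in> L2_unit"
 unfolding L2_unit_def
proof (intro CollectI conjI assms(1) U.integrable_const_bound[where B="B^2"])
 show "AE x in U. norm ((f x)^2) <= B^2"
 proof (rule AE_I2)
  fix x assume "x \<in> space U"
  then have "\<bar>f x\<bar> <= B" using assms(2)[of x] by (simp add: space_restrict_space)
  then have "\<bar>f x\<bar>\<^sup>2 <= B^2" by (intro power_mono) auto
  then show "norm ((f x)^2) <= B^2" by simp
 qed
 show "(%x. (f x)^2) \<in> borel_measurable U" using assms(1) by simp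
qed

definition l2_rel :: "(real => real) => (real => real) => bool" where
 "l2_rel f g \<longleftrightarrow> f \<in> L2_unit \<and> g \<in> L2_unit \<and> (AE x in U. f x = g x)"

lemma l2_rel_AE: "l2_rel f g ==> AE x in U. f x = g x" unfolding l2_rel_def by simp

lemma part_equivp_l2_rel: "part_equivp l2_rel"
proof (rule part_equivpI)
 have "l2_rel (%_. 0) (%_. 0)" unfolding l2_rel_def L2_unit_def by auto
 then show "\<exists>x. l2_rel x x" by blast
 show "symp l2_rel" unfolding symp_def l2_rel_def by auto
 show "transp l2_rel" unfolding transp_def l2_rel_def by (auto elim: AE_mp)
qed

text \<open>A type of its own makes the library of inner product spaces applicable.\<close>

quotient_type l2 = "real => real" / partial: l2_rel
 by (rule part_equivp_l2_rel)

lemma L2_unit_0: "(%x. 0) \<in> L2_unit" unfolding L2_unit_def by auto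

lemma L2_unit_diff: assumes "f \<in> L2_unit" "g \<in> L2_unit" shows "(%x. f x - g x) \<in> L2_unit"
 using L2_unit_add[OF assms(1) L2_unit_scale[OF assms(2), of "-1"]] by simp

instantiation l2 :: real_vector
begin
lift_definition zero_l2 :: l2 is "%x. 0" unfolding l2_rel_def by (simp add: L2_unit_0)
lift_definition plus_l2 :: "l2 => l2 => l2" is "%f g x. f x + g x"
 unfolding l2_rel_def by (auto intro: L2_unit_add)
lift_definition minus_l2 :: "l2 => l2 => l2" is "%f g x. f x - g x"
 unfolding l2_rel_def by (auto intro: L2_unit_diff)
lift_definition uminus_l2 :: "l2 => l2" is "%f x. - f x"
 unfolding l2_rel_def using L2_unit_scale[where c="-1"] by auto
lift_definition scaleR_l2 :: "real => l2 => l2" is "%c f x. c * f x"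
 unfolding l2_rel_def by (auto intro: L2_unit_scale)
instance
 by standard (transfer, auto simp: l2_rel_def algebra_simps intro!: L2_unit_add L2_unit_diff L2_unit_scale L2_unit_0 dest: L2_unit_scale[where c="-1"])+
end

instantiation l2 :: real_inner
begin
lift_definition inner_l2 :: "l2 => l2 => real" is "%f g. \<integral>x. f x * g x \<partial>U"
proof -
 fix f1 f2 g1 g2 assume "l2_rel f1 f2" "l2_rel g1 g2"
 then show "(\<integral>x. f1 x * g1 x \<partial>U) = (\<integral>x. f2 x * g2 x \<partial>U)"
  unfolding l2_rel_def
  by (intro integral_cong_AE) (auto intro!: borel_measurable_integrable[OF L2_unit_mult_integrable])
qed
definition norm_l2 :: "l2 => real" where "norm_l2 x = sqrt (inner x x)"
definition sgn_l2 :: "l2 => l2" where "sgn_l2 x = x /\<^sub>R norm x"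
definition dist_l2 :: "l2 => l2 => real" where "dist_l2 x y = norm (x - y)"
definition uniformity_l2 :: "(l2 \<times> l2) filter" where "uniformity_l2 = (INF e\<in>{0 <..}. principal {(x, y). dist x y < e})"
definition open_l2 :: "l2 set => bool" where "open_l2 S = (\<forall>x\<in>S. \<forall>\<^sub>F (x', y) in uniformity. x' = x --> y \<in> S)"
instance
proof
 fix x y z :: l2 and r :: real and S :: "l2 set"
 show "dist x y = norm (x - y)" by (rule dist_l2_def)
 show "sgn x = x /\<^sub>R norm x" by (rule sgn_l2_def)
 show "uniformity = (INF e\<in>{0 <..}. principal {(x :: l2, y). dist x y < e})" by (rule uniformity_l2_def)
 show "open S = (\<forall>x\<in>S. \<forall>\<^sub>F (x', y) in uniformity. x' = x --> y \<in> S)" by (rule open_l2_def)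
 show "inner x y = inner y x" by transfer (simp add: mult.commute)
 show "inner (x + y) z = inner x z + inner y z"
  by transfer (auto simp: l2_rel_def distrib_right intro!: Bochner_Integration.integral_add L2_unit_mult_integrable)
 show "inner (scaleR r x) y = r * inner x y" by transfer (simp add: mult.assoc)
 show "0 <= inner x x" by transfer (simp add: integral_nonneg_AE)
 show "(inner x x = 0) = (x = 0)"
 proof (transfer)
  fix f assume f: "l2_rel f f"
  then have i: "integrable U (%x. f x * f x)" unfolding l2_rel_def by (auto intro: L2_unit_mult_integrable)
  have "((\<integral>x. f x * f x \<partial>U) = 0) = (AE x in U. f x * f x = 0)"
   by (rule integral_nonneg_eq_0_iff_AE[OF i]) simp
  also have "\<dots> = l2_rel f (%x. 0)" using f unfolding l2_rel_def by (auto simp: L2_unit_0)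
  finally show "((\<integral>x. f x * f x \<partial>U) = 0) = l2_rel f (%x. 0)" .
 qed
 show "norm x = sqrt (inner x x)" by (rule norm_l2_def)
qed
end

abbreviation l2_of :: "(real => real) => l2" where "l2_of \<equiv> abs_l2"
abbreviation fun_of :: "l2 => real => real" where "fun_of \<equiv> rep_l2"

lemma l2_rel_refl: "f \<in> L2_unit ==> l2_rel f f" unfolding l2_rel_def by simp

lemma fun_of_L2: "fun_of x \<in> L2_unit"
 using Quotient_rep_reflp[OF Quotient_l2, of x] unfolding l2_rel_def by simp

lemma l2_of_fun_of: "l2_of (fun_of x) = x"
 by (rule Quotient_abs_rep[OF Quotient_l2])

lemma fun_of_l2_of: "f \<in> L2_unit ==> AE x in U. fun_of (l2_of f) x = f x"
 using Quotient_rep_abs[OF Quotient_l2 l2_rel_refl] by (rule l2_rel_AE)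

lemma l2_of_eq: "f \<in> L2_unit ==> g \<in> L2_unit ==> l2_of f = l2_of g \<longleftrightarrow> (AE x in U. f x = g x)"
 using Quotient_rel[OF Quotient_l2, of f g] unfolding l2_rel_def by auto

lemma l2_of_inner: "f \<in> L2_unit ==> g \<in> L2_unit ==> inner (l2_of f) (l2_of g) = (\<integral>x. f x * g x \<partial>U)"
 by (rule inner_l2.abs_eq) (auto intro: l2_rel_refl)

lemma l2_of_norm: "f \<in> L2_unit ==> norm (l2_of f) = L2_unit_norm f"
 unfolding norm_l2_def L2_unit_norm_def by (simp add: l2_of_inner power2_eq_square)

lemma norm_fun_of: "norm x = L2_unit_norm (fun_of x)"
 using l2_of_norm[OF fun_of_L2, of x] by (simp add: l2_of_fun_of)

lemma l2_of_add: "f \<in> L2_unit ==> g \<in> L2_unit ==> l2_of f + l2_of g = l2_of (%x. f x + g x)"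
 by (rule plus_l2.abs_eq) (auto intro: l2_rel_refl)

lemma l2_of_diff: "f \<in> L2_unit ==> g \<in> L2_unit ==> l2_of f - l2_of g = l2_of (%x. f x - g x)"
 by (rule minus_l2.abs_eq) (auto intro: l2_rel_refl)

lemma l2_of_scale: "f \<in> L2_unit ==> c *\<^sub>R l2_of f = l2_of (%x. c * f x)"
 by (rule scaleR_l2.abs_eq) (auto intro: l2_rel_refl)

lemma l2_of_sum:
 assumes "!!i. i \<in> I ==> f i \<in> L2_unit"
 shows "(%x. \<Sum>i\<in>I. f i x) \<in> L2_unit \<and> (\<Sum>i\<in>I. l2_of (f i)) = l2_of (%x. \<Sum>i\<in>I. f i x)"
 using assms
proof (induction I rule: infinite_finite_induct)
 case (insert i I)
 then show ?case by (simp add: l2_of_add L2_unit_add)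
qed (auto simp: L2_unit_0 zero_l2.abs_eq)

lemma fun_of_diff: "AE t in U. fun_of (x - y) t = fun_of x t - fun_of y t"
proof -
 have "x - y = l2_of (%t. fun_of x t - fun_of y t)"
  using l2_of_diff[OF fun_of_L2 fun_of_L2, of x y] by (simp add: l2_of_fun_of)
 then show ?thesis using fun_of_l2_of[OF L2_unit_diff[OF fun_of_L2 fun_of_L2, of x y]] by simp
qed

lemma norm_sq_nn: "(\<integral>\<^sup>+t. ennreal ((fun_of x t)^2) \<partial>U) = ennreal ((norm x)^2)"
proof -
 have "(norm x)^2 = (\<integral>t. (fun_of x t)^2 \<partial>U)"
  unfolding norm_fun_of L2_unit_norm_def by (simp add: integral_nonneg_AE)
 then show ?thesis by (subst nn_integral_eq_integral) (auto intro: L2_unitD fun_of_L2)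
qed

lemma norm_diff_sq_nn: "(\<integral>\<^sup>+t. ennreal ((fun_of x t - fun_of y t)^2) \<partial>U) = ennreal ((norm (x - y))^2)"
proof -
 have "(\<integral>\<^sup>+t. ennreal ((fun_of x t - fun_of y t)^2) \<partial>U) = (\<integral>\<^sup>+t. ennreal ((fun_of (x - y) t)^2) \<partial>U)"
  by (rule nn_integral_cong_AE) (use fun_of_diff[of x y] in eventually_elim, simp)
 then show ?thesis by (simp add: norm_sq_nn)
qed

lemma L1_le_norm: "(\<integral>\<^sup>+t. ennreal \<bar>fun_of x t - fun_of y t\<bar> \<partial>U) <= ennreal (norm (x - y))"
proof -
 have "integrable U (%t. (fun_of (x - y) t)^2)" by (rule L2_unitD[OF fun_of_L2])
 have m[measurable]: "fun_of z \<in> borel_measurable U" for z by (rule L2_unitD[OF fun_of_L2])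
 have one: "(%_. 1) \<in> L2_unit" by (rule L2_unit_bounded[where B=1]) auto
 have ab: "(%t. \<bar>fun_of (x - y) t\<bar>) \<in> L2_unit"
  using fun_of_L2[of "x - y"] unfolding L2_unit_def by auto
 have i: "integrable U (%t. \<bar>fun_of (x - y) t\<bar>)" using L2_unit_mult_integrable[OF ab one] by simp
 have "(\<integral>\<^sup>+t. ennreal \<bar>fun_of x t - fun_of y t\<bar> \<partial>U) = (\<integral>\<^sup>+t. ennreal \<bar>fun_of (x - y) t\<bar> \<partial>U)"
  by (rule nn_integral_cong_AE) (use fun_of_diff[of x y] in eventually_elim, simp)
 also have "\<dots> = ennreal (\<integral>t. \<bar>fun_of (x - y) t\<bar> \<partial>U)" using i by (intro nn_integral_eq_integral) auto
 also have "(\<integral>t. \<bar>fun_of (x - y) t\<bar> \<partial>U) = inner (l2_of (%t. \<bar>fun_of (x - y) t\<bar>)) (l2_of (%_. 1))"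
  by (simp add: l2_of_inner[OF ab one])
 also have "\<dots> <= norm (l2_of (%t. \<bar>fun_of (x - y) t\<bar>)) * norm (l2_of (%_. 1))" by (rule norm_cauchy_schwarz)
 also have "\<dots> = norm (x - y)"
  unfolding l2_of_norm[OF ab] l2_of_norm[OF one] norm_fun_of[of "x - y"] L2_unit_norm_def using U.prob_space by simp
 finally show ?thesis by (simp add: ennreal_leI)
qed

text \<open>Riesz-Fischer: a fast Cauchy subsequence converges almost everywhere, and Fatou's lemma identifies the
limit in the mean.\<close>

instance l2 :: complete_space
proof
 fix X :: "nat => l2" assume X: "Cauchy X"
 have "\<exists>n0. \<forall>m\<ge>n0. \<forall>n\<ge>n0. norm (X m - X n) < (1/2)^k" for k
  using CauchyD[OF X, of "(1/2)^k"] by simp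
 then obtain n0 where n0: "!!k m n. n0 k <= m ==> n0 k <= n ==> norm (X m - X n) < (1/2)^k" by metis
 define r where "r k = (\<Sum>i\<le>k. n0 i) + k" for k
 have r_ge: "n0 k <= r k" for k
 proof -
  have "n0 k <= (\<Sum>i\<le>k. n0 i)" by (rule member_le_sum) auto
  then show ?thesis unfolding r_def by simp
 qed
 have r_mono: "strict_mono r" unfolding strict_mono_Suc_iff r_def by simp
 then have rr: "r k <= r m" if "k <= m" for k m using that by (simp add: strict_mono_leD)
 define f where "f k = fun_of (X (r k))" for k
 have fm[measurable]: "f k \<in> borel_measurable U" for k unfolding f_def by (rule L2_unitD[OF fun_of_L2])
 have rk: "norm (X (r m) - X (r n)) < (1/2)^k" if "k <= m" "k <= n" for k m n
  using n0[of k "r m" "r n"] r_ge[of k] rr[OF that(1)] rr[OF that(2)] by auto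
 have "(\<integral>\<^sup>+t. (\<Sum>k. ennreal \<bar>f (Suc k) t - f k t\<bar>) \<partial>U) = (\<Sum>k. \<integral>\<^sup>+t. ennreal \<bar>f (Suc k) t - f k t\<bar> \<partial>U)"
  by (rule nn_integral_suminf) simp
 also have "\<dots> <= (\<Sum>k. ennreal ((1/2)^k))"
 proof (rule suminf_le)
  fix k show "(\<integral>\<^sup>+t. ennreal \<bar>f (Suc k) t - f k t\<bar> \<partial>U) <= ennreal ((1/2)^k)"
   unfolding f_def using L1_le_norm[of "X (r (Suc k))" "X (r k)"] rk[of k "Suc k" k]
   by (intro order_trans[OF L1_le_norm] ennreal_leI) auto
 qed auto
 also have "\<dots> = ennreal (\<Sum>k. (1/2)^k)" by (intro suminf_ennreal2) auto
 also have "\<dots> < \<infinity>" by simp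
 finally have "AE t in U. (\<Sum>k. ennreal \<bar>f (Suc k) t - f k t\<bar>) ~= \<infinity>"
  by (intro nn_integral_PInf_AE) (auto simp: less_top)
 then have conv: "AE t in U. (%k. f k t) ----> lim (%k. f k t)"
 proof eventually_elim
  fix t assume "(\<Sum>k. ennreal \<bar>f (Suc k) t - f k t\<bar>) ~= \<infinity>"
  then have "summable (%k. \<bar>f (Suc k) t - f k t\<bar>)" by (intro summable_suminf_not_top) auto
  then have "summable (%k. f (Suc k) t - f k t)" by (rule summable_rabs_cancel)
  then have "convergent (%n. \<Sum>k<n. f (Suc k) t - f k t)" by (simp add: summable_iff_convergent)
  moreover have "(\<Sum>k<n. f (Suc k) t - f k t) = f n t - f 0 t" for n
   by (rule sum_lessThan_telescope)
  ultimately have "convergent (%n. f n t - f 0 t)" by simp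
  then have "convergent (%n. (f n t - f 0 t) + f 0 t)" by (intro convergent_add convergent_const)
  then show "(%k. f k t) ----> lim (%k. f k t)" by (simp add: convergent_LIMSEQ_iff)
 qed
 define g where "g t = lim (%k. f k t)" for t
 have gm[measurable]: "g \<in> borel_measurable U" unfolding g_def by (rule borel_measurable_lim_metric) simp
 have fatou: "(\<integral>\<^sup>+t. ennreal ((f m t - g t)^2) \<partial>U) <= ennreal (((1/2)^k)^2)" if "k <= m" for m k
 proof -
  have "(\<integral>\<^sup>+t. ennreal ((f m t - g t)^2) \<partial>U) = (\<integral>\<^sup>+t. liminf (%n. ennreal ((f m t - f n t)^2)) \<partial>U)"
  proof (rule nn_integral_cong_AE)
   show "AE t in U. ennreal ((f m t - g t)^2) = liminf (%n. ennreal ((f m t - f n t)^2))"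
    using conv
   proof eventually_elim
    fix t assume "(%k. f k t) ----> lim (%k. f k t)"
    then have "(%n. ennreal ((f m t - f n t)^2)) ----> ennreal ((f m t - g t)^2)"
     unfolding g_def by (intro tendsto_intros)
    then show "ennreal ((f m t - g t)^2) = liminf (%n. ennreal ((f m t - f n t)^2))"
     by (intro lim_imp_Liminf[symmetric]) simp_all
   qed
  qed
  also have "\<dots> <= liminf (%n. \<integral>\<^sup>+t. ennreal ((f m t - f n t)^2) \<partial>U)"
   by (rule nn_integral_liminf) simp
  also have "\<dots> = liminf (%n. ennreal ((norm (X (r m) - X (r n)))^2))"
   unfolding f_def norm_diff_sq_nn ..
  also have "\<dots> <= liminf (%n. ennreal (((1/2)^k)^2))"
  proof (rule Liminf_mono, rule eventually_sequentiallyI[of k])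
   fix n assume "k <= n"
   then have "(norm (X (r m) - X (r n)))^2 <= ((1/2)^k)^2"
    using rk[OF that, of n] by (intro power_mono) auto
   then show "ennreal ((norm (X (r m) - X (r n)))^2) <= ennreal (((1/2)^k)^2)" by (rule ennreal_leI)
  qed
  also have "\<dots> = ennreal (((1/2)^k)^2)" by (simp add: Liminf_const)
  finally show ?thesis .
 qed
 have L: "(%t. f m t - g t) \<in> L2_unit" for m
  unfolding L2_unit_def using fatou[of 0 m]
  by (auto intro!: integrableI_nonneg simp: le_less_trans)
 have gL: "g \<in> L2_unit"
  using L2_unit_diff[OF fun_of_L2[of "X (r 0)"] L[of 0]] unfolding f_def by simp
 have nb: "norm (X (r m) - l2_of g) <= (1/2)^m" for m
 proof -
  have ae: "AE t in U. fun_of (l2_of g) t = g t" by (rule fun_of_l2_of[OF gL])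
  have "(\<integral>\<^sup>+t. ennreal ((fun_of (X (r m)) t - fun_of (l2_of g) t)^2) \<partial>U) = (\<integral>\<^sup>+t. ennreal ((f m t - g t)^2) \<partial>U)"
   unfolding f_def by (rule nn_integral_cong_AE) (use ae in eventually_elim, simp)
  then have "ennreal ((norm (X (r m) - l2_of g))^2) <= ennreal (((1/2)^m)^2)"
   unfolding norm_diff_sq_nn using fatou[of m m] by simp
  then have "(norm (X (r m) - l2_of g))^2 <= ((1/2)^m)^2" by (simp add: ennreal_le_iff)
  then show ?thesis by (rule power2_le_imp_le) simp
 qed
 have "(%m. X (r m) - l2_of g) ----> 0"
  by (rule Lim_null_comparison[where g="%m. (1/2)^m"]) (use nb in \<open>auto intro!: always_eventually LIMSEQ_power_zero\<close>)
 then have "(X \<circ> r) ----> l2_of g" by (simp add: LIM_zero_iff comp_def)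
 then have "X ----> l2_of g" by (rule Cauchy_converges_subseq[OF X r_mono])
 then show "convergent X" by (rule convergentI)
qed

section \<open>Spectral theory of compact symmetric operators\<close>

definition orthonormal :: "('i => 'h::real_inner) => 'i set => bool" where
 "orthonormal e I \<longleftrightarrow> (\<forall>i\<in>I. \<forall>j\<in>I. inner (e i) (e j) = (if i = j then 1 else 0))"

lemma orthonormalD:
 assumes "orthonormal e I" "i \<in> I"
 shows "inner (e i) (e i) = 1" "norm (e i) = 1" "j \<in> I ==> j ~= i ==> inner (e i) (e j) = 0"
 using assms unfolding orthonormal_def by (auto simp: norm_eq_sqrt_inner)

lemma orthonormal_inner_sum:
 assumes "orthonormal e I" "finite I" "j \<in> I"
 shows "inner (e j) (\<Sum>i\<in>I. c i *\<^sub>R e i) = c j"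
proof -
 have "inner (e j) (\<Sum>i\<in>I. c i *\<^sub>R e i) = (\<Sum>i\<in>I. if i = j then c i else 0)"
  unfolding inner_sum_right inner_scaleR_right
  by (rule sum.cong) (use assms in \<open>auto simp: orthonormal_def\<close>)
 then show ?thesis using assms by simp
qed

lemma orthonormal_norm_sum:
 assumes "orthonormal e I" "finite I"
 shows "(norm (\<Sum>i\<in>I. c i *\<^sub>R e i))^2 = (\<Sum>i\<in>I. (c i)^2)"
proof -
 have "(norm (\<Sum>i\<in>I. c i *\<^sub>R e i))^2 = (\<Sum>j\<in>I. c j * inner (e j) (\<Sum>i\<in>I. c i *\<^sub>R e i))"
  unfolding power2_norm_eq_inner by (subst inner_sum_left) simp
 also have "\<dots> = (\<Sum>j\<in>I. (c j)^2)"
  using orthonormal_inner_sum[OF assms] by (intro sum.cong) (auto simp: power2_eq_square)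
 finally show ?thesis .
qed

lemma orthonormal_pythagoras:
 assumes "orthonormal e I" "finite I"
 defines "P \<equiv> %x. \<Sum>i\<in>I. inner (e i) x *\<^sub>R e i"
 shows "(norm x)^2 = (\<Sum>i\<in>I. (inner (e i) x)^2) + (norm (x - P x))^2"
  and "i \<in> I ==> inner (e i) (x - P x) = 0"
proof -
 have 1: "inner (e i) (x - P x) = 0" if "i \<in> I" for i
  unfolding inner_diff_right P_def using orthonormal_inner_sum[OF assms(1,2) that] by simp
 then show "i \<in> I ==> inner (e i) (x - P x) = 0" .
 have 2: "inner (P x) (x - P x) = 0"
 proof -
  have "inner (P x) y = (\<Sum>i\<in>I. inner (e i) x * inner (e i) y)" for y
   unfolding P_def by (simp add: inner_sum_left)
  then show ?thesis using 1 by simp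
 qed
 have "x = P x + (x - P x)" by simp
 then have "(norm x)^2 = inner (P x + (x - P x)) (P x + (x - P x))" unfolding power2_norm_eq_inner by simp
 also have "\<dots> = inner (P x) (P x) + 2 * inner (P x) (x - P x) + inner (x - P x) (x - P x)"
  by (simp only: inner_add_left inner_add_right inner_commute[of "x - P x" "P x"])
 also have "\<dots> = (norm (P x))^2 + (norm (x - P x))^2" unfolding 2 power2_norm_eq_inner by simp
 also have "(norm (P x))^2 = (\<Sum>i\<in>I. (inner (e i) x)^2)"
  unfolding P_def by (rule orthonormal_norm_sum[OF assms(1,2)])
 finally show "(norm x)^2 = (\<Sum>i\<in>I. (inner (e i) x)^2) + (norm (x - P x))^2" .
qed

lemma orthonormal_bessel:
 assumes "orthonormal e I" "finite I" shows "(\<Sum>i\<in>I. (inner (e i) x)^2) <= (norm x)^2"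
 using orthonormal_pythagoras(1)[OF assms, of x] by simp

locale compact_symmetric =
 fixes T :: "'h::{real_inner,complete_space} => 'h"
 assumes bl: "bounded_linear T"
  and sym: "!!x y. inner (T x) y = inner x (T y)"
  and comp: "!!x :: nat => 'h. bounded (range x) ==> \<exists>r :: nat => nat. strict_mono r \<and> convergent (%n. T (x (r n)))"
begin

lemma T_simps: "T (x + y) = T x + T y" "T (x - y) = T x - T y" "T (c *\<^sub>R x) = c *\<^sub>R T x" "T 0 = 0" "T (sum f I) = (\<Sum>i\<in>I. T (f i))"
 by (simp_all add: linear_add linear_diff linear_scale linear_0 linear_sum bounded_linear.linear[OF bl])

lemma pow_bl: "bounded_linear (T ^^ k)"
proof (induction k)
 case 0 show ?case by (simp add: bounded_linear_ident id_def)
next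
 case (Suc k) show ?case using bounded_linear_compose[OF bl Suc] by (simp add: comp_def)
qed

lemma pow_sym: "inner ((T ^^ k) x) y = inner x ((T ^^ k) y)"
 by (induction k arbitrary: x y) (auto simp: sym funpow_swap1)

text \<open>Let \<open>s\<close> be the norm of \<open>T\<close> on \<open>V\<close>. On a maximizing sequence \<open>T\<^sup>2 x - s\<^sup>2 x\<close> tends to 0, so compactness gives
\<open>h\<close> with \<open>T\<^sup>2 h = s\<^sup>2 h\<close>; either \<open>T h + s h\<close> or \<open>h\<close> is an eigenvector.\<close>

lemma eigenvector_on_subspace:
 assumes V: "closed V" "subspace V" and inv: "!!v. v \<in> V ==> T v \<in> V" and nz: "v0 \<in> V" "T v0 ~= 0"
 obtains l f where "f \<in> V" "norm f = 1" "T f = l *\<^sub>R f" "l ~= 0" "!!v. v \<in> V ==> norm (T v) <= \<bar>l\<bar> * norm v"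
proof -
 define B where "B = V \<inter> cball 0 1"
 define s where "s = (SUP v\<in>B. norm (T v))"
 obtain K where K: "!!x. norm (T x) <= norm x * K" "0 < K" using bounded_linear.pos_bounded[OF bl] by auto
 have bdd: "bdd_above ((%v. norm (T v)) ` B)"
 proof (rule bdd_aboveI[of _ K])
  fix y assume "y \<in> (%v. norm (T v)) ` B"
  then obtain v where v: "v \<in> B" "y = norm (T v)" by auto
  then have "norm v * K <= 1 * K" using K unfolding B_def by (intro mult_right_mono) auto
  then show "y <= K" using K(1)[of v] v by simp
 qed
 have 0: "0 \<in> B" unfolding B_def using subspace_0[OF V(2)] by simp
 have sB: "norm (T v) <= s" if "v \<in> B" for v unfolding s_def by (rule cSUP_upper[OF that bdd])
 have bound: "norm (T v) <= s * norm v" if "v \<in> V" for v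
 proof (cases "v = 0")
  case True then show ?thesis by (simp add: T_simps)
 next
  case False
  have "(1/norm v) *\<^sub>R v \<in> B" unfolding B_def using that False subspace_scale[OF V(2)] by auto
  from sB[OF this] False show ?thesis by (simp add: T_simps field_simps)
 qed
 have s0: "0 < s"
 proof -
  have "v0 ~= 0" using nz T_simps(4) by auto
  have "0 < norm (T v0)" using nz by simp
  then have "0 < s * norm v0" using bound[OF nz(1)] by linarith
  then show ?thesis using \<open>v0 \<noteq> 0\<close> by (simp add: zero_less_mult_iff)
 qed
 have "\<exists>v\<in>B. s - inverse (real (Suc n)) < norm (T v)" for n
  unfolding s_def using less_cSUP_iff[of B "%v. norm (T v)" "(SUP v\<in>B. norm (T v)) - inverse (real (Suc n))"] bdd 0
  by (metis (no_types, lifting) diff_less_eq empty_iff inverse_positive_iff_positive less_add_same_cancel1 of_nat_0_less_iff zero_less_Suc)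
 then obtain x where x: "!!n. x n \<in> B" "!!n. s - inverse (real (Suc n)) < norm (T (x n))" by metis
 have "bounded (range x)" using x(1) unfolding B_def by (auto simp: bounded_iff intro!: exI[of _ 1])
 from comp[OF this] obtain r g where r: "strict_mono r" and g: "(%n. T (x (r n))) ----> g"
  unfolding convergent_def by blast
 have xV: "x n \<in> V" "norm (x n) <= 1" for n using x(1)[of n] unfolding B_def by auto
 have gV: "g \<in> V" by (rule closed_sequentially[OF V(1) _ g]) (use inv xV in auto)
 have nTx: "(%n. norm (T (x n))) ----> s"
 proof (rule tendsto_sandwich[of "%n. s - inverse (real (Suc n))" _ _ "%_. s"])
  show "(%n. s - inverse (real (Suc n))) ----> s"
   using tendsto_diff[OF tendsto_const[of s] LIMSEQ_inverse_real_of_nat] by simp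
  show "EV n. s - inverse (real (Suc n)) <= norm (T (x n))" using x(2) less_imp_le by (intro always_eventually) blast
  show "EV n. norm (T (x n)) <= s" using sB x(1) by (intro always_eventually) blast
 qed simp
 have key: "(norm (T (T (x n)) - s^2 *\<^sub>R x n))^2 <= s^2*(s^2 - (norm (T (x n)))^2)" for n
 proof -
  have "(norm (T (T (x n)) - s^2 *\<^sub>R x n))^2 = (norm (T (T (x n))))^2 - 2 * s^2 * inner (T (T (x n))) (x n) + s^4*(norm (x n))^2"
   unfolding power2_norm_eq_inner
   by (simp add: inner_diff_left inner_diff_right inner_commute[of "x n" "T (T (x n))"] power4_eq_xxxx power2_eq_square algebra_simps)
  also have "inner (T (T (x n))) (x n) = (norm (T (x n)))^2" unfolding power2_norm_eq_inner by (rule sym)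
  finally have 1: "(norm (T (T (x n)) - s^2 *\<^sub>R x n))^2 = (norm (T (T (x n))))^2 - 2 * s^2*(norm (T (x n)))^2 + s^4*(norm (x n))^2" .
  have "(norm (T (T (x n))))^2 <= (s * norm (T (x n)))^2" using bound[OF inv[OF xV(1)]] by (intro power_mono) auto
  then have 2: "(norm (T (T (x n))))^2 <= s^2*(norm (T (x n)))^2" by (simp add: power_mult_distrib)
  have "s^4*(norm (x n))^2 <= s^4*1" using xV(2)[of n] s0 by (intro mult_left_mono) (auto simp: power_le_one)
  moreover have "s^2*(s^2 - (norm (T (x n)))^2) = s^4 - s^2*(norm (T (x n)))^2"
   by (simp add: power4_eq_xxxx power2_eq_square algebra_simps)
  ultimately show ?thesis using 1 2 by linarith
 qed
 have "(%n. s\<^sup>2*(s^2 - (norm (T (x n)))^2)) ----> s\<^sup>2*(s^2 - s^2)"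
  by (intro tendsto_intros nTx)
 then have lim0: "(%n. s\<^sup>2*(s^2 - (norm (T (x n)))^2)) ----> 0" by simp
 have "(%n. (norm (T (T (x n)) - s^2 *\<^sub>R x n))^2) ----> 0"
 proof (rule Lim_null_comparison[OF always_eventually lim0], rule allI)
  fix n show "norm ((norm (T (T (x n)) - s^2 *\<^sub>R x n))^2) <= s^2*(s^2 - (norm (T (x n)))^2)"
   unfolding real_norm_def by (subst abs_of_nonneg[OF zero_le_power2]) (rule key)
 qed
 then have "(%n. norm (T (T (x n)) - s^2 *\<^sub>R x n)) ----> 0"
  using tendsto_real_sqrt[of "%n. (norm (T (T (x n)) - s^2 *\<^sub>R x n))^2" 0 sequentially] by simp
 then have d0: "(%n. T (T (x n)) - s^2 *\<^sub>R x n) ----> 0" by (rule tendsto_norm_zero_cancel)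
 have d0r: "(%n. T (T (x (r n))) - s^2 *\<^sub>R x (r n)) ----> 0"
  using LIMSEQ_subseq_LIMSEQ[OF d0 r] by (simp add: comp_def)
 have TTg: "(%n. T (T (x (r n)))) ----> T g" by (rule bounded_linear.tendsto[OF bl g])
 have "(%n. T (T (x (r n)))-(T (T (x (r n))) - s^2 *\<^sub>R x (r n))) ----> T g - 0"
  by (rule tendsto_diff[OF TTg d0r])
 then have "(%n. s\<^sup>2 *\<^sub>R x (r n)) ----> T g" by simp
 then have "(%n. (1/s^2) *\<^sub>R (s^2 *\<^sub>R x (r n))) ----> (1/s^2) *\<^sub>R T g" by (intro tendsto_intros)
 then have xr: "(%n. x (r n)) ----> (1/s^2) *\<^sub>R T g" using s0 by simp
 define h where "h = (1/s^2) *\<^sub>R T g"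
 have hV: "h \<in> V" unfolding h_def using inv[OF gV] subspace_scale[OF V(2)] by blast
 have Th: "T h = g"
  using LIMSEQ_unique[OF bounded_linear.tendsto[OF bl xr] g] unfolding h_def .
 have TTh: "T (T h) = s^2 *\<^sub>R h" unfolding Th unfolding h_def using s0 by simp
 have ng: "norm g = s"
  using LIMSEQ_unique[OF tendsto_norm[OF g] LIMSEQ_subseq_LIMSEQ[OF nTx r, unfolded comp_def]] .
 have h0: "h ~= 0"
 proof
  assume "h = 0"
  then have "g = 0" using Th T_simps(4) by simp
  then show False using ng s0 by simp
 qed
 have "\<exists>l f. f \<in> V \<and> f ~= 0 \<and> T f = l *\<^sub>R f \<and> \<bar>l\<bar> = s"
 proof (cases "T h + s *\<^sub>R h = 0")
  case True
  then have "T h = (- s) *\<^sub>R h" by (simp add: eq_neg_iff_add_eq_0)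
  then show ?thesis using hV h0 s0 by (intro exI[of _ "-s"] exI[of _ h]) auto
 next
  case False
  have "T (T h + s *\<^sub>R h) = s *\<^sub>R (T h + s *\<^sub>R h)"
   by (simp add: T_simps TTh scaleR_add_right power2_eq_square)
  moreover have "T h + s *\<^sub>R h \<in> V" using inv[OF hV] hV V(2) by (simp add: subspace_add subspace_scale)
  ultimately show ?thesis using False s0 by (intro exI[of _ s] exI[of _ "T h + s *\<^sub>R h"]) auto
 qed
 then obtain l f where lf: "f \<in> V" "f ~= 0" "T f = l *\<^sub>R f" "\<bar>l\<bar> = s" by blast
 show thesis
 proof (rule that[of "(1/norm f) *\<^sub>R f" l])
  show "(1/norm f) *\<^sub>R f \<in> V" using lf V(2) by (simp add: subspace_scale)
  show "norm ((1/norm f) *\<^sub>R f) = 1" using lf by simp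
  show "T ((1/norm f) *\<^sub>R f) = l *\<^sub>R ((1/norm f) *\<^sub>R f)" using lf by (simp add: T_simps)
  show "l ~= 0" using lf s0 by auto
  show "norm (T v) <= \<bar>l\<bar> * norm v" if "v \<in> V" for v using bound[OF that] lf by simp
 qed
qed

end

locale hilbert_schmidt = compact_symmetric T for T :: "'h::{real_inner,complete_space} => 'h" +
 fixes C :: real
 assumes HS: "!!e (I :: nat set). finite I ==> orthonormal e I ==> (\<Sum>i\<in>I. (norm (T (e i)))^2) <= C"
begin

lemma HS_gen:
 assumes "finite I" "orthonormal e I" shows "(\<Sum>i\<in>I. (norm (T (e i)))^2) <= C"
proof -
 obtain n h where h: "bij_betw h {..<n::nat} I"
  using assms(1) by (metis ex_bij_betw_nat_finite lessThan_atLeast0)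
 have "orthonormal (e \<circ> h) {..<n}"
  using assms(2) h unfolding orthonormal_def by (auto simp: bij_betw_def inj_on_eq_iff)
 from HS[OF _ this] show ?thesis using sum.reindex_bij_betw[OF h, of "%i. (norm (T (e i)))^2"] by simp
qed

definition E :: "real => 'h set" where "E l = {x. T x = l *\<^sub>R x}"

text \<open>The multiplicity of \<open>l\<close> is the largest member; by the Hilbert-Schmidt bound there is one.\<close>

definition ond :: "real => nat set" where
 "ond l = {n. \<exists>e :: nat => 'h. orthonormal e {..<n} \<and> (\<forall>i<n. e i \<in> E l)}"

lemma ond_bound: assumes "l ~= 0" "n \<in> ond l" shows "real n * l^2 <= C"
proof -
 from assms(2) obtain e :: "nat => 'h" where e: "orthonormal e {..<n}" "\<forall>i<n. e i \<in> E l" unfolding ond_def by blast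
 have "(\<Sum>i<n. (norm (T (e i)))^2) = (\<Sum>i<n. l\<^sup>2)"
  using e orthonormalD(2)[OF e(1)] by (intro sum.cong) (auto simp: E_def power_mult_distrib)
 then show ?thesis using HS[OF _ e(1)] by simp
qed

definition mult :: "real => nat" where "mult l = Max (ond l)"

lemma ond_finite: assumes "l ~= 0" shows "finite (ond l)"
proof -
 have "ond l \<subseteq> {..nat \<lceil>C/l^2\<rceil>}"
 proof
  fix n assume "n \<in> ond l"
  then have "real n <= C/l^2" using ond_bound[OF assms] assms by (simp add: field_simps)
  then show "n \<in> {..nat \<lceil>C/l^2\<rceil>}" by (simp add: le_nat_iff) linarith
 qed
 then show ?thesis by (rule finite_subset) simp
qed

lemma mult_in: assumes "l ~= 0" shows "mult l \<in> ond l"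
 unfolding mult_def
proof (rule Max_in[OF ond_finite[OF assms]])
 have "0 \<in> ond l" unfolding ond_def orthonormal_def by auto
 then show "ond l ~= {}" by blast
qed

definition eig :: "real => nat => 'h" where
 "eig l = (SOME e. orthonormal e {..<mult l} \<and> (\<forall>i<mult l. e i \<in> E l))"

lemma eig: assumes "l ~= 0"
 shows "orthonormal (eig l) {..<mult l}" "i < mult l ==> T (eig l i) = l *\<^sub>R eig l i"
proof -
 have "\<exists>e. orthonormal e {..<mult l} \<and> (\<forall>i<mult l. e i \<in> E l)" using mult_in[OF assms] unfolding ond_def by blast
 from someI_ex[OF this] show "orthonormal (eig l) {..<mult l}" "i < mult l ==> T (eig l i) = l *\<^sub>R eig l i"
  unfolding eig_def E_def by blast+
qed

lemma eig_complete:
 assumes "l ~= 0" "T x = l *\<^sub>R x" "!!i. i < mult l ==> inner (eig l i) x = 0"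
 shows "x = 0"
proof (rule ccontr)
 assume "x ~= 0"
 define e where "e i = (if i = mult l then (1/norm x) *\<^sub>R x else eig l i)" for i
 have xx: "inner x x = norm x * norm x" by (simp add: power2_norm_eq_inner[symmetric] power2_eq_square)
 have one: "inner ((1/norm x) *\<^sub>R x) ((1/norm x) *\<^sub>R x) = 1" using \<open>x \<noteq> 0\<close> by (simp add: xx)
 have orth: "inner (eig l i) x = 0" "inner x (eig l i) = 0" if "i < mult l" for i
  using assms(3)[OF that] by (auto simp: inner_commute)
 have eg: "inner (eig l i) (eig l j) = (if i = j then 1 else 0)" if "i < mult l" "j < mult l" for i j
  using eig(1)[OF assms(1)] that unfolding orthonormal_def by auto
 have "orthonormal e {..<Suc (mult l)}"
  unfolding orthonormal_def
 proof (intro ballI)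
  fix i j assume ij: "i \<in> {..<Suc (mult l)}" "j \<in> {..<Suc (mult l)}"
  consider "i = mult l" "j = mult l" | "i = mult l" "j < mult l" | "i < mult l" "j = mult l" | "i < mult l" "j < mult l"
   using ij by fastforce
  then show "inner (e i) (e j) = (if i = j then 1 else 0)"
  proof cases
   case 1
   then show ?thesis unfolding e_def using one by simp
  next
   case 2
   then have "inner (e i) (e j) = (1/norm x) * inner x (eig l j)" unfolding e_def by simp
   then show ?thesis using 2 orth by simp
  next
   case 3
   then have "inner (e i) (e j) = (1/norm x) * inner (eig l i) x" unfolding e_def by simp
   then show ?thesis using 3 orth by simp
  next
   case 4
   then show ?thesis unfolding e_def using eg by simp
  qed
 qed
 moreover have "\<forall>i<Suc (mult l). e i \<in> E l"
  using eig(2)[OF assms(1)] assms(2) unfolding E_def e_def by (auto simp: T_simps less_Suc_eq)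
 ultimately have "Suc (mult l) \<in> ond l" unfolding ond_def by blast
 then have "Suc (mult l) <= mult l" unfolding mult_def using ond_finite[OF assms(1)] by (intro Max_ge) auto
 then show False by simp
qed

definition spec :: "(real \<times> nat) set" where "spec = {(l, k). l ~= 0 \<and> k < mult l}"

definition phi :: "real \<times> nat => 'h" where "phi s = eig (fst s) (snd s)"

lemma T_phi: "s \<in> spec ==> T (phi s) = fst s *\<^sub>R phi s"
 unfolding spec_def phi_def using eig(2) by auto

lemma phi_orthonormal: "orthonormal phi spec"
 unfolding orthonormal_def
proof (intro ballI)
 fix s t assume st: "s \<in> spec" "t \<in> spec"
 show "inner (phi s) (phi t) = (if s = t then 1 else 0)"
 proof (cases "fst s = fst t")
  case True
  then show ?thesis using st eig(1)[of "fst s"] unfolding spec_def phi_def orthonormal_def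
   by (auto simp: prod_eq_iff)
 next
  case False
  have "fst s * inner (phi s) (phi t) = inner (T (phi s)) (phi t)" using T_phi[OF st(1)] by simp
  also have "\<dots> = fst t * inner (phi s) (phi t)" unfolding sym using T_phi[OF st(2)] by simp
  finally have "inner (phi s) (phi t) = 0" using False by simp
  then show ?thesis using False by auto
 qed
qed

lemma phi_orthonormal_sub: "F \<subseteq> spec ==> orthonormal phi F"
 using phi_orthonormal unfolding orthonormal_def by blast

lemma spec_sum_le: assumes "finite F" "F \<subseteq> spec" shows "(\<Sum>s\<in>F. (fst s)^2) <= C"
proof -
 have "(\<Sum>s\<in>F. (norm (T (phi s)))^2) = (\<Sum>s\<in>F. (fst s)^2)"
  using assms T_phi orthonormalD(2)[OF phi_orthonormal] by (intro sum.cong) (auto simp: power_mult_distrib subset_iff)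
 then show ?thesis using HS_gen[OF assms(1) phi_orthonormal_sub[OF assms(2)]] by simp
qed

lemma spec_large_finite: assumes "0 < \<epsilon>" shows "finite {s \<in> spec. \<epsilon> <= \<bar>fst s\<bar>}"
proof (rule finite_if_finite_subsets_card_bdd[of _ "nat \<lceil>C/\<epsilon>^2\<rceil>", THEN conjunct1])
 fix F assume F: "F \<subseteq> {s \<in> spec. \<epsilon> <= \<bar>fst s\<bar>}" "finite F"
 have "real (card F)*\<epsilon>^2 = (\<Sum>s\<in>F. \<epsilon>\<^sup>2)" by simp
 also have "\<dots> <= (\<Sum>s\<in>F. (fst s)^2)"
 proof (rule sum_mono)
  fix s assume "s \<in> F"
  then have "\<bar>\<epsilon>\<bar> <= \<bar>fst s\<bar>" using F assms by auto
  then show "\<epsilon>^2 <= (fst s)^2" by (rule abs_le_square_iff[THEN iffD1])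
 qed
 also have "\<dots> <= C" using F by (intro spec_sum_le) auto
 finally have "real (card F) <= C/\<epsilon>^2" using assms by (simp add: field_simps)
 then show "card F <= nat \<lceil>C/\<epsilon>^2\<rceil>" by linarith
qed

text \<open>Otherwise the complement would contain an eigenvector with eigenvalue at least \<open>\<epsilon>\<close> in modulus, orthogonal to
the complete system for that eigenvalue.\<close>

lemma small_on_complement:
 assumes \<epsilon>: "0 < \<epsilon>" and F: "{s \<in> spec. \<epsilon> <= \<bar>fst s\<bar>} \<subseteq> F" "F \<subseteq> spec" and v: "!!s. s \<in> F ==> inner (phi s) v = 0"
 shows "norm (T v) <= \<epsilon> * norm v"
proof (cases "T v = 0")
 case True then show ?thesis using \<epsilon> by simp
next
 case False
 define V where "V = {x. \<forall>s\<in>F. inner (phi s) x = 0}"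
 have cl: "closed V"
 proof -
  have "V = (\<Inter>s\<in>F. {x. inner (phi s) x = 0})" unfolding V_def by auto
  moreover have "closed {x. inner (phi s) x = 0}" for s by (intro closed_Collect_eq continuous_intros)
  ultimately show ?thesis by auto
 qed
 have sub: "subspace V" unfolding V_def subspace_def by (auto simp: inner_add_right)
 have inv: "T x \<in> V" if "x \<in> V" for x
  unfolding V_def
 proof (intro CollectI ballI)
  fix s assume s: "s \<in> F"
  have "inner (phi s) (T x) = inner (T (phi s)) x" by (rule sym[symmetric])
  also have "\<dots> = fst s * inner (phi s) x" using T_phi[of s] s F(2) by auto
  finally show "inner (phi s) (T x) = 0" using that s unfolding V_def by simp
 qed
 have "v \<in> V" unfolding V_def using v by blast
 from eigenvector_on_subspace[OF cl sub inv this False] obtain l f where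
  lf: "f \<in> V" "norm f = 1" "T f = l *\<^sub>R f" "l ~= 0" "!!v. v \<in> V ==> norm (T v) <= \<bar>l\<bar> * norm v" by blast
 have "\<bar>l\<bar> < \<epsilon>"
 proof (rule ccontr)
  assume "\<not> \<bar>l\<bar> < \<epsilon>"
  then have "(l, i) \<in> F" if "i < mult l" for i using that lf(4) F(1) unfolding spec_def by auto
  then have "inner (eig l i) f = 0" if "i < mult l" for i using that lf(1) unfolding V_def phi_def by force
  then have "f = 0" using eig_complete[OF lf(4,3)] by blast
  then show False using lf(2) by simp
 qed
 then have "\<bar>l\<bar> * norm v <= \<epsilon> * norm v" by (intro mult_right_mono) auto
 then show ?thesis using lf(5)[OF \<open>v \<in> V\<close>] by simp
qed

lemma T_pow_phi: "s \<in> spec ==> (T ^^ k) (phi s) = (fst s^k) *\<^sub>R phi s"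
 by (induction k) (auto simp: T_simps T_phi mult.commute)

theorem spectral_quadratic:
 assumes k: "k >= 1"
 shows "((%s. fst s^k*(inner (phi s) x)^2) has_sum inner ((T ^^ k) x) x) spec"
 unfolding has_sum_def tendsto_iff eventually_finite_subsets_at_top
proof (intro allI impI)
 fix \<delta> :: real assume \<delta>: "0 < \<delta>"
 define \<epsilon> where "\<epsilon> = min 1 (\<delta>/(2*((norm x)^2+1)))"
 have \<epsilon>: "0 < \<epsilon>" "\<epsilon> <= 1" "\<epsilon> <= \<delta>/(2*((norm x)^2+1))" unfolding \<epsilon>_def using \<delta> by (auto simp: add_nonneg_pos)
 have \<epsilon>x: "\<epsilon>*(norm x)^2 < \<delta>"
 proof -
  have "\<epsilon>*(norm x)^2 <= \<delta>/(2*((norm x)^2+1))*((norm x)^2+1)" using \<epsilon> by (intro mult_mono) auto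
  also have "\<dots> = \<delta>/2" by (simp add: divide_simps) (smt (verit) zero_le_power2)
  finally show ?thesis using \<delta> by simp
 qed
 let ?X = "{s \<in> spec. \<epsilon> <= \<bar>fst s\<bar>}"
 show "\<exists>X. finite X \<and> X \<subseteq> spec \<and> (\<forall>Y. finite Y \<and> X \<subseteq> Y \<and> Y \<subseteq> spec -->
   dist (\<Sum>s\<in>Y. fst s^k*(inner (phi s) x)^2) (inner ((T ^^ k) x) x) < \<delta>)"
 proof (intro exI[of _ ?X] conjI allI impI)
  show "finite ?X" by (rule spec_large_finite[OF \<epsilon>(1)])
  show "?X \<subseteq> spec" by auto
  fix Y assume Y: "finite Y \<and> ?X \<subseteq> Y \<and> Y \<subseteq> spec"
  have on: "orthonormal phi Y" using Y phi_orthonormal_sub by blast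
  define P where "P = (\<Sum>s\<in>Y. inner (phi s) x *\<^sub>R phi s)"
  define v where "v = x - P"
  have v0: "inner (phi s) v = 0" if "s \<in> Y" for s
   unfolding v_def P_def using orthonormal_pythagoras(2)[OF on] Y that by blast
  have vx: "norm v <= norm x"
  proof -
   have "(norm x)^2 = (\<Sum>s\<in>Y. (inner (phi s) x)^2) + (norm v)^2"
    unfolding v_def P_def using orthonormal_pythagoras(1)[OF on] Y by blast
   then have "(norm v)^2 <= (norm x)^2" by (simp add: sum_nonneg)
   then show ?thesis by (rule power2_le_imp_le) simp
  qed
  have Tkv0: "inner (phi s) ((T ^^ j) v) = 0" if "s \<in> Y" for s j
  proof -
   have "inner (phi s) ((T ^^ j) v) = inner ((T ^^ j) (phi s)) v" by (rule pow_sym[symmetric])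
   then show ?thesis using T_pow_phi[of s j] v0[OF that] Y that by auto
  qed
  have Tkv: "norm ((T ^^ j) v) <= \<epsilon>^j * norm v" for j
  proof (induction j)
   case (Suc j)
   have "norm ((T ^^ Suc j) v) <= \<epsilon> * norm ((T ^^ j) v)"
    using small_on_complement[OF \<epsilon>(1), of Y "(T ^^ j) v"] Y Tkv0 by simp
   also have "\<dots> <= \<epsilon>*(\<epsilon>^j * norm v)" using Suc \<epsilon> by (intro mult_left_mono) auto
   finally show ?case by simp
  qed simp
  have TkP: "(T ^^ k) P = (\<Sum>s\<in>Y. (inner (phi s) x * fst s^k) *\<^sub>R phi s)"
   unfolding P_def using T_pow_phi Y
   by (subst linear_sum[OF bounded_linear.linear[OF pow_bl]]) (auto simp: linear_scale[OF bounded_linear.linear[OF pow_bl]] intro!: sum.cong)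
  have xPv: "x = P + v" unfolding v_def by simp
  have "inner ((T ^^ k) x) x = inner ((T ^^ k) P) x + inner ((T ^^ k) v) x"
   unfolding inner_add_left[symmetric] by (subst (1) xPv) (simp add: linear_add[OF bounded_linear.linear[OF pow_bl]])
  also have "inner ((T ^^ k) P) x = (\<Sum>s\<in>Y. fst s^k*(inner (phi s) x)^2)"
   unfolding TkP inner_sum_left by (intro sum.cong) (auto simp: power2_eq_square)
  also have "inner ((T ^^ k) v) x = inner ((T ^^ k) v) v"
  proof -
   have "inner ((T ^^ k) v) P = 0" unfolding P_def inner_sum_right using Tkv0 by (simp add: inner_commute)
   then show ?thesis by (subst xPv) (simp add: inner_add_right)
  qed
  finally have "dist (\<Sum>s\<in>Y. fst s^k*(inner (phi s) x)^2) (inner ((T ^^ k) x) x) = \<bar>inner ((T ^^ k) v) v\<bar>"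
   by (simp add: dist_real_def)
  also have "\<dots> <= norm ((T ^^ k) v) * norm v" by (rule Cauchy_Schwarz_ineq2)
  also have "\<dots> <= (\<epsilon>^k * norm v) * norm v" using Tkv by (intro mult_right_mono) auto
  also have "\<dots> = \<epsilon>^k*(norm v)^2" by (simp add: power2_eq_square)
  also have "\<dots> <= \<epsilon>*(norm x)^2"
  proof (intro mult_mono power_mono vx)
   show "\<epsilon>^k <= \<epsilon>" using power_decreasing[of 1 k \<epsilon>] k \<epsilon> by simp
  qed (use \<epsilon> in auto)
  also have "\<dots> < \<delta>" by (rule \<epsilon>x)
  finally show "dist (\<Sum>s\<in>Y. fst s^k*(inner (phi s) x)^2) (inner ((T ^^ k) x) x) < \<delta>" .
 qed
qed

end

section \<open>Riemann integrable functions and step functions\<close>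

lemma riemann_integrable_sums:
 fixes f :: "'a::euclidean_space => real"
 assumes "f riemann_integrable_on S"
 obtains J where "!!e. 0 < e ==> \<exists>d>0. \<forall>(I :: 'c set) B u. finite I --> inj_on B I --> B ` I division_of S
  --> (\<forall>c\<in>I. \<forall>x\<in>B c. B c \<subseteq> ball x d) --> (\<forall>c\<in>I. u c \<in> B c) -->
  \<bar>(\<Sum>c\<in>I. measure lborel (B c) * f (u c)) - J\<bar> < e"
proof -
 obtain J where J: "!!e. 0 < e ==> \<exists>d>0. \<forall>p. p tagged_division_of S \<and> (%x. ball x d) fine p -->
    \<bar>(\<Sum>(x, K)\<in>p. measure lborel K * f x) - J\<bar> < e"
  using assms unfolding riemann_integrable_on_def by blast
 show thesis
 proof (rule that[of J])
  fix e :: real assume "0 < e"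
  from J[OF this] obtain d where d: "0 < d" and Jd: "!!p. p tagged_division_of S ==> (%x. ball x d) fine p ==>
    \<bar>(\<Sum>(x, K)\<in>p. measure lborel K * f x) - J\<bar> < e" by blast
  show "\<exists>d>0. \<forall>(I :: 'c set) B u. finite I --> inj_on B I --> B ` I division_of S
  --> (\<forall>c\<in>I. \<forall>x\<in>B c. B c \<subseteq> ball x d) --> (\<forall>c\<in>I. u c \<in> B c) -->
  \<bar>(\<Sum>c\<in>I. measure lborel (B c) * f (u c)) - J\<bar> < e"
  proof (intro exI[of _ d] conjI d allI impI)
   fix I :: "'c set" and B u
   assume I: "finite I" "inj_on B I" "B ` I division_of S" "\<forall>c\<in>I. \<forall>x\<in>B c. B c \<subseteq> ball x d" "\<forall>c\<in>I. u c \<in> B c"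
   define p where "p = (%c. (u c, B c)) ` I"
   have inj: "inj_on (%c. (u c, B c)) I" using I(2) by (auto simp: inj_on_def)
   have "p tagged_division_of S"
   proof (rule tagged_division_ofI)
    show "finite p" unfolding p_def using I by simp
    fix x K assume xK: "(x, K) \<in> p"
    then obtain c where c: "c \<in> I" "x = u c" "K = B c" unfolding p_def by auto
    show "x \<in> K" using c I by auto
    show "K \<subseteq> S" "\<exists>a b. K = cbox a b" using division_ofD(2,4)[OF I(3)] c by auto
    fix x' K' assume xK': "(x', K') \<in> p" "(x, K) ~= (x', K')"
    then obtain c' where c': "c' \<in> I" "x' = u c'" "K' = B c'" unfolding p_def by auto
    have "K ~= K'" using c c' xK'(2) I(2) by (auto simp: inj_on_def)
    then show "interior K \<inter> interior K' = {}" using division_ofD(5)[OF I(3)] c c' by auto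
   next
    show "\<Union>{K. \<exists>x. (x, K) \<in> p} = S" unfolding p_def division_ofD(6)[OF I(3), symmetric] by auto
   qed
   moreover have "(%x. ball x d) fine p" unfolding fine_def p_def using I by auto
   ultimately have "\<bar>(\<Sum>(x, K)\<in>p. measure lborel K * f x) - J\<bar> < e" by (rule Jd)
   then show "\<bar>(\<Sum>c\<in>I. measure lborel (B c) * f (u c)) - J\<bar> < e"
    unfolding p_def sum.reindex[OF inj] by (simp add: comp_def)
  qed
 qed
qed

lemma riemann_integrable_has_integral:
 fixes f :: "'a::euclidean_space => real"
 assumes "f riemann_integrable_on cbox a b"
 shows "f integrable_on cbox a b"
proof -
 obtain J where J: "!!e. 0 < e ==> \<exists>d>0. \<forall>p. p tagged_division_of cbox a b \<and> (%x. ball x d) fine p -->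
    \<bar>(\<Sum>(x, K)\<in>p. measure lborel K * f x) - J\<bar> < e"
  using assms unfolding riemann_integrable_on_def by blast
 have "(f has_integral J) (cbox a b)"
  unfolding has_integral
 proof (intro allI impI)
  fix e :: real assume "0 < e"
  from J[OF this] obtain d where d: "0 < d" and Jd: "!!p. p tagged_division_of cbox a b ==> (%x. ball x d) fine p ==>
    \<bar>(\<Sum>(x, K)\<in>p. measure lborel K * f x) - J\<bar> < e" by blast
  show "\<exists>\<gamma>. gauge \<gamma> \<and> (\<forall>\<D>. \<D> tagged_division_of cbox a b \<and> \<gamma> fine \<D> --> norm ((\<Sum>(x, k)\<in>\<D>. measure lborel k *\<^sub>R f x) - J) < e)"
   by (intro exI[of _ "%x. ball x d"] conjI gauge_ball d) (use Jd in auto)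
 qed
 then show ?thesis by blast
qed

text \<open>\<open>B\<close> are the closed cells of a division, \<open>u\<close> the tags, and \<open>H\<close> are disjoint parts of them, covering almost
everything, on which the step function with values \<open>f (u c)\<close> lives.\<close>

locale cell_family =
 fixes f :: "'a::euclidean_space => real" and a b :: 'a
  and I :: "nat => 'c set" and B H :: "nat => 'c => 'a set" and u :: "nat => 'c => 'a"
 assumes R: "f riemann_integrable_on cbox a b"
  and meas: "f \<in> borel_measurable (lebesgue_on (cbox a b))"
  and f01: "!!x. x \<in> cbox a b ==> f x \<in> {0..1}"
  and finI: "!!N. finite (I N)"
  and injB: "!!N. N >= 1 ==> inj_on (B N) (I N)"
  and div: "!!N. N >= 1 ==> B N ` I N division_of cbox a b"
  and diam: "!!d. 0 < d ==> \<exists>n0. \<forall>N\<ge>n0. \<forall>c\<in>I N. \<forall>x\<in>B N c. B N c \<subseteq> ball x d"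
  and uB: "!!N c. N >= 1 ==> c \<in> I N ==> u N c \<in> B N c"
  and HB: "!!N c. N >= 1 ==> c \<in> I N ==> H N c \<subseteq> B N c"
  and Hb: "!!N c. H N c \<in> sets borel"
  and disj: "!!N. N >= 1 ==> disjoint_family_on (H N) (I N)"
  and null: "!!N. N >= 1 ==> cbox a b - (\<Union>c\<in>I N. H N c) \<in> null_sets lborel"
begin

abbreviation Q :: "'a measure" where "Q \<equiv> lebesgue_on (cbox a b)"

definition step :: "(real => real) => nat => 'a => real" where
 "step \<Phi> N x = (\<Sum>c\<in>I N. \<Phi> (f (u N c)) * indicator (H N c) x)"

lemma step_eval:
 assumes "N >= 1" "c \<in> I N" "x \<in> H N c" shows "step \<Phi> N x = \<Phi> (f (u N c))"
proof -
 have "step \<Phi> N x = \<Phi> (f (u N c)) * indicator (H N c) x + (\<Sum>d\<in>I N - {c}. \<Phi> (f (u N d)) * indicator (H N d) x)"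
  unfolding step_def by (rule sum.remove[OF finI assms(2)])
 also have "(\<Sum>d\<in>I N - {c}. \<Phi> (f (u N d)) * indicator (H N d) x) = 0"
  using disj[OF assms(1)] assms unfolding disjoint_family_on_def
  by (intro sum.neutral) (auto simp: indicator_def)
 finally show ?thesis using assms by simp
qed

lemma AE_cell: assumes "N >= 1" shows "AE x in Q. \<exists>c\<in>I N. x \<in> H N c"
proof -
 have "cbox a b - (\<Union>c\<in>I N. H N c) \<in> null_sets lebesgue"
  using null[OF assms] null_sets_completionI by blast
 then have "AE x in lebesgue. x \<notin> cbox a b - (\<Union>c\<in>I N. H N c)" by (rule AE_not_in)
 then have "AE x in lebesgue. x \<in> cbox a b --> (\<exists>c\<in>I N. x \<in> H N c)" by eventually_elim auto
 then show ?thesis by (subst AE_restrict_space_iff) auto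
qed

lemma HS: "N >= 1 ==> c \<in> I N ==> H N c \<subseteq> cbox a b"
 using HB[of N c] division_ofD(2)[OF div[of N], of "B N c"] by auto

lemma step_meas[measurable]: "step \<Phi> N \<in> borel_measurable borel"
 unfolding step_def using Hb by measurable

lemma finite_meas: "finite_measure Q"
 by (rule finite_measureI) (simp add: emeasure_restrict_space emeasure_completion emeasure_lborel_cbox_eq)

lemma meas_leb: "g \<in> borel_measurable borel ==> g \<in> borel_measurable Q"
 by (intro measurable_restrict_space1 measurable_completion) simp

lemma integrable_step: "N >= 1 ==> integrable Q (step \<Phi> N)"
proof -
 assume N: "N >= 1"
 interpret finite_measure "Q" by (rule finite_meas)
 show ?thesis
 proof (rule integrable_const_bound[where B="\<Sum>c\<in>I N. \<bar>\<Phi> (f (u N c))\<bar>"])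
  show "AE x in Q. norm (step \<Phi> N x) <= (\<Sum>c\<in>I N. \<bar>\<Phi> (f (u N c))\<bar>)"
   unfolding step_def by (intro AE_I2) (auto intro!: order_trans[OF sum_abs] sum_mono simp: abs_mult indicator_def)
  show "step \<Phi> N \<in> borel_measurable Q" by (intro meas_leb step_meas)
 qed
qed

lemma integral_step:
 assumes N: "N >= 1"
 shows "(\<integral>x. step \<Phi> N x \<partial>Q) = (\<Sum>c\<in>I N. \<Phi> (f (u N c)) * measure lborel (H N c))"
proof -
 interpret finite_measure "Q" by (rule finite_meas)
 have m: "H N c \<in> sets Q" if "c \<in> I N" for c
  using HS[OF N that] Hb[of N c] by (auto simp: sets_restrict_space image_iff intro!: bexI[of _ "H N c"])
 have e: "measure Q (H N c) = measure lborel (H N c)" if "c \<in> I N" for c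
  using HS[OF N that] Hb[of N c] by (subst measure_restrict_space) (auto simp: measure_completion)
 have "(\<integral>x. step \<Phi> N x \<partial>Q) = (\<Sum>c\<in>I N. (\<integral>x. \<Phi> (f (u N c)) * indicator (H N c) x \<partial>Q))"
  unfolding step_def using m by (intro Bochner_Integration.integral_sum) (auto intro!: integrable_real_indicator simp: emeasure_eq_measure)
 also have "\<dots> = (\<Sum>c\<in>I N. \<Phi> (f (u N c)) * measure lborel (H N c))"
  using m e HS[OF N] by (intro sum.cong refl) (auto simp: Int_absorb1 Int_absorb2)
 finally show ?thesis .
qed

text \<open>Compare the Riemann sums whose tags are the larger and the smaller of \<open>f (u c)\<close> and a value where \<open>f\<close> deviates
almost maximally from it: both are close to the integral, so the total oscillation is small.\<close>

theorem L1_limit: "(%N. \<integral>x. \<bar>f x - step (%x. x) N x\<bar> \<partial>Q) ----> 0"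
proof (rule LIMSEQ_I)
 fix e :: real assume e: "0 < e"
 define m where "m = measure lborel (cbox a b)"
 have m0: "0 <= m" unfolding m_def by simp
 define e1 where "e1 = e/(2*(m+1))"
 have e1: "0 < e1" "m * e1 <= e/2" unfolding e1_def using e m0 by (auto simp: field_simps)
 obtain J where J: "!!e. 0 < e ==> \<exists>d>0. \<forall>(I :: 'c set) B u. finite I --> inj_on B I --> B ` I division_of cbox a b
  --> (\<forall>c\<in>I. \<forall>x\<in>B c. B c \<subseteq> ball x d) --> (\<forall>c\<in>I. u c \<in> B c) -->
  \<bar>(\<Sum>c\<in>I. measure lborel (B c) * f (u c)) - J\<bar> < e"
  by (rule riemann_integrable_sums[OF R], rule that)
 obtain d where d: "0 < d" and Jd: "!!(I :: 'c set) B u. finite I ==> inj_on B I ==> B ` I division_of cbox a b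
  ==> (\<forall>c\<in>I. \<forall>x\<in>B c. B c \<subseteq> ball x d) ==> (\<forall>c\<in>I. u c \<in> B c) ==>
  \<bar>(\<Sum>c\<in>I. measure lborel (B c) * f (u c)) - J\<bar> < e/8"
  using J[of "e/8"] e by auto
 obtain n0 where n0: "!!N. N >= n0 ==> \<forall>c\<in>I N. \<forall>x\<in>B N c. B N c \<subseteq> ball x d" using diam[OF d] by blast
 show "\<exists>no. \<forall>N\<ge>no. norm ((\<integral>x. \<bar>f x - step (%x. x) N x\<bar> \<partial>Q) - 0) < e"
 proof (intro exI[of _ "max n0 1"] allI impI)
  fix N assume "max n0 1 <= N"
  then have N: "N >= 1" and Nn: "N >= n0" by auto
  interpret finite_measure "Q" by (rule finite_meas)
  define osc where "osc c = (SUP y\<in>B N c. \<bar>f (u N c) - f y\<bar>)" for c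
  have Bsub: "B N c \<subseteq> cbox a b" if "c \<in> I N" for c using division_ofD(2)[OF div[OF N]] that by auto
  have le1: "\<bar>f (u N c) - f y\<bar> <= 1" if "c \<in> I N" "y \<in> B N c" for c y
   using f01[of y] f01[of "u N c"] uB[OF N that(1)] Bsub[OF that(1)] that by fastforce
  have bdd: "bdd_above ((%y. \<bar>f (u N c) - f y\<bar>) ` B N c)" if "c \<in> I N" for c
   using le1[OF that] by (intro bdd_aboveI[of _ 1]) auto
  have osc: "\<bar>f (u N c) - f y\<bar> <= osc c" if "c \<in> I N" "y \<in> B N c" for c y
   unfolding osc_def using bdd[OF that(1)] that(2) by (rule cSUP_upper2) auto
  have "\<exists>y\<in>B N c. osc c - e1 < \<bar>f (u N c) - f y\<bar>" if "c \<in> I N" for c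
   unfolding osc_def using less_cSUP_iff[of "B N c" "%y. \<bar>f (u N c) - f y\<bar>"] bdd[OF that] uB[OF N that] e1
   by (metis (no_types, lifting) empty_iff diff_less_eq less_add_same_cancel1)
  then obtain y where y: "!!c. c \<in> I N ==> y c \<in> B N c \<and> osc c - e1 < \<bar>f (u N c) - f (y c)\<bar>" by metis
  define g where "g x = (\<Sum>c\<in>I N. osc c * indicator (H N c) x)" for x
  have m: "H N c \<in> sets Q" if "c \<in> I N" for c
   using HS[OF N that] Hb[of N c] by (auto simp: sets_restrict_space image_iff intro!: bexI[of _ "H N c"])
  have mm: "measure Q (H N c) <= measure lborel (B N c)" if c: "c \<in> I N" for c
  proof -
   have "measure Q (H N c) = measure lborel (H N c)"
    using HS[OF N that] Hb[of N c] by (subst measure_restrict_space) (auto simp: measure_completion)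
   also have "\<dots> <= measure lborel (B N c)"
   proof (rule measure_mono_fmeasurable[OF HB[OF N c]])
    show "H N c \<in> sets lborel" using Hb by simp
    obtain a' b' where "B N c = cbox a' b'" using division_ofD(4)[OF div[OF N]] c by blast
    then show "B N c \<in> fmeasurable lborel" by simp
   qed
   finally show ?thesis .
  qed
  have "(\<integral>x. \<bar>f x - step (%x. x) N x\<bar> \<partial>Q) <= (\<integral>x. g x \<partial>Q)"
  proof (rule integral_mono_AE)
   show "integrable Q (%x. \<bar>f x - step (%x. x) N x\<bar>)"
   proof (intro integrable_abs Bochner_Integration.integrable_diff integrable_step[OF N])
    show "integrable Q f"
     using f01 meas by (intro integrable_const_bound[where B=1]) (auto intro!: AE_I2)
   qed
   show "integrable Q g" unfolding g_def using m
    by (intro Bochner_Integration.integrable_sum) (auto intro!: integrable_real_indicator simp: emeasure_eq_measure)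
   show "AE x in Q. \<bar>f x - step (%x. x) N x\<bar> <= g x"
    using AE_cell[OF N]
   proof eventually_elim
    fix x assume "\<exists>c\<in>I N. x \<in> H N c"
    then obtain c where c: "c \<in> I N" "x \<in> H N c" by blast
    have "\<bar>f x - step (%x. x) N x\<bar> <= osc c"
     using osc[OF c(1), of x] HB[OF N c(1)] c(2) unfolding step_eval[OF N c] by (auto simp: abs_minus_commute)
    also have "\<dots> = osc c * indicator (H N c) x" using c by simp
    also have "\<dots> <= g x" unfolding g_def
    proof (rule member_le_sum[OF c(1) _ finI])
     fix d assume "d \<in> I N - {c}"
     then have "0 <= osc d" using osc[of d "u N d"] uB[OF N, of d] by auto
     then show "0 <= osc d * indicator (H N d) x" by simp
    qed
    finally show "\<bar>f x - step (%x. x) N x\<bar> <= g x" .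
   qed
  qed
  also have "(\<integral>x. g x \<partial>Q) = (\<Sum>c\<in>I N. osc c * measure Q (H N c))"
  proof -
   have "(\<integral>x. g x \<partial>Q) = (\<Sum>c\<in>I N. (\<integral>x. osc c * indicator (H N c) x \<partial>Q))"
    unfolding g_def using m by (intro Bochner_Integration.integral_sum) (auto intro!: integrable_real_indicator simp: emeasure_eq_measure)
   also have "\<dots> = (\<Sum>c\<in>I N. osc c * measure Q (H N c))"
    using m HS[OF N] by (intro sum.cong refl) (auto simp: Int_absorb1 Int_absorb2)
   finally show ?thesis .
  qed
  also have "\<dots> <= (\<Sum>c\<in>I N. measure lborel (B N c)*(\<bar>f (u N c) - f (y c)\<bar> + e1))"
  proof (rule sum_mono)
   fix c assume c: "c \<in> I N"
   have "0 <= osc c" using osc[OF c uB[OF N c]] by simp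
   then have "osc c * measure Q (H N c) <= osc c * measure lborel (B N c)"
    using mm[OF c] by (intro mult_left_mono) auto
   also have "\<dots> <= (\<bar>f (u N c) - f (y c)\<bar> + e1) * measure lborel (B N c)"
    using y[OF c] by (intro mult_right_mono) auto
   finally show "osc c * measure Q (H N c) <= measure lborel (B N c)*(\<bar>f (u N c) - f (y c)\<bar> + e1)"
    by (simp add: mult.commute)
  qed
  also have "\<dots> = (\<Sum>c\<in>I N. measure lborel (B N c)*\<bar>f (u N c) - f (y c)\<bar>) + (\<Sum>c\<in>I N. measure lborel (B N c)) * e1"
   by (simp add: distrib_left sum.distrib sum_distrib_right)
  also have "(\<Sum>c\<in>I N. measure lborel (B N c)) = m"
   using additive_content_division[OF div[OF N]] unfolding m_def sum.reindex[OF injB[OF N]] by (simp add: comp_def)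
  also have "(\<Sum>c\<in>I N. measure lborel (B N c)*\<bar>f (u N c) - f (y c)\<bar>) < e/4"
  proof -
   define u1 where "u1 c = (if f (y c) <= f (u N c) then u N c else y c)" for c
   define u2 where "u2 c = (if f (y c) <= f (u N c) then y c else u N c)" for c
   have "\<bar>(\<Sum>c\<in>I N. measure lborel (B N c) * f (u1 c)) - J\<bar> < e/8"
    by (rule Jd[OF finI injB[OF N] div[OF N] n0[OF Nn]]) (use y uB[OF N] in \<open>auto simp: u1_def\<close>)
   moreover have "\<bar>(\<Sum>c\<in>I N. measure lborel (B N c) * f (u2 c)) - J\<bar> < e/8"
    by (rule Jd[OF finI injB[OF N] div[OF N] n0[OF Nn]]) (use y uB[OF N] in \<open>auto simp: u2_def\<close>)
   moreover have "(\<Sum>c\<in>I N. measure lborel (B N c)*\<bar>f (u N c) - f (y c)\<bar>)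
    = (\<Sum>c\<in>I N. measure lborel (B N c) * f (u1 c))-(\<Sum>c\<in>I N. measure lborel (B N c) * f (u2 c))"
    unfolding sum_subtractf[symmetric] by (intro sum.cong) (auto simp: u1_def u2_def algebra_simps)
   ultimately show ?thesis by linarith
  qed
  finally have "(\<integral>x. \<bar>f x - step (%x. x) N x\<bar> \<partial>Q) < e" using e1 e by linarith
  moreover have "0 <= (\<integral>x. \<bar>f x - step (%x. x) N x\<bar> \<partial>Q)" by (rule integral_nonneg_AE) auto
  ultimately show "norm ((\<integral>x. \<bar>f x - step (%x. x) N x\<bar> \<partial>Q) - 0) < e" by simp
 qed
qed

theorem sum_limit:
 assumes Lip: "!!x y. x \<in> {0..1} ==> y \<in> {0..1} ==> \<bar>\<Phi> x - \<Phi> y\<bar> <= L*\<bar>x - y\<bar>"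
  and \<Phi>m: "\<Phi> \<in> borel_measurable borel"
 shows "(%N. \<Sum>c\<in>I N. \<Phi> (f (u N c)) * measure lborel (H N c)) ----> (\<integral>x. \<Phi> (f x) \<partial>Q)"
proof -
 interpret finite_measure "Q" by (rule finite_meas)
 have if': "integrable Q f"
  using f01 meas by (intro integrable_const_bound[where B=1]) (auto intro!: AE_I2)
 have L0: "\<bar>\<Phi> x\<bar> <= \<bar>\<Phi> 0\<bar> + \<bar>L\<bar>" if "x \<in> {0..1}" for x
 proof -
  have "\<bar>\<Phi> x - \<Phi> 0\<bar> <= L*\<bar>x - 0\<bar>" using that by (intro Lip) auto
  also have "\<dots> <= \<bar>L\<bar>*1" using that by (intro mult_mono) auto
  finally show ?thesis by simp
 qed
 have i\<Phi>: "integrable Q (%x. \<Phi> (f x))"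
  using f01 measurable_compose[OF meas \<Phi>m] L0
  by (intro integrable_const_bound[where B="\<bar>\<Phi> 0\<bar> + \<bar>L\<bar>"]) (auto intro!: AE_I2)
 have "\<bar>(\<Sum>c\<in>I N. \<Phi> (f (u N c)) * measure lborel (H N c))-(\<integral>x. \<Phi> (f x) \<partial>Q)\<bar>
  <= L*(\<integral>x. \<bar>f x - step (%x. x) N x\<bar> \<partial>Q)" if N: "N >= 1" for N
 proof -
  have "(\<Sum>c\<in>I N. \<Phi> (f (u N c)) * measure lborel (H N c))-(\<integral>x. \<Phi> (f x) \<partial>Q)
   = (\<integral>x. step \<Phi> N x - \<Phi> (f x) \<partial>Q)"
   by (subst Bochner_Integration.integral_diff[OF integrable_step[OF N] i\<Phi>]) (simp add: integral_step[OF N])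
  also have "\<bar>\<dots>\<bar> <= (\<integral>x. \<bar>step \<Phi> N x - \<Phi> (f x)\<bar> \<partial>Q)" by (rule integral_abs_bound)
  also have "\<dots> <= (\<integral>x. L*\<bar>f x - step (%x. x) N x\<bar> \<partial>Q)"
  proof (rule integral_mono_AE)
   show "integrable Q (%x. \<bar>step \<Phi> N x - \<Phi> (f x)\<bar>)"
    by (intro integrable_abs Bochner_Integration.integrable_diff integrable_step[OF N] i\<Phi>)
   show "integrable Q (%x. L*\<bar>f x - step (%x. x) N x\<bar>)"
    by (intro integrable_mult_right integrable_abs Bochner_Integration.integrable_diff integrable_step[OF N] if')
   show "AE x in Q. \<bar>step \<Phi> N x - \<Phi> (f x)\<bar> <= L*\<bar>f x - step (%x. x) N x\<bar>"
    using AE_cell[OF N]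
   proof eventually_elim
    fix x assume "\<exists>c\<in>I N. x \<in> H N c"
    then obtain c where c: "c \<in> I N" "x \<in> H N c" by blast
    have "u N c \<in> cbox a b" "x \<in> cbox a b"
     using uB[OF N c(1)] HS[OF N c(1)] c division_ofD(2)[OF div[OF N], of "B N c"] by auto
    then have "\<bar>\<Phi> (f (u N c)) - \<Phi> (f x)\<bar> <= L*\<bar>f (u N c) - f x\<bar>" by (intro Lip f01)
    then show "\<bar>step \<Phi> N x - \<Phi> (f x)\<bar> <= L*\<bar>f x - step (%x. x) N x\<bar>"
     unfolding step_eval[OF N c] by (simp add: abs_minus_commute)
   qed
  qed
  finally show ?thesis by simp
 qed
 then have ev: "EV N. norm ((\<Sum>c\<in>I N. \<Phi> (f (u N c)) * measure lborel (H N c))-(\<integral>x. \<Phi> (f x) \<partial>Q))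
  <= L*(\<integral>x. \<bar>f x - step (%x. x) N x\<bar> \<partial>Q)"
  by (intro eventually_sequentiallyI[of 1]) simp
 have "(%N. (\<Sum>c\<in>I N. \<Phi> (f (u N c)) * measure lborel (H N c))-(\<integral>x. \<Phi> (f x) \<partial>Q)) ----> 0"
  by (rule Lim_null_comparison[OF ev]) (use tendsto_mult_right_zero[OF L1_limit, of L] in simp)
 then show ?thesis by (simp add: LIM_zero_iff)
qed

end

abbreviation grid :: "nat => nat => nat => real \<times> real" where "grid N i j \<equiv> (real i/real N, real j/real N)"

definition icell :: "nat => nat => real set" where
 "icell N i = {(real i-1)/real N..real i/real N}"

definition hcell :: "nat => nat => real set" where
 "hcell N i = {(real i-1)/real N<..real i/real N}"

lemma hcell_disjoint: "N >= 1 ==> i ~= j ==> hcell N i \<inter> hcell N j = {}"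
proof -
 assume N: "N >= 1" and "i ~= j"
 have *: "hcell N i \<inter> hcell N j = {}" if "i < j" for i j
 proof -
  have "real i <= real j - 1" using that by simp
  then have "real i/real N <= (real j-1)/real N" by (intro divide_right_mono) auto
  then show ?thesis unfolding hcell_def by auto
 qed
 show ?thesis using *[of i j] *[of j i] \<open>i \<noteq> j\<close> by (cases "i < j") auto
qed

lemma hcell_cover: assumes "N >= 1" "0 < x" "x <= 1" shows "\<exists>i\<in>{1..N}. x \<in> hcell N i"
proof -
 define i where "i = nat \<lceil>real N * x\<rceil>"
 have Nx: "0 < real N * x" using assms by simp
 have c: "real i = of_int \<lceil>real N * x\<rceil>" unfolding i_def using Nx by simp
 have "real N * x <= real N*1" using assms by (intro mult_left_mono) auto
 then have "\<lceil>real N * x\<rceil> <= int N" by (simp add: ceiling_le_iff)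
 then have iN: "i <= N" unfolding i_def by linarith
 have "0 < \<lceil>real N * x\<rceil>" using Nx by simp
 then have "1 <= i" unfolding i_def by linarith
 with iN have i: "i \<in> {1..N}" by simp
 have "real i - 1 < real N * x" "real N * x <= real i" unfolding c by linarith+
 then have "x \<in> hcell N i" unfolding hcell_def using assms by (auto simp: field_simps)
 with i show ?thesis by blast
qed

lemma icell_nonempty_interior: "N >= 1 ==> (real i-1)/real N < real i/real N"
 by (intro divide_strict_right_mono) auto

lemma icell_inj: assumes "N >= 1" shows "inj (icell N)"
proof (rule injI)
 fix i j assume "icell N i = icell N j"
 then have "real i/real N = real j/real N"
  unfolding icell_def using icell_nonempty_interior[OF assms, of i] icell_nonempty_interior[OF assms, of j]
  by (simp add: Icc_eq_Icc)
 then show "i = j" using assms by simp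
qed

lemma icell_sub: "N >= 1 ==> i \<in> {1..N} ==> icell N i \<subseteq> {0..1}"
 unfolding icell_def atLeastatMost_subset_iff by (auto simp: divide_le_eq_1)

lemma icell_union: assumes "N >= 1" shows "(\<Union>i\<in>{1..N}. icell N i) = {0..1}"
proof (intro subset_antisym UN_least icell_sub[OF assms] subsetI)
 fix x :: real assume x: "x \<in> {0..1}"
 show "x \<in> (\<Union>i\<in>{1..N}. icell N i)"
 proof (cases "x = 0")
  case True
  then show ?thesis using assms by (auto simp: icell_def intro!: bexI[of _ 1])
 next
  case False
  then obtain i where "i \<in> {1..N}" "x \<in> hcell N i" using hcell_cover[OF assms, of x] x by auto
  then show ?thesis unfolding hcell_def icell_def by (auto intro!: bexI[of _ i])
 qed
qed

lemma icell_interior: "interior (icell N i) \<subseteq> hcell N i"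
 unfolding icell_def hcell_def by (auto simp: interior_atLeastAtMost_real)

lemma measure_hcell: "N >= 1 ==> measure lborel (hcell N i) = 1/real N"
 unfolding hcell_def using icell_nonempty_interior[of N i] by (simp add: diff_divide_distrib[symmetric])

lemma icell_diam: "N >= 1 ==> x \<in> icell N i ==> y \<in> icell N i ==> dist x y <= 1/real N"
proof -
 assume "N >= 1" and xy: "x \<in> icell N i" "y \<in> icell N i"
 have "(real i-1)/real N = real i/real N - 1/real N" by (rule diff_divide_distrib)
 with xy show ?thesis unfolding icell_def dist_real_def by auto
qed

lemma hcell_sub: "hcell N i \<subseteq> icell N i" unfolding hcell_def icell_def by auto

lemma corner_icell: "N >= 1 ==> real i/real N \<in> icell N i"
 unfolding icell_def using icell_nonempty_interior[of N i] by auto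

lemma eventually_inv_less: "0 < d ==> \<exists>n0. \<forall>N\<ge>n0. N >= 1 \<and> c/real N < d"
proof -
 assume "0 < d"
 obtain n :: nat where n: "\<bar>c\<bar>/d < real n" using reals_Archimedean2 by blast
 show ?thesis
 proof (intro exI[of _ "max n 1"] allI impI conjI)
  fix N assume N: "max n 1 <= N"
  then have "\<bar>c\<bar>/d < real N" using n by linarith
  then show "c/real N < d" using \<open>0 < d\<close> N by (auto simp: field_simps)
 qed auto
qed

lemma cell_family_1D:
 assumes R: "f riemann_integrable_on {0..1}" and f01: "!!x. x \<in> {0..1} ==> f x \<in> {0..1::real}"
 shows "cell_family f 0 1 (%N. {1..N}) icell hcell (%N i. real i/real N)"
proof
 show "f riemann_integrable_on cbox 0 1" using R by (simp add: cbox_interval)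
 have "f absolutely_integrable_on {0..1}"
  using riemann_integrable_has_integral[of f 0 1] R f01 by (intro nonnegative_absolutely_integrable_1) (auto simp: cbox_interval)
 then show "f \<in> borel_measurable (lebesgue_on (cbox 0 1))"
  unfolding cbox_interval set_integrable_def by (subst borel_measurable_restrict_space_iff) (auto dest: borel_measurable_integrable)
 show "!!x. x \<in> cbox 0 1 ==> f x \<in> {0..1}" using f01 by (simp add: cbox_interval)
 show "finite {1..N}" for N :: nat by simp
 show "inj_on (icell N) {1..N}" if "N >= 1" for N using icell_inj[OF that] by (auto simp: inj_on_def)
 show "icell N ` {1..N} division_of cbox 0 1" if N: "N >= 1" for N
 proof (rule division_ofI)
  fix K assume "K \<in> icell N ` {1..N}"
  then obtain i where i: "i \<in> {1..N}" "K = icell N i" by auto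
  show "K \<subseteq> cbox 0 1" using icell_sub[OF N i(1)] i by (simp add: cbox_interval)
  show "K ~= {}" using corner_icell[OF N, of i] i by auto
  show "\<exists>a b. K = cbox a b" using i by (auto simp: icell_def cbox_interval)
  fix K' assume "K' \<in> icell N ` {1..N}" "K ~= K'"
  then obtain j where j: "j \<in> {1..N}" "K' = icell N j" "i ~= j" using i(2) by blast
  show "interior K \<inter> interior K' = {}"
   using hcell_disjoint[OF N j(3)] icell_interior[of N i] icell_interior[of N j] unfolding i(2) j(2) by fast
 qed (use icell_union[OF N] in \<open>auto simp: cbox_interval\<close>)
 show "\<exists>n0. \<forall>N\<ge>n0. \<forall>i\<in>{1..N}. \<forall>x\<in>icell N i. icell N i \<subseteq> ball x d" if d: "0 < d" for d
 proof -
  obtain n0 where n0: "\<forall>N\<ge>n0. N >= 1 \<and> 1/real N < d" using eventually_inv_less[OF d, of 1] by blast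
  show ?thesis
  proof (intro exI[of _ n0] allI impI ballI subsetI)
   fix N i x y assume N: "n0 <= N" and xy: "x \<in> icell N i" "y \<in> icell N i"
   have "N >= 1" "1/real N < d" using n0 N by auto
   then show "y \<in> ball x d" using icell_diam[OF _ xy] by simp
  qed
 qed
 show "real i/real N \<in> icell N i" if "1 <= N" for N i using corner_icell[OF that] .
 show "hcell N i \<subseteq> icell N i" for N i by (rule hcell_sub)
 show "hcell N i \<in> sets borel" for N i unfolding hcell_def by simp
 show "disjoint_family_on (hcell N) {1..N}" if "1 <= N" for N
  unfolding disjoint_family_on_def using hcell_disjoint[OF that] by auto
 show "cbox 0 1 - (\<Union>c\<in>{1..N}. hcell N c) \<in> null_sets lborel" if N: "1 <= N" for N
 proof (rule null_sets_subset[of "{0}"])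
  show "cbox 0 1 - (\<Union>c\<in>{1..N}. hcell N c) \<subseteq> {0::real}"
   using hcell_cover[OF N] by (auto simp: cbox_interval) (metis atLeastAtMost_iff leD less_eq_real_def)
  show "cbox 0 1 - (\<Union>c\<in>{1..N}. hcell N c) \<in> sets lborel" unfolding hcell_def by auto
 qed auto
qed

lemma cell_family_2D:
 assumes R: "W riemann_integrable_on unit_square" and g: "graphon W"
 shows "cell_family W (0,0) (1,1) (%N. {1..N} \<times> {1..N}) (%N (i,j). icell N i \<times> icell N j) (%N (i,j). hcell N i \<times> hcell N j)
  (%N (i,j). (grid N i j))"
proof
 have sq: "cbox (0,0) (1,1) = unit_square" unfolding cbox_Pair_eq by (simp add: cbox_interval)
 show "W riemann_integrable_on cbox (0,0) (1,1)" using R unfolding sq .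
 show "W \<in> borel_measurable (lebesgue_on (cbox (0,0) (1,1)))" using g unfolding sq graphon_def by blast
 show "!!x. x \<in> cbox (0,0) (1,1) ==> W x \<in> {0..1}" using g unfolding sq graphon_def by blast
 show "finite ({1..N} \<times> {1..N})" for N :: nat by simp
 show inj: "inj_on (%(i,j). icell N i \<times> icell N j) ({1..N} \<times> {1..N})" if N: "N >= 1" for N
  using icell_inj[OF N] corner_icell[OF N] by (auto simp: inj_on_def times_eq_iff)
 show "(%(i,j). icell N i \<times> icell N j) ` ({1..N} \<times> {1..N}) division_of cbox (0,0) (1,1)" if N: "N >= 1" for N
 proof (rule division_ofI)
  fix K assume "K \<in> (%(i,j). icell N i \<times> icell N j) ` ({1..N} \<times> {1..N})"
  then obtain i j where i: "i \<in> {1..N}" "j \<in> {1..N}" "K = icell N i \<times> icell N j" by auto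
  show "K \<subseteq> cbox (0,0) (1,1)" using icell_sub[OF N i(1)] icell_sub[OF N i(2)] i unfolding sq by blast
  show "K ~= {}" using corner_icell[OF N] i by auto
  show "\<exists>a b. K = cbox a b"
  proof (intro exI)
   show "K = cbox ((real i-1)/real N, (real j-1)/real N) (grid N i j)"
    unfolding i(3) icell_def cbox_Pair_eq by (simp add: cbox_interval)
  qed
  fix K' assume "K' \<in> (%(i,j). icell N i \<times> icell N j) ` ({1..N} \<times> {1..N})" "K ~= K'"
  then obtain k l where k: "K' = icell N k \<times> icell N l" "i ~= k \<or> j ~= l" using i by auto
  show "interior K \<inter> interior K' = {}"
   using k(2) hcell_disjoint[OF N, of i k] hcell_disjoint[OF N, of j l]
    icell_interior[of N i] icell_interior[of N j] icell_interior[of N k] icell_interior[of N l]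
   unfolding i(3) k(1) interior_Times by fast
 next
  have "\<Union> ((%(i,j). icell N i \<times> icell N j) ` ({1..N} \<times> {1..N})) = (\<Union>i\<in>{1..N}. icell N i) \<times> (\<Union>i\<in>{1..N}. icell N i)"
   by auto
  then show "\<Union> ((%(i,j). icell N i \<times> icell N j) ` ({1..N} \<times> {1..N})) = cbox (0,0) (1,1)"
   unfolding sq icell_union[OF N] .
 qed simp
 show "\<exists>n0. \<forall>N\<ge>n0. \<forall>c\<in>{1..N} \<times> {1..N}. \<forall>x\<in>case c of (i,j) => icell N i \<times> icell N j. (case c of (i,j) => icell N i \<times> icell N j) \<subseteq> ball x d" if d: "0 < d" for d
 proof -
  obtain n0 where n0: "\<forall>N\<ge>n0. N >= 1 \<and> 2/real N < d" using eventually_inv_less[OF d, of 2] by blast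
  show ?thesis
  proof (intro exI[of _ n0] allI impI ballI subsetI)
   fix N and c :: "nat \<times> nat" and x y :: "real \<times> real"
   assume N: "n0 <= N" and xy: "x \<in> (case c of (i,j) => icell N i \<times> icell N j)" "y \<in> (case c of (i,j) => icell N i \<times> icell N j)"
   have "N >= 1" and l: "2/real N < d" using n0 N by auto
   have "dist x y <= dist (fst x) (fst y) + dist (snd x) (snd y)"
    unfolding dist_prod_def by (rule sqrt_sum_squares_le_sum) auto
   also have "\<dots> <= 1/real N + 1/real N"
    using xy by (intro add_mono icell_diam[OF \<open>N \<ge> 1\<close>, of _ "fst c"] icell_diam[OF \<open>N \<ge> 1\<close>, of _ "snd c"]) (auto split: prod.splits)
   finally show "y \<in> ball x d" using l by simp
  qed
 qed
 show "(case c of (i,j) => (grid N i j)) \<in> (case c of (i,j) => icell N i \<times> icell N j)" if "1 <= N" for N c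
  using corner_icell[OF that] by (auto split: prod.splits)
 show "(case c of (i,j) => hcell N i \<times> hcell N j) \<subseteq> (case c of (i,j) => icell N i \<times> icell N j)" for N c
  using hcell_sub by (auto split: prod.splits)
 show hb: "(case c of (i,j) => hcell N i \<times> hcell N j) \<in> sets borel" for N c
  unfolding hcell_def borel_prod[symmetric] by (auto split: prod.splits)
 show "disjoint_family_on (%(i,j). hcell N i \<times> hcell N j) ({1..N} \<times> {1..N})" if "1 <= N" for N
  unfolding disjoint_family_on_def using hcell_disjoint[OF that] by (auto simp: Times_Int_Times)
 show "cbox (0,0) (1,1)-(\<Union>c\<in>{1..N} \<times> {1..N}. case c of (i,j) => hcell N i \<times> hcell N j) \<in> null_sets lborel" if N: "1 <= N" for N
 proof (rule null_sets_subset)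
  have "{0::real} \<times> (UNIV::real set) \<in> null_sets (lborel \<Otimes>\<^sub>M lborel)" "(UNIV::real set) \<times> {0::real} \<in> null_sets (lborel \<Otimes>\<^sub>M lborel)"
   by (auto simp: null_sets_def lborel.emeasure_pair_measure_Times)
  then show "{0::real} \<times> (UNIV::real set) \<union> (UNIV::real set) \<times> {0::real} \<in> null_sets lborel"
   unfolding lborel_prod by (rule null_sets.Un)
  show "cbox (0,0) (1,1)-(\<Union>c\<in>{1..N} \<times> {1..N}. case c of (i,j) => hcell N i \<times> hcell N j) \<in> sets lborel"
   using hb by auto
  show "cbox (0,0) (1,1)-(\<Union>c\<in>{1..N} \<times> {1..N}. case c of (i,j) => hcell N i \<times> hcell N j) \<subseteq> {0} \<times> UNIV \<union> UNIV \<times> {0}"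
  proof
   fix p assume p: "p \<in> cbox (0,0) (1,1)-(\<Union>c\<in>{1..N} \<times> {1..N}. case c of (i,j) => hcell N i \<times> hcell N j)"
   obtain x y where xy: "p = (x, y)" by force
   show "p \<in> {0} \<times> UNIV \<union> UNIV \<times> {0}"
   proof (rule ccontr)
    assume "p \<notin> {0} \<times> UNIV \<union> UNIV \<times> {0}"
    then have "0 < x" "x <= 1" "0 < y" "y <= 1" using p unfolding sq xy by auto
    then obtain i j where "i \<in> {1..N}" "x \<in> hcell N i" "j \<in> {1..N}" "y \<in> hcell N j"
     using hcell_cover[OF N, of x] hcell_cover[OF N, of y] by blast
    then show False using p unfolding xy by blast
   qed
  qed
 qed
qed

section \<open>The graphon operator and its discretization\<close>

lemma U_measurable_AE:
 assumes "f \<in> borel_measurable U" "AE x in U. f x = (g x :: real)" shows "g \<in> borel_measurable U"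
proof -
 have 1: "(%x. indicator {0..1} x *\<^sub>R f x) \<in> borel_measurable lebesgue"
  using assms(1) by (subst (asm) borel_measurable_restrict_space_iff) auto
 have "AE x in lebesgue. x \<in> {0..1} --> f x = g x"
  using assms(2) by (subst (asm) AE_restrict_space_iff) auto
 then have "AE x in lebesgue. indicator {0..1} x *\<^sub>R f x = indicator {0..1} x *\<^sub>R g x"
  by eventually_elim (auto simp: indicator_def)
 from borel_measurable_AE[OF 1 this] show ?thesis
  by (subst borel_measurable_restrict_space_iff) auto
qed

lemma AE_U_lborel: "(AE x in U. P x) \<longleftrightarrow> (AE x in lborel. x \<in> {0..1} --> P x)"
 by (subst AE_restrict_space_iff) (auto simp: AE_completion_iff)

lemma borel_measurable_U: "f \<in> borel_measurable borel ==> f \<in> borel_measurable U"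
 by (intro measurable_restrict_space1 measurable_completion) simp

lemma integral_U_borel:
 fixes f :: "real => real" assumes "f \<in> borel_measurable borel"
 shows "(\<integral>x. f x \<partial>U) = (\<integral>x. indicator {0..1} x * f x \<partial>lborel)"
proof -
 have "(\<integral>x. f x \<partial>U) = (\<integral>x. indicator {0..1} x *\<^sub>R f x \<partial>lebesgue)" by (rule integral_restrict_space) simp
 also have "\<dots> = (\<integral>x. indicator {0..1} x *\<^sub>R f x \<partial>lborel)" by (rule integral_completion) (use assms in simp)
 finally show ?thesis by simp
qed

text \<open>The squared Hilbert-Schmidt norm.\<close>

definition hs2 :: "(real \<times> real => real) => real" where
 "hs2 K = (\<integral>x. (\<integral>y. (K (x, y))^2 \<partial>U) \<partial>U)"

definition opl :: "(real \<times> real => real) => l2 => l2" where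
 "opl K x = l2_of (graphon_op K (fun_of x))"

locale bdd_kernel =
 fixes K :: "real \<times> real => real" and B :: real
 assumes Km[measurable]: "K \<in> borel_measurable borel" and KB: "!!p. \<bar>K p\<bar> <= B"
begin

lemma B_nonneg: "0 <= B" using KB[of undefined] abs_ge_zero order_trans by blast

lemma Kpair[measurable]: "K \<in> borel_measurable (borel \<Otimes>\<^sub>M borel)" using Km by (simp add: borel_prod)

lemma slice_borel: "(%y. K (x, y)) \<in> borel_measurable borel" by measurable

lemma slice_L2: "(%y. K (x, y)) \<in> L2_unit"
 by (rule L2_unit_bounded[where B=B]) (auto intro: borel_measurable_U slice_borel KB)

definition slice :: "real => l2" where "slice x = l2_of (%y. K (x, y))"

lemma graphon_op_inner: "f \<in> L2_unit ==> graphon_op K f x = inner (slice x) (l2_of f)"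
 unfolding graphon_op_def slice_def by (rule l2_of_inner[symmetric, OF slice_L2])

lemma graphon_op_inner': "graphon_op K (fun_of f) x = inner (slice x) f"
 using graphon_op_inner[OF fun_of_L2, of f x] by (simp add: l2_of_fun_of)

lemma slice_norm: "(norm (slice x))^2 = (\<integral>y. (K (x, y))^2 \<partial>U)"
 unfolding slice_def l2_of_norm[OF slice_L2] L2_unit_norm_def by (simp add: integral_nonneg_AE)

lemma slice_bound: "norm (slice x) <= B"
proof -
 have "(norm (slice x))^2 <= (\<integral>y. B\<^sup>2 \<partial>U)" unfolding slice_norm
 proof (rule integral_mono)
  show "integrable U (%y. (K (x, y))^2)" using L2_unitD(2)[OF slice_L2] .
  show "integrable U (%y. B\<^sup>2)" by simp
  show "(K (x, y))^2 <= B^2" for y using KB[of "(x,y)"] B_nonneg by (metis abs_le_square_iff abs_of_nonneg)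
 qed
 also have "\<dots> = B^2" using U.prob_space by simp
 finally show ?thesis using B_nonneg by (rule power2_le_imp_le)
qed

lemma graphon_op_meas:
 assumes f: "f \<in> borel_measurable U" shows "graphon_op K f \<in> borel_measurable U"
 unfolding graphon_op_def
proof (rule U.borel_measurable_lebesgue_integral)
 have id1: "(%p. p) \<in> U \<Otimes>\<^sub>M U \<rightarrow>\<^sub>M borel \<Otimes>\<^sub>M borel"
 proof -
  have m: "(%x. x) \<in> U \<rightarrow>\<^sub>M borel" by (rule borel_measurable_U) simp
  have "(%p. (fst p, snd p)) \<in> U \<Otimes>\<^sub>M U \<rightarrow>\<^sub>M borel \<Otimes>\<^sub>M borel"
   by (intro measurable_Pair measurable_compose[OF measurable_fst m] measurable_compose[OF measurable_snd m])
  then show ?thesis by simp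
 qed
 have "(%p. K p * f (snd p)) \<in> borel_measurable (U \<Otimes>\<^sub>M U)"
  by (intro borel_measurable_times measurable_compose[OF id1 Kpair] measurable_compose[OF measurable_snd f])
 then show "(%(x, y). K (x, y) * f y) \<in> borel_measurable (U \<Otimes>\<^sub>M U)"
  by (simp add: case_prod_beta')
qed

lemma graphon_op_L2: "f \<in> L2_unit ==> graphon_op K f \<in> L2_unit"
proof (rule L2_unit_bounded[where B="B * norm (l2_of f)"])
 assume f: "f \<in> L2_unit"
 show "graphon_op K f \<in> borel_measurable U" by (rule graphon_op_meas[OF L2_unitD(1)[OF f]])
 show "\<bar>graphon_op K f x\<bar> <= B * norm (l2_of f)" for x
  unfolding graphon_op_inner[OF f] using Cauchy_Schwarz_ineq2[of "slice x" "l2_of f"] slice_bound[of x]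
  by (meson mult_right_mono norm_ge_zero order_trans)
qed

lemma opl_norm: "(norm (opl K x))^2 = (\<integral>t. (inner (slice t) x)^2 \<partial>U)"
 unfolding opl_def l2_of_norm[OF graphon_op_L2[OF fun_of_L2]] L2_unit_norm_def graphon_op_inner'
 by (simp add: integral_nonneg_AE)

lemma inner_sq_int: "integrable U (%t. (inner (slice t) x)^2)"
 using L2_unitD(2)[OF graphon_op_L2[OF fun_of_L2, of x]] unfolding graphon_op_inner' .

lemma slice_norm_int: "integrable U (%x. \<integral>y. (K (x, y))^2 \<partial>U)"
proof (rule U.integrable_const_bound[where B="B^2"])
 show "AE x in U. norm (\<integral>y. (K (x, y))^2 \<partial>U) <= B^2"
  unfolding slice_norm[symmetric] using slice_bound by (auto intro!: power_mono)
 have "graphon_op (%p. (K p)^2) (%_. 1) \<in> borel_measurable U"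
  by (rule bdd_kernel.graphon_op_meas[of _ "B^2"]) (unfold_locales, use KB B_nonneg in \<open>auto simp: abs_le_square_iff[symmetric]\<close>)
 then show "(%x. \<integral>y. (K (x, y))^2 \<partial>U) \<in> borel_measurable U" unfolding graphon_op_def by simp
qed

lemma opl_HS:
 assumes "finite I" "orthonormal e I"
 shows "(\<Sum>i\<in>I. (norm (opl K (e i)))^2) <= hs2 K"
proof -
 have "(\<Sum>i\<in>I. (norm (opl K (e i)))^2) = (\<integral>t. (\<Sum>i\<in>I. (inner (slice t) (e i))^2) \<partial>U)"
  unfolding opl_norm by (rule Bochner_Integration.integral_sum[symmetric]) (rule inner_sq_int)
 also have "\<dots> <= hs2 K"
  unfolding hs2_def
 proof (rule integral_mono)
  show "integrable U (%t. \<Sum>i\<in>I. (inner (slice t) (e i))^2)" by (rule Bochner_Integration.integrable_sum) (rule inner_sq_int)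
  show "integrable U (%x. \<integral>y. (K (x, y))^2 \<partial>U)" by (rule slice_norm_int)
  show "(\<Sum>i\<in>I. (inner (slice t) (e i))^2) <= (\<integral>y. (K (t, y))^2 \<partial>U)" for t
   unfolding slice_norm[symmetric] using orthonormal_bessel[OF assms(2,1), of "slice t"] by (simp add: inner_commute)
 qed
 finally show ?thesis .
qed

lemma opl_op: "(norm (opl K x))^2 <= hs2 K*(norm x)^2"
proof -
 have "(norm (opl K x))^2 <= (\<integral>t. (\<integral>y. (K (t, y))^2 \<partial>U)*(norm x)^2 \<partial>U)"
  unfolding opl_norm
 proof (rule integral_mono)
  show "integrable U (%t. (inner (slice t) x)^2)" by (rule inner_sq_int)
  show "integrable U (%t. (\<integral>y. (K (t, y))^2 \<partial>U)*(norm x)^2)" by (intro integrable_mult_left slice_norm_int)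
  show "(inner (slice t) x)^2 <= (\<integral>y. (K (t, y))^2 \<partial>U)*(norm x)^2" for t
   unfolding slice_norm[symmetric] using Cauchy_Schwarz_ineq[of "slice t" x] by (simp add: power2_norm_eq_inner)
 qed
 then show ?thesis unfolding hs2_def by simp
qed

lemma opl_linear: "linear (opl K)"
proof (rule linearI)
 show "opl K (x + y) = opl K x + opl K y" for x y
  unfolding opl_def using l2_of_add[OF graphon_op_L2[OF fun_of_L2] graphon_op_L2[OF fun_of_L2], of x y]
  by (simp add: graphon_op_inner' inner_add_right)
   (metis (no_types, lifting) ext graphon_op_inner' inner_add_right)
 show "opl K (c *\<^sub>R x) = c *\<^sub>R opl K x" for c x
  unfolding opl_def using l2_of_scale[OF graphon_op_L2[OF fun_of_L2], of c x]
  by (metis (no_types, lifting) ext graphon_op_inner' inner_scaleR_right)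
qed

lemma hs2_square: "hs2 K = (\<integral>p. (K p)^2 \<partial>U2)"
proof -
 define g where "g p = indicator unit_square p*(K p)^2" for p
 have sqm: "unit_square \<in> sets borel" by (simp add: borel_prod[symmetric])
 have gm: "g \<in> borel_measurable borel" unfolding g_def using sqm by simp
 have gi: "integrable (lborel \<Otimes>\<^sub>M lborel) g"
 proof -
  have "integrable lborel (%p. indicator unit_square p *\<^sub>R (K p)\<^sup>2)"
  proof (rule integrableI_bounded_set_indicator[where B="B^2"])
   show "emeasure lborel unit_square < \<infinity>"
    unfolding lborel_prod[symmetric] by (subst lborel.emeasure_pair_measure_Times) auto
   show "AE x in lborel. x \<in> unit_square --> norm ((K x)^2) <= B^2" using KB B_nonneg by (auto simp: abs_le_square_iff[symmetric])
  qed (use sqm in auto)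
  then show ?thesis unfolding g_def lborel_prod by simp
 qed
 have "(\<integral>p. (K p)^2 \<partial>U2) = (\<integral>p. indicator unit_square p *\<^sub>R (K p)\<^sup>2 \<partial>lebesgue)"
  by (rule integral_restrict_space) (use sqm in auto)
 also have "\<dots> = (\<integral>p. g p \<partial>lborel)" unfolding g_def real_scaleR_def by (rule integral_completion) (use sqm in simp)
 also have "\<dots> = (\<integral>x. (\<integral>y. g (x, y) \<partial>lborel) \<partial>lborel)"
  unfolding lborel_prod[symmetric] by (rule lborel_pair.integral_fst'[symmetric, OF gi])
 also have "\<dots> = (\<integral>x. indicator {0..1} x*(\<integral>y. (K (x, y))^2 \<partial>U) \<partial>lborel)"
 proof (rule Bochner_Integration.integral_cong[OF refl])
  fix x
  have "(\<integral>y. g (x, y) \<partial>lborel) = (\<integral>y. indicator {0..1} x*(indicator {0..1} y*(K (x, y))^2) \<partial>lborel)"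
   unfolding g_def by (intro Bochner_Integration.integral_cong) (auto simp: indicator_def)
  also have "\<dots> = indicator {0..1} x*(\<integral>y. indicator {0..1} y*(K (x, y))^2 \<partial>lborel)" by (rule integral_mult_right_zero)
  also have "(\<integral>y. indicator {0..1} y*(K (x, y))^2 \<partial>lborel) = (\<integral>y. (K (x, y))^2 \<partial>U)"
   by (rule integral_U_borel[symmetric]) simp
  finally show "(\<integral>y. g (x, y) \<partial>lborel) = indicator {0..1} x*(\<integral>y. (K (x, y))^2 \<partial>U)" .
 qed
 also have "\<dots> = (\<integral>x. indicator {0..1} x*(\<integral>y. indicator {0..1} y*(K (x, y))^2 \<partial>lborel) \<partial>lborel)"
  by (simp add: integral_U_borel)
 also have "\<dots> = (\<integral>x. (\<integral>y. indicator {0..1} y*(K (x, y))^2 \<partial>lborel) \<partial>U)"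
 proof (rule integral_U_borel[symmetric])
  show "(%x. \<integral>y. indicator {0..1} y*(K (x, y))^2 \<partial>lborel) \<in> borel_measurable borel" by measurable
 qed
 also have "\<dots> = hs2 K" unfolding hs2_def by (simp add: integral_U_borel)
 finally show ?thesis by simp
qed

end

lemma opl_diff:
 assumes "bdd_kernel K1 B1" "bdd_kernel K2 B2"
 shows "opl K1 x - opl K2 x = opl (%p. K1 p - K2 p) x"
proof -
 interpret k1: bdd_kernel K1 B1 by fact
 interpret k2: bdd_kernel K2 B2 by fact
 have "graphon_op (%p. K1 p - K2 p) (fun_of x) = (%t. graphon_op K1 (fun_of x) t - graphon_op K2 (fun_of x) t)"
  unfolding graphon_op_def left_diff_distrib
  by (intro ext Bochner_Integration.integral_diff L2_unit_mult_integrable k1.slice_L2 k2.slice_L2 fun_of_L2)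
 then show ?thesis unfolding opl_def using l2_of_diff[OF k1.graphon_op_L2[OF fun_of_L2] k2.graphon_op_L2[OF fun_of_L2], of x x] by simp
qed

text \<open>Sections of a Lebesgue measurable kernel can fail to be measurable for a null set of points, so the operator is
studied through a Borel kernel that agrees with \<open>W\<close> almost everywhere.\<close>

lemma graphon_borel_version:
 assumes "graphon W"
 obtains K where "bdd_kernel K 1" "AE p in U2. W p = K p"
  "!!f. f \<in> L2_unit ==> AE x in U. graphon_op K f x = graphon_op W f x"
proof -
 have sqm: "unit_square \<in> sets borel" by (simp add: borel_prod[symmetric])
 have Wm: "W \<in> borel_measurable U2" and W01: "!!p. p \<in> unit_square ==> W p \<in> {0..1}"
  using assms unfolding graphon_def by auto
 have "(%p. indicator unit_square p *\<^sub>R W p) \<in> borel_measurable lebesgue"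
  using Wm sqm by (subst (asm) borel_measurable_restrict_space_iff) auto
 from completion_ex_borel_measurable_real[OF this] obtain g where g: "g \<in> borel_measurable lborel"
  "AE p in lborel. indicator unit_square p *\<^sub>R W p = g p" by blast
 define K where "K p = max 0 (min 1 (g p))" for p
 have [measurable]: "g \<in> borel_measurable borel" using g(1) by simp
 have K: "bdd_kernel K 1"
 proof
  show "K \<in> borel_measurable borel" unfolding K_def[abs_def] by measurable
 qed (auto simp: K_def)
 have ae: "AE p in lborel. p \<in> unit_square --> W p = K p"
  using g(2)
 proof eventually_elim
  fix p assume "indicator unit_square p *\<^sub>R W p = g p"
  then show "p \<in> unit_square --> W p = K p" using W01[of p] by (auto simp: K_def indicator_def)
 qed
 have "AE p in lebesgue. p \<in> unit_square --> W p = K p" using ae by (simp add: AE_completion_iff)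
 then have 2: "AE p in U2. W p = K p" using sqm by (subst AE_restrict_space_iff) auto
 have "AE x in lborel. AE y in lborel. (x, y) \<in> unit_square --> W (x, y) = K (x, y)"
  using lborel_pair.AE_pair[of "%p. p \<in> unit_square --> W p = K p"] ae unfolding lborel_prod by simp
 then have "AE x in lborel. x \<in> {0..1} --> (AE y in U. W (x, y) = K (x, y))"
 proof eventually_elim
  fix x assume a: "AE y in lborel. (x, y) \<in> unit_square --> W (x, y) = K (x, y)"
  show "x \<in> {0..1} --> (AE y in U. W (x, y) = K (x, y))"
   unfolding AE_U_lborel using a by auto
 qed
 then have ae2: "AE x in U. AE y in U. W (x, y) = K (x, y)" by (subst AE_U_lborel)
 have 3: "AE x in U. graphon_op K f x = graphon_op W f x" if f: "f \<in> L2_unit" for f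
  using ae2
 proof eventually_elim
  fix x assume a: "AE y in U. W (x, y) = K (x, y)"
  have m: "(%y. K (x, y) * f y) \<in> borel_measurable U"
   by (rule borel_measurable_integrable[OF L2_unit_mult_integrable[OF bdd_kernel.slice_L2[OF K] f]])
  have a': "AE y in U. K (x, y) * f y = W (x, y) * f y" using a by eventually_elim simp
  show "graphon_op K f x = graphon_op W f x"
   unfolding graphon_op_def by (rule integral_cong_AE[OF m U_measurable_AE[OF m a'] a'])
 qed
 show thesis by (rule that[OF K 2 3])
qed

context cell_family begin

lemma cell_sum_eval:
 assumes "N >= 1" "c \<in> I N" "x \<in> H N c"
 shows "(\<Sum>d\<in>I N. \<alpha> d * indicator (H N d) x) = (\<alpha> c :: real)"
proof -
 have "(\<Sum>d\<in>I N. \<alpha> d * indicator (H N d) x) = \<alpha> c * indicator (H N c) x + (\<Sum>d\<in>I N - {c}. \<alpha> d * indicator (H N d) x)"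
  by (rule sum.remove[OF finI assms(2)])
 also have "(\<Sum>d\<in>I N - {c}. \<alpha> d * indicator (H N d) x) = 0"
  using disj[OF assms(1)] assms unfolding disjoint_family_on_def
  by (intro sum.neutral) (auto simp: indicator_def)
 finally show ?thesis using assms by simp
qed

lemma cell_sum_integral:
 assumes N: "N >= 1"
 shows "integrable (lebesgue_on (cbox a b)) (%x. \<Sum>c\<in>I N. \<alpha> c * indicator (H N c) x)"
  and "(\<integral>x. (\<Sum>c\<in>I N. \<alpha> c * indicator (H N c) x) \<partial>lebesgue_on (cbox a b)) = (\<Sum>c\<in>I N. \<alpha> c * measure lborel (H N c))"
proof -
 interpret finite_measure "lebesgue_on (cbox a b)" by (rule finite_meas)
 have m: "H N c \<in> sets (lebesgue_on (cbox a b))" if "c \<in> I N" for c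
  using HS[OF N that] Hb[of N c] by (auto simp: sets_restrict_space image_iff intro!: bexI[of _ "H N c"])
 have e: "measure (lebesgue_on (cbox a b)) (H N c) = measure lborel (H N c)" if "c \<in> I N" for c
  using HS[OF N that] Hb[of N c] by (subst measure_restrict_space) (auto simp: measure_completion)
 show "integrable (lebesgue_on (cbox a b)) (%x. \<Sum>c\<in>I N. \<alpha> c * indicator (H N c) x)"
  using m by (intro Bochner_Integration.integrable_sum) (auto intro!: integrable_real_indicator simp: emeasure_eq_measure)
 have "(\<integral>x. (\<Sum>c\<in>I N. \<alpha> c * indicator (H N c) x) \<partial>lebesgue_on (cbox a b)) = (\<Sum>c\<in>I N. (\<integral>x. \<alpha> c * indicator (H N c) x \<partial>lebesgue_on (cbox a b)))"
  using m by (intro Bochner_Integration.integral_sum) (auto intro!: integrable_real_indicator simp: emeasure_eq_measure)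
 also have "\<dots> = (\<Sum>c\<in>I N. \<alpha> c * measure lborel (H N c))"
  using m e HS[OF N] by (intro sum.cong refl) (auto simp: Int_absorb1 Int_absorb2)
 finally show "(\<integral>x. (\<Sum>c\<in>I N. \<alpha> c * indicator (H N c) x) \<partial>lebesgue_on (cbox a b)) = (\<Sum>c\<in>I N. \<alpha> c * measure lborel (H N c))" .
qed

end

text \<open>The diagonal is removed because spin couplings have none; it is negligible in mean square.\<close>

definition wt :: "(real \<times> real => real) => nat => nat => nat => real" where
 "wt W N i j = (if i = j then 0 else W (grid N i j))"

definition stepK :: "(real \<times> real => real) => nat => real \<times> real => real" where
 "stepK W N p = (\<Sum>i=1..N. \<Sum>j=1..N. wt W N i j*(indicator (hcell N i) (fst p) * indicator (hcell N j) (snd p)))"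

definition stepf :: "nat => nat => real => real" where "stepf N i t = sqrt (real N) * indicator (hcell N i) t"

text \<open>In this orthonormal system the step kernel acts as the matrix \<open>wt/N\<close>.\<close>

definition stepe :: "nat => nat => l2" where "stepe N i = l2_of (stepf N i)"

lemma hcell_borel[measurable]: "hcell N i \<in> sets borel" unfolding hcell_def by simp

lemma stepf_L2: "stepf N i \<in> L2_unit"
 by (rule L2_unit_bounded[where B="sqrt (real N)"]) (auto simp: stepf_def[abs_def] indicator_def intro!: borel_measurable_U)

lemma stepe_orthonormal: assumes N: "N >= 1" shows "orthonormal (stepe N) {1..N}"
 unfolding orthonormal_def
proof (intro ballI)
 fix i j assume ij: "i \<in> {1..N}" "j \<in> {1..N}"
 have "inner (stepe N i) (stepe N j) = (\<integral>t. stepf N i t * stepf N j t \<partial>U)"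
  unfolding stepe_def by (rule l2_of_inner[OF stepf_L2 stepf_L2])
 also have "\<dots> = (\<integral>t. (if i = j then real N else 0) * indicator (hcell N i) t \<partial>U)"
  using hcell_disjoint[OF N, of i j] by (intro Bochner_Integration.integral_cong) (auto simp: stepf_def indicator_def)
 also have "\<dots> = (if i = j then 1 else 0)"
 proof -
  have "hcell N i \<subseteq> {0..1}" using icell_sub[OF N ij(1)] hcell_sub by blast
  then have "measure U (hcell N i) = 1/real N"
   using measure_hcell[OF N, of i] by (subst measure_restrict_space) (auto simp: measure_completion)
  moreover have "hcell N i \<inter> {0..1} = hcell N i" using \<open>hcell N i \<subseteq> {0..1}\<close> by auto
  ultimately show ?thesis using N by (auto simp: Int_commute)
 qed
 finally show "inner (stepe N i) (stepe N j) = (if i = j then 1 else 0)" .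
qed

lemma stepK_kernel: "bdd_kernel (stepK W N) (\<Sum>i=1..N. \<Sum>j=1..N. \<bar>wt W N i j\<bar>)"
proof
 show "stepK W N \<in> borel_measurable borel"
 proof -
  have "stepK W N \<in> borel_measurable (borel \<Otimes>\<^sub>M borel)" unfolding stepK_def[abs_def] by measurable
  then show ?thesis by (simp add: borel_prod)
 qed
 show "\<bar>stepK W N p\<bar> <= (\<Sum>i=1..N. \<Sum>j=1..N. \<bar>wt W N i j\<bar>)" for p
  unfolding stepK_def
  by (intro order_trans[OF sum_abs] sum_mono) (auto simp: abs_mult indicator_def)
qed

lemma opl_stepK:
 assumes N: "N >= 1"
 shows "opl (stepK W N) x = (\<Sum>i=1..N. (\<Sum>j=1..N. wt W N i j/real N * inner (stepe N j) x) *\<^sub>R stepe N i)"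
proof -
 define c where "c i = (\<Sum>j=1..N. wt W N i j/real N * inner (stepe N j) x)" for i
 have ii: "integrable U (%y. stepf N j y * fun_of x y)" for j by (rule L2_unit_mult_integrable[OF stepf_L2 fun_of_L2])
 have ip: "inner (stepe N j) x = (\<integral>y. stepf N j y * fun_of x y \<partial>U)" for j
  unfolding stepe_def using l2_of_inner[OF stepf_L2 fun_of_L2, of N j x] by (simp add: l2_of_fun_of)
 have "graphon_op (stepK W N) (fun_of x) t = (\<Sum>i=1..N. c i * stepf N i t)" for t
 proof -
  have eq: "stepK W N (t, y) * fun_of x y
   = (\<Sum>i=1..N. \<Sum>j=1..N. (wt W N i j/real N * stepf N i t)*(stepf N j y * fun_of x y))" for y
  proof -
   have "real N = sqrt (real N) * sqrt (real N)" by simp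
   then have "indicator (hcell N i) t * indicator (hcell N j) y = stepf N i t * stepf N j y/real N" for i j
    using N unfolding stepf_def by (auto simp: indicator_def)
   then show ?thesis unfolding stepK_def sum_distrib_right by (intro sum.cong refl) simp
  qed
  have "graphon_op (stepK W N) (fun_of x) t = (\<Sum>i=1..N. \<Sum>j=1..N. (wt W N i j/real N * stepf N i t)*(\<integral>y. stepf N j y * fun_of x y \<partial>U))"
   unfolding graphon_op_def eq
   by (subst Bochner_Integration.integral_sum, intro Bochner_Integration.integrable_sum integrable_mult_right ii,
     intro sum.cong refl, subst Bochner_Integration.integral_sum, intro integrable_mult_right ii, simp)
  then show ?thesis unfolding c_def ip[symmetric] by (simp add: sum_distrib_right sum_distrib_left mult_ac)
 qed
 then have g: "graphon_op (stepK W N) (fun_of x) = (%t. \<Sum>i=1..N. c i * stepf N i t)" by auto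
 have "opl (stepK W N) x = (\<Sum>i=1..N. l2_of (%t. c i * stepf N i t))"
  unfolding opl_def g using l2_of_sum[of "{1..N}" "%i t. c i * stepf N i t"] L2_unit_scale[OF stepf_L2] by simp
 also have "\<dots> = (\<Sum>i=1..N. c i *\<^sub>R stepe N i)" unfolding stepe_def by (simp add: l2_of_scale[OF stepf_L2])
 finally show ?thesis unfolding c_def .
qed

definition gop :: "(real \<times> real => real) => l2 => l2" where "gop W x = l2_of (graphon_op W (fun_of x))"

locale riemann_graphon =
 fixes W assumes gW: "graphon W" and RW: "W riemann_integrable_on unit_square"
begin

sublocale C2: cell_family W "(0,0)" "(1,1)" "%N. {1..N} \<times> {1..N}" "%N (i,j). icell N i \<times> icell N j"
 "%N (i,j). hcell N i \<times> hcell N j" "%N (i,j). (grid N i j)"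
 by (rule cell_family_2D[OF RW gW])

lemma sq: "cbox (0,0) (1,1) = (unit_square :: (real\<times>real) set)" unfolding cbox_Pair_eq by (simp add: cbox_interval)

lemma corner01: "N >= 1 ==> i \<in> {1..N} ==> real i/real N \<in> {0..1}" by auto

lemma W01: "p \<in> unit_square ==> 0 <= W p \<and> W p <= 1" using gW unfolding graphon_def by auto

lemma wt01: "i \<in> {1..N} ==> j \<in> {1..N} ==> 0 <= wt W N i j \<and> wt W N i j <= 1"
 unfolding wt_def using W01[of "(grid N i j)"] corner01[of N] by auto

lemma wt_sym: "i \<in> {1..N} ==> j \<in> {1..N} ==> wt W N i j = wt W N j i"
 unfolding wt_def using gW corner01[of N] unfolding graphon_def by auto

lemma stepK_sum: "stepK W N p = (\<Sum>c\<in>{1..N} \<times> {1..N}. wt W N (fst c) (snd c) * indicator (case c of (i,j) => hcell N i \<times> hcell N j) p)"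
 unfolding stepK_def sum.cartesian_product
 by (intro sum.cong refl, cases p) (auto simp: indicator_def split: prod.splits)

definition bker where "bker = (SOME K. bdd_kernel K 1 \<and> (AE p in U2. W p = K p) \<and>
  (\<forall>f\<in>L2_unit. AE x in U. graphon_op K f x = graphon_op W f x))"

lemma bker: "bdd_kernel bker 1" "AE p in U2. W p = bker p"
  "f \<in> L2_unit ==> AE x in U. graphon_op bker f x = graphon_op W f x"
proof -
 have "\<exists>K. bdd_kernel K 1 \<and> (AE p in U2. W p = K p) \<and>
  (\<forall>f\<in>L2_unit. AE x in U. graphon_op K f x = graphon_op W f x)"
 proof (rule graphon_borel_version[OF gW])
  fix K assume K: "bdd_kernel K 1" "AE p in U2. W p = K p"
   "!!f. f \<in> L2_unit ==> AE x in U. graphon_op K f x = graphon_op W f x"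
  show ?thesis by (intro exI[of _ K] conjI ballI K)
 qed
 from someI_ex[OF this] show "bdd_kernel bker 1" "AE p in U2. W p = bker p"
  "f \<in> L2_unit ==> AE x in U. graphon_op bker f x = graphon_op W f x" unfolding bker_def by blast+
qed

interpretation bk: bdd_kernel bker 1 by (rule bker(1))

lemma graphon_op_L2: assumes f: "f \<in> L2_unit" shows "graphon_op W f \<in> L2_unit"
proof -
 have ae: "AE x in U. graphon_op bker f x = graphon_op W f x" by (rule bker(3)[OF f])
 have L: "graphon_op bker f \<in> L2_unit" by (rule bk.graphon_op_L2[OF f])
 have m: "graphon_op W f \<in> borel_measurable U" by (rule U_measurable_AE[OF L2_unitD(1)[OF L] ae])
 have "integrable U (%x. (graphon_op W f x)^2)"
 proof (rule Bochner_Integration.integrable_cong_AE_imp[OF L2_unitD(2)[OF L]])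
  show "(%x. (graphon_op W f x)^2) \<in> borel_measurable U" using m by simp
  show "AE x in U. (graphon_op bker f x)^2 = (graphon_op W f x)^2" using ae by eventually_elim simp
 qed
 with m show ?thesis unfolding L2_unit_def by simp
qed

lemma gop_opl: "gop W x = opl bker x"
 unfolding gop_def opl_def using bker(3)[OF fun_of_L2, of x]
 by (subst l2_of_eq[OF graphon_op_L2[OF fun_of_L2] bk.graphon_op_L2[OF fun_of_L2]]) (auto elim: AE_mp)

lemma gop_l2_of: assumes f: "f \<in> L2_unit" shows "gop W (l2_of f) = l2_of (graphon_op W f)"
proof -
 have e: "graphon_op bker (fun_of (l2_of f)) = graphon_op bker f"
  by (rule ext) (simp add: bk.graphon_op_inner' bk.graphon_op_inner[OF f])
 show ?thesis unfolding gop_opl opl_def e using bker(3)[OF f]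
  by (subst l2_of_eq[OF bk.graphon_op_L2[OF f] graphon_op_L2[OF f]])
qed

lemma gop_bounded_linear: "bounded_linear (gop W)"
proof -
 have "gop W = opl bker" using gop_opl by auto
 moreover have "bounded_linear (opl bker)"
 proof (rule bounded_linear_intro[where K="sqrt (hs2 bker)"])
  show "opl bker (x + y) = opl bker x + opl bker y" "opl bker (r *\<^sub>R x) = r *\<^sub>R opl bker x" for x y r
   using bk.opl_linear by (auto simp: linear_add linear_scale)
  show "norm (opl bker x) <= norm x * sqrt (hs2 bker)" for x
  proof (rule power2_le_imp_le)
   have "0 <= hs2 bker" unfolding hs2_def by (simp add: integral_nonneg_AE)
   then show "(norm (opl bker x))^2 <= (norm x * sqrt (hs2 bker))^2" "0 <= norm x * sqrt (hs2 bker)"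
    using bk.opl_op[of x] by (simp_all add: power_mult_distrib mult.commute)
  qed
 qed
 ultimately show ?thesis by simp
qed

definition dlt :: "nat => real" where "dlt N = hs2 (%p. bker p - stepK W N p)"

lemma dk: "bdd_kernel (%p. bker p - stepK W N p) (1 + (\<Sum>i=1..N. \<Sum>j=1..N. \<bar>wt W N i j\<bar>))"
proof -
 interpret s: bdd_kernel "stepK W N" "\<Sum>i=1..N. \<Sum>j=1..N. \<bar>wt W N i j\<bar>" by (rule stepK_kernel)
 show ?thesis
 proof
  show "(%p. bker p - stepK W N p) \<in> borel_measurable borel" by measurable
  show "\<bar>bker p - stepK W N p\<bar> <= 1 + (\<Sum>i=1..N. \<Sum>j=1..N. \<bar>wt W N i j\<bar>)" for p
   using abs_triangle_ineq4[of "bker p" "stepK W N p"] bk.KB[of p] s.KB[of p] by linarith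
 qed
qed

lemma dlt_nonneg: "0 <= dlt N" unfolding dlt_def hs2_def by (simp add: integral_nonneg_AE)

lemma dlt_limit: "dlt ----> 0"
proof -
 let ?S = "U2"
 define L where "L N = (\<integral>p. \<bar>W p - C2.step (%x. x) N p\<bar> \<partial>?S)" for N
 have L: "L ----> 0" using C2.L1_limit unfolding L_def sq .
 have ev: "norm (dlt N) <= L N + 1/real N" if N: "N >= 1" for N
 proof -
  interpret s: bdd_kernel "stepK W N" "\<Sum>i=1..N. \<Sum>j=1..N. \<bar>wt W N i j\<bar>" by (rule stepK_kernel)
  interpret d: bdd_kernel "%p. bker p - stepK W N p" "1 + (\<Sum>i=1..N. \<Sum>j=1..N. \<bar>wt W N i j\<bar>)" by (rule dk)
  interpret finite_measure ?S using C2.finite_meas unfolding sq .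
  let ?I = "{1..N} \<times> {1..N}"
  let ?H = "%c. case c of (i,j) => hcell N i \<times> hcell N j"
  define dg where "dg c = (if fst c = snd c then 1 else (0::real))" for c :: "nat \<times> nat"
  define D where "D p = (\<Sum>c\<in>?I. dg c * indicator (?H c) p)" for p
  have Wi: "integrable ?S W"
   using C2.f01 C2.meas unfolding sq by (intro integrable_const_bound[where B=1]) (auto intro!: AE_I2)
  have sti: "integrable ?S (C2.step (%x. x) N)" using C2.integrable_step[OF N] unfolding sq .
  have Di: "integrable ?S D" using C2.cell_sum_integral(1)[OF N, of dg] unfolding sq D_def .
  have Dint: "(\<integral>p. D p \<partial>?S) = 1/real N"
  proof -
   have mH: "measure lborel (?H c) = 1/real N*(1/real N)" for c
   proof -
    obtain i j where c: "c = (i, j)" by force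
    have "emeasure (lborel \<Otimes>\<^sub>M lborel) (hcell N i \<times> hcell N j) = emeasure lborel (hcell N i) * emeasure lborel (hcell N j)"
     by (rule lborel.emeasure_pair_measure_Times) (auto simp: hcell_def)
    then have "measure (lborel \<Otimes>\<^sub>M lborel) (hcell N i \<times> hcell N j) = measure lborel (hcell N i) * measure lborel (hcell N j)"
     unfolding measure_def by (simp add: enn2real_mult)
    then show ?thesis unfolding c lborel_prod measure_hcell[OF N] by simp
   qed
   have "(\<integral>p. D p \<partial>?S) = (\<Sum>c\<in>?I. dg c * measure lborel (?H c))"
    using C2.cell_sum_integral(2)[OF N, of dg] unfolding sq D_def .
   also have "\<dots> = (\<Sum>i=1..N. \<Sum>j=1..N. (if i = j then 1/real N*(1/real N) else 0))"
    unfolding sum.cartesian_product mH dg_def by (intro sum.cong refl) auto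
   also have "\<dots> = 1/real N" using N by (simp add: sum.delta)
   finally show ?thesis .
  qed
  have "dlt N = (\<integral>p. (bker p - stepK W N p)^2 \<partial>?S)" unfolding dlt_def by (rule d.hs2_square)
  also have "\<dots> <= (\<integral>p. \<bar>W p - C2.step (%x. x) N p\<bar> + D p \<partial>?S)"
  proof (rule integral_mono_AE')
   show "integrable ?S (%p. \<bar>W p - C2.step (%x. x) N p\<bar> + D p)"
    by (intro Bochner_Integration.integrable_add integrable_abs Bochner_Integration.integrable_diff Wi sti Di)
   have cell: "AE p in ?S. \<exists>c\<in>?I. p \<in> ?H c" using C2.AE_cell[OF N] unfolding sq .
   have main: "AE p in ?S. (bker p - stepK W N p)^2 <= \<bar>W p - C2.step (%x. x) N p\<bar> + D p \<and> 0 <= \<bar>W p - C2.step (%x. x) N p\<bar> + D p"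
    using cell bker(2)
   proof eventually_elim
    fix p assume "\<exists>c\<in>?I. p \<in> ?H c" and bp: "W p = bker p"
    then obtain c where c: "c \<in> ?I" "p \<in> ?H c" by blast
    obtain i j where ij: "c = (i, j)" "i \<in> {1..N}" "j \<in> {1..N}" using c by auto
    have st: "C2.step (%x. x) N p = W (grid N i j)" using C2.step_eval[OF N c] unfolding ij by simp
    have Dp: "D p = dg c" unfolding D_def by (rule C2.cell_sum_eval[OF N c])
    have sK: "stepK W N p = wt W N i j" unfolding stepK_sum using C2.cell_sum_eval[OF N c, of "%c. wt W N (fst c) (snd c)"] unfolding ij by simp
    have pS: "p \<in> unit_square" using C2.HS[OF N c(1)] c(2) unfolding sq by blast
    have b1: "\<bar>W p - stepK W N p\<bar> <= 1" unfolding sK using W01[OF pS] wt01[OF ij(2,3)] by linarith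
    have "(W p - stepK W N p)^2 <= \<bar>W p - stepK W N p\<bar>"
     using mult_left_mono[OF b1 abs_ge_zero[of "W p - stepK W N p"]] by (simp add: power2_eq_square abs_mult[symmetric])
    moreover have "\<bar>W p - stepK W N p\<bar> <= \<bar>W p - C2.step (%x. x) N p\<bar> + D p"
    proof (cases "i = j")
     case True
     then show ?thesis using b1 unfolding Dp dg_def ij by simp
    next
     case False
     then show ?thesis unfolding sK st Dp dg_def ij wt_def by simp
    qed
    ultimately show "(bker p - stepK W N p)^2 <= \<bar>W p - C2.step (%x. x) N p\<bar> + D p \<and> 0 <= \<bar>W p - C2.step (%x. x) N p\<bar> + D p"
     using bp by auto
   qed
   show "AE p in ?S. (bker p - stepK W N p)^2 <= \<bar>W p - C2.step (%x. x) N p\<bar> + D p"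
    using main by eventually_elim simp
   show "AE p in ?S. 0 <= \<bar>W p - C2.step (%x. x) N p\<bar> + D p"
    using main by eventually_elim simp
  qed
  also have "\<dots> = L N + 1/real N" unfolding L_def Dint[symmetric]
   by (intro Bochner_Integration.integral_add integrable_abs Bochner_Integration.integrable_diff Wi sti Di)
  finally show ?thesis using dlt_nonneg[of N] by simp
 qed
 have "(%N. L N + 1/real N) ----> 0 + 0" by (intro tendsto_add L lim_1_over_n)
 then have l: "(%N. L N + 1/real N) ----> 0" by simp
 have "EV N. norm (dlt N) <= L N + 1/real N" by (rule eventually_sequentiallyI[of 1]) (rule ev)
 from Lim_null_comparison[OF this l] show ?thesis .
qed

lemma gop_stepK_diff: "gop W x - opl (stepK W N) x = opl (%p. bker p - stepK W N p) x"
 unfolding gop_opl by (rule opl_diff[OF bker(1) stepK_kernel])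

lemma gop_approx: "(norm (gop W x - opl (stepK W N) x))^2 <= dlt N*(norm x)^2"
 unfolding gop_stepK_diff dlt_def by (rule bdd_kernel.opl_op[OF dk])

lemma gop_approx_HS: "finite I ==> orthonormal e I ==> (\<Sum>i\<in>I. (norm (gop W (e i) - opl (stepK W N) (e i)))^2) <= dlt N"
 unfolding gop_stepK_diff dlt_def by (rule bdd_kernel.opl_HS[OF dk])

lemma gop_HS: assumes "finite I" "orthonormal e I" shows "(\<Sum>i\<in>I. (norm (gop W (e i)))^2) <= 1"
proof -
 have "(\<Sum>i\<in>I. (norm (gop W (e i)))^2) <= hs2 bker" unfolding gop_opl by (rule bk.opl_HS[OF assms])
 also have "\<dots> <= (\<integral>x. 1 \<partial>U)" unfolding hs2_def
 proof (rule integral_mono[OF bk.slice_norm_int])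
  show "(\<integral>y. (bker (x, y))^2 \<partial>U) <= 1" for x unfolding bk.slice_norm[symmetric] using bk.slice_bound[of x] by (simp add: power_le_one)
 qed simp
 also have "\<dots> = 1" using U.prob_space by simp
 finally show ?thesis .
qed

lemma opl_stepK_sym: assumes N: "N >= 1" shows "inner (opl (stepK W N) x) y = inner x (opl (stepK W N) y)"
proof -
 have 1: "inner (opl (stepK W N) x) y = (\<Sum>i=1..N. \<Sum>j=1..N. wt W N i j/real N * inner (stepe N j) x * inner (stepe N i) y)" for x y
  unfolding opl_stepK[OF N] by (simp add: inner_sum_left sum_distrib_right)
 have "inner (opl (stepK W N) x) y = (\<Sum>j=1..N. \<Sum>i=1..N. wt W N i j/real N * inner (stepe N j) x * inner (stepe N i) y)"
  unfolding 1 by (rule sum.swap)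
 also have "\<dots> = (\<Sum>j=1..N. \<Sum>i=1..N. wt W N j i/real N * inner (stepe N i) y * inner (stepe N j) x)"
  by (intro sum.cong refl) (simp add: wt_sym[of _ N])
 also have "\<dots> = inner (opl (stepK W N) y) x" unfolding 1 ..
 finally show ?thesis by (simp add: inner_commute)
qed

lemma gop_approx_norm: "norm (gop W x - opl (stepK W N) x) <= sqrt (dlt N) * norm x"
 by (rule power2_le_imp_le) (use gop_approx[of x N] dlt_nonneg[of N] in \<open>auto simp: power_mult_distrib\<close>)

lemma opl_stepK_tendsto: "(%N. opl (stepK W N) x) ----> gop W x"
proof -
 have "(%N. sqrt (dlt N) * norm x) ----> sqrt 0 * norm x" by (intro tendsto_intros dlt_limit)
 then have l: "(%N. sqrt (dlt N) * norm x) ----> 0" by simp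
 have "(%N. opl (stepK W N) x - gop W x) ----> 0"
  by (rule Lim_null_comparison[OF always_eventually l]) (use gop_approx_norm in \<open>auto simp: norm_minus_commute\<close>)
 then show ?thesis by (simp add: LIM_zero_iff)
qed

end

lemma compact_bounded_combinations:
 assumes "finite I"
 shows "compact {\<Sum>i\<in>I. c i *\<^sub>R (e i :: 'h::real_normed_vector) | c. \<forall>i\<in>I. \<bar>c i\<bar> <= M}"
 using assms
proof (induction I)
 case empty
 have "{\<Sum>i\<in>{}. c i *\<^sub>R e i | c. \<forall>i\<in>{}. \<bar>c i\<bar> <= M} = {0::'h}" by auto
 then show ?case by simp
next
 case (insert k I)
 let ?S = "%I. {\<Sum>i\<in>I. c i *\<^sub>R e i | c. \<forall>i\<in>I. \<bar>c i\<bar> <= M}"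
 have "compact ((%p. fst p *\<^sub>R e k + snd p) ` ({-M..M} \<times> ?S I))"
  by (intro compact_continuous_image continuous_intros compact_Times insert.IH) auto
 moreover have "(%p. fst p *\<^sub>R e k + snd p) ` ({-M..M} \<times> ?S I) = ?S (insert k I)"
 proof (intro subset_antisym subsetI)
  fix y assume "y \<in> (%p. fst p *\<^sub>R e k + snd p) ` ({-M..M} \<times> ?S I)"
  then obtain a c where "a \<in> {-M..M}" "\<forall>i\<in>I. \<bar>c i\<bar> <= M" "y = a *\<^sub>R e k + (\<Sum>i\<in>I. c i *\<^sub>R e i)" by auto
  moreover have "(\<Sum>i\<in>I. c i *\<^sub>R e i) = (\<Sum>i\<in>I. (c(k := a)) i *\<^sub>R e i)" using insert.hyps by (intro sum.cong) auto
  ultimately show "y \<in> ?S (insert k I)" using insert.hyps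
   by (intro CollectI exI[of _ "c(k := a)"]) auto
 next
  fix y assume "y \<in> ?S (insert k I)"
  then obtain c where c: "\<forall>i\<in>insert k I. \<bar>c i\<bar> <= M" "y = (\<Sum>i\<in>insert k I. c i *\<^sub>R e i)" by auto
  then show "y \<in> (%p. fst p *\<^sub>R e k + snd p) ` ({-M..M} \<times> ?S I)" using insert.hyps
   by (intro image_eqI[of _ _ "(c k, \<Sum>i\<in>I. c i *\<^sub>R e i)"]) (auto simp: abs_le_iff)
 qed
 ultimately show ?case by simp
qed

context riemann_graphon begin

text \<open>Mean-square approximation by the finite-rank step operators.\<close>

lemma gop_compact:
 assumes "bounded (range (x :: nat => l2))"
 shows "\<exists>r :: nat => nat. strict_mono r \<and> convergent (%n. gop W (x (r n)))"
proof -
 obtain R where R: "0 < R" "!!n. norm (x n) <= R" using assms unfolding bounded_pos by auto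
 define S where "S = gop W ` cball 0 R"
 have tb: "\<exists>k. finite k \<and> S \<subseteq> (\<Union>x\<in>k. ball x e)" if e: "0 < e" for e
 proof -
  have "(%N. sqrt (dlt N) * R) ----> sqrt 0 * R" by (intro tendsto_intros dlt_limit)
  then have "EV N. sqrt (dlt N) * R < e/2" using e by (intro order_tendstoD) auto
  then obtain n0 where n0: "!!N. N >= n0 ==> sqrt (dlt N) * R < e/2" unfolding eventually_sequentially by auto
  define N where "N = max n0 1"
  have N: "N >= 1" "sqrt (dlt N) * R < e/2" using n0[of N] unfolding N_def by auto
  obtain K where K: "!!x. norm (gop W x) <= norm x * K" "0 < K" using bounded_linear.pos_bounded[OF gop_bounded_linear] by auto
  define M where "M = R * K + e"
  define Q where "Q = {\<Sum>i=1..N. c i *\<^sub>R stepe N i | c. \<forall>i\<in>{1..N}. \<bar>c i\<bar> <= M}"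
  have "compact Q" unfolding Q_def by (rule compact_bounded_combinations) simp
  then obtain k where k: "finite k" "Q \<subseteq> (\<Union>x\<in>k. ball x (e/2))"
   using e half_gt_zero[OF e] unfolding compact_eq_totally_bounded by blast
  have "S \<subseteq> (\<Union>x\<in>k. ball x e)"
  proof
   fix s assume "s \<in> S"
   then obtain y where y: "norm y <= R" "s = gop W y" unfolding S_def by auto
   let ?t = "opl (stepK W N) y"
   have d: "norm (s - ?t) < e/2"
   proof -
    have "norm (s - ?t) <= sqrt (dlt N) * norm y" unfolding y by (rule gop_approx_norm)
    also have "\<dots> <= sqrt (dlt N) * R" using y dlt_nonneg by (intro mult_left_mono) auto
    finally show ?thesis using N by simp
   qed
   have "norm ?t <= M"
   proof -
    have "norm ?t <= norm s + norm (s - ?t)" using norm_triangle_ineq2[of ?t s] by (simp add: norm_minus_commute)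
    also have "norm s <= R * K" unfolding y(2) using K(1)[of y] mult_right_mono[OF y(1), of K] K(2) by linarith
    finally show ?thesis unfolding M_def using d e by linarith
   qed
   then have "?t \<in> Q"
   proof -
    define c where "c i = (\<Sum>j=1..N. wt W N i j/real N * inner (stepe N j) y)" for i
    have t: "?t = (\<Sum>i=1..N. c i *\<^sub>R stepe N i)" unfolding c_def by (rule opl_stepK[OF N(1)])
    have "\<bar>c i\<bar> <= M" if i: "i \<in> {1..N}" for i
    proof -
     have "c i = inner (stepe N i) ?t" unfolding t using orthonormal_inner_sum[OF stepe_orthonormal[OF N(1)] _ i, of c] by simp
     also have "\<bar>\<dots>\<bar> <= norm (stepe N i) * norm ?t" by (rule Cauchy_Schwarz_ineq2)
     also have "norm (stepe N i) = 1" by (rule orthonormalD(2)[OF stepe_orthonormal[OF N(1)] i])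
     finally show ?thesis using \<open>norm ?t \<le> M\<close> by simp
    qed
    then show ?thesis unfolding Q_def t by blast
   qed
   then obtain z where z: "z \<in> k" "dist z ?t < e/2" using k by auto
   have "dist z s <= dist z ?t + dist ?t s" by (rule dist_triangle)
   then have "dist z s < e" using z d by (simp add: dist_norm norm_minus_commute)
   then show "s \<in> (\<Union>x\<in>k. ball x e)" using z by auto
  qed
  then show ?thesis using k by blast
 qed
 have "compact (closure S)"
  unfolding compact_eq_totally_bounded
 proof (intro conjI allI impI)
  show "uniform_space_class.complete (closure S)" by (simp add: complete_eq_closed)
  fix e :: real assume e: "0 < e"
  obtain k where k: "finite k" "S \<subseteq> (\<Union>x\<in>k. ball x (e/2))" using tb[of "e/2"] e by auto
  have "closure S \<subseteq> (\<Union>x\<in>k. cball x (e/2))"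
   by (rule closure_minimal) (use k in \<open>force intro!: closed_UN\<close>)+
  also have "\<dots> \<subseteq> (\<Union>x\<in>k. ball x e)" using e by force
  finally show "\<exists>k. finite k \<and> closure S \<subseteq> (\<Union>x\<in>k. ball x e)" using k(1) by blast
 qed
 moreover have "\<forall>n. gop W (x n) \<in> closure S" unfolding S_def using R by (intro allI subsetD[OF closure_subset]) auto
 ultimately have "\<exists>l\<in>closure S. \<exists>r :: nat => nat. strict_mono r \<and> ((%n. gop W (x n)) \<circ> r) ----> l"
  unfolding compact_def by (elim allE[of _ "%n. gop W (x n)"]) auto
 then show ?thesis unfolding convergent_def comp_def by blast
qed

sublocale HSW: hilbert_schmidt "gop W" 1
proof (intro hilbert_schmidt.intro compact_symmetric.intro hilbert_schmidt_axioms.intro)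
 show "bounded_linear (gop W)" by (rule gop_bounded_linear)
 show "inner (gop W x) y = inner x (gop W y)" for x y
 proof (rule LIMSEQ_unique)
  show "(%N. inner (opl (stepK W N) x) y) ----> inner (gop W x) y" by (intro tendsto_intros opl_stepK_tendsto)
  have "(%N. inner x (opl (stepK W N) y)) ----> inner x (gop W y)" by (intro tendsto_intros opl_stepK_tendsto)
  then show "(%N. inner (opl (stepK W N) x) y) ----> inner x (gop W y)"
   by (rule Lim_transform_eventually) (auto intro!: eventually_sequentiallyI[of 1] simp: opl_stepK_sym)
 qed
 show "\<exists>r :: nat => nat. strict_mono r \<and> convergent (%n. gop W (x (r n)))" if "bounded (range x)" for x :: "nat => l2"
  by (rule gop_compact[OF that])
 show "(\<Sum>i\<in>I. (norm (gop W (e i)))^2) <= 1" if "finite I" "orthonormal e I" for e and I :: "nat set"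
  by (rule gop_HS[OF that])
qed

end

context riemann_graphon begin

lemma eigenspace_iff:
 assumes "f \<in> L2_unit"
 shows "f \<in> eigenspace W l \<longleftrightarrow> gop W (l2_of f) = l *\<^sub>R l2_of f"
proof -
 have "gop W (l2_of f) = l *\<^sub>R l2_of f \<longleftrightarrow> l2_of (graphon_op W f) = l2_of (%x. l * f x)"
  by (simp add: gop_l2_of[OF assms] l2_of_scale[OF assms])
 also have "\<dots> \<longleftrightarrow> (AE x in U. graphon_op W f x = l * f x)"
  by (rule l2_of_eq[OF graphon_op_L2[OF assms] L2_unit_scale[OF assms]])
 finally show ?thesis using assms unfolding eigenspace_def by simp
qed

lemma l2_combination_zero:
 assumes "!!i. i < n ==> f i \<in> L2_unit"
 shows "(\<Sum>i<n. c i *\<^sub>R l2_of (f i)) = 0 \<longleftrightarrow> (AE x in U. (\<Sum>i<n. c i * f i x) = 0)"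
proof -
 have L: "(%x. \<Sum>i<n. c i * f i x) \<in> L2_unit" and s: "(\<Sum>i<n. l2_of (%x. c i * f i x)) = l2_of (%x. \<Sum>i<n. c i * f i x)"
  using l2_of_sum[of "{..<n}" "%i x. c i * f i x"] L2_unit_scale[OF assms] by auto
 have a: "(\<Sum>i<n. c i *\<^sub>R l2_of (f i)) = l2_of (%x. \<Sum>i<n. c i * f i x)"
  unfolding s[symmetric] using assms by (intro sum.cong) (auto simp: l2_of_scale)
 have z: "(0::l2) = l2_of (%x. 0)" by (simp add: zero_l2.abs_eq)
 show ?thesis unfolding a z by (rule l2_of_eq[OF L L2_unit_0])
qed

definition indep_lengths :: "real => nat set" where
 "indep_lengths l = {n. \<exists>f :: nat => real => real. (\<forall>i<n. f i \<in> eigenspace W l) \<and>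
   (\<forall>c :: nat => real. (AE x in U. (\<Sum>i<n. c i * f i x) = 0) --> (\<forall>i<n. c i = 0))}"

lemma eigen_multiplicity_alt: "eigen_multiplicity W l = (SUP n\<in>indep_lengths l. enat n)"
 unfolding eigen_multiplicity_def indep_lengths_def ..

lemma mult_in_indep: assumes l: "l ~= 0" shows "HSW.mult l \<in> indep_lengths l"
 unfolding indep_lengths_def
proof (intro CollectI exI[of _ "%i. fun_of (HSW.eig l i)"] conjI allI impI)
 fix i assume i: "i < HSW.mult l"
 show "fun_of (HSW.eig l i) \<in> eigenspace W l"
  using HSW.eig(2)[OF l i] by (subst eigenspace_iff[OF fun_of_L2]) (simp add: l2_of_fun_of)
next
 fix c :: "nat => real" and i assume "AE x in U. (\<Sum>i<HSW.mult l. c i * fun_of (HSW.eig l i) x) = 0" and i: "i < HSW.mult l"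
 then have z: "(\<Sum>i<HSW.mult l. c i *\<^sub>R HSW.eig l i) = 0"
  using l2_combination_zero[of "HSW.mult l" "%i. fun_of (HSW.eig l i)" c] fun_of_L2 by (simp add: l2_of_fun_of)
 have "c i = inner (HSW.eig l i) (\<Sum>i<HSW.mult l. c i *\<^sub>R HSW.eig l i)"
  using orthonormal_inner_sum[OF HSW.eig(1)[OF l], of i c] i by simp
 then show "c i = 0" unfolding z by simp
qed

text \<open>A family that is independent modulo null sets spans a space of eigenvectors, on which the coordinates with
respect to the maximal orthonormal system are injective.\<close>

lemma indep_le_mult: assumes l: "l ~= 0" and n: "n \<in> indep_lengths l" shows "n <= HSW.mult l"
proof -
 obtain f :: "nat => real => real" where f: "!!i. i < n ==> f i \<in> eigenspace W l"
  and ind: "!!c :: nat => real. (AE x in U. (\<Sum>i<n. c i * f i x) = 0) ==> (\<forall>i<n. c i = 0)"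
  using n unfolding indep_lengths_def by blast
 have fL: "f i \<in> L2_unit" if "i < n" for i using f[OF that] unfolding eigenspace_def by blast
 define v where "v i = l2_of (f i)" for i
 have comb: "(\<Sum>i<n. c i *\<^sub>R v i) = 0 ==> i < n ==> c i = 0" for c i
  using l2_combination_zero[of n f c] fL ind unfolding v_def by blast
 have inj: "inj_on v {..<n}"
 proof (rule inj_onI, rule ccontr)
  fix i j assume ij: "i \<in> {..<n}" "j \<in> {..<n}" "v i = v j" "i ~= j"
  define c :: "nat => real" where "c k = (if k = i then 1 else if k = j then -1 else 0)" for k
  have "(\<Sum>k<n. c k *\<^sub>R v k) = (\<Sum>k\<in>{i, j}. c k *\<^sub>R v k)"
   using ij by (intro sum.mono_neutral_right) (auto simp: c_def)
  also have "\<dots> = 0" using ij by (simp add: c_def)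
  finally have "c i = 0" using comb[of c i] ij by simp
  then show False by (simp add: c_def)
 qed
 have ii: "independent (v ` {..<n})"
 proof (rule independent_if_scalars_zero)
  show "finite (v ` {..<n})" by simp
  fix g x assume "(\<Sum>x\<in>v ` {..<n}. g x *\<^sub>R x) = 0" "x \<in> v ` {..<n}"
  then obtain i where i: "i < n" "x = v i" and "(\<Sum>i<n. g (v i) *\<^sub>R v i) = 0"
   by (auto simp: sum.reindex[OF inj])
  then show "g x = 0" using comb[of "%i. g (v i)" i] by simp
 qed
 have sp: "v ` {..<n} \<subseteq> span (HSW.eig l ` {..<HSW.mult l})"
 proof
  fix y assume "y \<in> v ` {..<n}"
  then obtain i where i: "i < n" "y = v i" by auto
  have Ty: "gop W y = l *\<^sub>R y" unfolding i v_def using f[OF i(1)] eigenspace_iff[OF fL[OF i(1)]] by blast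
  define P where "P = (\<Sum>k<HSW.mult l. inner (HSW.eig l k) y *\<^sub>R HSW.eig l k)"
  have TP: "gop W P = l *\<^sub>R P" unfolding P_def HSW.T_simps scaleR_sum_right
   using HSW.eig(2)[OF l] by (intro sum.cong) (auto simp: mult.commute)
  have "y - P = 0"
  proof (rule HSW.eig_complete[OF l])
   show "gop W (y - P) = l *\<^sub>R (y - P)" by (simp add: HSW.T_simps Ty TP scaleR_diff_right)
   show "inner (HSW.eig l k) (y - P) = 0" if "k < HSW.mult l" for k
    unfolding P_def using orthonormal_pythagoras(2)[OF HSW.eig(1)[OF l], of k y] that by simp
  qed
  then have "y = P" by simp
  moreover have "P \<in> span (HSW.eig l ` {..<HSW.mult l})" unfolding P_def
   by (intro span_sum span_scale span_base) auto
  ultimately show "y \<in> span (HSW.eig l ` {..<HSW.mult l})" by simp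
 qed
 have "card (v ` {..<n}) <= card (HSW.eig l ` {..<HSW.mult l})"
  using independent_span_bound[OF _ ii sp] by simp
 also have "\<dots> <= HSW.mult l" using card_image_le[of "{..<HSW.mult l}" "HSW.eig l"] by simp
 finally show ?thesis using card_image[OF inj] by simp
qed

lemma eigen_multiplicity_eq: assumes "l ~= 0" shows "eigen_multiplicity W l = enat (HSW.mult l)"
 unfolding eigen_multiplicity_alt
proof (rule antisym)
 show "(SUP n\<in>indep_lengths l. enat n) <= enat (HSW.mult l)"
  by (rule SUP_least) (use indep_le_mult[OF assms] in simp)
 show "enat (HSW.mult l) <= (SUP n\<in>indep_lengths l. enat n)"
  by (rule SUP_upper[OF mult_in_indep[OF assms]])
qed

lemma graphon_spec_eq: "graphon_spec W = HSW.spec"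
 unfolding graphon_spec_def HSW.spec_def using eigen_multiplicity_eq by auto

lemma gop_norm_le: "norm (gop W x) <= graphon_op_norm W * norm x"
proof (cases "x = 0")
 case True then show ?thesis by (simp add: HSW.T_simps)
next
 case False
 obtain K where K: "!!x. norm (gop W x) <= norm x * K" "0 < K" using bounded_linear.pos_bounded[OF gop_bounded_linear] by auto
 let ?F = "{f \<in> L2_unit. L2_unit_norm f <= 1}"
 have n: "L2_unit_norm (graphon_op W f) = norm (gop W (l2_of f))" if "f \<in> L2_unit" for f
  using gop_l2_of[OF that] l2_of_norm[OF graphon_op_L2[OF that]] by simp
 have bdd: "bdd_above ((%f. L2_unit_norm (graphon_op W f)) ` ?F)"
 proof (rule bdd_aboveI[of _ K])
  fix y assume "y \<in> (%f. L2_unit_norm (graphon_op W f)) ` ?F"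
  then obtain f where f: "f \<in> L2_unit" "L2_unit_norm f <= 1" "y = norm (gop W (l2_of f))" using n by auto
  have "norm (l2_of f) * K <= 1 * K" using f(2) K(2) unfolding l2_of_norm[OF f(1)] by (intro mult_right_mono) auto
  then show "y <= K" using K(1)[of "l2_of f"] f(3) by simp
 qed
 define y where "y = (1/norm x) *\<^sub>R x"
 have y1: "norm y = 1" unfolding y_def using False by simp
 have "fun_of y \<in> ?F" using fun_of_L2 y1 by (simp add: norm_fun_of[symmetric])
 then have "L2_unit_norm (graphon_op W (fun_of y)) <= graphon_op_norm W"
  unfolding graphon_op_norm_def by (rule cSUP_upper[OF _ bdd])
 then have "norm (gop W y) <= graphon_op_norm W" using n[OF fun_of_L2, of y] by (simp add: l2_of_fun_of)
 then show ?thesis unfolding y_def using False by (simp add: HSW.T_simps field_simps)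
qed

lemma spec_op_norm: assumes "s \<in> HSW.spec" shows "\<bar>fst s\<bar> <= graphon_op_norm W"
proof -
 have "norm (gop W (HSW.phi s)) = \<bar>fst s\<bar> * norm (HSW.phi s)" using HSW.T_phi[OF assms] by simp
 then show ?thesis using gop_norm_le[of "HSW.phi s"] orthonormalD(2)[OF HSW.phi_orthonormal assms] by simp
qed

lemma graphon_op_norm_nonneg: "0 <= graphon_op_norm W"
proof -
 have "norm (stepe 1 1) = 1" by (rule orthonormalD(2)[OF stepe_orthonormal]) auto
 then show ?thesis using order_trans[OF norm_ge_zero gop_norm_le[of "stepe 1 1"]] by simp
qed

abbreviation opb :: "nat => real" where "opb N \<equiv> graphon_op_norm W + sqrt (dlt N)"

text \<open>Realize the vector in the span of \<open>stepe\<close>; the excess over the graphon norm is the distance of the operators.\<close>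

lemma matrix_op_bound:
 assumes N: "N >= 1"
 shows "L2_set (%i. \<Sum>j=1..N. wt W N i j/real N * v j) {1..N} <= opb N * L2_set v {1..N}"
proof -
 let ?e = "stepe N"
 note on = stepe_orthonormal[OF N]
 have nrm: "norm (\<Sum>i=1..N. c i *\<^sub>R ?e i) = L2_set c {1..N}" for c
  using orthonormal_norm_sum[OF on, of c] unfolding L2_set_def by (simp add: real_sqrt_unique)
 define x where "x = (\<Sum>j=1..N. v j *\<^sub>R ?e j)"
 have ip: "inner (?e j) x = v j" if "j \<in> {1..N}" for j unfolding x_def by (rule orthonormal_inner_sum[OF on _ that]) simp
 have "opl (stepK W N) x = (\<Sum>i=1..N. (\<Sum>j=1..N. wt W N i j/real N * v j) *\<^sub>R ?e i)"
  unfolding opl_stepK[OF N] using ip by (intro sum.cong refl arg_cong2[where f=scaleR]) auto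
 then have "L2_set (%i. \<Sum>j=1..N. wt W N i j/real N * v j) {1..N} = norm (opl (stepK W N) x)"
  using nrm by simp
 also have "\<dots> <= norm (gop W x) + norm (gop W x - opl (stepK W N) x)"
  using norm_triangle_ineq2[of "opl (stepK W N) x" "gop W x"] by (simp add: norm_minus_commute)
 also have "\<dots> <= graphon_op_norm W * norm x + sqrt (dlt N) * norm x"
  by (intro add_mono gop_norm_le gop_approx_norm)
 also have "norm x = L2_set v {1..N}" unfolding x_def by (rule nrm)
 finally show ?thesis by (simp add: distrib_right)
qed

definition TN :: "nat => l2 => l2" where "TN N = opl (stepK W N)"

lemma TN_linear: "linear (TN N)" unfolding TN_def by (rule bdd_kernel.opl_linear[OF stepK_kernel])

lemma TN_bound: "norm (TN N x) <= (1 + sqrt (dlt N)) * norm x"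
proof -
 have "norm (TN N x) <= norm (gop W x) + norm (gop W x - TN N x)"
  using norm_triangle_ineq2[of "TN N x" "gop W x"] by (simp add: norm_minus_commute)
 moreover have "norm (gop W x) <= 1 * norm x"
 proof (cases "x = 0")
  case False
  have "orthonormal (%_::nat. (1/norm x) *\<^sub>R x) {0}" using False
   unfolding orthonormal_def by (simp add: dot_square_norm power2_eq_square)
  from gop_HS[OF _ this] have "(norm (gop W ((1/norm x) *\<^sub>R x)))^2 <= 1\<^sup>2" by simp
  then have "norm (gop W ((1/norm x) *\<^sub>R x)) <= 1" by (rule power2_le_imp_le) simp
  then show ?thesis using False by (simp add: HSW.T_simps field_simps)
 qed (simp add: HSW.T_simps)
 ultimately show ?thesis using gop_approx_norm[of x N] unfolding TN_def by (simp add: distrib_right)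
qed

end

lemma L2_set_scale_mono:
 assumes "!!i. i \<in> I ==> 0 <= f i" "!!i. i \<in> I ==> f i <= c * g i" "0 <= c"
 shows "L2_set f I <= c * L2_set g I"
proof -
 have "L2_set f I <= L2_set (%i. c * g i) I" by (intro L2_set_mono assms)
 also have "\<dots> = c * L2_set g I" using assms(3) by (simp add: L2_set_right_distrib)
 finally show ?thesis .
qed

lemma L2_norm_triangle:
 fixes f g :: "'i => 'h::real_normed_vector"
 shows "L2_set (%i. norm (f i + g i)) I <= L2_set (%i. norm (f i)) I + L2_set (%i. norm (g i)) I"
 by (rule order_trans[OF L2_set_mono L2_set_triangle_ineq]) (auto intro: norm_triangle_ineq)

lemma sum_inner_le_L2:
 fixes f g :: "'i => 'h::real_inner"
 shows "\<bar>\<Sum>i\<in>I. inner (f i) (g i)\<bar> <= L2_set (%i. norm (f i)) I * L2_set (%i. norm (g i)) I"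
proof -
 have "\<bar>\<Sum>i\<in>I. inner (f i) (g i)\<bar> <= (\<Sum>i\<in>I. norm (f i) * norm (g i))"
  by (intro order_trans[OF sum_abs] sum_mono Cauchy_Schwarz_ineq2)
 also have "\<dots> <= L2_set (%i. norm (f i)) I * L2_set (%i. norm (g i)) I"
  using L2_set_mult_ineq[of "%i. norm (f i)" "%i. norm (g i)" I] by simp
 finally show ?thesis .
qed

lemma has_sum_finite_sum:
 fixes f :: "'i => 's => real"
 assumes "finite I" "!!i. i \<in> I ==> (f i has_sum a i) A"
 shows "((%s. \<Sum>i\<in>I. f i s) has_sum (\<Sum>i\<in>I. a i)) A"
 using assms
proof (induction I)
 case empty
 show ?case by (simp add: has_sum_0)
next
 case (insert i I)
 then show ?case by (simp add: has_sum_add)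
qed

context riemann_graphon begin

abbreviation T where "T \<equiv> gop W"
abbreviation nrmN :: "nat => (nat => l2) => real" where "nrmN N f \<equiv> L2_set (%i. norm (f i)) {1..N}"

lemma T_le1: "norm (T x) <= norm x"
proof (cases "x = 0")
 case False
 have "orthonormal (%_::nat. (1/norm x) *\<^sub>R x) {0}" using False
  unfolding orthonormal_def by (simp add: dot_square_norm power2_eq_square)
 from gop_HS[OF _ this] have "(norm (T ((1/norm x) *\<^sub>R x)))^2 <= 1\<^sup>2" by simp
 then have "norm (T ((1/norm x) *\<^sub>R x)) <= 1" by (rule power2_le_imp_le) simp
 then show ?thesis using False by (simp add: HSW.T_simps field_simps)
qed (simp add: HSW.T_simps)

lemma D_norm: "norm (TN N x - T x) <= sqrt (dlt N) * norm x"
 using gop_approx_norm[of x N] unfolding TN_def by (simp add: norm_minus_commute)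

lemma D_HS: assumes "N >= 1" shows "nrmN N (%i. TN N (stepe N i) - T (stepe N i)) <= sqrt (dlt N)"
 unfolding L2_set_def using gop_approx_HS[OF _ stepe_orthonormal[OF assms], of N]
 by (simp add: TN_def norm_minus_commute)

lemma T_pow_HS: assumes "N >= 1" "k >= 1" shows "nrmN N (%i. (T ^^ k) (stepe N i)) <= 1"
 using assms(2)
proof (induction k rule: nat_induct_at_least)
 case base
 then show ?case unfolding L2_set_def using gop_HS[OF _ stepe_orthonormal[OF assms(1)]] by simp
next
 case (Suc k)
 have "nrmN N (%i. (T ^^ Suc k) (stepe N i)) <= nrmN N (%i. (T ^^ k) (stepe N i))"
  by (intro L2_set_mono) (auto intro: T_le1)
 then show ?case using Suc by simp
qed

text \<open>Telescoping the difference of powers keeps one Hilbert-Schmidt factor and one small factor.\<close>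

lemma pow_diff_limit: "(%N. nrmN N (%i. (TN N ^^ k) (stepe N i)-(T ^^ k) (stepe N i))) ----> 0"
proof (induction k)
 case 0
 then show ?case by (simp add: L2_set_def)
next
 case (Suc k)
 let ?A = "%k N. nrmN N (%i. (TN N ^^ k) (stepe N i)-(T ^^ k) (stepe N i))"
 have sd: "(%N. sqrt (dlt N)) ----> 0" using tendsto_real_sqrt[OF dlt_limit] by simp
 have bd: "?A (Suc k) N <= (1 + sqrt (dlt N)) * ?A k N + sqrt (dlt N)" if N: "N >= 1" for N
 proof -
  have eq: "(TN N ^^ Suc k) x - (T ^^ Suc k) x = TN N ((TN N ^^ k) x - (T ^^ k) x) + (TN N ((T ^^ k) x) - T ((T ^^ k) x))" for x
   by (simp add: linear_diff[OF TN_linear])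
  have "?A (Suc k) N <= nrmN N (%i. TN N ((TN N ^^ k) (stepe N i)-(T ^^ k) (stepe N i)))
   + nrmN N (%i. TN N ((T ^^ k) (stepe N i)) - T ((T ^^ k) (stepe N i)))"
   unfolding eq by (rule L2_norm_triangle)
  also have "nrmN N (%i. TN N ((TN N ^^ k) (stepe N i)-(T ^^ k) (stepe N i))) <= (1 + sqrt (dlt N)) * ?A k N"
   by (rule L2_set_scale_mono) (use TN_bound dlt_nonneg in auto)
  also have "nrmN N (%i. TN N ((T ^^ k) (stepe N i)) - T ((T ^^ k) (stepe N i))) <= sqrt (dlt N)"
  proof (cases "k = 0")
   case True
   then show ?thesis using D_HS[OF N] by simp
  next
   case False
   have "nrmN N (%i. TN N ((T ^^ k) (stepe N i)) - T ((T ^^ k) (stepe N i))) <= sqrt (dlt N) * nrmN N (%i. (T ^^ k) (stepe N i))"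
    by (rule L2_set_scale_mono) (use D_norm dlt_nonneg in auto)
   also have "\<dots> <= sqrt (dlt N)*1" using T_pow_HS[OF N, of k] False dlt_nonneg by (intro mult_left_mono) auto
   finally show ?thesis by simp
  qed
  finally show ?thesis by simp
 qed
 have "(%N. (1 + sqrt (dlt N)) * ?A k N + sqrt (dlt N)) ----> (1 + 0)*0 + 0"
  by (intro tendsto_intros sd Suc)
 then have l: "(%N. (1 + sqrt (dlt N)) * ?A k N + sqrt (dlt N)) ----> 0" by simp
 have "EV N. norm (?A (Suc k) N) <= (1 + sqrt (dlt N)) * ?A k N + sqrt (dlt N)"
  using bd by (intro eventually_sequentiallyI[of 1]) (simp only: real_norm_def abs_of_nonneg[OF L2_set_nonneg])
 from Lim_null_comparison[OF this l] show ?case .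
qed

definition trc :: "nat => nat => real" where
 "trc N k = (\<Sum>i=1..N. inner ((TN N ^^ k) (stepe N i)) (stepe N i))"

lemma TN_sym: "N >= 1 ==> inner (TN N x) y = inner x (TN N y)"
 unfolding TN_def by (rule opl_stepK_sym)

lemma TN_HS: assumes N: "N >= 1" shows "nrmN N (%i. TN N (stepe N i)) <= 1 + sqrt (dlt N)"
proof -
 have "nrmN N (%i. T (stepe N i) + (TN N (stepe N i) - T (stepe N i))) <= nrmN N (%i. T (stepe N i)) + nrmN N (%i. TN N (stepe N i) - T (stepe N i))"
  by (rule L2_norm_triangle)
 then show ?thesis using D_HS[OF N] T_pow_HS[OF N, of 1] by simp
qed

lemma trace_diff_limit:
 assumes k: "k >= 2"
 shows "(%N. trc N k - (\<Sum>i=1..N. inner ((T ^^ k) (stepe N i)) (stepe N i))) ----> 0"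
proof -
 obtain m where m: "k = Suc m" "m >= 1" using k by (cases k) auto
 let ?A = "%N. nrmN N (%i. (TN N ^^ m) (stepe N i)-(T ^^ m) (stepe N i))"
 have sd: "(%N. sqrt (dlt N)) ----> 0" using tendsto_real_sqrt[OF dlt_limit] by simp
 have bd: "\<bar>trc N k - (\<Sum>i=1..N. inner ((T ^^ k) (stepe N i)) (stepe N i))\<bar> <= ?A N*(1 + sqrt (dlt N)) + sqrt (dlt N)"
  if N: "N >= 1" for N
 proof -
  have "trc N k - (\<Sum>i=1..N. inner ((T ^^ k) (stepe N i)) (stepe N i))
   = (\<Sum>i=1..N. inner ((TN N ^^ m) (stepe N i)-(T ^^ m) (stepe N i)) (TN N (stepe N i)))
   + (\<Sum>i=1..N. inner ((T ^^ m) (stepe N i)) (TN N (stepe N i) - T (stepe N i)))"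
   unfolding trc_def m sum.distrib[symmetric] sum_subtractf[symmetric]
   by (intro sum.cong refl) (simp add: TN_sym[OF N] HSW.sym inner_diff_left inner_diff_right)
  then have e: "trc N k - (\<Sum>i=1..N. inner ((T ^^ k) (stepe N i)) (stepe N i))
   = (\<Sum>i=1..N. inner ((TN N ^^ m) (stepe N i)-(T ^^ m) (stepe N i)) (TN N (stepe N i)))
   + (\<Sum>i=1..N. inner ((T ^^ m) (stepe N i)) (TN N (stepe N i) - T (stepe N i)))" .
  have i1: "\<bar>\<Sum>i=1..N. inner ((TN N ^^ m) (stepe N i)-(T ^^ m) (stepe N i)) (TN N (stepe N i))\<bar>
   <= ?A N * nrmN N (%i. TN N (stepe N i))" by (rule sum_inner_le_L2)
  have i2: "\<bar>\<Sum>i=1..N. inner ((T ^^ m) (stepe N i)) (TN N (stepe N i) - T (stepe N i))\<bar>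
   <= nrmN N (%i. (T ^^ m) (stepe N i)) * nrmN N (%i. TN N (stepe N i) - T (stepe N i))" by (rule sum_inner_le_L2)
  have "\<bar>trc N k - (\<Sum>i=1..N. inner ((T ^^ k) (stepe N i)) (stepe N i))\<bar>
   <= ?A N * nrmN N (%i. TN N (stepe N i)) + nrmN N (%i. (T ^^ m) (stepe N i)) * nrmN N (%i. TN N (stepe N i) - T (stepe N i))"
   unfolding e by (rule order_trans[OF abs_triangle_ineq add_mono[OF i1 i2]])
  also have "\<dots> <= ?A N*(1 + sqrt (dlt N)) + 1 * sqrt (dlt N)"
  proof (rule add_mono)
   show "?A N * nrmN N (%i. TN N (stepe N i)) <= ?A N*(1 + sqrt (dlt N))"
    by (rule mult_left_mono[OF TN_HS[OF N] L2_set_nonneg])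
   show "nrmN N (%i. (T ^^ m) (stepe N i)) * nrmN N (%i. TN N (stepe N i) - T (stepe N i)) <= 1 * sqrt (dlt N)"
    by (rule mult_mono[OF T_pow_HS[OF N m(2)] D_HS[OF N]]) (auto simp: L2_set_nonneg)
  qed
  finally show ?thesis by simp
 qed
 have "(%N. ?A N*(1 + sqrt (dlt N)) + sqrt (dlt N)) ----> 0*(1 + 0) + 0"
  by (intro tendsto_intros sd pow_diff_limit)
 then have l: "(%N. ?A N*(1 + sqrt (dlt N)) + sqrt (dlt N)) ----> 0" by simp
 have "EV N. norm (trc N k - (\<Sum>i=1..N. inner ((T ^^ k) (stepe N i)) (stepe N i))) <= ?A N*(1 + sqrt (dlt N)) + sqrt (dlt N)"
  using bd by (intro eventually_sequentiallyI[of 1]) (simp only: real_norm_def)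
 from Lim_null_comparison[OF this l] show ?thesis .
qed

definition proj :: "nat => real \<times> nat => real" where
 "proj N s = (\<Sum>i=1..N. (inner (HSW.phi s) (stepe N i))^2)"

lemma proj_le1: assumes "N >= 1" "s \<in> HSW.spec" shows "proj N s <= 1" "0 <= proj N s"
proof -
 show "proj N s <= 1"
  using orthonormal_bessel[OF stepe_orthonormal[OF assms(1)], of "HSW.phi s"] orthonormalD(2)[OF HSW.phi_orthonormal assms(2)]
  unfolding proj_def by (simp add: inner_commute)
qed (simp add: proj_def sum_nonneg)

lemma proj_limit: assumes s: "s \<in> HSW.spec" shows "(%N. proj N s) ----> 1"
proof -
 let ?p = "HSW.phi s" let ?l = "fst s"
 have l0: "?l ~= 0" using s unfolding HSW.spec_def by auto
 have n1: "norm ?p = 1" by (rule orthonormalD(2)[OF HSW.phi_orthonormal s])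
 have bd: "\<bar>proj N s - 1\<bar> <= dlt N/?l\<^sup>2" if N: "N >= 1" for N
 proof -
  note on = stepe_orthonormal[OF N]
  define P where "P x = (\<Sum>i=1..N. inner (stepe N i) x *\<^sub>R stepe N i)" for x
  have PT: "P (TN N ?p) = TN N ?p"
  proof -
   define c where "c i = (\<Sum>j=1..N. wt W N i j/real N * inner (stepe N j) ?p)" for i
   have t: "TN N ?p = (\<Sum>i=1..N. c i *\<^sub>R stepe N i)" unfolding TN_def c_def by (rule opl_stepK[OF N])
   have "P (TN N ?p) = (\<Sum>i=1..N. c i *\<^sub>R stepe N i)" unfolding P_def t
    using orthonormal_inner_sum[OF on, of _ c] by (intro sum.cong refl arg_cong2[where f=scaleR]) auto
   then show ?thesis using t by simp
  qed
  have Pl: "P (x - y) = P x - P y" "P (a *\<^sub>R x) = a *\<^sub>R P x" for x y a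
   unfolding P_def by (simp_all add: inner_diff_right scaleR_diff_left sum_subtractf scaleR_sum_right)
  define w where "w = ?l *\<^sub>R ?p - TN N ?p"
  have "w - P w = ?l *\<^sub>R (?p - P ?p)" unfolding w_def Pl PT by (simp add: scaleR_diff_right)
  then have "\<bar>?l\<bar>\<^sup>2*(norm (?p - P ?p))^2 = (norm (w - P w))^2" by (simp add: power_mult_distrib)
  also have "\<dots> <= (norm w)^2"
   using orthonormal_pythagoras(1)[OF on, of w] unfolding P_def by (simp add: sum_nonneg)
  also have "\<dots> <= dlt N"
   using gop_approx[of ?p N] HSW.T_phi[OF s] n1 unfolding w_def TN_def by simp
  finally have "(norm (?p - P ?p))^2 <= dlt N/?l\<^sup>2" using l0 by (simp add: field_simps)
  moreover have "1 = proj N s + (norm (?p - P ?p))^2"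
   using orthonormal_pythagoras(1)[OF on, of ?p] n1 unfolding P_def proj_def by (simp add: inner_commute)
  ultimately show ?thesis using zero_le_power2[of "norm (?p - P ?p)"] by linarith
 qed
 have "(%N. dlt N/?l\<^sup>2) ----> 0/?l\<^sup>2" by (intro tendsto_intros dlt_limit) (use l0 in simp)
 then have l: "(%N. dlt N/?l\<^sup>2) ----> 0" by simp
 have "EV N. norm (proj N s-1) <= dlt N/?l\<^sup>2"
  using bd by (intro eventually_sequentiallyI[of 1]) (simp only: real_norm_def)
 from Lim_null_comparison[OF this l] show ?thesis by (simp add: LIM_zero_iff)
qed

lemma spec_sq_summable: "(%s. (fst s)^2) summable_on HSW.spec"
 by (rule nonneg_bdd_above_summable_on) (use HSW.spec_sum_le in \<open>auto intro!: bdd_aboveI[of _ 1]\<close>)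

lemma spec_abs_le1: "s \<in> HSW.spec ==> \<bar>fst s\<bar> <= 1"
 using HSW.spec_sum_le[of "{s}"] by (simp add: abs_square_le_1)

lemma spec_pow_le: assumes "s \<in> HSW.spec" "k >= 2" shows "\<bar>fst s^k\<bar> <= (fst s)^2"
proof -
 have "\<bar>fst s\<bar>^k <= \<bar>fst s\<bar>^2" using spec_abs_le1[OF assms(1)] assms(2) by (intro power_decreasing) auto
 then show ?thesis by (simp add: power_abs)
qed

lemma spec_pow_summable: assumes "k >= 2" shows "(%s. fst s^k) summable_on HSW.spec"
proof (rule abs_summable_summable, rule summable_on_comparison_test[OF spec_sq_summable])
 show "norm (fst s^k) <= (fst s)^2" if "s \<in> HSW.spec" for s using spec_pow_le[OF that assms] by simp
qed auto

definition spow :: "nat => real" where "spow k = (\<Sum>\<^sub>\<infinity>s\<in>HSW.spec. fst s^k)"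

text \<open>The trace over the step functions weights each eigenvalue by \<open>proj\<close>, which tends to 1; the summable squares
dominate since the exponent is at least two.\<close>

lemma trace_limit: assumes k: "k >= 2" shows "(%N. trc N k) ----> spow k"
proof -
 define u where "u N = (\<Sum>i=1..N. inner ((T ^^ k) (stepe N i)) (stepe N i))" for N
 have hu: "((%s. fst s^k * proj N s) has_sum u N) HSW.spec" for N
 proof -
  have "((%s. \<Sum>i=1..N. fst s^k*(inner (HSW.phi s) (stepe N i))^2) has_sum u N) HSW.spec"
   unfolding u_def by (rule has_sum_finite_sum) (use HSW.spectral_quadratic[of k] k in auto)
  then show ?thesis unfolding proj_def by (simp add: sum_distrib_left)
 qed
 have hs: "((%s. fst s^k) has_sum spow k) HSW.spec" unfolding spow_def by (rule has_sum_infsum[OF spec_pow_summable[OF k]])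
 define S2 where "S2 = (\<Sum>\<^sub>\<infinity>s\<in>HSW.spec. (fst s)^2)"
 have h2: "((%s. (fst s)^2) has_sum S2) HSW.spec" unfolding S2_def by (rule has_sum_infsum[OF spec_sq_summable])
 have "(%N. u N) ----> spow k"
 proof (rule LIMSEQ_I)
  fix e :: real assume e: "0 < e"
  obtain F where F: "finite F" "F \<subseteq> HSW.spec" "dist (\<Sum>s\<in>F. (fst s)^2) S2 < e/2"
  proof -
   have "\<forall>\<^sub>F Y in finite_subsets_at_top HSW.spec. dist (\<Sum>s\<in>Y. (fst s)^2) S2 < e/2"
    using h2 half_gt_zero[OF e] unfolding has_sum_def by (rule tendstoD)
   then obtain X where "finite X" "X \<subseteq> HSW.spec" "\<forall>Y. finite Y \<and> X \<subseteq> Y \<and> Y \<subseteq> HSW.spec --> dist (\<Sum>s\<in>Y. (fst s)^2) S2 < e/2"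
    unfolding eventually_finite_subsets_at_top by blast
   then show thesis by (intro that[of X]) auto
  qed
  have FY: "(\<Sum>s\<in>Y. (fst s)^2) <= S2" if "finite Y" "Y \<subseteq> HSW.spec" for Y
   by (rule has_sum_mono_neutral[OF has_sum_finite[OF that(1)] h2]) (use that in auto)
  have "(%N. \<Sum>s\<in>F. (fst s)^2*(1-proj N s)) ----> (\<Sum>s\<in>F. (fst s)^2*(1-1))"
   by (intro tendsto_intros proj_limit) (use F in auto)
  then have "EV N. (\<Sum>s\<in>F. (fst s)^2*(1-proj N s)) < e/2"
   using e by (intro order_tendstoD(2)) auto
  then obtain n0 where n0: "!!N. N >= n0 ==> (\<Sum>s\<in>F. (fst s)^2*(1-proj N s)) < e/2"
   unfolding eventually_sequentially by auto
  show "\<exists>no. \<forall>N\<ge>no. norm (u N - spow k) < e"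
  proof (intro exI[of _ "max n0 1"] allI impI)
   fix N assume "max n0 1 <= N"
   then have N: "N >= 1" "N >= n0" by auto
   have hd: "((%s. fst s^k - fst s^k * proj N s) has_sum (spow k - u N)) HSW.spec"
    using has_sum_add[OF hs has_sum_cmult_right[OF hu[of N], of "-1"]] by simp
   define Q where "Q = (\<Sum>s\<in>F. (fst s)^2*(1-proj N s)) + (S2 - (\<Sum>s\<in>F. (fst s)^2))"
   have Y: "\<bar>\<Sum>s\<in>Y. fst s^k - fst s^k * proj N s\<bar> <= Q" if Y: "finite Y" "F \<subseteq> Y" "Y \<subseteq> HSW.spec" for Y
   proof -
    have b: "\<bar>fst s^k - fst s^k * proj N s\<bar> <= (fst s)^2*(1-proj N s)" if "s \<in> HSW.spec" for s
    proof -
     have "\<bar>fst s^k - fst s^k * proj N s\<bar> = \<bar>fst s^k\<bar>*(1-proj N s)"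
     proof -
      have "fst s^k - fst s^k * proj N s = fst s^k*(1-proj N s)" by (simp add: right_diff_distrib)
      then show ?thesis using proj_le1[OF N(1) that] by (simp only: abs_mult abs_of_nonneg diff_ge_0_iff_ge)
     qed
     then show ?thesis using spec_pow_le[OF that k] proj_le1[OF N(1) that] by (simp add: mult_right_mono)
    qed
    have "\<bar>\<Sum>s\<in>Y. fst s^k - fst s^k * proj N s\<bar> <= (\<Sum>s\<in>Y. (fst s)^2*(1-proj N s))"
     by (rule order_trans[OF sum_abs sum_mono]) (use b Y in auto)
    also have "\<dots> = (\<Sum>s\<in>F. (fst s)^2*(1-proj N s)) + (\<Sum>s\<in>Y-F. (fst s)^2*(1-proj N s))"
     using Y by (simp add: sum.subset_diff)
    also have "(\<Sum>s\<in>Y-F. (fst s)^2*(1-proj N s)) <= (\<Sum>s\<in>Y-F. (fst s)^2)"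
     by (intro sum_mono) (use proj_le1[OF N(1)] Y in \<open>auto intro!: mult_left_le\<close>)
    also have "\<dots> = (\<Sum>s\<in>Y. (fst s)^2)-(\<Sum>s\<in>F. (fst s)^2)" using Y F by (simp add: sum_diff)
    also have "\<dots> <= S2 - (\<Sum>s\<in>F. (fst s)^2)" using FY[OF Y(1,3)] by simp
    finally show ?thesis unfolding Q_def by simp
   qed
   have "\<bar>spow k - u N\<bar> <= Q"
   proof (rule tendsto_upperbound)
    show "((%Y. \<bar>\<Sum>s\<in>Y. fst s^k - fst s^k * proj N s\<bar>) \<longlongrightarrow> \<bar>spow k - u N\<bar>) (finite_subsets_at_top HSW.spec)"
     using hd unfolding has_sum_def by (rule tendsto_rabs)
    show "\<forall>\<^sub>F Y in finite_subsets_at_top HSW.spec. \<bar>\<Sum>s\<in>Y. fst s^k - fst s^k * proj N s\<bar> <= Q"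
     unfolding eventually_finite_subsets_at_top using Y F by blast
   qed simp
   also have "Q < e" unfolding Q_def using n0[OF N(2)] F(3) unfolding dist_real_def by linarith
   finally show "norm (u N - spow k) < e" by (simp add: abs_minus_commute)
  qed
 qed
 from tendsto_add[OF trace_diff_limit[OF k] this[unfolded u_def]] show ?thesis by simp
qed

end

section \<open>The partition function of the dense Ising model\<close>

lemma ln_one_minus_tail:
 fixes x r :: real
 assumes "\<bar>x\<bar> <= r" "r < 1"
 shows "\<bar>- (ln (1-x) + x)-(\<Sum>a=1..K. x^(a+1)/real (a+1))\<bar> <= x^2 * r^K/(1-r)"
proof -
 have x1: "\<bar>x\<bar> < 1" using assms by simp
 have "(%n. - ((- (- x))^n)/real n) sums ln (1 + (- x))"
  by (rule ln_series') (use x1 in auto)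
 from sums_minus[OF this] have s: "(%n. x^n/real n) sums (- ln (1-x))" by simp
 define R where "R = - (ln (1-x) + x)-(\<Sum>a=1..K. x^(a+1)/real (a+1))"
 have "(%n. x^(n + (K + 2))/real (n + (K + 2))) sums (- ln (1-x)-(\<Sum>n<K + 2. x^n/real n))"
  by (rule sums_split_initial_segment[OF s])
 moreover have "(\<Sum>n<K + 2. x^n/real n) = x + (\<Sum>a=1..K. x^(a+1)/real (a+1))"
 proof -
  have "(\<Sum>n<K + 2. x^n/real n) = (\<Sum>n<Suc K. x^Suc n/real (Suc n))"
   by (simp add: sum.lessThan_Suc_shift del: sum.lessThan_Suc)
  also have "\<dots> = x + (\<Sum>n<K. x^Suc (Suc n)/real (Suc (Suc n)))"
   by (simp add: sum.lessThan_Suc_shift del: sum.lessThan_Suc)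
  also have "(\<Sum>n<K. x^Suc (Suc n)/real (Suc (Suc n))) = (\<Sum>a=1..K. x^(a+1)/real (a+1))"
   by (rule sum.reindex_bij_witness[of _ "%a. a - 1" Suc]) auto
  finally show ?thesis .
 qed
 moreover have "R = - ln (1-x)-(x + (\<Sum>a=1..K. x^(a+1)/real (a+1)))" unfolding R_def by simp
 ultimately have R: "(%n. x^(n + (K + 2))/real (n + (K + 2))) sums R" by (simp only:)
 have g: "(%n. (x^2 * r^K) * r^n) sums ((x^2 * r^K)*(1/(1-r)))"
  by (intro sums_mult geometric_sums) (use assms in auto)
 have "norm (suminf (%n. x^(n + (K + 2))/real (n + (K + 2)))) <= suminf (%n. (x^2 * r^K) * r^n)"
 proof (rule norm_suminf_le)
  fix n
  have "\<bar>x\<bar>^(n + (K + 2)) = x^2*\<bar>x\<bar>^K*\<bar>x\<bar>^n" by (simp add: power_add power2_eq_square)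
  also have "\<dots> = x^2*(\<bar>x\<bar>^K*\<bar>x\<bar>^n)" by (simp only: mult.assoc)
  also have "\<dots> <= x^2*(r^K * r^n)"
  proof (rule mult_left_mono)
   have "0 <= r" using assms by linarith
   then show "\<bar>x\<bar>^K*\<bar>x\<bar>^n <= r^K * r^n" using assms by (intro mult_mono power_mono) auto
  qed simp
  also have "\<dots> = x^2 * r^K * r^n" by (simp only: mult.assoc)
  finally have 1: "\<bar>x\<bar>^(n + (K + 2)) <= x^2 * r^K * r^n" .
  have "norm (x^(n + (K + 2))/real (n + (K + 2))) = \<bar>x\<bar>^(n + (K + 2))/real (n + (K + 2))"
   by (simp only: real_norm_def abs_divide power_abs abs_of_nat)
  also have "\<dots> <= \<bar>x\<bar>^(n + (K + 2))/1" by (intro divide_left_mono) auto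
  finally show "norm (x^(n + (K + 2))/real (n + (K + 2))) <= x^2 * r^K * r^n" using 1 by simp
 qed (rule sums_summable[OF g])
 then show ?thesis unfolding R_def[symmetric] using sums_unique[OF R] sums_unique[OF g] by simp
qed

lemma ising_sub_mono:
 assumes "ising_sub V b r" "ising V c" "!!i j. i \<in> V ==> j \<in> V ==> c i j <= b i j"
 shows "ising_sub V c r"
proof -
 interpret b: ising_sub V b r by fact
 interpret c: ising V c by fact
 show ?thesis
 proof
  fix v :: "'a => real" assume v: "!!i. i \<in> V ==> 0 <= v i"
  have "L2_set (%i. \<Sum>l\<in>V. c i l * v l) V <= L2_set (%i. \<Sum>l\<in>V. b i l * v l) V"
   by (intro L2_set_mono sum_mono sum_nonneg mult_right_mono mult_nonneg_nonneg assms(3) v c.b_nonneg)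
  also have "\<dots> <= r * L2_set v V" by (rule b.op[OF v])
  finally show "L2_set (%i. \<Sum>l\<in>V. c i l * v l) V <= r * L2_set v V" .
 qed (rule b.r)+
qed

context riemann_graphon begin

definition bm :: "nat => nat => nat => real" where "bm N i j = wt W N i j/real N"

lemma ising_bm: "ising {1..N} (bm N)"
proof
 fix i j assume ij: "i \<in> {1..N}" "j \<in> {1..N}"
 show "0 <= bm N i j" unfolding bm_def using wt01[OF ij] by simp
 show "bm N i j = bm N j i" unfolding bm_def using wt_sym[OF ij] by simp
 show "bm N i i = 0" unfolding bm_def wt_def by simp
qed simp

lemma ising_sub_bm:
 assumes N: "N >= 1" and "0 <= \<mu>" "\<mu> * opb N <= r" "r < 1"
 shows "ising_sub {1..N} (%i j. \<mu> * bm N i j) r"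
proof (intro ising_sub.intro ising_sub_axioms.intro ising.scaled[OF ising_bm] assms(2,4))
 have "0 <= \<mu> * opb N" using graphon_op_norm_nonneg dlt_nonneg assms(2) by simp
 then show "0 <= r" using assms(3) by linarith
 fix v :: "nat => real"
 have "L2_set (%i. \<Sum>l=1..N. \<mu> * bm N i l * v l) {1..N} = \<mu> * L2_set (%i. \<Sum>l=1..N. wt W N i l/real N * v l) {1..N}"
  unfolding L2_set_right_distrib[OF assms(2)] bm_def sum_distrib_left by (simp add: mult.assoc)
 also have "\<dots> <= \<mu>*(opb N * L2_set v {1..N})"
  by (intro mult_left_mono matrix_op_bound[OF N] assms(2))
 also have "\<dots> <= r * L2_set v {1..N}"
  using mult_right_mono[OF assms(3) L2_set_nonneg[of v "{1..N}"]] by (simp add: mult.assoc)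
 finally show "L2_set (%i. \<Sum>l=1..N. \<mu> * bm N i l * v l) {1..N} <= r * L2_set v {1..N}" .
qed

abbreviation dsum :: "nat => real => real" where
 "dsum N \<mu> \<equiv> (\<Sum>j=1..N. \<Sum>i=1..N. bm N i j * ising.offcorr {1..N} (%i j. \<mu> * bm N i j) i j)"

lemma bm01: assumes "i \<in> {1..N}" "j \<in> {1..N}" shows "0 <= bm N i j" "bm N i j <= 1/real N"
 using wt01[OF assms] unfolding bm_def by (auto intro: divide_right_mono)

lemma bm_row: assumes "i \<in> {1..N}" shows "(\<Sum>l=1..N. (bm N i l)^2) <= 1/real N"
proof -
 have "(\<Sum>l=1..N. (bm N i l)^2) <= (\<Sum>l=1..N. (1/real N)^2)"
  using bm01[OF assms] by (intro sum_mono power_mono) auto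
 then show ?thesis using assms by (simp add: power2_eq_square)
qed

lemma frob_bm: "frob {1..N} (bm N) <= 1"
proof (cases "N = 0")
 case True
 then show ?thesis by (simp add: frob_def L2_set_def)
next
 case False
 have "(frob {1..N} (bm N))^2 <= (\<Sum>j=1..N. \<Sum>i=1..N. (1/real N)^2)"
  unfolding frob_sq using bm01 by (intro sum_mono power_mono) auto
 also have "\<dots> = 1\<^sup>2" using False by (simp add: power2_eq_square)
 finally show ?thesis by (rule power2_le_imp_le) simp
qed

lemma frob_offcorr_bm:
 assumes "ising_sub {1..N} (%i j. \<mu> * bm N i j) r" "0 <= \<mu>"
 shows "frob {1..N} (ising.offcorr {1..N} (%i j. \<mu> * bm N i j)) <= \<mu>/(1-r)"
proof -
 interpret S: ising_sub "{1..N}" "%i j. \<mu> * bm N i j" r by fact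
 have "frob {1..N} (%i j. \<mu> * bm N i j) = \<mu> * frob {1..N} (bm N)"
  unfolding frob_def using assms(2) by (simp add: L2_set_right_distrib[symmetric] L2_set_nonneg)
 also have "\<dots> <= \<mu>*1" by (intro mult_left_mono frob_bm assms)
 finally have "frob {1..N} (%i j. \<mu> * bm N i j)/(1-r) <= \<mu>/(1-r)" using S.r by (simp add: divide_right_mono)
 then show ?thesis using S.frob_offcorr by simp
qed

abbreviation lser :: "nat => real => (nat => real) => real" where
 "lser K m f \<equiv> \<Sum>a=1..K. m^(a+1)/real (a+1) * f (a+1)"
abbreviation tser :: "nat => nat => real => real" where
 "tser K N m \<equiv> \<Sum>a=1..K. m^a * trc N (a+1)"

definition epsN :: "nat => real => real => real" where
 "epsN N \<beta> r = sqrt ((4 + 3*(\<beta>/(1-r)))*(\<beta>^2/(1-r))^2/real N)"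

lemma frob_resid:
 assumes S: "ising_sub {1..N} (%i j. \<mu> * bm N i j) r" and \<mu>: "0 <= \<mu>" "\<mu> <= \<beta>" and N: "N >= 1"
 shows "frob {1..N} (ising.resid {1..N} (%i j. \<mu> * bm N i j)) <= epsN N \<beta> r"
proof -
 interpret S: ising_sub "{1..N}" "%i j. \<mu> * bm N i j" r by fact
 define C where "C = (4 + 3*(\<beta>/(1-r)))"
 have C0: "0 <= C" unfolding C_def using \<mu> S.r by auto
 have "(frob {1..N} S.resid)^2 = (\<Sum>i=1..N. \<Sum>j=1..N. (S.resid i j)^2)"
  unfolding frob_sq by (rule sum.swap)
 also have "\<dots> <= (\<Sum>i=1..N. C*((\<beta>^2/(1-r))/real N)^2)"
 proof (rule sum_mono)
  fix i assume i: "i \<in> {1..N}"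
  have "(\<Sum>j=1..N. (S.resid i j)^2) <= (4 + 3 * frob {1..N} S.offcorr)*((\<Sum>l=1..N. (\<mu> * bm N i l)^2)/(1-r))^2"
   by (rule S.resid_row[OF i])
  also have "\<dots> <= C*((\<beta>^2/(1-r))/real N)^2"
  proof (rule mult_mono)
   have "frob {1..N} S.offcorr <= \<mu>/(1-r)" by (rule frob_offcorr_bm[OF S \<mu>(1)])
   also have "\<dots> <= \<beta>/(1-r)" using \<mu> S.r by (simp add: divide_right_mono)
   finally show "4 + 3 * frob {1..N} S.offcorr <= C" unfolding C_def by simp
   have "(\<Sum>l=1..N. (\<mu> * bm N i l)^2) = \<mu>^2*(\<Sum>l=1..N. (bm N i l)^2)"
    by (simp add: power_mult_distrib sum_distrib_left)
   also have "\<dots> <= \<beta>^2*(1/real N)" using \<mu> bm_row[OF i] by (intro mult_mono power_mono sum_nonneg) auto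
   finally have "(\<Sum>l=1..N. (\<mu> * bm N i l)^2)/(1-r) <= \<beta>^2*(1/real N)/(1-r)"
    by (rule divide_right_mono) (use S.r in simp)
   then show "((\<Sum>l=1..N. (\<mu> * bm N i l)^2)/(1-r))^2 <= ((\<beta>^2/(1-r))/real N)^2"
    using S.r by (intro power_mono) (auto intro!: divide_nonneg_nonneg sum_nonneg simp: mult.commute)
  qed (use C0 in auto)
  finally show "(\<Sum>j=1..N. (S.resid i j)^2) <= C*((\<beta>^2/(1-r))/real N)^2" .
 qed
 also have "\<dots> = C*(\<beta>^2/(1-r))^2/real N" using N by (simp add: power_divide power2_eq_square)
 finally have "sqrt ((frob {1..N} S.resid)^2) <= epsN N \<beta> r" unfolding epsN_def C_def by (rule real_sqrt_le_mono)
 then show ?thesis by (simp add: frob_nonneg)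
qed

lemma epsN_limit: "(%N. epsN N \<beta> r) ----> 0"
proof -
 have "(%N. ((4 + 3*(\<beta>/(1-r)))*(\<beta>^2/(1-r))^2)*(1/real N)) ----> ((4 + 3*(\<beta>/(1-r)))*(\<beta>^2/(1-r))^2)*0"
  by (intro tendsto_mult tendsto_const lim_1_over_n)
 from tendsto_real_sqrt[OF this] show ?thesis unfolding epsN_def by simp
qed

text \<open>Iterating the approximate equation for the correlations \<open>K\<close> times yields a partial Neumann series; pairing with
the coupling matrix gives traces, and the remainder is geometric in \<open>r\<close>.\<close>

lemma deriv_approx:
 assumes N: "N >= 1" and \<mu>: "0 <= \<mu>" "\<mu> <= \<beta>" and r: "\<beta> * opb N <= r" "r < 1"
 shows "\<bar>dsum N \<mu> - (tser K N \<mu>)\<bar>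
  <= (1 + sqrt (dlt N))*(r^K*(\<beta>/(1-r)) + epsN N \<beta> r/(1-r))"
proof -
 define g where "g = graphon_op_norm W + sqrt (dlt N)"
 have g0: "0 <= g" unfolding g_def using graphon_op_norm_nonneg dlt_nonneg by simp
 have \<mu>g: "\<mu> * g <= r" using r(1) mult_right_mono[OF \<mu>(2) g0] unfolding g_def by linarith
 have r0: "0 <= r" using \<mu>g mult_nonneg_nonneg[OF \<mu>(1) g0] by linarith
 have S: "ising_sub {1..N} (%i j. \<mu> * bm N i j) r" by (rule ising_sub_bm[OF N \<mu>(1) \<mu>g[unfolded g_def] r(2)])
 interpret S: ising_sub "{1..N}" "%i j. \<mu> * bm N i j" r by (rule S)
 note on = stepe_orthonormal[OF N]
 define X where "X x = \<mu> *\<^sub>R TN N x" for x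
 have Xl: "linear X" unfolding X_def using TN_linear by (intro linear_compose_scale_right)
 have Xb: "norm (X x) <= r * norm x" for x
 proof -
  have "norm (TN N x) <= norm (T x) + norm (T x - TN N x)"
   using norm_triangle_ineq2[of "TN N x" "T x"] by (simp add: norm_minus_commute)
  also have "\<dots> <= graphon_op_norm W * norm x + sqrt (dlt N) * norm x"
   unfolding TN_def by (intro add_mono gop_norm_le gop_approx_norm)
  finally have "norm (TN N x) <= g * norm x" unfolding g_def by (simp add: distrib_right)
  then have "norm (X x) <= \<mu>*(g * norm x)" unfolding X_def using \<mu> by (simp add: mult_left_mono)
  also have "\<dots> <= r * norm x" using mult_right_mono[OF \<mu>g norm_ge_zero[of x]] by (simp add: mult.assoc)
  finally show ?thesis .
 qed
 have Xp: "nrmN N (%i. (X ^^ a) (f i)) <= r^a * nrmN N f" for a f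
 proof (induction a)
  case (Suc a)
  have "nrmN N (%i. (X ^^ Suc a) (f i)) <= r * nrmN N (%i. (X ^^ a) (f i))"
   by (rule L2_set_scale_mono) (use Xb r0 in auto)
  also have "\<dots> <= r*(r^a * nrmN N f)" using Suc r0 by (intro mult_left_mono) auto
  finally show ?case by simp
 qed simp
 have nrm: "norm (\<Sum>i=1..N. c i *\<^sub>R stepe N i) = L2_set c {1..N}" for c
  using orthonormal_norm_sum[OF on, of c] unfolding L2_set_def by (simp add: real_sqrt_unique)
 have TNsum: "TN N x = (\<Sum>i=1..N. (\<Sum>l=1..N. bm N i l * inner (stepe N l) x) *\<^sub>R stepe N i)" for x
  unfolding TN_def opl_stepK[OF N] bm_def ..
 define oc where "oc j = (\<Sum>i=1..N. S.offcorr i j *\<^sub>R stepe N i)" for j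
 define \<rho> where "\<rho> j = (\<Sum>i=1..N. S.resid i j *\<^sub>R stepe N i)" for j
 have no: "nrmN N oc <= \<beta>/(1-r)"
 proof -
  have "nrmN N oc = frob {1..N} S.offcorr" unfolding oc_def frob_def nrm ..
  also have "\<dots> <= \<mu>/(1-r)" by (rule frob_offcorr_bm[OF S \<mu>(1)])
  also have "\<dots> <= \<beta>/(1-r)" using \<mu> r by (simp add: divide_right_mono)
  finally show ?thesis .
 qed
 have n\<rho>: "nrmN N \<rho> <= epsN N \<beta> r"
  using frob_resid[OF S \<mu> N] unfolding \<rho>_def nrm frob_def .
 have ipo: "inner (stepe N l) (oc j) = S.offcorr l j" if "l \<in> {1..N}" for l j
  unfolding oc_def by (rule orthonormal_inner_sum[OF on _ that]) simp
 have fix1: "oc j = X (stepe N j) + X (oc j) - \<rho> j" if j: "j \<in> {1..N}" for j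
 proof -
  have "X (stepe N j) + X (oc j) = (\<Sum>i=1..N. (\<Sum>l=1..N. \<mu> * bm N i l * S.corr l j) *\<^sub>R stepe N i)"
  proof -
   have "X (stepe N j) + X (oc j) = \<mu> *\<^sub>R TN N (stepe N j + oc j)"
    unfolding X_def by (simp add: linear_add[OF TN_linear] scaleR_add_right)
   also have "\<dots> = (\<Sum>i=1..N. (\<mu>*(\<Sum>l=1..N. bm N i l * inner (stepe N l) (stepe N j + oc j))) *\<^sub>R stepe N i)"
    unfolding TNsum by (simp add: scaleR_sum_right)
   also have "\<dots> = (\<Sum>i=1..N. (\<Sum>l=1..N. \<mu> * bm N i l * S.corr l j) *\<^sub>R stepe N i)"
   proof (intro sum.cong refl arg_cong2[where f=scaleR])
    fix i assume i: "i \<in> {1..N}"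
    have "inner (stepe N l) (stepe N j + oc j) = S.corr l j" if "l \<in> {1..N}" for l
     using on that j ipo[OF that] S.corr_self[OF j] unfolding orthonormal_def inner_add_right S.offcorr_def by auto
    then show "\<mu>*(\<Sum>l=1..N. bm N i l * inner (stepe N l) (stepe N j + oc j)) = (\<Sum>l=1..N. \<mu> * bm N i l * S.corr l j)"
     by (simp add: sum_distrib_left mult.assoc)
   qed
   finally show ?thesis .
  qed
  then have "X (stepe N j) + X (oc j) - \<rho> j = (\<Sum>i=1..N. ((\<Sum>l=1..N. \<mu> * bm N i l * S.corr l j) - S.resid i j) *\<^sub>R stepe N i)"
   unfolding \<rho>_def by (simp add: scaleR_diff_left sum_subtractf)
  also have "\<dots> = oc j" unfolding oc_def
  proof (intro sum.cong refl arg_cong2[where f=scaleR])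
   fix i assume i: "i \<in> {1..N}"
   show "(\<Sum>l=1..N. \<mu> * bm N i l * S.corr l j) - S.resid i j = S.offcorr i j"
    unfolding S.resid_def S.offcorr_def using S.corr_self[OF i] by auto
  qed
  finally show ?thesis by simp
 qed
 have iter: "oc j = (\<Sum>a=1..K. (X ^^ a) (stepe N j)) + (X ^^ K) (oc j)-(\<Sum>a<K. (X ^^ a) (\<rho> j))" if j: "j \<in> {1..N}" for j K
 proof (induction K)
  case (Suc K)
  have lp: "linear (X ^^ K)" by (induction K) (auto intro: linear_compose[OF _ Xl, unfolded comp_def] simp: linear_id linear_ident)
  have "(X ^^ K) (oc j) = (X ^^ K) (X (stepe N j) + X (oc j) - \<rho> j)" using fix1[OF j] by simp
  also have "\<dots> = (X ^^ Suc K) (stepe N j) + (X ^^ Suc K) (oc j)-(X ^^ K) (\<rho> j)"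
   by (simp add: linear_add[OF lp] linear_diff[OF lp] funpow_swap1)
  finally show ?case by (subst Suc) (simp add: algebra_simps)
 qed simp
 have Xpow: "(X ^^ a) x = (\<mu>^a) *\<^sub>R (TN N ^^ a) x" for a x
  by (induction a) (simp_all add: X_def linear_scale[OF TN_linear])
 have TNe: "TN N (stepe N j) = (\<Sum>i=1..N. bm N i j *\<^sub>R stepe N i)" if j: "j \<in> {1..N}" for j
 proof -
  have "(\<Sum>l=1..N. bm N i l * inner (stepe N l) (stepe N j)) = (\<Sum>l=1..N. if l = j then bm N i l else 0)" for i
   using on j unfolding orthonormal_def by (intro sum.cong) auto
  then show ?thesis unfolding TNsum using j by simp
 qed
 have trc: "(\<Sum>j=1..N. inner (TN N (stepe N j)) ((X ^^ a) (stepe N j))) = \<mu>^a * trc N (a+1)" for a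
  unfolding trc_def sum_distrib_left Xpow
  by (intro sum.cong refl) (simp add: TN_sym[OF N] inner_commute)
 have "(\<Sum>j=1..N. \<Sum>i=1..N. bm N i j * S.offcorr i j) = (\<Sum>j=1..N. inner (TN N (stepe N j)) (oc j))"
 proof (intro sum.cong refl)
  fix j assume j: "j \<in> {1..N}"
  show "(\<Sum>i=1..N. bm N i j * S.offcorr i j) = inner (TN N (stepe N j)) (oc j)"
   unfolding TNe[OF j] inner_sum_left using ipo by (intro sum.cong) auto
 qed
 also have "\<dots> = (\<Sum>j=1..N. (\<Sum>a=1..K. inner (TN N (stepe N j)) ((X ^^ a) (stepe N j)))
   + inner (TN N (stepe N j)) ((X ^^ K) (oc j))-(\<Sum>a<K. inner (TN N (stepe N j)) ((X ^^ a) (\<rho> j))))"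
  by (intro sum.cong refl, subst iter[where K=K]) (simp_all add: inner_add_right inner_diff_right inner_sum_right)
 also have "\<dots> = (\<Sum>a=1..K. \<Sum>j=1..N. inner (TN N (stepe N j)) ((X ^^ a) (stepe N j)))
   + (\<Sum>j=1..N. inner (TN N (stepe N j)) ((X ^^ K) (oc j)))-(\<Sum>a<K. \<Sum>j=1..N. inner (TN N (stepe N j)) ((X ^^ a) (\<rho> j)))"
  unfolding sum_subtractf sum.distrib by (subst (1 2) sum.swap) simp
 finally have eq: "(\<Sum>j=1..N. \<Sum>i=1..N. bm N i j * S.offcorr i j)-(tser K N \<mu>)
   = (\<Sum>j=1..N. inner (TN N (stepe N j)) ((X ^^ K) (oc j)))-(\<Sum>a<K. \<Sum>j=1..N. inner (TN N (stepe N j)) ((X ^^ a) (\<rho> j)))"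
  unfolding trc by simp
 define h where "h = nrmN N (%i. TN N (stepe N i))"
 have h: "0 <= h" "h <= 1 + sqrt (dlt N)" unfolding h_def using TN_HS[OF N] L2_set_nonneg by auto
 have b1: "\<bar>\<Sum>j=1..N. inner (TN N (stepe N j)) ((X ^^ K) (oc j))\<bar> <= h*(r^K*(\<beta>/(1-r)))"
 proof -
  have "nrmN N (%j. (X ^^ K) (oc j)) <= r^K * nrmN N oc" by (rule Xp)
  also have "\<dots> <= r^K*(\<beta>/(1-r))" using no r0 by (intro mult_left_mono) auto
  finally have q: "nrmN N (%j. (X ^^ K) (oc j)) <= r^K*(\<beta>/(1-r))" .
  have "\<bar>\<Sum>j=1..N. inner (TN N (stepe N j)) ((X ^^ K) (oc j))\<bar> <= h * nrmN N (%j. (X ^^ K) (oc j))"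
   unfolding h_def by (rule sum_inner_le_L2)
  also have "\<dots> <= h*(r^K*(\<beta>/(1-r)))" by (rule mult_left_mono[OF q h(1)])
  finally show ?thesis .
 qed
 have e0: "0 <= epsN N \<beta> r" using n\<rho> L2_set_nonneg[of "%i. norm (\<rho> i)" "{1..N}"] by linarith
 have b2: "\<bar>\<Sum>a<K. \<Sum>j=1..N. inner (TN N (stepe N j)) ((X ^^ a) (\<rho> j))\<bar> <= h*(epsN N \<beta> r/(1-r))"
 proof -
  have "\<bar>\<Sum>a<K. \<Sum>j=1..N. inner (TN N (stepe N j)) ((X ^^ a) (\<rho> j))\<bar> <= (\<Sum>a<K. h*(epsN N \<beta> r * r^a))"
  proof (rule order_trans[OF sum_abs sum_mono])
   fix a
   have "nrmN N (%j. (X ^^ a) (\<rho> j)) <= r^a * nrmN N \<rho>" by (rule Xp)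
   also have "\<dots> <= r^a * epsN N \<beta> r" using n\<rho> r0 by (intro mult_left_mono) auto
   finally have q: "nrmN N (%j. (X ^^ a) (\<rho> j)) <= epsN N \<beta> r * r^a" by (simp only: mult.commute)
   have "\<bar>\<Sum>j=1..N. inner (TN N (stepe N j)) ((X ^^ a) (\<rho> j))\<bar> <= h * nrmN N (%j. (X ^^ a) (\<rho> j))"
    unfolding h_def by (rule sum_inner_le_L2)
   also have "\<dots> <= h*(epsN N \<beta> r * r^a)" by (rule mult_left_mono[OF q h(1)])
   finally show "\<bar>\<Sum>j=1..N. inner (TN N (stepe N j)) ((X ^^ a) (\<rho> j))\<bar> <= h*(epsN N \<beta> r * r^a)" .
  qed
  also have "\<dots> = h*(epsN N \<beta> r*(\<Sum>a<K. r^a))" by (simp add: sum_distrib_left)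
  also have "\<dots> <= h*(epsN N \<beta> r*(1/(1-r)))"
  proof (intro mult_left_mono e0 h(1))
   have "(\<Sum>a<K. r^a) <= (\<Sum>a. r^a)" using r0 r by (intro sum_le_suminf summable_geometric) auto
   also have "\<dots> = 1/(1-r)" using r0 r by (intro suminf_geometric) auto
   finally show "(\<Sum>a<K. r^a) <= 1/(1-r)" .
  qed
  finally show ?thesis by simp
 qed
 have "\<bar>(\<Sum>j=1..N. \<Sum>i=1..N. bm N i j * S.offcorr i j)-(tser K N \<mu>)\<bar>
  <= h*(r^K*(\<beta>/(1-r)) + epsN N \<beta> r/(1-r))"
  unfolding eq distrib_left using b1 b2 by linarith
 also have "\<dots> <= (1 + sqrt (dlt N))*(r^K*(\<beta>/(1-r)) + epsN N \<beta> r/(1-r))"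
  using h(2) r0 r e0 \<mu> by (intro mult_right_mono add_nonneg_nonneg mult_nonneg_nonneg divide_nonneg_nonneg) auto
 finally show ?thesis .
qed

definition psi :: "nat => real => real" where "psi N \<mu> = ln (ising.part {1..N} (bm N) \<mu>)"

lemma psi_deriv: assumes "0 <= \<mu>"
 shows "(psi N has_real_derivative dsum N \<mu>/2) (at \<mu>)"
 unfolding psi_def[abs_def] by (rule ising.ln_part_deriv[OF ising_bm assms])

lemma psi_0: "psi N 0 = 0" unfolding psi_def using ising.part_0[OF ising_bm] by simp

lemma psi_approx:
 assumes N: "N >= 1" and \<beta>: "0 < \<beta>" and r: "\<beta> * opb N <= r" "r < 1"
 shows "\<bar>psi N \<beta> - (lser K \<beta> (trc N))/2\<bar>
  <= \<beta>*((1 + sqrt (dlt N))*(r^K*(\<beta>/(1-r)) + epsN N \<beta> r/(1-r))/2)"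
proof -
 define d where "d \<mu> = dsum N \<mu>" for \<mu>
 define h where "h \<mu> = psi N \<mu> - (lser K \<mu> (trc N))/2" for \<mu>
 have dh: "(h has_real_derivative (d \<mu>/2 - (tser K N \<mu>)/2)) (at \<mu>)" if "0 <= \<mu>" for \<mu>
  unfolding h_def
 proof (rule DERIV_diff)
  show "(psi N has_real_derivative d \<mu>/2) (at \<mu>)" unfolding d_def by (rule psi_deriv[OF that])
  have "((%\<mu>. (lser K \<mu> (trc N))) has_real_derivative (tser K N \<mu>)) (at \<mu>)"
  proof (rule DERIV_sum)
   fix a
   have "((%\<mu>. \<mu>^(a+1)) has_real_derivative (real (a+1)*\<mu>^a)) (at \<mu>)"
    using DERIV_pow[of "a + 1" \<mu> UNIV] by simp
   from DERIV_cmult[OF this, of "trc N (a+1)/real (a+1)"]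
   show "((%\<mu>. \<mu>^(a+1)/real (a+1) * trc N (a+1)) has_real_derivative \<mu>^a * trc N (a+1)) (at \<mu>)"
    by (simp add: mult_ac del: of_nat_add of_nat_Suc)
  qed
  then show "((%\<mu>. (lser K \<mu> (trc N))/2) has_real_derivative (tser K N \<mu>)/2) (at \<mu>)"
   by (rule DERIV_cdivide)
 qed
 obtain z where z: "0 < z" "z < \<beta>" "h \<beta> - h 0 = (\<beta> - 0)*(d z/2 - (tser K N z)/2)"
  using MVT2[OF \<beta>, of h "%\<mu>. d \<mu>/2 - (tser K N \<mu>)/2"] dh by auto
 have h0: "h 0 = 0" unfolding h_def psi_0 by simp
 have "\<bar>d z - (tser K N z)\<bar> <= (1 + sqrt (dlt N))*(r^K*(\<beta>/(1-r)) + epsN N \<beta> r/(1-r))"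
  unfolding d_def using z by (intro deriv_approx[OF N _ _ r]) auto
 then have "\<bar>d z/2 - (tser K N z)/2\<bar> <= (1 + sqrt (dlt N))*(r^K*(\<beta>/(1-r)) + epsN N \<beta> r/(1-r))/2"
  unfolding diff_divide_distrib[symmetric] abs_divide by simp
 then have "\<beta>*\<bar>d z/2 - (tser K N z)/2\<bar> <= \<beta>*((1 + sqrt (dlt N))*(r^K*(\<beta>/(1-r)) + epsN N \<beta> r/(1-r))/2)"
  using \<beta> by (intro mult_left_mono) auto
 moreover have "\<bar>h \<beta>\<bar> = \<beta>*\<bar>d z/2 - (tser K N z)/2\<bar>"
  using z(3) h0 \<beta> by (simp add: abs_mult)
 ultimately show ?thesis unfolding h_def by simp
qed

definition logdet :: "real => real" where
 "logdet \<beta> = - 1/2*(\<Sum>\<^sub>\<infinity>(l, k)\<in>graphon_spec W. ln (1-\<beta> * l) + \<beta> * l)"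

lemma logdet_approx:
 assumes \<beta>: "0 < \<beta>" and r: "\<beta> * graphon_op_norm W <= r" "r < 1"
 shows "\<bar>logdet \<beta> - (lser K \<beta> spow)/2\<bar>
  <= \<beta>^2 * spow 2/(1-r) * r^K/2"
proof -
 define f where "f s = - (ln (1-\<beta> * fst s) + \<beta> * fst s)" for s :: "real \<times> nat"
 let ?F = "\<Sum>\<^sub>\<infinity>s\<in>HSW.spec. f s"
 define gK where "gK K s = (\<Sum>a=1..K. (\<beta> * fst s)^(a+1)/real (a+1))" for K and s :: "real \<times> nat"
 have xr: "\<bar>\<beta> * fst s\<bar> <= r" if "s \<in> HSW.spec" for s
 proof -
  have "\<bar>\<beta> * fst s\<bar> <= \<beta> * graphon_op_norm W" using spec_op_norm[OF that] \<beta> by (simp add: abs_mult)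
  then show ?thesis using r by simp
 qed
 have h2: "((%s. fst s^2) has_sum spow 2) HSW.spec" unfolding spow_def by (rule has_sum_infsum[OF spec_pow_summable]) simp
 have bd: "\<bar>f s - gK K s\<bar> <= (\<beta>^2/(1-r) * r^K) * fst s^2" if "s \<in> HSW.spec" for s K
  using ln_one_minus_tail[OF xr[OF that] r(2), of K] unfolding f_def gK_def by (simp add: power_mult_distrib mult_ac)
 have hb: "((%s. (\<beta>^2/(1-r) * r^K) * fst s^2) has_sum (\<beta>^2/(1-r) * r^K) * spow 2) HSW.spec" for K
  by (rule has_sum_cmult_right[OF h2])
 have fs: "f summable_on HSW.spec"
 proof (rule abs_summable_summable, rule summable_on_comparison_test[OF has_sum_imp_summable[OF hb[of 0]]])
  show "norm (f s) <= \<beta>^2/(1-r) * r^0*(fst s)^2" if "s \<in> HSW.spec" for s using bd[OF that, of 0] by (simp add: gK_def)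
 qed auto
 have hf: "(f has_sum ?F) HSW.spec" by (rule has_sum_infsum[OF fs])
 have hg: "(gK K has_sum (lser K \<beta> spow)) HSW.spec"
  unfolding gK_def
 proof (rule has_sum_finite_sum)
  fix a assume a: "a \<in> {1..K}"
  have "((%s. fst s^(a+1)) has_sum spow (a+1)) HSW.spec" unfolding spow_def using a by (intro has_sum_infsum spec_pow_summable) auto
  from has_sum_cmult_right[OF this, of "\<beta>^(a+1)/real (a+1)"]
  show "((%s. (\<beta> * fst s)^(a+1)/real (a+1)) has_sum \<beta>^(a+1)/real (a+1) * spow (a+1)) HSW.spec"
   by (simp add: power_mult_distrib mult_ac del: power_Suc)
 qed simp
 have hd: "((%s. f s - gK K s) has_sum (?F-(lser K \<beta> spow))) HSW.spec"
  using has_sum_add[OF hf has_sum_cmult_right[OF hg, of "-1"]] by simp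
 have hnd: "((%s. - (f s - gK K s)) has_sum (- (?F-(lser K \<beta> spow)))) HSW.spec"
  using has_sum_cmult_right[OF hd, of "-1"] by simp
 have le: "\<bar>?F-(lser K \<beta> spow)\<bar> <= (\<beta>^2/(1-r) * r^K) * spow 2"
 proof (rule abs_leI)
  show "?F-(lser K \<beta> spow) <= (\<beta>^2/(1-r) * r^K) * spow 2"
   by (rule has_sum_mono[OF hd hb]) (use bd[of _ K] in \<open>force simp: abs_le_iff\<close>)
  show "- (?F-(lser K \<beta> spow)) <= (\<beta>^2/(1-r) * r^K) * spow 2"
   by (rule has_sum_mono[OF hnd hb]) (use bd[of _ K] in \<open>force simp: abs_le_iff\<close>)
 qed
 have "logdet \<beta> = ?F/2"
 proof -
  have "?F = - (\<Sum>\<^sub>\<infinity>s\<in>HSW.spec. ln (1-\<beta> * fst s) + \<beta> * fst s)"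
   unfolding f_def by (rule infsum_uminus)
  then show ?thesis unfolding logdet_def graphon_spec_eq by (simp add: case_prod_unfold)
 qed
 then have "logdet \<beta> - (lser K \<beta> spow)/2
  = (?F-(lser K \<beta> spow))/2"
  by (simp only: diff_divide_distrib)
 then have "\<bar>logdet \<beta> - (lser K \<beta> spow)/2\<bar>
  = \<bar>?F-(lser K \<beta> spow)\<bar>/2"
  by (simp only: abs_divide abs_numeral)
 also have "\<dots> <= ((\<beta>^2/(1-r) * r^K) * spow 2)/2"
  by (rule divide_right_mono[OF le]) simp
 also have "\<dots> = \<beta>^2 * spow 2/(1-r) * r^K/2" by (simp add: mult_ac)
 finally show ?thesis .
qed

text \<open>For fixed \<open>K\<close> both sides are within a multiple of \<open>r^K\<close> of finite sums whose terms converge by \<open>trace_limit\<close>.\<close>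

theorem psi_limit:
 assumes \<beta>: "0 < \<beta>" and sub: "\<beta> * graphon_op_norm W < 1"
 shows "(%N. psi N \<beta>) ----> logdet \<beta>"
proof (rule LIMSEQ_I)
 fix e :: real assume e: "0 < e"
 define r where "r = (1 + \<beta> * graphon_op_norm W)/2"
 have r: "\<beta> * graphon_op_norm W < r" "r < 1" "0 < r" unfolding r_def using sub \<beta> graphon_op_norm_nonneg
  by (auto intro: add_pos_nonneg)
 have r1: "0 < 1 - r" using r by simp
 define c1 where "c1 = \<beta>^2 * spow 2/(1-r)/2"
 define c2 where "c2 = \<beta>*(2*(\<beta>/(1-r)))/2"
 have "(%K. c1 * r^K + c2 * r^K) ----> c1*0 + c2*0"
  by (intro tendsto_intros LIMSEQ_realpow_zero) (use r in auto)
 then have "EV K. c1 * r^K + c2 * r^K < e/3" using e by (intro order_tendstoD) auto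
 then obtain K where K: "c1 * r^K + c2 * r^K < e/3" by (meson eventually_sequentially order_refl)
 have sd: "(%N. sqrt (dlt N)) ----> 0" using tendsto_real_sqrt[OF dlt_limit] by simp
 have "(%N. \<beta> * opb N) ----> \<beta>*(graphon_op_norm W + 0)" by (intro tendsto_intros sd)
 then have E1: "EV N. \<beta> * opb N < r" using r by (intro order_tendstoD) auto
 have E2: "EV N. sqrt (dlt N) < 1" using sd by (intro order_tendstoD) auto
 have "(%N. \<beta>*(2*(epsN N \<beta> r/(1-r)))/2) ----> \<beta>*(2*(0/(1-r)))/2"
  by (intro tendsto_intros epsN_limit) (use r in auto)
 then have E3: "EV N. \<beta>*(2*(epsN N \<beta> r/(1-r)))/2 < e/3" using e by (intro order_tendstoD) auto
 have "(%N. (lser K \<beta> (trc N))/2) ----> (lser K \<beta> spow)/2"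
  by (intro tendsto_intros trace_limit) auto
 then have E4: "EV N. dist ((lser K \<beta> (trc N))/2) ((lser K \<beta> spow)/2) < e/3"
  using e by (intro tendstoD) auto
 have "EV N. norm (psi N \<beta> - logdet \<beta>) < e"
  using E1 E2 E3 E4 eventually_ge_at_top[of 1]
 proof eventually_elim
  fix N assume A: "\<beta> * opb N < r" "sqrt (dlt N) < 1" "\<beta>*(2*(epsN N \<beta> r/(1-r)))/2 < e/3"
   "dist ((lser K \<beta> (trc N))/2) ((lser K \<beta> spow)/2) < e/3"
   and N: "1 <= N"
  have "\<bar>psi N \<beta> - (lser K \<beta> (trc N))/2\<bar>
   <= \<beta>*((1 + sqrt (dlt N))*(r^K*(\<beta>/(1-r)) + epsN N \<beta> r/(1-r))/2)"
   by (rule psi_approx[OF N \<beta> less_imp_le[OF A(1)] r(2)])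
  also have "\<dots> <= \<beta>*(2*(r^K*(\<beta>/(1-r)) + epsN N \<beta> r/(1-r))/2)"
  proof -
   have "0 <= epsN N \<beta> r" unfolding epsN_def using \<beta> r by (intro real_sqrt_ge_zero divide_nonneg_nonneg mult_nonneg_nonneg) auto
   then show ?thesis using A(2) \<beta> r by (intro mult_left_mono divide_right_mono mult_right_mono add_nonneg_nonneg mult_nonneg_nonneg divide_nonneg_nonneg) auto
  qed
  also have "\<dots> = c2 * r^K + \<beta>*(2*(epsN N \<beta> r/(1-r)))/2"
  proof -
   have "\<beta>*(2*(q * A + B)/2) = \<beta>*(2 * A)/2 * q + \<beta>*(2 * B)/2" for q A B :: real
    by (simp add: algebra_simps)
   then show ?thesis unfolding c2_def .
  qed
  finally have 1: "\<bar>psi N \<beta> - (lser K \<beta> (trc N))/2\<bar> <= c2 * r^K + e/3" using A(3) by simp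
  have 2: "\<bar>logdet \<beta> - (lser K \<beta> spow)/2\<bar> <= c1 * r^K"
   using logdet_approx[OF \<beta> less_imp_le[OF r(1)] r(2), of K] unfolding c1_def by simp
  show "norm (psi N \<beta> - logdet \<beta>) < e" using 1 2 A(4) K unfolding dist_real_def real_norm_def by linarith
 qed
 then show "\<exists>no. \<forall>N\<ge>no. norm (psi N \<beta> - logdet \<beta>) < e" unfolding eventually_sequentially .
qed

text \<open>The effective coupling \<open>N\<theta> tanh b\<close> depends on \<open>N\<close>; this lets it be replaced by its limit.\<close>

lemma psi_lipschitz:
 assumes N: "N >= 1" and r: "\<beta> * opb N <= r" "r < 1" and \<mu>: "0 <= \<mu>" "\<mu> <= \<nu>" "\<nu> <= \<beta>"
 shows "0 <= psi N \<nu> - psi N \<mu>" "psi N \<nu> - psi N \<mu> <= (\<nu> - \<mu>)*(\<beta>/(1-r)/2)"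
proof -
 have d: "0 <= dsum N z"
  "dsum N z <= \<beta>/(1-r)"
  if z: "0 <= z" "z <= \<beta>" for z
 proof -
  have "z * opb N <= \<beta> * opb N"
   using z graphon_op_norm_nonneg dlt_nonneg by (intro mult_right_mono) auto
  then have S: "ising_sub {1..N} (%i j. z * bm N i j) r" using r by (intro ising_sub_bm[OF N z(1)]) auto
  interpret S: ising_sub "{1..N}" "%i j. z * bm N i j" r by (rule S)
  show "0 <= (\<Sum>j=1..N. \<Sum>i=1..N. bm N i j * S.offcorr i j)"
   by (intro sum_nonneg mult_nonneg_nonneg bm01 S.offcorr_nonneg)
  have "(\<Sum>j=1..N. \<Sum>i=1..N. bm N i j * S.offcorr i j) <= frob {1..N} (bm N) * frob {1..N} S.offcorr" by (rule frob_inner)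
  also have "\<dots> <= 1*(z/(1-r))"
   by (intro mult_mono frob_bm frob_offcorr_bm[OF S z(1)] frob_nonneg) auto
  also have "\<dots> <= \<beta>/(1-r)" using z r by (simp add: divide_right_mono)
  finally show "(\<Sum>j=1..N. \<Sum>i=1..N. bm N i j * S.offcorr i j) <= \<beta>/(1-r)" .
 qed
 have "0 <= psi N \<nu> - psi N \<mu> \<and> psi N \<nu> - psi N \<mu> <= (\<nu> - \<mu>)*(\<beta>/(1-r)/2)"
 proof (cases "\<mu> = \<nu>")
  case False
  then have "\<mu> < \<nu>" using \<mu> by simp
  define D where "D z = dsum N z/2" for z
  have "\<exists>z>\<mu>. z < \<nu> \<and> psi N \<nu> - psi N \<mu> = (\<nu> - \<mu>) * D z"
  proof (rule MVT2[OF \<open>\<mu> < \<nu>\<close>])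
   fix z assume "\<mu> <= z" "z <= \<nu>"
   then have "0 <= z" using \<mu> by simp
   then show "(psi N has_real_derivative D z) (at z)" unfolding D_def by (rule psi_deriv)
  qed
  then obtain z where z: "\<mu> < z" "z < \<nu>" and eq: "psi N \<nu> - psi N \<mu> = (\<nu> - \<mu>) * D z" by blast
  have z': "0 <= z" "z <= \<beta>" using z \<mu> by auto
  have "0 <= D z" unfolding D_def using d(1)[OF z'] by simp
  moreover have "D z <= \<beta>/(1-r)/2" unfolding D_def by (rule divide_right_mono[OF d(2)[OF z']]) simp
  ultimately show ?thesis unfolding eq using \<mu>(2) by (intro conjI mult_nonneg_nonneg mult_left_mono) auto
 qed simp
 then show "0 <= psi N \<nu> - psi N \<mu>" "psi N \<nu> - psi N \<mu> <= (\<nu> - \<mu>)*(\<beta>/(1-r)/2)" by auto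
qed

end

section \<open>Normal limits\<close>

lemma (in prob_space) indep_bool_expectation:
 fixes g :: "'e => bool => 'c::{real_normed_field,banach,second_countable_topology}"
 assumes I: "finite I" "indep_vars (%_. count_space UNIV) B I"
  and p: "!!e. e \<in> I ==> distr M (count_space UNIV) (B e) = measure_pmf (bernoulli_pmf (p e))"
  and p01: "!!e. e \<in> I ==> 0 <= p e \<and> p e <= 1"
 shows "(\<integral>\<omega>. (\<Prod>e\<in>I. g e (B e \<omega>)) \<partial>M) = (\<Prod>e\<in>I. p e *\<^sub>R g e True + (1-p e) *\<^sub>R g e False)"
  and "integrable M (%\<omega>. (\<Prod>e\<in>I. g e (B e \<omega>)))"
proof -
 have B: "B e \<in> measurable M (count_space UNIV)" if "e \<in> I" for e
  using I(2) that unfolding indep_vars_def by auto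
 have ind: "indep_vars (%_. borel) (%e \<omega>. g e (B e \<omega>)) I"
  by (rule indep_vars_compose2[OF I(2)]) auto
 have int: "integrable M (%\<omega>. g e (B e \<omega>))" if "e \<in> I" for e
 proof (rule integrable_const_bound[where B="max (norm (g e True)) (norm (g e False))"])
  show "AE \<omega> in M. norm (g e (B e \<omega>)) <= max (norm (g e True)) (norm (g e False))"
   by (rule AE_I2) (metis (full_types) max.cobounded1 max.cobounded2)
  show "(%\<omega>. g e (B e \<omega>)) \<in> borel_measurable M"
   using measurable_compose[OF B[OF that], of "g e" borel] by simp
 qed
 have ex: "(\<integral>\<omega>. g e (B e \<omega>) \<partial>M) = p e *\<^sub>R g e True + (1-p e) *\<^sub>R g e False" if "e \<in> I" for e
 proof -
  have "(\<integral>\<omega>. g e (B e \<omega>) \<partial>M) = (\<integral>x. g e x \<partial>distr M (count_space UNIV) (B e))"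
   by (rule integral_distr[symmetric, OF B[OF that]]) simp
  also have "\<dots> = (\<integral>x. g e x \<partial>measure_pmf (bernoulli_pmf (p e)))" unfolding p[OF that] ..
  also have "\<dots> = p e *\<^sub>R g e True + (1-p e) *\<^sub>R g e False"
   using p01[OF that] by (subst integral_measure_pmf[of UNIV]) (auto simp: UNIV_bool)
  finally show ?thesis .
 qed
 show "(\<integral>\<omega>. (\<Prod>e\<in>I. g e (B e \<omega>)) \<partial>M) = (\<Prod>e\<in>I. p e *\<^sub>R g e True + (1-p e) *\<^sub>R g e False)"
  using indep_vars_lebesgue_integral[OF I(1) ind int] ex by simp
 show "integrable M (%\<omega>. (\<Prod>e\<in>I. g e (B e \<omega>)))"
  by (rule indep_vars_integrable[OF I(1) ind int])
qed

lemma real_distribution_normal_law: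
 assumes "0 <= v" shows "real_distribution (normal_law m v)"
proof (cases "v = 0")
 case True
 then show ?thesis unfolding normal_law_def
  by (auto intro!: real_distribution.intro real_distribution_axioms.intro prob_space_return)
next
 case False
 then have "0 < sqrt v" using assms by simp
 then show ?thesis using False unfolding normal_law_def
  by (auto intro!: real_distribution.intro real_distribution_axioms.intro prob_space_normal_density)
qed

lemma char_normal_law:
 assumes "0 <= v"
 shows "char (normal_law m v) t = iexp (t * m) * of_real (exp (- (v * t^2)/2))"
proof (cases "v = 0")
 case True
 then show ?thesis unfolding normal_law_def char_def by (simp add: integral_return)
next
 case False
 then have s: "0 < sqrt v" using assms by simp
 interpret S: prob_space "std_normal_distribution" by (rule prob_space_normal_density) simp
 have "distributed std_normal_distribution lborel (%x. x) (normal_density 0 1)"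
  unfolding distributed_def by (auto simp: distr_id2 cong: distr_cong intro!: distr_id2)
 then have "distributed std_normal_distribution lborel (%x. m + sqrt v * x) (normal_density (m + sqrt v * 0) (\<bar>sqrt v\<bar>*1))"
  using s by (intro S.normal_density_affine) auto
 then have d: "distr std_normal_distribution lborel (%x. m + sqrt v * x) = normal_law m v"
  using s False assms unfolding distributed_def normal_law_def by auto
 have "char (normal_law m v) t = (CLINT x|std_normal_distribution. iexp (t*(m + sqrt v * x)))"
  unfolding char_def d[symmetric] by (rule integral_distr) auto
 also have "\<dots> = (CLINT x|std_normal_distribution. iexp (t * m) * iexp ((t * sqrt v) * x))"
  by (intro Bochner_Integration.integral_cong) (auto simp: exp_add[symmetric] algebra_simps)
 also have "\<dots> = iexp (t * m) * char std_normal_distribution (t * sqrt v)"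
  unfolding char_def by (rule integral_mult_right_zero)
 also have "\<dots> = iexp (t * m) * of_real (exp (- (v * t^2)/2))"
  using assms by (simp add: char_std_normal_distribution power_mult_distrib mult.commute)
 finally show ?thesis .
qed

lemma converges_to_normal_char:
 assumes "0 <= v"
  and "!!N. N >= 1 ==> prob_space (M N)" "!!N. N >= 1 ==> X N \<in> borel_measurable (M N)"
  and "!!t. (%N. CLINT \<omega>|M N. iexp (t * X N \<omega>)) ----> iexp (t * m) * of_real (exp (- (v * t^2)/2))"
 shows "converges_to_normal M X m v"
proof -
 define D where "D N = distr (M (Suc N)) borel (X (Suc N))" for N
 have "weak_conv_m D (normal_law m v)"
 proof (rule levy_continuity)
  show "real_distribution (D n)" for n
   unfolding D_def by (intro prob_space.real_distribution_distr assms) auto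
  show "real_distribution (normal_law m v)" by (rule real_distribution_normal_law[OF assms(1)])
  show "(%n. char (D n) t) ----> char (normal_law m v) t" for t
  proof -
   have "char (D n) t = (CLINT \<omega>|M (Suc n). iexp (t * X (Suc n) \<omega>))" for n
    unfolding D_def char_def by (rule integral_distr) (use assms(3) in auto)
   then show ?thesis using LIMSEQ_Suc[OF assms(4)[of t]] by (simp add: char_normal_law[OF assms(1)])
  qed
 qed
 then have w: "!!x. isCont (cdf (normal_law m v)) x ==> (%n. cdf (distr (M (Suc n)) borel (X (Suc n))) x) ----> cdf (normal_law m v) x"
  unfolding weak_conv_m_def weak_conv_def D_def by auto
 show ?thesis
  unfolding converges_to_normal_def weak_conv_m_def weak_conv_def
  by (intro allI impI, rule LIMSEQ_imp_Suc, rule w)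
qed

definition tends_in_prob_0 :: "(nat => 'a measure) => (nat => 'a => real) => bool" where
 "tends_in_prob_0 M D \<longleftrightarrow> (\<forall>\<epsilon>>0. (%N. measure (M N) {\<omega>\<in>space (M N). \<epsilon> < \<bar>D N \<omega>\<bar>}) ----> 0)"

lemma iexp_diff_bound: "cmod (iexp a - iexp b) <= \<bar>a - b\<bar>"
proof -
 have "iexp a - iexp b = iexp b*(iexp (a - b)-1)" by (simp add: exp_diff field_simps)
 then have "cmod (iexp a - iexp b) = cmod (iexp (a - b)-1)" by (simp add: norm_mult)
 also have "\<dots> <= \<bar>a - b\<bar>" using iexp_approx1[of "a - b" 0] by simp
 finally show ?thesis .
qed

text \<open>At \<open>N = 0\<close> the hypotheses can fail; the limit ignores that law.\<close>

lemma converges_to_normal_slutsky: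
 assumes v: "0 <= v"
  and M: "!!N. N >= 1 ==> prob_space (M N)"
  and X: "!!N. N >= 1 ==> X N \<in> borel_measurable (M N)"
  and Y: "!!N. N >= 1 ==> Y N \<in> borel_measurable (M N)"
  and lim: "!!t. (%N. CLINT \<omega>|M N. iexp (t * X N \<omega>)) ----> iexp (t * m) * of_real (exp (- (v * t^2)/2))"
  and D: "tends_in_prob_0 M (%N \<omega>. Y N \<omega> - X N \<omega>)"
 shows "converges_to_normal M Y m v"
proof (rule converges_to_normal_char[OF v M Y])
 fix t :: real
 define P where "P \<epsilon> N = measure (M N) {\<omega>\<in>space (M N). \<epsilon> < \<bar>Y N \<omega> - X N \<omega>\<bar>}" for \<epsilon> N
 have bd: "cmod ((CLINT \<omega>|M N. iexp (t * Y N \<omega>))-(CLINT \<omega>|M N. iexp (t * X N \<omega>))) <= \<bar>t\<bar>*\<epsilon> + 2 * P \<epsilon> N"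
  if N: "N >= 1" and \<epsilon>: "0 < \<epsilon>" for N \<epsilon>
 proof -
  interpret prob_space "M N" by (rule M[OF N])
  note [measurable] = X[OF N] Y[OF N]
  define S where "S = {\<omega>\<in>space (M N). \<epsilon> < \<bar>Y N \<omega> - X N \<omega>\<bar>}"
  have S [measurable]: "S \<in> sets (M N)" unfolding S_def by measurable
  have iY: "integrable (M N) (%\<omega>. iexp (t * Y N \<omega>))" and iX: "integrable (M N) (%\<omega>. iexp (t * X N \<omega>))"
   by (auto intro!: integrable_const_bound[where B=1])
  have "cmod ((CLINT \<omega>|M N. iexp (t * Y N \<omega>))-(CLINT \<omega>|M N. iexp (t * X N \<omega>)))
   = cmod (CLINT \<omega>|M N. iexp (t * Y N \<omega>) - iexp (t * X N \<omega>))"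
   using iX iY by simp
  also have "\<dots> <= (\<integral>\<omega>. cmod (iexp (t * Y N \<omega>) - iexp (t * X N \<omega>)) \<partial>M N)" by (rule integral_norm_bound)
  also have "\<dots> <= (\<integral>\<omega>. \<bar>t\<bar>*\<epsilon> + 2 * indicator S \<omega> \<partial>M N)"
  proof (rule integral_mono)
   show "integrable (M N) (%\<omega>. cmod (iexp (t * Y N \<omega>) - iexp (t * X N \<omega>)))"
    using iX iY by (intro integrable_norm Bochner_Integration.integrable_diff)
   show "integrable (M N) (%\<omega>. \<bar>t\<bar>*\<epsilon> + 2 * indicator S \<omega>)"
    by (auto intro!: integrable_real_indicator simp: emeasure_eq_measure)
   fix \<omega> assume w: "\<omega> \<in> space (M N)"
   have 1: "cmod (iexp (t * Y N \<omega>) - iexp (t * X N \<omega>)) <= 2"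
    using norm_triangle_ineq4[of "iexp (t * Y N \<omega>)" "iexp (t * X N \<omega>)"] by simp
   have 2: "cmod (iexp (t * Y N \<omega>) - iexp (t * X N \<omega>)) <= \<bar>t\<bar>*\<bar>Y N \<omega> - X N \<omega>\<bar>"
    using iexp_diff_bound[of "t * Y N \<omega>" "t * X N \<omega>"] by (simp add: right_diff_distrib[symmetric] abs_mult)
   show "cmod (iexp (t * Y N \<omega>) - iexp (t * X N \<omega>)) <= \<bar>t\<bar>*\<epsilon> + 2 * indicator S \<omega>"
   proof (cases "\<omega> \<in> S")
    case True
    then show ?thesis using 1 \<epsilon> by (simp add: add_increasing)
   next
    case False
    then have "\<bar>Y N \<omega> - X N \<omega>\<bar> <= \<epsilon>" using w unfolding S_def by auto
    then have "\<bar>t\<bar>*\<bar>Y N \<omega> - X N \<omega>\<bar> <= \<bar>t\<bar>*\<epsilon>" by (intro mult_left_mono) auto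
    then show ?thesis using False 2 by simp
   qed
  qed
  also have "\<dots> = \<bar>t\<bar>*\<epsilon> + 2 * P \<epsilon> N" unfolding P_def S_def[symmetric]
   by (subst Bochner_Integration.integral_add) (auto simp: prob_space emeasure_eq_measure intro!: integrable_real_indicator)
  finally show ?thesis .
 qed
 have "(%N. (CLINT \<omega>|M N. iexp (t * Y N \<omega>))-(CLINT \<omega>|M N. iexp (t * X N \<omega>))) ----> 0"
 proof (rule LIMSEQ_I)
  fix e :: real assume e: "0 < e"
  define \<epsilon> where "\<epsilon> = e/(2*(\<bar>t\<bar>+1))"
  have \<epsilon>: "0 < \<epsilon>" unfolding \<epsilon>_def using e by (auto intro!: divide_pos_pos)
  have t\<epsilon>: "\<bar>t\<bar>*\<epsilon> <= e/2" unfolding \<epsilon>_def using e by (simp add: field_simps)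
  have "P \<epsilon> ----> 0" using D \<epsilon> unfolding tends_in_prob_0_def P_def by blast
  then obtain n0 where n0: "!!N. N >= n0 ==> \<bar>P \<epsilon> N\<bar> < e/4"
   using LIMSEQ_D[of "P \<epsilon>" 0 "e/4"] e by auto
  show "\<exists>no. \<forall>N\<ge>no. norm ((CLINT \<omega>|M N. iexp (t * Y N \<omega>))-(CLINT \<omega>|M N. iexp (t * X N \<omega>)) - 0) < e"
  proof (intro exI[of _ "max n0 1"] allI impI)
   fix N assume "max n0 1 <= N"
   then show "norm ((CLINT \<omega>|M N. iexp (t * Y N \<omega>))-(CLINT \<omega>|M N. iexp (t * X N \<omega>)) - 0) < e"
    using bd[of N \<epsilon>, OF _ \<epsilon>] n0[of N] t\<epsilon> by auto
  qed
 qed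
 from tendsto_add[OF this lim[of t]]
 show "(%N. CLINT \<omega>|M N. iexp (t * Y N \<omega>)) ----> iexp (t * m) * of_real (exp (- (v * t^2)/2))" by simp
qed

lemma bernoulli_char_approx:
 fixes p x :: real
 assumes p: "0 <= p" "p <= 1"
 shows "cmod (p *\<^sub>R iexp (x*(1-p)) + (1-p) *\<^sub>R iexp (x*(0 - p)) - of_real (exp (- (p*(1-p) * x^2/2))))
  <= p*\<bar>x\<bar>^3 + p * x^4"
proof -
 define R where "R y = iexp y - (1 + \<i> * of_real y - of_real (y^2/2))" for y :: real
 define z where "z = p*(1-p) * x^2/2"
 have R: "cmod (R y) <= \<bar>y\<bar>^3/6" for y
 proof -
  have "(\<Sum>k\<le>2. (\<i> * complex_of_real y)^k/fact k) = 1 + \<i> * of_real y - of_real (y^2/2)"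
  proof -
   have "(\<Sum>k\<le>2. (\<i> * complex_of_real y)^k/fact k) = 1 + \<i> * of_real y + (\<i> * complex_of_real y)^2/2"
    by (simp add: numeral_2_eq_2)
   also have "(\<i> * complex_of_real y)^2 = - of_real (y^2)" by (simp add: power_mult_distrib)
   finally show ?thesis by simp
  qed
  then show ?thesis using iexp_approx1[of y 2] unfolding R_def by (simp add: fact_numeral)
 qed
 have z0: "0 <= z" unfolding z_def using p by simp
 have zz: "\<bar>exp (- z)-(1-z)\<bar> <= z^2/2"
 proof -
  have 1: "1 - z <= exp (- z)" using exp_ge_add_one_self[of "-z"] by simp
  have "(%z. exp (- z) - 1 + z - z^2/2) z <= (%z. exp (- z) - 1 + z - z^2/2) 0"
  proof (rule DERIV_nonpos_imp_nonincreasing[OF z0], intro exI conjI)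
   fix y :: real
   show "((%z. exp (- z) - 1 + z - z^2/2) has_real_derivative (- exp (- y) + 1 - y)) (at y)"
    by (auto intro!: derivative_eq_intros)
   show "- exp (- y) + 1 - y <= 0" using exp_ge_add_one_self[of "-y"] by simp
  qed
  with 1 show ?thesis by simp
 qed
 have split: "p *\<^sub>R iexp (x*(1-p)) + (1-p) *\<^sub>R iexp (x*(0 - p)) - of_real (exp (- z))
  = (of_real p * R (x*(1-p)) + of_real (1-p) * R (x*(0 - p))) - of_real (exp (- z)-(1-z))"
 proof -
  define a where "a = x*(1-p)"
  define b where "b = x*(0 - p)"
  have ab: "p * a + (1-p) * b = 0" "(p * a^2 + (1-p) * b^2)/2 = z"
   unfolding a_def b_def z_def by (simp_all add: algebra_simps power2_eq_square)
  have "of_real p*(1 + \<i> * of_real a - of_real (a^2/2)) + of_real (1-p)*(1 + \<i> * of_real b - of_real (b^2/2))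
   = 1 + \<i> * of_real (p * a + (1-p) * b)-(of_real ((p * a^2 + (1-p) * b^2)/2) :: complex)"
   by (simp add: algebra_simps add_divide_distrib diff_divide_distrib)
  also have "\<dots> = of_real (1-z)" unfolding ab by simp
  finally have "of_real p*(1 + \<i> * of_real a - of_real (a^2/2)) + of_real (1-p)*(1 + \<i> * of_real b - of_real (b^2/2))
   = (of_real (1-z) :: complex)" .
  moreover define A where "A = 1 + \<i> * of_real a - of_real (a^2/2)"
  moreover define C where "C = 1 + \<i> * of_real b - of_real (b^2/2)"
  ultimately have AC: "of_real p * A + of_real (1-p) * C = of_real (1-z)" by simp
  have gen: "P * X + Q * Y - E = (P*(X - A') + Q*(Y - C'))-(E - Z)" if "P * A' + Q * C' = Z"
   for P Q X Y E A' C' Z :: complex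
   using that by (simp add: algebra_simps)
  show ?thesis unfolding a_def[symmetric] b_def[symmetric] R_def A_def[symmetric] C_def[symmetric]
   using gen[OF AC, of "iexp a" "iexp b" "of_real (exp (- z))"]
   by (simp only: scaleR_conv_of_real of_real_diff)
 qed
 have "cmod (of_real p * R (x*(1-p))) <= p*\<bar>x\<bar>^3/6"
 proof -
  have "\<bar>x*(1-p)\<bar>^3 <= \<bar>x\<bar>^3" using p by (intro power_mono) (auto simp: abs_mult mult_left_le)
  then have "cmod (R (x*(1-p))) <= \<bar>x\<bar>^3/6" using R[of "x*(1-p)"] by linarith
  then have "p * cmod (R (x*(1-p))) <= p*(\<bar>x\<bar>^3/6)" using p by (intro mult_left_mono) auto
  then show ?thesis using p by (simp add: norm_mult)
 qed
 moreover have "cmod (of_real (1-p) * R (x*(0 - p))) <= p*\<bar>x\<bar>^3/6"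
 proof -
  have "\<bar>x*(0 - p)\<bar>^3 = p^3*\<bar>x\<bar>^3" using p by (simp add: abs_mult power_mult_distrib)
  also have "\<dots> <= p*\<bar>x\<bar>^3" using p power_decreasing[of 1 3 p] by (intro mult_right_mono) auto
  finally have 1: "cmod (R (x*(0 - p))) <= p*\<bar>x\<bar>^3/6" using R[of "x*(0 - p)"] by linarith
  have "cmod (of_real (1-p) * R (x*(0 - p))) = (1-p) * cmod (R (x*(0 - p)))"
   unfolding norm_mult norm_of_real using p by simp
  also have "\<dots> <= 1 * cmod (R (x*(0 - p)))" using p by (intro mult_right_mono) auto
  finally show ?thesis using 1 by simp
 qed
 moreover have "cmod (of_real (exp (- z)-(1-z))) <= p * x^4"
 proof -
  have "z <= p * x^2/2" unfolding z_def using p by (auto intro!: divide_right_mono mult_right_mono mult_left_le)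
  then have "z^2 <= (p * x^2/2)^2" using z0 by (intro power_mono) auto
  also have "\<dots> = p^2 * x^4/4" by (simp add: power_mult_distrib power_divide)
  also have "\<dots> <= p * x^4/4" using p power_decreasing[of 1 2 p] by (intro divide_right_mono mult_right_mono) auto
  finally have "z^2/2 <= p * x^4/8" by simp
  also have "\<dots> <= p * x^4" using p by simp
  finally show ?thesis using zz unfolding norm_of_real by linarith
 qed
 moreover have "p*\<bar>x\<bar>^3/6 + p*\<bar>x\<bar>^3/6 <= p*\<bar>x\<bar>^3" using p by simp
 ultimately show ?thesis unfolding z_def[symmetric] split
  using norm_triangle_ineq4[of "of_real p * R (x*(1-p)) + of_real (1-p) * R (x*(0 - p))" "of_real (exp (- z)-(1-z))"]
   norm_triangle_ineq[of "of_real p * R (x*(1-p))" "of_real (1-p) * R (x*(0 - p))"] by linarith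
qed

lemma (in prob_space) bernoulli_sum_char_approx:
 assumes I: "finite I" "indep_vars (%_. count_space UNIV) B I"
  and p: "!!e. e \<in> I ==> distr M (count_space UNIV) (B e) = measure_pmf (bernoulli_pmf (p e))"
  and p01: "!!e. e \<in> I ==> 0 <= p e \<and> p e <= 1"
  and c: "!!e. e \<in> I ==> \<bar>c e\<bar> <= \<delta>"
 shows "cmod ((CLINT \<omega>|M. iexp (t*(\<Sum>e\<in>I. c e*(of_bool (B e \<omega>) - p e))))
   - of_real (exp (- ((\<Sum>e\<in>I. (c e)^2*(p e*(1-p e))) * t^2)/2)))
  <= (\<bar>t\<bar>^3*\<delta> + t^4*\<delta>^2)*(\<Sum>e\<in>I. (c e)^2 * p e)"
proof -
 define w :: "_ => complex" where "w e = of_real (exp (- (p e*(1-p e)*(t * c e)^2/2)))" for e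
 define z where "z e = p e *\<^sub>R iexp (t * c e*(1-p e)) + (1-p e) *\<^sub>R iexp (t * c e*(0 - p e))" for e
 have "(CLINT \<omega>|M. iexp (t*(\<Sum>e\<in>I. c e*(of_bool (B e \<omega>) - p e))))
  = (CLINT \<omega>|M. (\<Prod>e\<in>I. iexp (t * c e*(of_bool (B e \<omega>) - p e))))"
  using I(1) by (simp add: exp_sum[symmetric] sum_distrib_left mult.assoc)
 also have "\<dots> = (\<Prod>e\<in>I. z e)"
  unfolding z_def using indep_bool_expectation(1)[OF I p p01, of "%e b. iexp (t * c e*(of_bool b - p e))"] by simp
 finally have 1: "(CLINT \<omega>|M. iexp (t*(\<Sum>e\<in>I. c e*(of_bool (B e \<omega>) - p e)))) = (\<Prod>e\<in>I. z e)" .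
 have "(\<Prod>e\<in>I. w e) = of_real (exp (\<Sum>e\<in>I. - (p e*(1-p e)*(t * c e)^2/2)))"
  unfolding w_def exp_sum[OF I(1)] by simp
 also have "(\<Sum>e\<in>I. - (p e*(1-p e)*(t * c e)^2/2)) = - ((\<Sum>e\<in>I. (c e)^2*(p e*(1-p e))) * t^2)/2"
 proof -
  have "(\<Sum>e\<in>I. - (p e*(1-p e)*(t * c e)^2/2)) = - (\<Sum>e\<in>I. p e*(1-p e)*(t * c e)^2)/2"
   by (simp add: sum_negf sum_divide_distrib)
  also have "(\<Sum>e\<in>I. p e*(1-p e)*(t * c e)^2) = (\<Sum>e\<in>I. (c e)^2*(p e*(1-p e))) * t^2"
   unfolding sum_distrib_right by (intro sum.cong refl) (simp add: power_mult_distrib mult_ac)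
  finally show ?thesis .
 qed
 finally have 2: "(\<Prod>e\<in>I. w e) = of_real (exp (- ((\<Sum>e\<in>I. (c e)^2*(p e*(1-p e))) * t^2)/2))" .
 have "cmod ((\<Prod>e\<in>I. z e)-(\<Prod>e\<in>I. w e)) <= (\<Sum>e\<in>I. cmod (z e - w e))"
 proof (rule norm_prod_diff)
  fix e assume e: "e \<in> I"
  have "cmod (z e) <= p e*1 + (1-p e)*1" unfolding z_def
   using p01[OF e] by (intro norm_triangle_le add_mono) (auto simp: norm_mult)
  then show "cmod (z e) <= 1" by simp
  show "cmod (w e) <= 1" unfolding w_def using p01[OF e] by auto
 qed
 also have "\<dots> <= (\<Sum>e\<in>I. (\<bar>t\<bar>^3*\<delta> + t^4*\<delta>^2)*((c e)^2 * p e))"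
 proof (rule sum_mono)
  fix e assume e: "e \<in> I"
  have "cmod (z e - w e) <= p e*\<bar>t * c e\<bar>^3 + p e*(t * c e)^4"
   unfolding z_def w_def using p01[OF e] by (intro bernoulli_char_approx) auto
  also have "\<bar>t * c e\<bar>^3 = \<bar>t\<bar>^3*\<bar>c e\<bar>*(c e)^2"
  proof -
   have cc: "(c e)^2 = \<bar>c e\<bar>\<^sup>2" by simp
   show ?thesis unfolding cc by (simp only: abs_mult power3_eq_cube power2_eq_square mult_ac)
  qed
  also have "p e*(\<bar>t\<bar>^3*\<bar>c e\<bar>*(c e)^2) <= p e*(\<bar>t\<bar>^3*\<delta>*(c e)^2)"
   using p01[OF e] c[OF e] by (intro mult_left_mono mult_right_mono) auto
  also have "p e*(t * c e)^4 = p e*(t^4*(\<bar>c e\<bar>\<^sup>2)*(c e)^2)"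
   by (simp add: power_mult_distrib power4_eq_xxxx power2_eq_square)
  also have "\<dots> <= p e*(t^4*\<delta>^2*(c e)^2)"
   using p01[OF e] c[OF e] by (intro mult_left_mono mult_right_mono power_mono) auto
  finally show "cmod (z e - w e) <= (\<bar>t\<bar>^3*\<delta> + t^4*\<delta>^2)*((c e)^2 * p e)" by (simp add: algebra_simps)
 qed
 finally show ?thesis unfolding 1 2 by (simp add: sum_distrib_left)
qed

section \<open>Sparse regimes: the mean of the polynomial and its concentration\<close>

lemma ln_one_plus_quadratic:
 fixes u :: real assumes "\<bar>u\<bar> <= 1/2"
 shows "\<bar>ln (1 + u)-(u - u^2/2)\<bar> <= 2*\<bar>u\<bar>^3"
proof -
 define f where "f z = ln (1 + z)-(z - z^2/2)" for z :: real
 have "norm (f u - f 0) <= (2 * u^2) * norm (u - 0)"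
 proof (rule field_differentiable_bound[where S="{-\<bar>u\<bar>..\<bar>u\<bar>}" and f'="%z. z\<^sup>2/(1 + z)"])
  fix z assume z: "z \<in> {-\<bar>u\<bar>..\<bar>u\<bar>}"
  then have zu: "\<bar>z\<bar> <= \<bar>u\<bar>" by auto
  have z1: "1/2 <= 1 + z" using z assms by auto
  have "(f has_real_derivative (1/(1 + z)-(1-z))) (at z within {-\<bar>u\<bar>..\<bar>u\<bar>})"
   unfolding f_def using z1 by (auto intro!: derivative_eq_intros)
  moreover have "1/(1 + z)-(1-z) = z^2/(1 + z)" using z1 by (simp add: field_simps power2_eq_square)
  ultimately show "(f has_real_derivative z\<^sup>2/(1 + z)) (at z within {-\<bar>u\<bar>..\<bar>u\<bar>})" by simp
  have "z^2 <= u^2" using zu by (simp add: abs_le_square_iff)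
  then have "z^2/(1 + z) <= u^2/(1/2)" using z1 by (intro frac_le) auto
  then show "norm (z^2/(1 + z)) <= 2 * u^2" using z1 by simp
 qed auto
 then have "\<bar>f u\<bar> <= 2 * u^2*\<bar>u\<bar>" by (simp add: f_def)
 also have "\<dots> = 2*\<bar>u\<bar>^3" by (simp add: power3_eq_cube power2_eq_square abs_mult_self_eq mult.assoc[symmetric] abs_mult[symmetric])
 finally show ?thesis unfolding f_def .
qed

text \<open>Second-order Taylor expansion of each factor, with squared spins equal to 1.\<close>

lemma htp_log:
 assumes I: "ising V x" and x: "!!i j. i \<in> V ==> j \<in> V ==> x i j <= 1/2"
 shows "\<bar>ln (htp V x)-(ln (ising.part V x 1)-(\<Sum>e\<in>edges V. (x (fst e) (snd e))^2)/2)\<bar> <= 2*(\<Sum>e\<in>edges V. (x (fst e) (snd e))^3)"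
proof -
 interpret ising V x by (rule I)
 let ?x = "%e. x (fst e) (snd e)"
 define Q where "Q = (\<Sum>e\<in>edges V. (?x e)^2)/2"
 define R where "R = 2*(\<Sum>e\<in>edges V. (?x e)^3)"
 have fe: "finite (edges V)" by (rule finite_edges[OF fin])
 have xe: "0 <= ?x e" "?x e <= 1/2" if "e \<in> edges V" for e using that b_nonneg x unfolding edges_def by auto
 have log: "(\<Prod>e\<in>edges V. 1 + ?x e * eps s e) = exp (\<Sum>e\<in>edges V. ln (1 + ?x e * eps s e))"
  and est: "\<bar>(\<Sum>e\<in>edges V. ln (1 + ?x e * eps s e))-(energy s - Q)\<bar> <= R" if s: "s \<in> spins V" for s
 proof -
  have u: "\<bar>?x e * eps s e\<bar> = ?x e" "(?x e * eps s e)^2 = (?x e)^2" if e: "e \<in> edges V" for e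
   using eps_spin[OF s e] xe[OF e] by auto
  have "exp (\<Sum>e\<in>edges V. ln (1 + ?x e * eps s e)) = (\<Prod>e\<in>edges V. exp (ln (1 + ?x e * eps s e)))"
   by (rule exp_sum[OF fe])
  also have "\<dots> = (\<Prod>e\<in>edges V. 1 + ?x e * eps s e)"
  proof (rule prod.cong[OF refl])
   fix e assume e: "e \<in> edges V"
   have "0 < 1 + ?x e * eps s e" using u(1)[OF e] xe[OF e] by linarith
   then show "exp (ln (1 + ?x e * eps s e)) = 1 + ?x e * eps s e" by simp
  qed
  finally show "(\<Prod>e\<in>edges V. 1 + ?x e * eps s e) = exp (\<Sum>e\<in>edges V. ln (1 + ?x e * eps s e))" by simp
  have "(\<Sum>e\<in>edges V. ln (1 + ?x e * eps s e))-(energy s - Q)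
   = (\<Sum>e\<in>edges V. ln (1 + ?x e * eps s e)-(?x e * eps s e - (?x e)^2/2))"
   unfolding energy_edges[OF I] Q_def by (simp add: sum_subtractf sum_divide_distrib)
  also have "\<bar>\<dots>\<bar> <= (\<Sum>e\<in>edges V. 2*(?x e)^3)"
  proof (rule order_trans[OF sum_abs sum_mono])
   fix e assume e: "e \<in> edges V"
   show "\<bar>ln (1 + ?x e * eps s e)-(?x e * eps s e - (?x e)^2/2)\<bar> <= 2*(?x e)^3"
    using ln_one_plus_quadratic[of "?x e * eps s e"] u[OF e] xe[OF e] by simp
  qed
  finally show "\<bar>(\<Sum>e\<in>edges V. ln (1 + ?x e * eps s e))-(energy s - Q)\<bar> <= R"
   unfolding R_def by (simp add: sum_distrib_left)
 qed
 have p: "part 1 = savg V (%s. exp (energy s))" unfolding part_def savg_def by simp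
 have "htp V x <= savg V (%s. exp (R - Q) * exp (energy s))"
  unfolding htp_def
 proof (rule savg_mono)
  fix s assume s: "s \<in> spins V"
  show "(\<Prod>e\<in>edges V. 1 + ?x e * eps s e) <= exp (R - Q) * exp (energy s)"
   unfolding log[OF s] exp_add[symmetric] using est[OF s] by simp
 qed
 then have up: "htp V x <= exp (R - Q) * part 1" unfolding savg_cmult p .
 have "savg V (%s. exp (- R - Q) * exp (energy s)) <= htp V x"
  unfolding htp_def
 proof (rule savg_mono)
  fix s assume s: "s \<in> spins V"
  show "exp (- R - Q) * exp (energy s) <= (\<Prod>e\<in>edges V. 1 + ?x e * eps s e)"
   unfolding log[OF s] exp_add[symmetric] using est[OF s] by simp
 qed
 then have lo: "exp (- R - Q) * part 1 <= htp V x" unfolding savg_cmult p .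
 have h: "0 < htp V x" using lo part_pos[of 1] by (smt (verit) exp_gt_zero mult_pos_pos)
 have lnm: "ln (exp c * part 1) = c + ln (part 1)" for c using part_pos[of 1] by (simp add: ln_mult)
 have "ln (htp V x) <= R - Q + ln (part 1)" using up h part_pos[of 1] unfolding lnm[symmetric] by simp
 moreover have "- R - Q + ln (part 1) <= ln (htp V x)" using lo h part_pos[of 1] unfolding lnm[symmetric] by simp
 ultimately show ?thesis unfolding Q_def[symmetric] R_def[symmetric] by simp
qed

lemma frob_mono:
 assumes "!!i j. i \<in> V ==> j \<in> V ==> 0 <= f i j \<and> f i j <= g i j"
 shows "frob V f <= frob V g"
 unfolding frob_def by (intro L2_set_mono L2_set_nonneg) (use assms in auto)

lemma frob_scale: assumes "0 <= \<mu>" shows "frob V (%i j. \<mu> * f i j) = \<mu> * frob V f"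
proof (rule power2_eq_imp_eq)
 show "(frob V (%i j. \<mu> * f i j))^2 = (\<mu> * frob V f)^2"
  unfolding power_mult_distrib frob_sq sum_distrib_left ..
qed (auto intro!: mult_nonneg_nonneg frob_nonneg assms)

lemma artanh_le: fixes x :: real assumes "0 <= x" "x < 1" shows "artanh x <= x/(1-x)"
proof -
 have "(1 + x)/(1-x) = 1 + 2 * x/(1-x)" using assms by (simp add: field_simps)
 moreover have "ln (1 + 2 * x/(1-x)) <= 2 * x/(1-x)" by (rule ln_add_one_self_le_self) (use assms in auto)
 ultimately show ?thesis unfolding artanh_def using assms by (simp add: mult.commute[of x 2])
qed

lemma tendsto_eventually_1:
 fixes f g :: "nat => real"
 assumes "f ----> l" "!!N. N >= 1 ==> f N = g N" shows "g ----> l"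
 by (rule Lim_transform_eventually[OF assms(1) eventually_mono[OF eventually_ge_at_top[of 1]]]) (rule assms(2))

lemma tendsto_eventually_1':
 fixes f g :: "nat => real"
 assumes "f ----> l'" "l' = l" "!!N. N >= 1 ==> f N = g N" shows "g ----> l"
 using tendsto_eventually_1[OF assms(1,3)] assms(2) by simp

lemma eventually_1: "(!!N. N >= 1 ==> P N) ==> EV N. P N"
 by (rule eventually_mono[OF eventually_ge_at_top[of 1]])

lemma square_lipschitz: "x \<in> {0..1} ==> y \<in> {0..1} ==> \<bar>x\<^sup>2 - y^2\<bar> <= 2*\<bar>x - y\<bar>" for x y :: real
proof -
 assume "x \<in> {0..1}" "y \<in> {0..1}"
 then have "\<bar>x + y\<bar>*\<bar>x - y\<bar> <= 2*\<bar>x - y\<bar>" by (intro mult_right_mono) auto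
 moreover have "x^2 - y^2 = (x + y)*(x - y)" by (simp add: power2_eq_square algebra_simps)
 ultimately show "\<bar>x\<^sup>2 - y^2\<bar> <= 2*\<bar>x - y\<bar>" by (simp only: abs_mult)
qed

lemma measure_hcell2: assumes "N >= 1" shows "measure lborel (hcell N i \<times> hcell N j) = 1/(real N)^2"
proof -
 have "emeasure (lborel \<Otimes>\<^sub>M lborel) (hcell N i \<times> hcell N j) = emeasure lborel (hcell N i) * emeasure lborel (hcell N j)"
  by (rule lborel.emeasure_pair_measure_Times) (auto simp: hcell_def)
 then have "measure lborel (hcell N i \<times> hcell N j) = measure lborel (hcell N i) * measure lborel (hcell N j)"
  unfolding measure_def lborel_prod by (simp add: enn2real_mult)
 then show ?thesis using measure_hcell[OF assms] by (simp add: power2_eq_square)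
qed

locale sparse_regime = riemann_graphon W for W +
 fixes \<beta> :: real and \<theta> :: "nat => real"
 assumes beta: "0 < \<beta>" and sub: "\<beta> * graphon_op_norm W < 1"
  and theta: "!!N. N >= 1 ==> 0 < \<theta> N \<and> \<theta> N < 1"
  and dense: "filterlim (%N. real N*\<theta> N) at_top sequentially"
  and RD: "(%x. W (x, x)) riemann_integrable_on {0..1}"
begin

abbreviation "W1d \<equiv> (\<integral>x. W (x, x) \<partial>U)"
abbreviation "W2d \<equiv> (\<integral>x. (W (x, x))^2 \<partial>U)"
abbreviation "W1 \<equiv> (\<integral>p. W p \<partial>U2)"
abbreviation "W2 \<equiv> (\<integral>p. (W p)^2 \<partial>U2)"

definition loopsum :: "(real => real) => nat => real" where
 "loopsum \<Phi> N = (\<Sum>i=1..N. \<Phi> (W (grid N i i)))"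
definition edgesum :: "(real => real) => nat => real" where
 "edgesum \<Phi> N = (\<Sum>e\<in>edges {1..N}. \<Phi> (W (grid N (fst e) (snd e))))"

abbreviation D1 :: "nat => real" where "D1 \<equiv> loopsum (%x. x)"
abbreviation E1 :: "nat => real" where "E1 \<equiv> edgesum (%x. x)"

lemma loop_limit:
 assumes Lip: "!!x y. x \<in> {0..1} ==> y \<in> {0..1} ==> \<bar>\<Phi> x - \<Phi> y\<bar> <= L*\<bar>x - y\<bar>" and m: "\<Phi> \<in> borel_measurable borel"
 shows "(%N. loopsum \<Phi> N/real N) ----> (\<integral>x. \<Phi> (W (x, x)) \<partial>U)"
proof -
 interpret C1: cell_family "%x. W (x, x)" 0 1 "%N. {1..N}" icell hcell "%N i. real i/real N"
  by (rule cell_family_1D[OF RD]) (use W01 in auto)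
 show ?thesis
 proof (rule tendsto_eventually_1[OF C1.sum_limit[OF Lip m, unfolded cbox_interval]], goal_cases)
  case (3 N) then show ?case by (simp add: loopsum_def measure_hcell sum_divide_distrib)
 qed
qed

lemma edgesum_eq:
 "(\<Sum>i=1..N. \<Sum>j=1..N. \<Phi> (W (grid N i j))) = loopsum \<Phi> N + 2 * edgesum \<Phi> N"
proof -
 let ?f = "%i j. \<Phi> (W (grid N i j))"
 have "(\<Sum>i=1..N. \<Sum>j=1..N. ?f i j) = (\<Sum>i=1..N. \<Sum>j=1..N. (if i = j then 0 else ?f i j) + (if j = i then ?f i i else 0))"
  by (intro sum.cong refl) auto
 also have "\<dots> = (\<Sum>i=1..N. \<Sum>j=1..N. if i = j then 0 else ?f i j) + loopsum \<Phi> N"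
  unfolding sum.distrib loopsum_def by (simp add: sum.delta)
 also have "(\<Sum>i=1..N. \<Sum>j=1..N. if i = j then 0 else ?f i j) = 2*(\<Sum>e\<in>edges {1..N}. if fst e = snd e then 0 else ?f (fst e) (snd e))"
 proof (rule sum_edges)
  fix i j assume ij: "i \<in> {1..N}" "j \<in> {1..N}"
  show "(if i = j then 0 else ?f i j) = (if j = i then 0 else ?f j i)"
   using wt_sym[OF ij] unfolding wt_def by (auto split: if_splits)
 qed auto
 also have "(\<Sum>e\<in>edges {1..N}. if fst e = snd e then 0 else ?f (fst e) (snd e)) = edgesum \<Phi> N"
  unfolding edgesum_def by (intro sum.cong refl) (auto simp: edges_def)
 finally show ?thesis by simp
qed

lemma edge_limit:
 assumes Lip: "!!x y. x \<in> {0..1} ==> y \<in> {0..1} ==> \<bar>\<Phi> x - \<Phi> y\<bar> <= L*\<bar>x - y\<bar>" and m: "\<Phi> \<in> borel_measurable borel"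
 shows "(%N. edgesum \<Phi> N/(real N)^2) ----> (\<integral>p. \<Phi> (W p) \<partial>U2)/2"
proof -
 have "(%N. (loopsum \<Phi> N + 2 * edgesum \<Phi> N)/(real N)^2) ----> (\<integral>p. \<Phi> (W p) \<partial>U2)"
 proof (rule tendsto_eventually_1[OF C2.sum_limit[OF Lip m, unfolded sq]], goal_cases)
  case (3 N) then show ?case
   by (simp add: edgesum_eq[symmetric] sum.cartesian_product case_prod_unfold measure_hcell2 sum_divide_distrib)
 qed
 from tendsto_divide[OF tendsto_diff[OF this tendsto_mult[OF loop_limit[OF Lip m] lim_1_over_n]] tendsto_const, of 2]
 show ?thesis by (simp add: add_divide_distrib power2_eq_square)
qed

lemmas loop1 = loop_limit[where \<Phi>="%x. x" and L=1, simplified]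
lemmas edge1 = edge_limit[where \<Phi>="%x. x" and L=1, simplified]

lemma loop2: "(%N. loopsum (%x. x\<^sup>2) N/real N) ----> W2d" by (rule loop_limit[where L=2]) (rule square_lipschitz, auto)
lemma edge2: "(%N. edgesum (%x. x\<^sup>2) N/(real N)^2) ----> W2/2" by (rule edge_limit[where L=2]) (rule square_lipschitz, auto)

abbreviation uu :: "nat => real" where "uu N \<equiv> real N*\<theta> N"
definition bb :: "nat => real" where "bb N = \<beta>/uu N"
definition ss :: "nat => real" where "ss N = real N*\<theta> N * tanh (bb N)"
definition xx :: "nat => nat => nat => real" where "xx N i j = ss N * bm N i j"
definition kap :: "nat => nat => nat => real" where
 "kap N i j = (tanh (bb N))^2*(\<theta> N * wt W N i j)*(1-\<theta> N * wt W N i j)"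
definition hh :: "nat => real" where "hh N = htp {1..N} (xx N)"

lemma inv_dense: "filterlim (%N. inverse (uu N)) (at_right 0) sequentially"
 by (rule filterlim_compose[OF filterlim_inverse_at_right_top dense])

lemma bb_at_right: "filterlim bb (at_right 0) sequentially"
proof -
 have "filterlim (%N. (1/\<beta>)*(uu N)) at_top sequentially"
  by (rule filterlim_tendsto_pos_mult_at_top[OF tendsto_const _ dense]) (use beta in simp)
 then have "filterlim (%N. inverse ((1/\<beta>)*(uu N))) (at_right 0) sequentially"
  by (rule filterlim_compose[OF filterlim_inverse_at_right_top])
 moreover have "inverse ((1/\<beta>)*(uu N)) = bb N" for N unfolding bb_def by (simp add: divide_simps)
 ultimately show ?thesis by simp
qed

lemma bb_limit: "bb ----> 0" using bb_at_right by (simp add: filterlim_at)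

lemma Nth: assumes "N >= 1" shows "0 < real N*\<theta> N" "0 < bb N" "0 <= tanh (bb N)" "tanh (bb N) <= bb N"
proof -
 show p: "0 < real N*\<theta> N" using theta[OF assms] assms by simp
 show b: "0 < bb N" unfolding bb_def using p beta by simp
 show "0 <= tanh (bb N)" using b by simp
 show "tanh (bb N) <= bb N" using b by (intro tanh_le_self) simp
qed

lemma ss_bounds: assumes "N >= 1" shows "0 <= ss N" "ss N <= \<beta>"
proof -
 show "0 <= ss N" unfolding ss_def using Nth[OF assms] by simp
 have "ss N <= real N*\<theta> N * bb N" unfolding ss_def using Nth[OF assms] by (intro mult_left_mono) auto
 also have "\<dots> = \<beta>" unfolding bb_def using Nth(1)[OF assms] by (simp only: times_divide_eq_right nonzero_mult_div_cancel_left less_imp_neq[symmetric] not_False_eq_True)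
 finally show "ss N <= \<beta>" .
qed

lemma ss_limit: "ss ----> \<beta>"
proof -
 have l: "((%x::real. tanh (\<beta> * x)/x) \<longlongrightarrow> \<beta>) (at_right 0)"
  unfolding tanh_def sinh_def cosh_def using beta by simp real_asymp
 have "(%N. tanh (\<beta> * inverse (uu N))/inverse (uu N)) ----> \<beta>"
  by (rule filterlim_compose[OF l inv_dense])
 then show ?thesis unfolding ss_def[abs_def] bb_def by (simp add: divide_inverse mult_ac)
qed

lemma xx_bounds: assumes "i \<in> {1..N}" "j \<in> {1..N}" shows "0 <= xx N i j" "xx N i j <= \<beta>/real N"
proof -
 have N: "N >= 1" using assms by auto
 show "0 <= xx N i j" unfolding xx_def by (intro mult_nonneg_nonneg bm01 ss_bounds assms N)
 have "xx N i j <= \<beta>*(1/real N)" unfolding xx_def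
  by (intro mult_mono bm01 ss_bounds assms N) (use beta in auto)
 then show "xx N i j <= \<beta>/real N" by simp
qed

lemma xx_ising: "N >= 1 ==> ising {1..N} (xx N)"
 using ising.scaled[OF ising_bm ss_bounds(1)] unfolding xx_def[abs_def] .

lemma part_scaled: assumes I: "ising V b" and \<mu>: "0 <= \<mu>" shows "ising.part V (%i j. \<mu> * b i j) \<nu> = ising.part V b (\<nu>*\<mu>)"
proof -
 interpret b: ising V b by (rule I)
 interpret m: ising V "%i j. \<mu> * b i j" by (rule b.scaled[OF \<mu>])
 show ?thesis unfolding b.part_def m.part_def b.energy_scaled[OF \<mu>] by (simp add: mult.assoc)
qed

lemma subcritical_eventually:
 assumes m: "m ----> \<mu>" and \<mu>: "\<mu> * graphon_op_norm W < r" and mb: "!!N. N >= 1 ==> 0 <= m N"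
 shows "EV N. m N * opb N <= r"
proof -
 have "(%N. m N * opb N) ----> \<mu>*(graphon_op_norm W + sqrt 0)"
  by (intro tendsto_intros m dlt_limit)
 from order_tendstoD(2)[OF this, of r] \<mu> show ?thesis by (auto elim: eventually_mono)
qed

text \<open>The weights are \<open>ss N\<close> times the coupling matrix. The quadratic term of \<open>htp_log\<close> produces the integral of \<open>W\<^sup>2\<close>;
the cubic one is of order \<open>1/N\<close>.\<close>

lemma ln_hh_limit: "(%N. ln (hh N)) ----> logdet \<beta> - \<beta>^2/4 * W2"
proof -
 define Q where "Q N = (\<Sum>e\<in>edges {1..N}. (xx N (fst e) (snd e))^2)/2" for N
 define R where "R N = 2*(\<Sum>e\<in>edges {1..N}. (xx N (fst e) (snd e))^3)" for N
 have R: "R ----> 0"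
 proof (rule real_tendsto_sandwich[where f="%_. 0" and h="%N. 2*\<beta>^3/real N"])
  show "EV N. R N <= 2*\<beta>^3/real N"
   using eventually_ge_at_top[of 1]
  proof eventually_elim
   fix N :: nat assume N: "1 <= N"
   have "(\<Sum>e\<in>edges {1..N}. (xx N (fst e) (snd e))^3) <= (\<Sum>e\<in>edges {1..N}. (\<beta>/real N)^3)"
    by (intro sum_mono power_mono xx_bounds) (auto simp: edges_def)
   also have "\<dots> <= (\<Sum>e\<in>{1..N}\<times>{1..N}. (\<beta>/real N)^3)" using beta by (intro sum_mono2) (auto simp: edges_def)
   also have "\<dots> = (real N)^2*(\<beta>/real N)^3" by (simp add: power2_eq_square)
   also have "\<dots> = \<beta>^3/real N" using N by (simp add: power2_eq_square power3_eq_cube field_simps)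
   finally show "R N <= 2*\<beta>^3/real N" unfolding R_def by simp
  qed
  show "EV N. 0 <= R N"
   unfolding R_def by (intro always_eventually allI mult_nonneg_nonneg sum_nonneg zero_le_power xx_bounds) (auto simp: edges_def)
  show "(%N. 2*\<beta>^3/real N) ----> 0" by (rule lim_const_over_n)
 qed simp
 have QN: "(ss N)^2/2*(edgesum (%x. x^2) N/(real N)^2) = Q N" for N
  unfolding Q_def edgesum_def sum_distrib_left sum_divide_distrib
  by (intro sum.cong refl) (auto simp: xx_def bm_def wt_def edges_def power_mult_distrib power_divide)
 from tendsto_mult[OF tendsto_divide[OF tendsto_power[OF ss_limit, of 2] tendsto_const, of 2] edge2]
 have Q: "Q ----> \<beta>^2/4 * W2" unfolding QN by simp
 have P: "(%N. psi N (ss N)) ----> logdet \<beta>"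
 proof -
  obtain r where r: "\<beta> * graphon_op_norm W < r" "r < 1" using dense_order_class.dense[OF sub] by blast
  have "(%N. psi N \<beta> - psi N (ss N)) ----> 0"
  proof (rule real_tendsto_sandwich[where f="%_. 0" and h="%N. (\<beta> - ss N)*(\<beta>/(1-r)/2)"])
   have ev: "EV N. 1 <= N \<and> \<beta> * opb N <= r"
    using eventually_ge_at_top[of 1] subcritical_eventually[OF tendsto_const r(1)] beta by (auto intro: eventually_conj)
   show "EV N. 0 <= psi N \<beta> - psi N (ss N)"
    using ev by eventually_elim (rule psi_lipschitz(1)[OF _ _ r(2) ss_bounds], auto)
   show "EV N. psi N \<beta> - psi N (ss N) <= (\<beta> - ss N)*(\<beta>/(1-r)/2)"
    using ev by eventually_elim (rule psi_lipschitz(2)[OF _ _ r(2) ss_bounds], auto)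
   have "(%N. (\<beta> - ss N)*(\<beta>/(1-r)/2)) ----> (\<beta> - \<beta>)*(\<beta>/(1-r)/2)"
    by (intro tendsto_mult tendsto_diff tendsto_const ss_limit)
   then show "(%N. (\<beta> - ss N)*(\<beta>/(1-r)/2)) ----> 0" by simp
  qed simp
  from tendsto_diff[OF psi_limit[OF beta sub] this] show ?thesis by simp
 qed
 have main: "EV N. \<bar>ln (hh N)-(psi N (ss N) - Q N)\<bar> <= R N"
 proof -
  have "(%N. \<beta>/real N) ----> 0" by (rule lim_const_over_n)
  then have "EV N. \<beta>/real N < 1/2" by (rule order_tendstoD) simp
  with eventually_ge_at_top[of 1] show ?thesis
  proof eventually_elim
   fix N :: nat assume N: "1 <= N" and s: "\<beta>/real N < 1/2"
   have "psi N (ss N) = ln (ising.part {1..N} (xx N) 1)"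
    unfolding psi_def xx_def[abs_def] part_scaled[OF ising_bm ss_bounds(1)[OF N]] by simp
   then show "\<bar>ln (hh N)-(psi N (ss N) - Q N)\<bar> <= R N"
    unfolding hh_def Q_def R_def
   proof (simp only:, intro htp_log[OF xx_ising[OF N]])
    fix i j assume "i \<in> {1..N}" "j \<in> {1..N}"
    from xx_bounds(2)[OF this] s show "xx N i j <= 1/2" by linarith
   qed
  qed
 qed
 have "(%N. ln (hh N)-(psi N (ss N) - Q N)) ----> 0"
  by (rule Lim_null_comparison[OF _ R]) (use main in simp)
 from tendsto_add[OF this tendsto_diff[OF P Q]] show ?thesis by simp
qed

end

context sparse_regime begin

lemma kap_bounds: assumes "i \<in> {1..N}" "j \<in> {1..N}" shows "0 <= kap N i j" "kap N i j <= (tanh (bb N))^2*\<theta> N * wt W N i j"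
proof -
 have N: "N >= 1" using assms by auto
 have w: "0 <= wt W N i j" "wt W N i j <= 1" using wt01[OF assms] by auto
 have t: "0 < \<theta> N" "\<theta> N < 1" using theta[OF N] by auto
 have tw: "0 <= \<theta> N * wt W N i j" "\<theta> N * wt W N i j <= 1" using w t by (auto intro: mult_le_one)
 show "0 <= kap N i j" unfolding kap_def using tw by simp
 have "kap N i j <= (tanh (bb N))^2*(\<theta> N * wt W N i j)*1" unfolding kap_def using tw by (intro mult_left_mono) auto
 then show "kap N i j <= (tanh (bb N))^2*\<theta> N * wt W N i j" by (simp add: mult.assoc)
qed

lemma hh_ge_1: "1 <= hh N"
 unfolding hh_def by (rule htp_ge_1) (auto intro: xx_bounds(1))

lemma part_bm_bound:
 assumes N: "N >= 1" and c: "ising {1..N} c" "!!i j. i \<in> {1..N} ==> j \<in> {1..N} ==> c i j <= \<mu> * bm N i j"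
  and \<mu>: "0 <= \<mu>" and r: "\<mu> * opb N <= r" "r < 1"
 shows "ising.part {1..N} c 1 <= exp (\<mu>^2/(4*(1-r)))"
  and "(frob {1..N} (ising.offcorr {1..N} c))^2 <= (\<mu>/(1-r))^2"
proof -
 interpret c: ising_sub "{1..N}" c r by (rule ising_sub_mono[OF ising_sub_bm[OF N \<mu> r] c])
 have "frob {1..N} c <= frob {1..N} (%i j. \<mu> * bm N i j)" by (rule frob_mono) (use c.b_nonneg c(2) in auto)
 also have "\<dots> = \<mu> * frob {1..N} (bm N)" by (rule frob_scale[OF \<mu>])
 also have "\<dots> <= \<mu>*1" by (rule mult_left_mono[OF frob_bm \<mu>])
 finally have f: "frob {1..N} c <= \<mu>" by simp
 have "(frob {1..N} c)^2 <= \<mu>^2" by (rule power_mono[OF f frob_nonneg])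
 then have "(frob {1..N} c)^2/(4*(1-r)) <= \<mu>^2/(4*(1-r))" using r by (intro divide_right_mono) auto
 with c.part_le show "ising.part {1..N} c 1 <= exp (\<mu>^2/(4*(1-r)))" by (meson exp_le_cancel_iff order_trans)
 have "frob {1..N} c.offcorr <= frob {1..N} c/(1-r)" by (rule c.frob_offcorr)
 also have "\<dots> <= \<mu>/(1-r)" using f r by (intro divide_right_mono) auto
 finally show "(frob {1..N} c.offcorr)^2 <= (\<mu>/(1-r))^2" by (rule power_mono[OF _ frob_nonneg])
qed

text \<open>In \<open>htp2_variance\<close> take \<open>L = \<delta>N\<theta>\<close>. Since \<open>\<kappa> \<le> \<beta>\<^sup>2\<theta>/(N\<theta>)\<^sup>2\<close>, the scaled weights stay a small multiple of the coupling matrix,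
so for small \<open>\<delta>\<close> all couplings in the exponential bound are subcritical.\<close>

lemma second_moment:
 obtains C where "0 < C" "EV N. htp2 {1..N} (xx N) (kap N) <= (hh N)^2*(1 + C/(uu N)^2)"
proof -
 define r0 where "r0 = \<beta> * graphon_op_norm W"
 have r0: "0 <= r0" "r0 < 1" unfolding r0_def using beta graphon_op_norm_nonneg sub by auto
 define p where "p = 2/(1 + r0)"
 have p: "1 < p" unfolding p_def using r0 by simp
 define q where "q = p/(p-1)"
 have q: "0 < q" unfolding q_def using p by simp
 have pr: "p * r0 < 1" unfolding p_def using r0 by simp
 have "max (p * r0) r0 < 1" using pr r0 by simp
 then obtain r where r': "max (p * r0) r0 < r" "r < 1" using dense_order_class.dense by blast
 then have r: "p * r0 < r" "r0 < r" "r < 1" by auto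
 define \<delta> where "\<delta> = 1/(q*\<beta>)"
 have \<delta>: "0 < \<delta>" unfolding \<delta>_def using q beta by simp
 define \<mu>y where "\<mu>y N = q*(\<delta>*\<beta>^2 + \<beta>^2/real N)" for N
 define \<mu>a where "\<mu>a N = \<beta>/(1-\<beta>/real N)" for N
 have bN: "(%N. \<beta>/real N) ----> 0" and b2N: "(%N. \<beta>\<^sup>2/real N) ----> 0" by (rule lim_const_over_n)+
 have "\<mu>y ----> q*(\<delta>*\<beta>^2 + 0)" unfolding \<mu>y_def by (intro tendsto_intros b2N)
 moreover have "q*(\<delta>*\<beta>^2 + 0) = \<beta>" unfolding \<delta>_def using q beta by (simp add: power2_eq_square)
 ultimately have \<mu>y: "\<mu>y ----> \<beta>" by simp
 have "\<mu>a ----> \<beta>/(1-0)" unfolding \<mu>a_def by (intro tendsto_intros bN) auto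
 then have \<mu>a: "\<mu>a ----> \<beta>" by simp
 define F where "F = exp ((p*\<beta>)^2/(4*(1-r)))^2 + exp ((2*\<beta>)^2/(4*(1-r)))"
 define C where "C = \<beta>^2*(2*\<beta>/(1-r))^2/2 + F/\<delta>^2"
 have F: "0 < F" unfolding F_def by (intro add_pos_pos) auto
 have "0 < F/\<delta>^2" using F \<delta> by simp
 moreover have "0 <= \<beta>^2*(2*\<beta>/(1-r))^2/2" by simp
 ultimately have C: "0 < C" unfolding C_def by linarith
 have evp: "EV N. p*\<beta> * opb N <= r"
  by (rule subcritical_eventually[OF tendsto_const]) (use r p beta in \<open>auto simp: r0_def mult.assoc\<close>)
 have evy: "EV N. \<mu>y N * opb N <= r"
  by (rule subcritical_eventually[OF \<mu>y]) (use r q \<delta> in \<open>auto simp: r0_def \<mu>y_def\<close>)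
 have ev1: "EV N. \<beta>/real N < 1/8" by (rule order_tendstoD[OF bN]) simp
 have ev4: "EV N. \<beta>/real N < 1/(8*(\<delta>*\<beta>+1))"
  by (rule order_tendstoD[OF bN]) (use \<delta> beta in \<open>auto intro: add_pos_pos\<close>)
 have eva: "EV N. \<mu>a N * opb N <= r"
 proof -
  have "(%N. \<mu>a N * opb N) ----> \<beta>*(graphon_op_norm W + sqrt 0)"
   by (intro tendsto_intros \<mu>a dlt_limit)
  from order_tendstoD(2)[OF this, of r] r show ?thesis unfolding r0_def by (auto elim: eventually_mono)
 qed
 have evL: "EV N. 1/\<delta> <= real N*\<theta> N" using dense unfolding filterlim_at_top by blast
 have evy2: "EV N. \<mu>y N < 2*\<beta>" by (rule order_tendstoD[OF \<mu>y]) (use beta in simp)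
 have "EV N. htp2 {1..N} (xx N) (kap N) <= (hh N)^2*(1 + C/(uu N)^2)"
  using evp evy ev1 ev4 eva evL evy2 eventually_ge_at_top[of 1]
 proof eventually_elim
  fix N :: nat
  assume evp: "p*\<beta> * opb N <= r" and evy: "\<mu>y N * opb N <= r"
   and ev1: "\<beta>/real N < 1/8" and ev4: "\<beta>/real N < 1/(8*(\<delta>*\<beta>+1))"
   and eva: "\<mu>a N * opb N <= r" and evL: "1/\<delta> <= real N*\<theta> N" and evy2: "\<mu>y N < 2*\<beta>" and N: "1 <= N"
  define b t \<Lambda> u where "b = bb N" and "t = tanh (bb N)" and "\<Lambda> = \<delta>*(uu N)" and "u = real N*\<theta> N"
  have u: "0 < u" "0 < t \<or> t = 0" "0 <= t" "t <= \<beta>/u" using Nth[OF N] unfolding u_def t_def bb_def by auto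
  have \<Lambda>: "1 <= \<Lambda>" using evL \<delta> unfolding \<Lambda>_def by (simp add: field_simps)
  have tu: "t * u <= \<beta>" using u by (simp add: pos_le_divide_eq)
  have "t^2 * u^2 <= \<beta>^2" using power_mono[OF tu, of 2] u by (simp add: power_mult_distrib)
  then have t2: "t^2*\<theta> N * u <= \<beta>^2/real N" unfolding u_def using N by (simp add: field_simps power2_eq_square)
  define k where "k = t^2*\<theta> N"
  have k0: "0 <= k" unfolding k_def using theta[OF N] by simp
  have xI: "ising {1..N} (xx N)" by (rule xx_ising[OF N])
  have x18: "xx N i j < 1/8" if "i \<in> {1..N}" "j \<in> {1..N}" for i j by (rule le_less_trans[OF xx_bounds(2)[OF that] ev1])
  have \<mu>a0: "0 <= \<mu>a N" unfolding \<mu>a_def by (rule divide_nonneg_nonneg) (use beta ev1 in linarith)+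
  define D where "D = (frob {1..N} (ising.offcorr {1..N} (%i j. artanh (xx N i j))))^2"
  have D: "D <= (2*\<beta>/(1-r))^2"
  proof -
   have "D <= (\<mu>a N/(1-r))^2" unfolding D_def
   proof (rule part_bm_bound(2)[OF N htp_part(2)[OF xI] _ _ eva r(3)])
    show "xx N i j < 1" if "i \<in> {1..N}" "j \<in> {1..N}" for i j using x18[OF that] by simp
    show "0 <= \<mu>a N" by (rule \<mu>a0)
    show "artanh (xx N i j) <= \<mu>a N * bm N i j" if ij: "i \<in> {1..N}" "j \<in> {1..N}" for i j
    proof -
     have "artanh (xx N i j) <= xx N i j/(1-xx N i j)" using xx_bounds(1)[OF ij] x18[OF ij] by (intro artanh_le) auto
     also have "\<dots> <= (\<beta> * bm N i j)/(1-\<beta>/real N)"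
     proof (rule frac_le)
      show "xx N i j <= \<beta> * bm N i j" unfolding xx_def by (intro mult_right_mono ss_bounds[OF N] bm01 ij)
      show "0 <= \<beta> * bm N i j" using beta bm01(1)[OF ij] by simp
      show "0 < 1 - \<beta>/real N" using ev1 by linarith
      show "1 - \<beta>/real N <= 1 - xx N i j" using xx_bounds(2)[OF ij] by linarith
     qed
     finally show ?thesis unfolding \<mu>a_def by simp
    qed
   qed
   also have "\<dots> <= (2*\<beta>/(1-r))^2"
   proof (rule power_mono)
    have half: "1/2 <= 1 - \<beta>/real N" using ev1 by linarith
    have "\<mu>a N <= \<beta>/(1/2)" unfolding \<mu>a_def by (rule frac_le) (use beta half in linarith)+
    then have "\<mu>a N <= 2*\<beta>" by simp
    then show "\<mu>a N/(1-r) <= 2*\<beta>/(1-r)" using r by (intro divide_right_mono) auto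
    show "0 <= \<mu>a N/(1-r)" using \<mu>a0 r by simp
   qed
   finally show ?thesis .
  qed
  have T: "htp2 {1..N} (xx N) (%i j. \<Lambda> * kap N i j) <= F"
  proof -
   define y where "y i j = \<Lambda> * kap N i j + (xx N i j)^2" for i j
   have yb: "y i j <= (\<delta>*\<beta>^2 + \<beta>^2/real N) * bm N i j" and y0: "0 <= y i j" if ij: "i \<in> {1..N}" "j \<in> {1..N}" for i j
   proof -
    have "\<Lambda> * kap N i j <= \<Lambda>*(t^2*\<theta> N * wt W N i j)" using kap_bounds(2)[OF ij] \<Lambda> unfolding t_def by (intro mult_left_mono) auto
    also have "\<dots> = \<delta>*(t^2*\<theta> N * u) * wt W N i j" unfolding \<Lambda>_def u_def by (simp add: mult_ac)
    also have "\<dots> <= \<delta>*(\<beta>^2/real N) * wt W N i j" using t2 \<delta> wt01[OF ij] by (intro mult_right_mono mult_left_mono) auto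
    also have "\<dots> = \<delta>*\<beta>^2 * bm N i j" unfolding bm_def by simp
    finally have 1: "\<Lambda> * kap N i j <= \<delta>*\<beta>^2 * bm N i j" .
    have "(xx N i j)^2 = xx N i j * xx N i j" by (simp add: power2_eq_square)
    also have "\<dots> <= (\<beta>/real N)*(\<beta> * bm N i j)"
    proof (rule mult_mono[OF xx_bounds(2)[OF ij]])
     show "xx N i j <= \<beta> * bm N i j" unfolding xx_def by (intro mult_right_mono ss_bounds[OF N] bm01 ij)
    qed (use xx_bounds[OF ij] beta in auto)
    also have "\<dots> = \<beta>^2/real N * bm N i j" by (simp add: power2_eq_square)
    finally show "y i j <= (\<delta>*\<beta>^2 + \<beta>^2/real N) * bm N i j" unfolding y_def using 1 by (simp add: distrib_right)
    show "0 <= y i j" unfolding y_def using \<Lambda> kap_bounds(1)[OF ij] by simp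
   qed
   have yI: "ising {1..N} y"
    by unfold_locales (use y0 wt_sym[of _ N] in \<open>auto simp: y_def kap_def xx_def bm_def wt_def[of W N i i for i]\<close>)
   have "htp2 {1..N} (xx N) (%i j. \<Lambda> * kap N i j) <= (ising.part {1..N} (xx N) p)^2 + ising.part {1..N} y q"
    unfolding q_def
   proof (rule htp2_exp_bound[OF xI yI p])
    show "y i j = \<Lambda> * kap N i j + (xx N i j)^2" for i j unfolding y_def ..
    fix i j assume ij: "i \<in> {1..N}" "j \<in> {1..N}"
    have "y i j <= (\<delta>*\<beta>^2 + \<beta>^2/real N)*(1/real N)"
     using yb[OF ij] bm01[OF ij] mult_left_mono[of "bm N i j" "1/real N" "\<delta>*\<beta>^2 + \<beta>^2/real N"] \<delta> by simp
    also have "\<dots> = (\<delta>*\<beta> + \<beta>/real N)*(\<beta>/real N)" by (simp add: power2_eq_square distrib_right distrib_left)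
    also have "\<dots> <= (\<delta>*\<beta>+1)*(1/(8*(\<delta>*\<beta>+1)))"
    proof (rule mult_mono[OF add_left_mono less_imp_le[OF ev4]])
     show "\<beta>/real N <= 1" using ev1 by linarith
    qed (use \<delta> beta in auto)
    also have "\<dots> = 1/8" using \<delta> beta by (simp add: add_pos_pos less_imp_neq[symmetric])
    finally show "2 * xx N i j + y i j <= 1" using x18[OF ij] by simp
   qed
   also have "\<dots> <= F"
    unfolding F_def
   proof (rule add_mono[OF power_mono])
    have "ising.part {1..N} (xx N) p = ising.part {1..N} (%i j. p * xx N i j) 1" using part_scaled[OF xI, of p 1] p by simp
    also have "\<dots> <= exp ((p*\<beta>)^2/(4*(1-r)))"
    proof (rule part_bm_bound(1)[OF N ising.scaled[OF xI] _ _ evp r(3)])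
     show "p * xx N i j <= p*\<beta> * bm N i j" if ij: "i \<in> {1..N}" "j \<in> {1..N}" for i j
      unfolding xx_def mult.assoc using p by (intro mult_left_mono mult_right_mono ss_bounds[OF N] bm01 ij) auto
    qed (use p beta in auto)
    finally show "ising.part {1..N} (xx N) p <= exp ((p*\<beta>)^2/(4*(1-r)))" .
    show "0 <= ising.part {1..N} (xx N) p" using ising.part_pos[OF xI, of p] by simp
    have "ising.part {1..N} y q = ising.part {1..N} (%i j. q * y i j) 1" using part_scaled[OF yI, of q 1] q by simp
    also have "\<dots> <= exp ((\<mu>y N)^2/(4*(1-r)))"
    proof (rule part_bm_bound(1)[OF N ising.scaled[OF yI] _ _ evy r(3)])
     show "q * y i j <= \<mu>y N * bm N i j" if ij: "i \<in> {1..N}" "j \<in> {1..N}" for i j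
      unfolding \<mu>y_def mult.assoc using q by (intro mult_left_mono yb ij) auto
    qed (use q \<delta> in \<open>auto simp: \<mu>y_def\<close>)
    also have "\<dots> <= exp ((2*\<beta>)^2/(4*(1-r)))"
    proof -
     have "0 <= \<mu>y N" unfolding \<mu>y_def using q \<delta> by simp
     then have "(\<mu>y N)^2 <= (2*\<beta>)^2" using evy2 by (intro power_mono) auto
     then show ?thesis using r by (simp add: divide_right_mono)
    qed
    finally show "ising.part {1..N} y q <= exp ((2*\<beta>)^2/(4*(1-r)))" .
   qed
   finally show ?thesis .
  qed
  have "htp2 {1..N} (xx N) (kap N) <= (htp {1..N} (xx N))^2*(1 + k * D/2) + htp2 {1..N} (xx N) (%i j. \<Lambda> * kap N i j)/\<Lambda>^2"
   unfolding D_def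
  proof (rule htp2_variance[OF xI _ _ \<Lambda>])
   show "xx N i j < 1" if "i \<in> {1..N}" "j \<in> {1..N}" for i j using x18[OF that] by simp
   show "0 <= kap N i j \<and> kap N i j <= k" if ij: "i \<in> {1..N}" "j \<in> {1..N}" for i j
   proof -
    have "k * wt W N i j <= k*1" using wt01[OF ij] k0 by (intro mult_left_mono) auto
    then show ?thesis using kap_bounds[OF ij] unfolding k_def t_def by simp
   qed
  qed
  also have "\<dots> <= (hh N)^2*(1 + k * D/2) + (hh N)^2*(F/\<Lambda>^2)"
  proof -
   have "1 <= (hh N)^2" using hh_ge_1[of N] by (simp add: one_le_power)
   then have "1*(F/\<Lambda>^2) <= (hh N)^2*(F/\<Lambda>^2)" using F by (intro mult_right_mono) auto
   moreover have "htp2 {1..N} (xx N) (%i j. \<Lambda> * kap N i j)/\<Lambda>^2 <= F/\<Lambda>^2" using T by (intro divide_right_mono) auto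
   ultimately show ?thesis unfolding hh_def by simp
  qed
  also have "\<dots> = (hh N)^2*(1 + (k * D/2 + F/\<Lambda>^2))" by (simp add: distrib_left)
  also have "\<dots> <= (hh N)^2*(1 + C/u^2)"
  proof (intro mult_left_mono add_mono order_refl)
   have "k <= \<beta>^2/u^2"
   proof -
    have "t^2 <= (\<beta>/u)^2" using u by (intro power_mono) auto
    then have "t^2*\<theta> N <= (\<beta>/u)^2*1" using theta[OF N] by (intro mult_mono) auto
    then show ?thesis unfolding k_def by (simp add: power_divide)
   qed
   then have kD: "k * D <= \<beta>^2/u^2*(2*\<beta>/(1-r))^2" using D by (rule mult_mono) (auto simp: D_def)
   have FL: "F/\<Lambda>^2 = (F/\<delta>^2)/u^2" unfolding \<Lambda>_def u_def by (simp add: power_mult_distrib)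
   have Cu: "C/u^2 = \<beta>^2/u^2*(2*\<beta>/(1-r))^2/2 + (F/\<delta>^2)/u^2" unfolding C_def by (simp add: add_divide_distrib)
   show "k * D/2 + F/\<Lambda>^2 <= C/u^2" unfolding FL Cu using kD by (simp only: add_le_cancel_right divide_right_mono zero_le_numeral)
  qed simp
  finally show "htp2 {1..N} (xx N) (kap N) <= (hh N)^2*(1 + C/(uu N)^2)" unfolding u_def .
 qed
 with C show ?thesis by (rule that)
qed

end

section \<open>The random graph with a fixed number of vertices\<close>

definition pairs :: "nat => (nat \<times> nat) set" where "pairs N = {(i, j). 1 <= i \<and> i <= j \<and> j <= N}"

lemma finite_pairs: "finite (pairs N)"
 by (rule finite_subset[of _ "{1..N} \<times> {1..N}"]) (auto simp: pairs_def)

lemma edges_pairs: "edges {1..N} \<subseteq> pairs N" by (auto simp: edges_def pairs_def)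

lemma sum_pairs: "(\<Sum>e\<in>pairs N. f e) = (\<Sum>i=1..N. f (i, i)) + (\<Sum>e\<in>edges {1..N}. f e)" for f :: "nat \<times> nat => real"
proof -
 have "pairs N = (%i. (i, i)) ` {1..N} \<union> edges {1..N}" by (force simp: edges_def pairs_def)
 then have "(\<Sum>e\<in>pairs N. f e) = (\<Sum>e\<in>(%i. (i, i)) ` {1..N} \<union> edges {1..N}. f e)" by simp
 also have "\<dots> = (\<Sum>e\<in>(%i. (i, i)) ` {1..N}. f e) + (\<Sum>e\<in>edges {1..N}. f e)"
  by (rule sum.union_disjoint[OF _ finite_edges]) (auto simp: edges_def)
 also have "(\<Sum>e\<in>(%i. (i, i)) ` {1..N}. f e) = (\<Sum>i=1..N. f (i, i))"
  by (subst sum.reindex) (auto simp: inj_on_def)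
 finally show ?thesis .
qed

definition coef :: "real => nat \<times> nat => real" where
 "coef b e = (if fst e = snd e then b/2 else ln (cosh b))"

lemma coef_nonneg: "0 <= b ==> 0 <= coef b e"
 unfolding coef_def using cosh_real_ge_1[of b] by simp

lemma exp_bernoulli_spin:
 fixes b e :: real assumes "e = 1 \<or> e = -1"
 shows "exp (b * of_bool P * e) = exp (ln (cosh b) * of_bool P)*(1 + tanh b * of_bool P * e)"
proof -
 have c: "cosh b > 0" by simp
 have "exp b = cosh b*(1 + tanh b)" "exp (- b) = cosh b*(1-tanh b)"
  using c unfolding tanh_def by (simp_all add: distrib_left right_diff_distrib sinh_plus_cosh[symmetric] cosh_minus_sinh[symmetric] add.commute)
 then show ?thesis using assms c by auto
qed

lemma second_moment_ratio:
 fixes h :: real assumes "0 < h" "E <= h^2*(1 + v)" shows "E/h^2 <= 1 + v"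
 using assms by (subst pos_divide_le_eq) (simp_all add: mult.commute)

locale random_edges = prob_space M for M :: "'a measure" +
 fixes N :: nat and th :: real and W :: "real \<times> real => real" and A :: "nat => nat => 'a => bool" and \<beta> :: real
 assumes RG: "random_graph M N th W A" and N1: "N >= 1" and th: "0 < th" "th < 1" and beta: "0 < \<beta>"
  and W01: "!!i j. i \<in> {1..N} ==> j \<in> {1..N} ==> 0 <= W (grid N i j) \<and> W (grid N i j) <= 1"
begin

definition B :: "nat \<times> nat => 'a => bool" where "B = (%(i, j). A i j)"
definition p :: "nat \<times> nat => real" where "p e = th * W (grid N (fst e) (snd e))"
definition b :: real where "b = \<beta>/(real N * th)"
definition Y :: "'a => real" where "Y w = exp (\<Sum>e\<in>pairs N. coef b e * of_bool (B e w))"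
definition Zh :: "'a => real" where
 "Zh w = savg {1..N} (%s. \<Prod>e\<in>edges {1..N}. 1 + tanh b * of_bool (B e w) * eps s e)"

lemma b_pos: "0 < b" unfolding b_def using N1 th beta by simp

lemma B_indep: "indep_vars (%_. count_space UNIV) B (pairs N)"
 using RG unfolding random_graph_def B_def pairs_def by auto

lemma B_distr: "e \<in> pairs N ==> distr M (count_space UNIV) (B e) = measure_pmf (bernoulli_pmf (p e))"
 using RG unfolding random_graph_def B_def pairs_def p_def by auto

lemma p01: assumes "e \<in> pairs N" shows "0 <= p e \<and> p e <= 1"
proof -
 have "fst e \<in> {1..N}" "snd e \<in> {1..N}" using assms unfolding pairs_def by auto
 from W01[OF this] th show ?thesis unfolding p_def by (auto intro: mult_le_one)
qed

lemma B_measurable [measurable]: "e \<in> pairs N ==> B e \<in> measurable M (count_space UNIV)"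
 using B_indep unfolding indep_vars_def by auto

lemma ind_measurable: assumes "e \<in> pairs N" shows "(%w. of_bool (B e w) :: real) \<in> borel_measurable M"
 using measurable_compose[OF B_measurable[OF assms], of "of_bool :: bool => real" borel] by simp

lemma Y_measurable: "Y \<in> borel_measurable M"
 unfolding Y_def[abs_def]
 by (intro borel_measurable_exp[THEN measurable_compose[rotated]] borel_measurable_sum borel_measurable_times borel_measurable_const ind_measurable)

lemma Zh_measurable: "Zh \<in> borel_measurable M"
 unfolding Zh_def[abs_def] savg_def
 by (intro borel_measurable_divide borel_measurable_sum borel_measurable_prod borel_measurable_add borel_measurable_times borel_measurable_const ind_measurable)
  (use edges_pairs in auto)

lemma partition_factor:
 assumes w: "w \<in> space M"
 shows "partition_fun \<beta> N th A w = Y w * Zh w"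
proof -
 define x :: "nat \<times> nat => real" where "x e = of_bool (B e w)" for e
 define f where "f s i j = of_bool (A i j w) * s i * s j" for s :: "nat => real" and i j
 have half_b: "\<beta>/(2 * real N * th) = b/2" unfolding b_def by simp
 have sym: "A i j w = A j i w" if "i \<in> {1..N}" "j \<in> {1..N}" for i j
  using RG w that unfolding random_graph_def by blast
 have term_eq: "exp (\<beta>/(2 * real N * th)*(\<Sum>i=1..N. \<Sum>j=1..N. f s i j))
  = Y w*(\<Prod>e\<in>edges {1..N}. 1 + tanh b * x e * eps s e)" if s: "s \<in> spins {1..N}" for s
 proof -
  have "(\<Sum>i=1..N. \<Sum>j=1..N. f s i j) = (\<Sum>i=1..N. \<Sum>j=1..N. (if i = j then 0 else f s i j) + (if j = i then f s i i else 0))"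
   by (intro sum.cong refl) auto
  also have "\<dots> = (\<Sum>i=1..N. \<Sum>j=1..N. if i = j then 0 else f s i j) + (\<Sum>i=1..N. f s i i)"
   unfolding sum.distrib by (simp add: sum.delta)
  also have "(\<Sum>i=1..N. \<Sum>j=1..N. if i = j then 0 else f s i j) = 2*(\<Sum>e\<in>edges {1..N}. if fst e = snd e then 0 else f s (fst e) (snd e))"
   by (rule sum_edges) (auto simp: f_def sym)
  also have "(\<Sum>e\<in>edges {1..N}. if fst e = snd e then 0 else f s (fst e) (snd e)) = (\<Sum>e\<in>edges {1..N}. x e * eps s e)"
   by (intro sum.cong refl) (auto simp: f_def x_def B_def edges_def)
  also have "(\<Sum>i=1..N. f s i i) = (\<Sum>i=1..N. x (i, i))"
  proof (intro sum.cong refl)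
   fix i assume "i \<in> {1..N}"
   from spins_val[OF s this] show "f s i i = x (i, i)" unfolding f_def x_def B_def by auto
  qed
  finally have "\<beta>/(2 * real N * th)*(\<Sum>i=1..N. \<Sum>j=1..N. f s i j) = (\<Sum>e\<in>edges {1..N}. b * x e * eps s e) + (\<Sum>i=1..N. b/2 * x (i, i))"
   unfolding half_b by (simp add: distrib_left sum_distrib_left mult.assoc)
  then have "exp (\<beta>/(2 * real N * th)*(\<Sum>i=1..N. \<Sum>j=1..N. f s i j)) = (\<Prod>e\<in>edges {1..N}. exp (b * x e * eps s e)) * exp (\<Sum>i=1..N. b/2 * x (i, i))"
   by (simp add: exp_add exp_sum finite_edges)
  also have "(\<Prod>e\<in>edges {1..N}. exp (b * x e * eps s e)) = (\<Prod>e\<in>edges {1..N}. exp (ln (cosh b) * x e)*(1 + tanh b * x e * eps s e))"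
   unfolding x_def by (intro prod.cong refl exp_bernoulli_spin eps_spin[OF s])
  also have "\<dots> = exp (\<Sum>e\<in>edges {1..N}. ln (cosh b) * x e)*(\<Prod>e\<in>edges {1..N}. 1 + tanh b * x e * eps s e)"
   unfolding prod.distrib by (simp add: exp_sum finite_edges)
  also have "\<dots> * exp (\<Sum>i=1..N. b/2 * x (i, i)) = Y w*(\<Prod>e\<in>edges {1..N}. 1 + tanh b * x e * eps s e)"
  proof -
   have "(\<Sum>e\<in>pairs N. coef b e * x e) = (\<Sum>i=1..N. b/2 * x (i, i)) + (\<Sum>e\<in>edges {1..N}. ln (cosh b) * x e)"
    unfolding sum_pairs by (intro arg_cong2[where f="(+)"] sum.cong refl) (auto simp: coef_def edges_def)
   then show ?thesis unfolding Y_def x_def[symmetric] by (simp add: exp_add)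
  qed
  finally show ?thesis .
 qed
 have "partition_fun \<beta> N th A w = savg {1..N} (%s. exp (\<beta>/(2 * real N * th)*(\<Sum>i=1..N. \<Sum>j=1..N. f s i j)))"
  unfolding partition_fun_def savg_def spins_def f_def by simp
 also have "\<dots> = savg {1..N} (%s. Y w*(\<Prod>e\<in>edges {1..N}. 1 + tanh b * x e * eps s e))"
  by (rule savg_cong) (rule term_eq)
 finally show ?thesis unfolding savg_cmult Zh_def x_def .
qed

lemma tanh_b: "0 <= tanh b" "tanh b < 1" using b_pos tanh_real_lt_1 by auto

lemma factor_bounds:
 assumes "s \<in> spins {1..N}" "e \<in> edges {1..N}"
 shows "0 < 1 + tanh b * of_bool P * eps s e" "1 + tanh b * of_bool P * eps s e <= 2"
proof -
 define t where "t = tanh b"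
 have t: "0 <= t" "t < 1" unfolding t_def by (rule tanh_b)+
 show "0 < 1 + tanh b * of_bool P * eps s e" "1 + tanh b * of_bool P * eps s e <= 2"
  unfolding t_def[symmetric] using eps_spin[OF assms] t by auto
qed

lemma Zh_bounds: "0 < Zh w" "Zh w <= 2^card (edges {1..N})"
proof -
 let ?F = "%s. \<Prod>e\<in>edges {1..N}. 1 + tanh b * of_bool (B e w) * eps s e"
 have "?F s > 0" if "s \<in> spins {1..N}" for s by (intro prod_pos factor_bounds that)
 moreover have "spins {1..N} ~= {}" "finite (spins {1..N})" by (auto simp: spins_def PiE_eq_empty_iff intro: finite_PiE)
 ultimately show "0 < Zh w" unfolding Zh_def savg_def by (intro divide_pos_pos sum_pos) auto
 have "Zh w <= savg {1..N} (%_. 2^card (edges {1..N}))" unfolding Zh_def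
 proof (rule savg_mono)
  fix s assume s: "s \<in> spins {1..N}"
  have "?F s <= (\<Prod>e\<in>edges {1..N}. 2)" by (intro prod_mono conjI less_imp_le factor_bounds s)
  then show "?F s <= 2^card (edges {1..N})" by simp
 qed
 then show "Zh w <= 2^card (edges {1..N})" by (simp add: savg_const)
qed

lemma Y_bounds: "0 < Y w" "Y w <= exp (\<Sum>e\<in>pairs N. coef b e)"
 unfolding Y_def using coef_nonneg[of b] b_pos by (auto intro!: sum_mono mult_left_le)

lemma expect_edges:
 fixes g :: "nat \<times> nat => bool => real"
 shows "expectation (%w. \<Prod>e\<in>edges {1..N}. g e (B e w)) = (\<Prod>e\<in>edges {1..N}. p e * g e True + (1-p e) * g e False)"
  and "integrable M (%w. \<Prod>e\<in>edges {1..N}. g e (B e w))"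
proof -
 note I = finite_edges[of "{1..N}"] indep_vars_subset[OF B_indep edges_pairs]
 have *: "e \<in> pairs N" if "e \<in> edges {1..N}" for e using that edges_pairs by auto
 show "expectation (%w. \<Prod>e\<in>edges {1..N}. g e (B e w)) = (\<Prod>e\<in>edges {1..N}. p e * g e True + (1-p e) * g e False)"
  using indep_bool_expectation(1)[OF I B_distr[OF *] p01[OF *], of g] by simp
 show "integrable M (%w. \<Prod>e\<in>edges {1..N}. g e (B e w))"
  using indep_bool_expectation(2)[OF I B_distr[OF *] p01[OF *], of g] by simp
qed

lemma savg_expectation:
 assumes "!!s. integrable M (F s)"
 shows "expectation (%w. savg V (%s. F s w)) = savg V (%s. expectation (F s))" "integrable M (%w. savg V (%s. F s w))"
 unfolding savg_def using assms by simp_all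

definition x :: "nat => nat => real" where "x i j = tanh b * th * wt W N i j"
definition \<kappa> :: "nat => nat => real" where "\<kappa> i j = (tanh b)^2*(th * wt W N i j)*(1-th * wt W N i j)"

lemma p_wt: "e \<in> edges {1..N} ==> p e = th * wt W N (fst e) (snd e)"
 by (auto simp: p_def wt_def edges_def)

lemma Zh_mean: "expectation Zh = htp {1..N} x"
proof -
 have "expectation Zh = savg {1..N} (%s. expectation (%w. \<Prod>e\<in>edges {1..N}. 1 + tanh b * of_bool (B e w) * eps s e))"
  unfolding Zh_def[abs_def] by (rule savg_expectation) (rule expect_edges)
 also have "\<dots> = htp {1..N} x"
  unfolding htp_def
 proof (rule savg_cong)
  fix s
  show "expectation (%w. \<Prod>e\<in>edges {1..N}. 1 + tanh b * of_bool (B e w) * eps s e) = (\<Prod>e\<in>edges {1..N}. 1 + x (fst e) (snd e) * eps s e)"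
   unfolding expect_edges(1)[of "%e P. 1 + tanh b * of_bool P * eps s e"]
   by (intro prod.cong refl) (simp add: p_wt x_def algebra_simps)
 qed
 finally show ?thesis .
qed

lemma Zh_square: "(Zh w)^2 = savg {1..N} (%s. savg {1..N} (%\<tau>. \<Prod>e\<in>edges {1..N}. (1 + tanh b * of_bool (B e w) * eps s e)*(1 + tanh b * of_bool (B e w) * eps \<tau> e)))"
 unfolding prod.distrib savg_cmult savg_cmult_right by (simp add: Zh_def power2_eq_square)

lemma Zh_second_moment: "expectation (%w. (Zh w)^2) = htp2 {1..N} x \<kappa>"
proof -
 let ?F = "%s \<tau> w. \<Prod>e\<in>edges {1..N}. (1 + tanh b * of_bool (B e w) * eps s e)*(1 + tanh b * of_bool (B e w) * eps \<tau> e)"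
 have i: "integrable M (?F s \<tau>)" for s \<tau>
  by (rule expect_edges(2)[of "%e P. (1 + tanh b * of_bool P * eps s e)*(1 + tanh b * of_bool P * eps \<tau> e)"])
 have "expectation (%w. (Zh w)^2) = savg {1..N} (%s. expectation (%w. savg {1..N} (%\<tau>. ?F s \<tau> w)))"
  unfolding Zh_square by (rule savg_expectation) (rule savg_expectation(2)[OF i])
 also have "\<dots> = savg {1..N} (%s. savg {1..N} (%\<tau>. expectation (?F s \<tau>)))"
  by (intro savg_cong savg_expectation(1) i)
 also have "\<dots> = htp2 {1..N} x \<kappa>"
  unfolding htp2_def
 proof (intro savg_cong)
  fix s \<tau>
  show "expectation (?F s \<tau>) = (\<Prod>e\<in>edges {1..N}. \<kappa> (fst e) (snd e)*(eps s e * eps \<tau> e) + (1 + x (fst e) (snd e) * eps s e)*(1 + x (fst e) (snd e) * eps \<tau> e))"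
   unfolding expect_edges(1)[of "%e P. (1 + tanh b * of_bool P * eps s e)*(1 + tanh b * of_bool P * eps \<tau> e)"]
   by (intro prod.cong refl) (simp add: p_wt x_def \<kappa>_def power2_eq_square algebra_simps)
 qed
 finally show ?thesis .
qed

lemma Zh_integrable: "integrable M Zh" "integrable M (%w. (Zh w)^2)"
proof -
 have "\<bar>Zh w\<bar> <= 2^card (edges {1..N})" for w using Zh_bounds[of w] by simp
 moreover have "\<bar>(Zh w)\<^sup>2\<bar> <= (2^card (edges {1..N}))^2" for w using Zh_bounds[of w] by (simp add: power_mono)
 ultimately show "integrable M Zh" "integrable M (%w. (Zh w)^2)"
  using Zh_measurable borel_measurable_power[OF Zh_measurable, of 2]
  by (auto intro: integrable_const_bound[where B="2^card (edges {1..N})"] integrable_const_bound[where B="(2^card (edges {1..N}))^2"])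
qed

lemma Y_integrable: "integrable M Y" "integrable M (%w. (Y w)^2)"
proof -
 let ?C = "exp (\<Sum>e\<in>pairs N. coef b e)"
 have "\<bar>Y w\<bar> <= ?C" for w using Y_bounds[of w] by simp
 moreover have "\<bar>(Y w)\<^sup>2\<bar> <= ?C\<^sup>2" for w using Y_bounds[of w] by (simp add: power_mono less_imp_le)
 ultimately show "integrable M Y" "integrable M (%w. (Y w)^2)"
  using Y_measurable borel_measurable_power[OF Y_measurable, of 2]
  by (auto intro: integrable_const_bound[where B="?C"] integrable_const_bound[where B="?C\<^sup>2"])
qed

definition EY :: real where "EY = (\<Prod>e\<in>pairs N. 1 + p e*(exp (coef b e)-1))"

lemma Y_prod: "Y w = (\<Prod>e\<in>pairs N. exp (coef b e * of_bool (B e w)))"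
 unfolding Y_def by (rule exp_sum[OF finite_pairs])

lemma Y_mean: "expectation Y = EY"
proof -
 have "expectation Y = (\<Prod>e\<in>pairs N. p e *\<^sub>R exp (coef b e * of_bool True) + (1-p e) *\<^sub>R exp (coef b e * of_bool False))"
  unfolding Y_prod[abs_def] by (rule indep_bool_expectation(1)[OF finite_pairs B_indep B_distr p01])
 then show ?thesis unfolding EY_def by (simp add: algebra_simps)
qed

lemma EY_pos: "0 < EY"
 unfolding EY_def using p01 coef_nonneg[of b] b_pos by (auto intro!: prod_pos add_pos_nonneg mult_nonneg_nonneg)

lemma Y_second_moment: "expectation (%w. (Y w)^2) <= EY^2 * exp (\<Sum>e\<in>pairs N. p e*(exp (coef b e)-1)^2)"
proof -
 have "(Y w)^2 = (\<Prod>e\<in>pairs N. (exp (coef b e * of_bool (B e w)))^2)" for w unfolding Y_prod by (simp add: prod_power_distrib)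
 then have "expectation (%w. (Y w)^2) = (\<Prod>e\<in>pairs N. p e *\<^sub>R (exp (coef b e * of_bool True))\<^sup>2 + (1-p e) *\<^sub>R (exp (coef b e * of_bool False))\<^sup>2)"
  using indep_bool_expectation(1)[OF finite_pairs B_indep B_distr p01, of "%e P. (exp (coef b e * of_bool P))^2"] by simp
 also have "\<dots> <= (\<Prod>e\<in>pairs N. (1 + p e*(exp (coef b e)-1))^2 * exp (p e*(exp (coef b e)-1)^2))"
 proof (rule prod_mono)
  fix e assume e: "e \<in> pairs N"
  define u where "u = exp (coef b e) - 1"
  have u: "0 <= u" unfolding u_def using coef_nonneg[of b e] b_pos by simp
  have p: "0 <= p e" "p e <= 1" using p01[OF e] by auto
  have E: "exp (coef b e) = 1 + u" unfolding u_def by simp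
  have "p e*(1 + u)^2 + (1-p e) = (1 + p e * u)^2 + p e*(1-p e) * u^2"
   by (simp add: power2_eq_square algebra_simps)
  also have "\<dots> <= (1 + p e * u)^2 + (1 + p e * u)^2*(p e * u^2)"
  proof (rule add_left_mono)
   have "p e*(1-p e) * u^2 <= 1*(p e * u^2)" using p by (simp add: mult.assoc mult_left_le_one_le mult_mono mult.left_commute)
   also have "\<dots> <= (1 + p e * u)^2*(p e * u^2)" using p u by (intro mult_right_mono one_le_power) auto
   finally show "p e*(1-p e) * u^2 <= (1 + p e * u)^2*(p e * u^2)" .
  qed
  also have "\<dots> = (1 + p e * u)^2*(1 + p e * u^2)" by (simp add: distrib_left)
  also have "\<dots> <= (1 + p e * u)^2 * exp (p e * u^2)" by (intro mult_left_mono exp_ge_add_one_self) simp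
  finally have "p e*(1 + u)^2 + (1-p e) <= (1 + p e * u)^2 * exp (p e * u^2)" .
  then show "0 <= p e *\<^sub>R (exp (coef b e * of_bool True))\<^sup>2 + (1-p e) *\<^sub>R (exp (coef b e * of_bool False))\<^sup>2 \<and>
   p e *\<^sub>R (exp (coef b e * of_bool True))\<^sup>2 + (1-p e) *\<^sub>R (exp (coef b e * of_bool False))\<^sup>2
   <= (1 + p e*(exp (coef b e)-1))^2 * exp (p e*(exp (coef b e)-1)^2)"
   using p unfolding u_def[symmetric] by (simp add: E)
 qed
 also have "\<dots> = EY^2 * exp (\<Sum>e\<in>pairs N. p e*(exp (coef b e)-1)^2)"
  unfolding prod.distrib EY_def exp_sum[OF finite_pairs] prod_power_distrib ..
 finally show ?thesis .
qed

text \<open>\<open>2 |y z| \<le> \<eta> y\<^sup>2 + z\<^sup>2/\<eta>\<close> for the normalized deviations; \<open>\<eta>\<close> balances the bounded variance of \<open>Y\<close> against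
the small one of \<open>Zh\<close>.\<close>

lemma covariance_bound:
 assumes h: "expectation Zh = h" "0 < h" and v: "expectation (%w. (Zh w)^2) <= h^2*(1 + v)" and \<eta>: "0 < \<eta>"
  and K: "exp (\<Sum>e\<in>pairs N. p e*(exp (coef b e)-1)^2) <= 1 + K"
 shows "\<bar>expectation (%w. Y w * Zh w)/(EY * h) - 1\<bar> <= (\<eta> * K + v/\<eta>)/2"
proof -
 define y where "y w = Y w/EY - 1" for w
 define z where "z w = Zh w/h - 1" for w
 have iYZ: "integrable M (%w. Y w * Zh w)"
 proof (rule integrable_const_bound[where B="exp (\<Sum>e\<in>pairs N. coef b e)*2^card (edges {1..N})"])
  show "(%w. Y w * Zh w) \<in> borel_measurable M" by (intro borel_measurable_times Y_measurable Zh_measurable)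
  have "norm (Y w * Zh w) <= exp (\<Sum>e\<in>pairs N. coef b e)*2^card (edges {1..N})" for w
   using Y_bounds[of w] Zh_bounds[of w] by (simp add: abs_mult mult_mono)
  then show "AE w in M. norm (Y w * Zh w) <= exp (\<Sum>e\<in>pairs N. coef b e)*2^card (edges {1..N})" by simp
 qed
 have y2: "(y w)^2 = (Y w)^2/EY^2 - 2*(Y w/EY) + 1" for w unfolding y_def by (simp add: power2_diff power_divide)
 have z2: "(z w)^2 = (Zh w)^2/h^2 - 2*(Zh w/h) + 1" for w unfolding z_def by (simp add: power2_diff power_divide)
 have yz: "y w * z w = Y w * Zh w/(EY * h) - Y w/EY - Zh w/h + 1" for w unfolding y_def z_def by (simp add: right_diff_distrib left_diff_distrib diff_divide_distrib)
 have iy: "integrable M (%w. (y w)^2)" and iz: "integrable M (%w. (z w)^2)" and iyz: "integrable M (%w. y w * z w)"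
  unfolding y2 z2 yz using Y_integrable Zh_integrable iYZ by simp_all
 have "expectation (%w. (y w)^2) = expectation (%w. (Y w)^2)/EY^2 - 2*(EY/EY) + 1"
  unfolding y2 using Y_integrable by (simp add: Y_mean prob_space)
 also have "\<dots> <= K"
 proof -
  have "expectation (%w. (Y w)^2) <= EY^2*(1 + K)" using Y_second_moment K by (meson mult_left_mono order_trans zero_le_power2)
  from second_moment_ratio[OF EY_pos this] show ?thesis using EY_pos by simp
 qed
 finally have Ey: "expectation (%w. (y w)^2) <= K" .
 have "expectation (%w. (z w)^2) = expectation (%w. (Zh w)^2)/h^2 - 2*(h/h) + 1"
  unfolding z2 using Zh_integrable by (simp add: h(1) prob_space)
 also have "\<dots> <= v" using second_moment_ratio[OF h(2) v] h(2) by simp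
 finally have Ez: "expectation (%w. (z w)^2) <= v" .
 have pt: "\<bar>y w * z w\<bar> <= (\<eta>*(y w)^2 + (z w)^2/\<eta>)/2" for w
 proof -
  have "0 <= (sqrt \<eta>*\<bar>y w\<bar> - \<bar>z w\<bar>/sqrt \<eta>)^2" by simp
  also have "\<dots> = \<eta>*(y w)^2 + (z w)^2/\<eta> - 2*(\<bar>y w\<bar>*\<bar>z w\<bar>)"
   using \<eta> by (simp add: power2_diff power_mult_distrib power_divide)
  finally show ?thesis by (simp add: abs_mult)
 qed
 have "expectation (%w. Y w * Zh w)/(EY * h) - 1 = expectation (%w. y w * z w)"
  unfolding yz using Y_integrable Zh_integrable iYZ EY_pos h by (simp add: Y_mean prob_space)
 also have "\<bar>\<dots>\<bar> <= expectation (%w. \<bar>y w * z w\<bar>)" using integral_norm_bound[of M "%w. y w * z w"] by simp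
 also have "\<dots> <= expectation (%w. (\<eta>*(y w)^2 + (z w)^2/\<eta>)/2)"
  by (rule integral_mono) (use iy iz iyz pt in auto)
 also have "\<dots> = (\<eta> * expectation (%w. (y w)^2) + expectation (%w. (z w)^2)/\<eta>)/2" using iy iz by simp
 also have "\<dots> <= (\<eta> * K + v/\<eta>)/2" using Ey Ez \<eta> by (simp add: add_mono divide_right_mono)
 finally show ?thesis .
qed

lemma Zh_deviation:
 assumes h: "expectation Zh = h" "0 < h" and v: "expectation (%w. (Zh w)^2) <= h^2*(1 + v)" and \<delta>: "0 < \<delta>"
 shows "prob {w\<in>space M. \<delta> <= \<bar>Zh w/h - 1\<bar>} <= v/\<delta>^2"
proof -
 define z where "z w = Zh w/h" for w
 have zm: "z \<in> borel_measurable M" unfolding z_def by (intro borel_measurable_divide Zh_measurable borel_measurable_const)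
 have z2: "(z w)^2 = (Zh w)^2/h^2" for w unfolding z_def by (simp add: power_divide)
 have i: "integrable M (%w. (z w)^2)" "integrable M z" unfolding z2 unfolding z_def using Zh_integrable by simp_all
 have m: "expectation z = 1" unfolding z_def using h by simp
 have "prob {w\<in>space M. \<delta> <= \<bar>z w - expectation z\<bar>} <= variance z/\<delta>^2"
  by (rule Chebyshev_inequality[OF zm i(1) \<delta>])
 also have "variance z = expectation (%w. (z w)^2) - 1" using variance_eq[OF i(2) i(1)] m by simp
 also have "\<dots> <= v" unfolding z2 using second_moment_ratio[OF h(2) v] by simp
 finally show ?thesis using \<delta> h unfolding m z_def by (simp add: divide_right_mono)
qed

lemma ln_EY:
 assumes b1: "coef b (0,0) <= 1" "coef b (0,1) <= 1"
 shows "\<bar>ln EY - (\<Sum>e\<in>pairs N. coef b e * p e)\<bar> <= 4*(\<Sum>e\<in>pairs N. (coef b e)^2 * p e)"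
  and "(\<Sum>e\<in>pairs N. p e*(exp (coef b e)-1)^2) <= 4*(\<Sum>e\<in>pairs N. (coef b e)^2 * p e)"
proof -
 have c: "0 <= coef b e" "coef b e <= 1" for e using b1 coef_nonneg[of b e] b_pos unfolding coef_def by (auto split: if_splits)
 have u: "coef b e <= exp (coef b e) - 1" "exp (coef b e) - 1 <= coef b e + (coef b e)^2" "exp (coef b e) - 1 <= 2 * coef b e" for e
 proof -
  show "coef b e <= exp (coef b e) - 1" using exp_ge_add_one_self[of "coef b e"] by linarith
  show *: "exp (coef b e) - 1 <= coef b e + (coef b e)^2" using exp_bound[OF c(1) c(2), of e] by simp
  have "(coef b e)^2 <= coef b e" using c[of e] by (simp add: power2_eq_square mult_left_le)
  then show "exp (coef b e) - 1 <= 2 * coef b e" using * by linarith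
 qed
 have sqle: "(exp (coef b e)-1)^2 <= 4*(coef b e)^2" for e
 proof -
  have "0 <= exp (coef b e) - 1" using u(1)[of e] c(1)[of e] by linarith
  then have "(exp (coef b e)-1)^2 <= (2 * coef b e)^2" by (intro power_mono u)
  then show ?thesis by (simp add: power_mult_distrib)
 qed
 show "(\<Sum>e\<in>pairs N. p e*(exp (coef b e)-1)^2) <= 4*(\<Sum>e\<in>pairs N. (coef b e)^2 * p e)"
  unfolding sum_distrib_left
 proof (rule sum_mono)
  fix e assume "e \<in> pairs N"
  then show "p e*(exp (coef b e)-1)^2 <= 4*((coef b e)^2 * p e)"
   using mult_left_mono[OF sqle, of "p e" e] p01[of e] by (simp add: mult_ac)
 qed
 have pos: "0 < 1 + p e*(exp (coef b e)-1)" if "e \<in> pairs N" for e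
  using p01[OF that] u(1)[of e] c(1)[of e] by (intro add_pos_nonneg mult_nonneg_nonneg) auto
 have "ln EY = (\<Sum>e\<in>pairs N. ln (1 + p e*(exp (coef b e)-1)))"
  unfolding EY_def by (rule ln_prod[OF finite_pairs]) (use pos in fastforce)
 then have "\<bar>ln EY - (\<Sum>e\<in>pairs N. coef b e * p e)\<bar> = \<bar>\<Sum>e\<in>pairs N. ln (1 + p e*(exp (coef b e)-1)) - coef b e * p e\<bar>"
  by (simp add: sum_subtractf)
 also have "\<dots> <= (\<Sum>e\<in>pairs N. 4*((coef b e)^2 * p e))"
 proof (rule order_trans[OF sum_abs sum_mono])
  fix e assume e: "e \<in> pairs N"
  define v where "v = p e*(exp (coef b e)-1)"
  have p: "0 <= p e" "p e <= 1" using p01[OF e] by auto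
  have v0: "0 <= v" unfolding v_def using p u(1)[of e] c(1)[of e] by (intro mult_nonneg_nonneg) auto
  have v1: "p e * coef b e <= v" unfolding v_def using p u(1) by (intro mult_left_mono)
  have v2: "v <= p e * coef b e + p e*(coef b e)^2" unfolding v_def using mult_left_mono[OF u(2)[of e] p(1)] by (simp add: distrib_left)
  have v3: "v^2 <= 4*((coef b e)^2 * p e)"
  proof -
   have "v^2 = (p e * p e)*(exp (coef b e)-1)^2" unfolding v_def by (simp add: power_mult_distrib power2_eq_square)
   also have "\<dots> <= (p e*1)*(4*(coef b e)^2)" using p sqle by (intro mult_mono) auto
   finally show ?thesis by (simp add: mult_ac)
  qed
  have l1: "ln (1 + v) <= v" by (rule ln_add_one_self_le_self[OF v0])
  have l2: "v - v^2 <= ln (1 + v)"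
  proof -
   have "- v\<^sup>2 <= ln (1 + v) - v"
   proof -
    have "v/(1 + v) <= ln (1 + v)"
     using ln_le_minus_one[of "1/(1 + v)"] v0 by (simp add: ln_div field_simps)
    moreover have "v - v^2 <= v/(1 + v)" using v0 by (simp add: field_simps power2_eq_square)
    ultimately show ?thesis by linarith
   qed
   then show ?thesis by linarith
  qed
  have c2: "0 <= p e*(coef b e)^2" using p by simp
  have "ln (1 + v) - coef b e * p e <= 4*((coef b e)^2 * p e)" using l1 v2 c2 by (simp add: mult.commute)
  moreover have "- (4*((coef b e)^2 * p e)) <= ln (1 + v) - coef b e * p e" using l2 v1 v3 by (simp add: mult.commute)
  ultimately show "\<bar>ln (1 + p e*(exp (coef b e)-1)) - coef b e * p e\<bar> <= 4*((coef b e)^2 * p e)"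
   unfolding v_def[symmetric] by linarith
 qed
 finally show "\<bar>ln EY - (\<Sum>e\<in>pairs N. coef b e * p e)\<bar> <= 4*(\<Sum>e\<in>pairs N. (coef b e)^2 * p e)"
  by (simp add: sum_distrib_left)
qed

end

section \<open>The central limit theorem for the partition function\<close>

locale sparse_graphs = sparse_regime W \<beta> \<theta> for W \<beta> \<theta> +
 fixes M :: "nat => 'a measure" and A :: "nat => nat => nat => 'a => bool"
 assumes RG: "!!N. N >= 1 ==> random_graph (M N) N (\<theta> N) W (A N)"
begin

lemma corner_W01: assumes "i \<in> {1..N}" "j \<in> {1..N}" shows "0 <= W (grid N i j) \<and> W (grid N i j) <= 1"
proof -
 have "N >= 1" using assms by auto
 from W01[of "(grid N i j)"] corner01[OF this assms(1)] corner01[OF this assms(2)] show ?thesis by auto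
qed

lemma graph: assumes N: "N >= 1" shows "random_edges (M N) N (\<theta> N) W (A N) \<beta>"
proof -
 have "prob_space (M N)" using RG[OF N] unfolding random_graph_def by simp
 then show ?thesis
  by (intro random_edges.intro random_edges_axioms.intro RG[OF N] N corner_W01 beta) (use theta[OF N] in auto)
qed

abbreviation v3 :: "nat => real" where "v3 N \<equiv> (real N)\<^sup>2*\<theta> N^3"
abbreviation lc :: "nat => real" where "lc N \<equiv> ln (cosh (bb N))"
abbreviation ZH :: "nat => 'a => real" where "ZH N \<equiv> random_edges.Zh N (\<theta> N) (A N) \<beta>"
abbreviation YY :: "nat => 'a => real" where "YY N \<equiv> random_edges.Y N (\<theta> N) (A N) \<beta>"
abbreviation pr :: "nat => nat \<times> nat => real" where "pr N \<equiv> random_edges.p N (\<theta> N) W"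
abbreviation BB :: "nat => nat \<times> nat => 'a => bool" where "BB N \<equiv> random_edges.B (A N)"
abbreviation cc :: "nat => nat \<times> nat => real" where "cc N \<equiv> coef (bb N)"
abbreviation Z :: "nat => 'a => real" where "Z N \<equiv> partition_fun \<beta> N (\<theta> N) (A N)"

text \<open>Mean, second-moment bound, variance and centred value of \<open>ln Y\<close>.\<close>

definition LL :: "nat => real" where "LL N = (\<Sum>e\<in>pairs N. cc N e * pr N e)"
definition UU :: "nat => real" where "UU N = (\<Sum>e\<in>pairs N. (cc N e)^2 * pr N e)"
definition VV :: "nat => real" where "VV N = (\<Sum>e\<in>pairs N. (cc N e)^2*(pr N e*(1-pr N e)))"
definition SS :: "nat => 'a => real" where "SS N w = (\<Sum>e\<in>pairs N. cc N e*(of_bool (BB N e w) - pr N e))"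

lemma random_b: "random_edges.b N (\<theta> N) \<beta> = bb N"
 if "N >= 1" unfolding random_edges.b_def[OF graph[OF that]] bb_def ..

lemma pr_def: "pr N e = \<theta> N * W (grid N (fst e) (snd e))" if "N >= 1"
 unfolding random_edges.p_def[OF graph[OF that]] ..

lemma LL_eq: assumes N: "N >= 1" shows "LL N = bb N/2*\<theta> N * D1 N + lc N*\<theta> N * E1 N"
 unfolding LL_def sum_pairs loopsum_def edgesum_def pr_def[OF N] sum_distrib_left
 by (intro arg_cong2[where f="(+)"] sum.cong refl) (auto simp: coef_def edges_def)

lemma UU_eq: assumes N: "N >= 1" shows "UU N = (bb N/2)^2*\<theta> N * D1 N + (lc N)^2*\<theta> N * E1 N"
 unfolding UU_def sum_pairs loopsum_def edgesum_def pr_def[OF N] sum_distrib_left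
 by (intro arg_cong2[where f="(+)"] sum.cong refl) (auto simp: coef_def edges_def)

lemma VV_eq: assumes N: "N >= 1"
 shows "VV N = (bb N/2)^2*\<theta> N*(D1 N - \<theta> N * loopsum (%x. x\<^sup>2) N)
  + (lc N)^2*\<theta> N*(E1 N - \<theta> N * edgesum (%x. x\<^sup>2) N)"
 unfolding VV_def sum_pairs loopsum_def edgesum_def pr_def[OF N] sum_distrib_left sum_subtractf[symmetric]
 by (intro arg_cong2[where f="(+)"] sum.cong refl) (auto simp: coef_def edges_def power2_eq_square algebra_simps)

lemma lncosh_limit: "(%N. lc N/(bb N)^2) ----> 1/2"
proof -
 have l: "((%x::real. ln (cosh x)/x^2) \<longlongrightarrow> 1/2) (at_right 0)"
  unfolding cosh_def by simp real_asymp
 show ?thesis by (rule filterlim_compose[OF l bb_at_right])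
qed

text \<open>Loop weights squared are of order \<open>1/(N\<theta>)\<^sup>2\<close> and \<open>(ln cosh b)\<^sup>2 \<sim> b\<^sup>4/4\<close>; the number of terms and the edge
probability turn them into the two scales.\<close>

lemma quadratic_limit:
 assumes s1: "(%N. s N/uu N) ----> \<gamma>" and s2: "(%N. s N/v3 N) ----> \<gamma>'"
  and D: "(%N. D N/real N) ----> d" and E: "(%N. E N/(real N)^2) ----> e"
 shows "(%N. s N*((bb N/2)^2*\<theta> N * D N + (lc N)^2*\<theta> N * E N)) ----> \<gamma>*\<beta>^2/4 * d + \<gamma>'*\<beta>^4/4 * e"
proof -
 have "(%N. \<beta>\<^sup>2/4*(s N/uu N)*(D N/real N) + (lc N/(bb N)^2)^2*\<beta>^4*(s N/v3 N)*(E N/(real N)^2))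
  ----> \<beta>\<^sup>2/4*\<gamma> * d + (1/2)^2*\<beta>^4*\<gamma>' * e"
  by (intro tendsto_add tendsto_mult tendsto_power tendsto_const s1 s2 D E lncosh_limit)
 then show ?thesis
 proof (rule tendsto_eventually_1', goal_cases)
  case 1 show ?case by (simp add: power2_eq_square mult_ac)
  case (2 N)
  define l n where "l = lc N" and "n = real N"
  have n: "n ~= 0" "\<theta> N ~= 0" using 2 theta[OF 2] unfolding n_def by auto
  show ?case
   unfolding l_def[symmetric] bb_def n_def[symmetric] using n beta
   by (simp add: power_divide power_mult_distrib distrib_left) (simp add: field_simps power2_eq_square power3_eq_cube power4_eq_xxxx)
 qed
qed

lemma UU_limit:
 assumes "(%N. s N/uu N) ----> \<gamma>" "(%N. s N/v3 N) ----> \<gamma>'"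
 shows "(%N. s N * UU N) ----> \<gamma>*\<beta>^2/4 * W1d + \<gamma>'*\<beta>^4/4*(W1/2)"
 by (rule Lim_transform_eventually[OF quadratic_limit[OF assms loop1 edge1] eventually_1]) (simp add: UU_eq)

lemma VV_limit:
 assumes s: "(%N. s N/uu N) ----> \<gamma>" "(%N. s N/v3 N) ----> \<gamma>'" and t: "\<theta> ----> \<tau>"
 shows "(%N. s N * VV N) ----> \<gamma>*\<beta>^2/4*(W1d - \<tau> * W2d) + \<gamma>'*\<beta>^4/4*(W1/2 - \<tau>*(W2/2))"
proof -
 have D: "(%N. (D1 N - \<theta> N * loopsum (%x. x\<^sup>2) N)/real N) ----> W1d - \<tau> * W2d"
  unfolding diff_divide_distrib times_divide_eq_right[symmetric] by (intro tendsto_diff tendsto_mult t loop1 loop2)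
 have E: "(%N. (E1 N - \<theta> N * edgesum (%x. x\<^sup>2) N)/(real N)^2) ----> W1/2 - \<tau>*(W2/2)"
  unfolding diff_divide_distrib times_divide_eq_right[symmetric] by (intro tendsto_diff tendsto_mult t edge1 edge2)
 show ?thesis
  by (rule Lim_transform_eventually[OF quadratic_limit[OF s D E] eventually_1]) (simp add: VV_eq)
qed

lemma inv_u: "(%N. 1/uu N) ----> 0"
 using inv_dense by (simp add: filterlim_at inverse_eq_divide)

lemma cc_bounds: assumes N: "N >= 1" shows "0 <= cc N e" "cc N e <= bb N"
proof -
 have b: "0 < bb N" by (rule Nth(2)[OF N])
 show "0 <= cc N e" using coef_nonneg[of "bb N"] b by simp
 have "exp (- bb N) <= exp (bb N)" using b by simp
 then have "cosh (bb N) <= exp (bb N)" unfolding cosh_def by simp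
 then have "lc N <= ln (exp (bb N))" by (subst ln_le_cancel_iff) auto
 then have "lc N <= bb N" by simp
 then show "cc N e <= bb N" unfolding coef_def using b by simp
qed

lemma char_limit:
 assumes a: "!!N. N >= 1 ==> 0 <= a N" and a1: "(%N. (a N)^2/uu N) ----> \<gamma>" and a2: "(%N. (a N)^2/v3 N) ----> \<gamma>'"
  and t: "\<theta> ----> \<tau>" and v: "v = \<gamma>*\<beta>^2/4*(W1d - \<tau> * W2d) + \<gamma>'*\<beta>^4/4*(W1/2 - \<tau>*(W2/2))"
  and au: "(%N. a N/uu N) ----> 0"
 shows "(%N. CLINT w|M N. iexp (t*(a N * SS N w))) ----> of_real (exp (- (v * t^2)/2))"
proof -
 define E where "E N = complex_of_real (exp (- (((a N)^2 * VV N) * t^2)/2))" for N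
 define R where "R N = (\<bar>t\<bar>^3*(a N * bb N) + t^4*(a N * bb N)^2)*((a N)^2 * UU N)" for N
 have lim: "E ----> of_real (exp (- (v * t^2)/2))" unfolding E_def v
  by (intro tendsto_of_real tendsto_exp tendsto_divide tendsto_minus tendsto_mult tendsto_const VV_limit a1 a2 t) simp
 have ab: "(%N. a N * bb N) ----> 0"
  using tendsto_mult[OF au tendsto_const[of \<beta>]] unfolding bb_def by (simp add: mult.commute)
 have "R ----> (\<bar>t\<bar>^3*0 + t^4*0\<^sup>2)*(\<gamma>*\<beta>^2/4 * W1d + \<gamma>'*\<beta>^4/4*(W1/2))"
  unfolding R_def by (intro tendsto_intros ab UU_limit a1 a2)
 then have R: "R ----> 0" by simp
 have main: "EV N. norm ((CLINT w|M N. iexp (t*(a N * SS N w))) - E N) <= R N"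
 proof (rule eventually_1)
  fix N :: nat assume N: "N >= 1"
  interpret G: random_edges "M N" N "\<theta> N" W "A N" \<beta> by (rule graph[OF N])
  have c: "\<bar>a N * cc N e\<bar> <= a N * bb N" if "e \<in> pairs N" for e
   using a[OF N] cc_bounds[OF N, of e] by (simp add: abs_mult mult_left_mono)
  have "norm ((CLINT w|M N. iexp (t*(\<Sum>e\<in>pairs N. (a N * cc N e)*(of_bool (G.B e w) - G.p e))))
   - of_real (exp (- ((\<Sum>e\<in>pairs N. (a N * cc N e)^2*(G.p e*(1-G.p e))) * t^2)/2)))
  <= (\<bar>t\<bar>^3*(a N * bb N) + t^4*(a N * bb N)^2)*(\<Sum>e\<in>pairs N. (a N * cc N e)^2 * G.p e)"
   by (rule G.bernoulli_sum_char_approx[OF finite_pairs G.B_indep G.B_distr G.p01 c])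
  moreover have "(\<Sum>e\<in>pairs N. (a N * cc N e)*(of_bool (G.B e w) - G.p e)) = a N * SS N w" for w
   unfolding SS_def sum_distrib_left by (simp add: mult.assoc)
  moreover have "(\<Sum>e\<in>pairs N. (a N * cc N e)^2*(G.p e*(1-G.p e))) = (a N)^2 * VV N"
   unfolding VV_def sum_distrib_left by (simp add: power_mult_distrib mult.assoc)
  moreover have "(\<Sum>e\<in>pairs N. (a N * cc N e)^2 * G.p e) = (a N)^2 * UU N"
   unfolding UU_def sum_distrib_left by (simp add: power_mult_distrib mult.assoc)
  ultimately show "norm ((CLINT w|M N. iexp (t*(a N * SS N w))) - E N) <= R N"
   unfolding E_def R_def by simp
 qed
 have "(%N. (CLINT w|M N. iexp (t*(a N * SS N w))) - E N) ----> 0"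
  by (rule Lim_null_comparison[OF main R])
 from tendsto_add[OF this lim] show ?thesis by simp
qed

lemma x_eq: assumes N: "N >= 1" shows "random_edges.x N (\<theta> N) W \<beta> = xx N"
proof (intro ext)
 fix i j show "random_edges.x N (\<theta> N) W \<beta> i j = xx N i j"
  unfolding random_edges.x_def[OF graph[OF N]] random_b[OF N] xx_def ss_def bm_def using N by simp
qed

lemma kap_eq: assumes N: "N >= 1" shows "random_edges.\<kappa> N (\<theta> N) W \<beta> = kap N"
proof (intro ext)
 fix i j show "random_edges.\<kappa> N (\<theta> N) W \<beta> i j = kap N i j"
  unfolding random_edges.\<kappa>_def[OF graph[OF N]] random_b[OF N] kap_def ..
qed

lemma ZH_moments: assumes N: "N >= 1"
 shows "(\<integral>w. ZH N w \<partial>M N) = hh N" "(\<integral>w. (ZH N w)^2 \<partial>M N) = htp2 {1..N} (xx N) (kap N)"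
 using random_edges.Zh_mean[OF graph[OF N]] random_edges.Zh_second_moment[OF graph[OF N]]
 unfolding x_eq[OF N] kap_eq[OF N] hh_def by simp_all

lemma hh_pos: "0 < hh N" using hh_ge_1[of N] by simp

lemma abs_ln_le: fixes x :: real assumes "\<bar>x - 1\<bar> <= 1/2" shows "\<bar>ln x\<bar> <= 2*\<bar>x - 1\<bar>"
 using abs_ln_one_plus_x_minus_x_bound[of "x - 1"] assms power2_eq_square[of "x - 1"] mult_left_mono[of "\<bar>x - 1\<bar>" "1/2" "\<bar>x - 1\<bar>"]
 by (simp add: abs_mult_self_eq) (smt (verit) abs_mult_self_eq power2_abs power2_eq_square)

lemma ln_ZH_concentrates:
 assumes a: "!!N. N >= 1 ==> 0 <= a N" and au: "(%N. a N/uu N) ----> 0"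
 shows "tends_in_prob_0 M (%N w. a N*(ln (ZH N w) - ln (hh N)))"
 unfolding tends_in_prob_0_def
proof (intro allI impI)
 fix \<epsilon> :: real assume \<epsilon>: "0 < \<epsilon>"
 obtain C where C: "0 < C" "EV N. htp2 {1..N} (xx N) (kap N) <= (hh N)^2*(1 + C/(uu N)^2)"
  by (rule second_moment)
 define R where "R N = C*(4*(1/uu N)^2 + 4*(a N/uu N)^2/\<epsilon>^2)" for N
 have "R ----> C*(4*0\<^sup>2 + 4*0\<^sup>2/\<epsilon>^2)" unfolding R_def by (intro tendsto_intros inv_u au) (use \<epsilon> in simp)
 then have R: "R ----> 0" by simp
 show "(%N. measure (M N) {w\<in>space (M N). \<epsilon> < \<bar>a N*(ln (ZH N w) - ln (hh N))\<bar>}) ----> 0"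
 proof (rule real_tendsto_sandwich[where f="%_. 0", OF _ _ tendsto_const R])
  show "EV N. measure (M N) {w\<in>space (M N). \<epsilon> < \<bar>a N*(ln (ZH N w) - ln (hh N))\<bar>} <= R N"
   using C(2) eventually_ge_at_top[of 1]
  proof eventually_elim
   fix N :: nat assume c: "htp2 {1..N} (xx N) (kap N) <= (hh N)^2*(1 + C/(uu N)^2)" and N: "1 <= N"
   interpret G: random_edges "M N" N "\<theta> N" W "A N" \<beta> by (rule graph[OF N])
   note zm [measurable] = G.Zh_measurable
   define \<delta> where "\<delta> = (if a N = 0 then 1/2 else min (1/2) (\<epsilon>/(2 * a N)))"
   have \<delta>: "0 < \<delta>" "\<delta> <= 1/2" "2 * a N*\<delta> <= \<epsilon>"
   proof -
    show "0 < \<delta>" "\<delta> <= 1/2" unfolding \<delta>_def using \<epsilon> a[OF N] by auto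
    show "2 * a N*\<delta> <= \<epsilon>"
    proof (cases "a N = 0")
     case False
     then have "0 < a N" using a[OF N] by simp
     then have "2 * a N*\<delta> <= 2 * a N*(\<epsilon>/(2 * a N))" unfolding \<delta>_def using False by (intro mult_left_mono) auto
     then show ?thesis using False by simp
    qed (use \<epsilon> in simp)
   qed
   have inv: "1/\<delta>^2 <= 4 + 4*(a N)^2/\<epsilon>^2"
   proof (cases "\<delta> = 1/2")
    case True show ?thesis unfolding True by (simp add: power2_eq_square)
   next
    case False
    then have "a N ~= 0" "\<delta> = \<epsilon>/(2 * a N)" unfolding \<delta>_def by (auto split: if_splits simp: min_def)
    then have "1/\<delta>^2 = 4*(a N)^2/\<epsilon>^2" by (simp add: power_divide power_mult_distrib)
    then show ?thesis by simp
   qed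
   have sub: "{w\<in>space (M N). \<epsilon> < \<bar>a N*(ln (ZH N w) - ln (hh N))\<bar>} \<subseteq> {w\<in>space (M N). \<delta> <= \<bar>ZH N w/hh N - 1\<bar>}"
   proof (intro subsetI CollectI conjI; elim CollectE conjE)
    fix w assume e: "\<epsilon> < \<bar>a N*(ln (ZH N w) - ln (hh N))\<bar>"
    show "\<delta> <= \<bar>ZH N w/hh N - 1\<bar>"
    proof (rule ccontr)
     assume *: "\<not> \<delta> <= \<bar>ZH N w/hh N - 1\<bar>"
     then have l: "\<bar>ln (ZH N w/hh N)\<bar> <= 2*\<bar>ZH N w/hh N - 1\<bar>" using \<delta>(2) by (intro abs_ln_le) linarith
     have "\<bar>a N*(ln (ZH N w) - ln (hh N))\<bar> = a N*\<bar>ln (ZH N w/hh N)\<bar>"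
      using G.Zh_bounds(1)[of w] hh_pos[of N] a[OF N] by (simp add: ln_div abs_mult)
     also have "\<dots> <= a N*(2*\<delta>)" using l * a[OF N] by (intro mult_left_mono) auto
     also have "\<dots> <= \<epsilon>" using \<delta>(3) by (simp add: mult_ac)
     finally show False using e by simp
    qed
   qed auto
   have "measure (M N) {w\<in>space (M N). \<epsilon> < \<bar>a N*(ln (ZH N w) - ln (hh N))\<bar>} <= measure (M N) {w\<in>space (M N). \<delta> <= \<bar>ZH N w/hh N - 1\<bar>}"
    by (rule G.finite_measure_mono[OF sub]) measurable
   also have "\<dots> <= (C/(uu N)^2)/\<delta>^2"
    by (rule G.Zh_deviation[OF ZH_moments(1)[OF N] hh_pos _ \<delta>(1)]) (simp only: ZH_moments(2)[OF N] c)
   also have "\<dots> = (C/(uu N)^2)*(1/\<delta>^2)" by simp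
   also have "\<dots> <= (C/(uu N)^2)*(4 + 4*(a N)^2/\<epsilon>^2)" using C(1) by (intro mult_left_mono inv) auto
   also have "\<dots> = R N" unfolding R_def by (simp add: power_divide distrib_left mult_ac)
   finally show "measure (M N) {w\<in>space (M N). \<epsilon> < \<bar>a N*(ln (ZH N w) - ln (hh N))\<bar>} <= R N" .
  qed
 qed auto
qed

lemma ln_Z: assumes N: "N >= 1" and w: "w \<in> space (M N)" shows "ln (Z N w) = SS N w + LL N + ln (ZH N w)" "Z N w = YY N w * ZH N w"
proof -
 interpret G: random_edges "M N" N "\<theta> N" W "A N" \<beta> by (rule graph[OF N])
 show f: "Z N w = YY N w * ZH N w" by (rule G.partition_factor[OF w])
 have "ln (Z N w) = ln (YY N w) + ln (ZH N w)" unfolding f using G.Y_bounds(1)[of w] G.Zh_bounds(1)[of w] by (simp add: ln_mult)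
 also have "ln (YY N w) = SS N w + LL N" unfolding G.Y_def SS_def LL_def random_b[OF N] by (simp add: sum.distrib[symmetric] right_diff_distrib)
 finally show "ln (Z N w) = SS N w + LL N + ln (ZH N w)" .
qed

text \<open>The regimes differ only in \<open>\<gamma>\<close>, \<open>\<gamma>'\<close>, the limit of \<open>\<theta>\<close> and the centring.\<close>

theorem partition_clt:
 assumes a: "!!N. N >= 1 ==> 0 <= a N" and a1: "(%N. (a N)^2/uu N) ----> \<gamma>" and a2: "(%N. (a N)^2/v3 N) ----> \<gamma>'"
  and t: "\<theta> ----> \<tau>" and v: "v = \<gamma>*\<beta>^2/4*(W1d - \<tau> * W2d) + \<gamma>'*\<beta>^4/4*(W1/2 - \<tau>*(W2/2))"
  and m: "(%N. a N*(LL N + ln (hh N) - m N)) ----> \<mu>"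
 shows "converges_to_normal M (%N w. a N*(ln (Z N w) - m N)) \<mu> v"
proof -
 have au: "(%N. a N/uu N) ----> 0"
 proof -
  have "(%N. sqrt ((a N)^2/uu N*(1/uu N))) ----> sqrt (\<gamma>*0)"
   by (intro tendsto_real_sqrt tendsto_mult a1 inv_u)
  then have "(%N. sqrt ((a N)^2/uu N*(1/uu N))) ----> 0" by simp
  then show ?thesis
  proof (rule Lim_transform_eventually, intro eventually_1)
   fix N :: nat assume N: "N >= 1"
   have "(a N)^2/uu N*(1/uu N) = (a N/uu N)^2" by (simp add: power2_eq_square)
   then show "sqrt ((a N)^2/uu N*(1/uu N)) = a N/uu N"
    using a[OF N] Nth(1)[OF N] by simp
  qed
 qed
 have V0: "0 <= (a N)^2 * VV N" if N: "N >= 1" for N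
  unfolding VV_def using random_edges.p01[OF graph[OF N]] by (intro mult_nonneg_nonneg sum_nonneg) auto
 have v0: "0 <= v" unfolding v by (rule LIMSEQ_le_const[OF VV_limit[OF a1 a2 t]]) (use V0 in blast)
 show ?thesis
 proof (rule converges_to_normal_slutsky[where X="%N w. a N * SS N w + \<mu>", OF v0])
  show "prob_space (M N)" if "N >= 1" for N using RG[OF that] unfolding random_graph_def by simp
  show "(%w. a N * SS N w + \<mu>) \<in> borel_measurable (M N)" if N: "N >= 1" for N
   unfolding SS_def using random_edges.ind_measurable[OF graph[OF N]]
   by (intro borel_measurable_add borel_measurable_times borel_measurable_sum borel_measurable_diff borel_measurable_const) auto
  show "(%w. a N*(ln (Z N w) - m N)) \<in> borel_measurable (M N)" if N: "N >= 1" for N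
  proof -
   have [measurable]: "YY N \<in> borel_measurable (M N)" "ZH N \<in> borel_measurable (M N)"
    using random_edges.Y_measurable[OF graph[OF N]] random_edges.Zh_measurable[OF graph[OF N]] by auto
   have "(%w. a N*(ln (YY N w * ZH N w) - m N)) \<in> borel_measurable (M N)" by measurable
   then show ?thesis by (rule measurable_cong[THEN iffD2, rotated]) (simp add: ln_Z(2)[OF N])
  qed
  show "(%N. CLINT w|M N. iexp (t*(a N * SS N w + \<mu>))) ----> iexp (t*\<mu>) * of_real (exp (- (v * t^2)/2))" for t
  proof -
   have "(CLINT w|M N. iexp (t*(a N * SS N w + \<mu>))) = iexp (t*\<mu>)*(CLINT w|M N. iexp (t*(a N * SS N w)))" for N
   proof -
    have "iexp (t*(a N * SS N w + \<mu>)) = iexp (t*\<mu>) * iexp (t*(a N * SS N w))" for w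
     unfolding exp_add[symmetric] by (simp add: algebra_simps)
    then show ?thesis by simp
   qed
   then show ?thesis using tendsto_mult[OF tendsto_const char_limit[OF a a1 a2 assms(4) v au, of t]] by simp
  qed
  show "tends_in_prob_0 M (%N w. a N*(ln (Z N w) - m N)-(a N * SS N w + \<mu>))"
   unfolding tends_in_prob_0_def
  proof (intro allI impI)
   fix \<epsilon> :: real assume \<epsilon>: "0 < \<epsilon>"
   define P where "P N = measure (M N) {w\<in>space (M N). \<epsilon>/2 < \<bar>a N*(ln (ZH N w) - ln (hh N))\<bar>}" for N
   have P: "P ----> 0" unfolding P_def
    by (rule ln_ZH_concentrates[OF a au, unfolded tends_in_prob_0_def, rule_format]) (use \<epsilon> in auto)
   have "EV N. \<bar>a N*(LL N + ln (hh N) - m N) - \<mu>\<bar> < \<epsilon>/2"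
    using tendstoD[OF m, of "\<epsilon>/2"] \<epsilon> by (simp add: dist_real_def)
   with eventually_ge_at_top[of 1] have "EV N. measure (M N) {w\<in>space (M N). \<epsilon> < \<bar>a N*(ln (Z N w) - m N)-(a N * SS N w + \<mu>)\<bar>} <= P N"
   proof eventually_elim
    fix N :: nat assume N: "1 <= N" and d: "\<bar>a N*(LL N + ln (hh N) - m N) - \<mu>\<bar> < \<epsilon>/2"
    interpret G: random_edges "M N" N "\<theta> N" W "A N" \<beta> by (rule graph[OF N])
    note zm [measurable] = G.Zh_measurable
    show "measure (M N) {w\<in>space (M N). \<epsilon> < \<bar>a N*(ln (Z N w) - m N)-(a N * SS N w + \<mu>)\<bar>} <= P N"
     unfolding P_def
    proof (rule G.finite_measure_mono)
     show "{w\<in>space (M N). \<epsilon> < \<bar>a N*(ln (Z N w) - m N)-(a N * SS N w + \<mu>)\<bar>} \<subseteq> {w\<in>space (M N). \<epsilon>/2 < \<bar>a N*(ln (ZH N w) - ln (hh N))\<bar>}"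
     proof (intro subsetI CollectI conjI; elim CollectE conjE)
      fix w assume w: "w \<in> space (M N)" and e: "\<epsilon> < \<bar>a N*(ln (Z N w) - m N)-(a N * SS N w + \<mu>)\<bar>"
      have "a N*(ln (Z N w) - m N)-(a N * SS N w + \<mu>) = a N*(ln (ZH N w) - ln (hh N)) + (a N*(LL N + ln (hh N) - m N) - \<mu>)"
       unfolding ln_Z(1)[OF N w] by (simp add: algebra_simps)
      then show "\<epsilon>/2 < \<bar>a N*(ln (ZH N w) - ln (hh N))\<bar>" using e d by linarith
     qed auto
    qed measurable
   qed
   then show "(%N. measure (M N) {w\<in>space (M N). \<epsilon> < \<bar>a N*(ln (Z N w) - m N)-(a N * SS N w + \<mu>)\<bar>}) ----> 0"
    by (intro real_tendsto_sandwich[where f="%_. 0", OF _ _ tendsto_const P]) auto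
  qed
 qed
qed

text \<open>\<open>E Z\<close> is \<open>E Y \<cdot> E Zh\<close> up to a factor \<open>1 + O(1/(N\<theta>))\<close> by \<open>covariance_bound\<close> with \<open>\<eta> = 1/(N\<theta>)\<close>.\<close>

lemma ln_mean_limit:
 assumes a: "!!N. N >= 1 ==> 0 <= a N" and au: "(%N. a N/uu N) ----> 0"
  and a3: "(%N. a N/v3 N) ----> 0" and i3: "(%N. 1/v3 N) ----> 0"
 shows "(%N. a N*(LL N + ln (hh N) - ln (\<integral>w. Z N w \<partial>M N))) ----> 0"
proof -
 obtain C where C: "0 < C" "EV N. htp2 {1..N} (xx N) (kap N) <= (hh N)^2*(1 + C/(uu N)^2)"
  by (rule second_moment)
 have U0: "UU ----> 0" using UU_limit[OF inv_u i3] by simp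
 have aU: "(%N. a N * UU N) ----> 0" using UU_limit[OF au a3] by simp
 define R where "R N = 4*(a N * UU N) + (1 + C)*(a N/uu N)" for N
 have "R ----> 4*0 + (1 + C)*0" unfolding R_def by (intro tendsto_intros aU au)
 then have R: "R ----> 0" by simp
 have "(%N. exp (4 * UU N)) ----> exp (4*0)" by (intro tendsto_intros U0)
 then have evU: "EV N. exp (4 * UU N) < 2" by (rule order_tendstoD) simp
 have evb: "EV N. bb N < 1" by (rule order_tendstoD[OF bb_limit]) simp
 have "(%N. (1 + C)/2*(1/uu N)) ----> (1 + C)/2*0" by (intro tendsto_intros inv_u)
 then have "(%N. (1 + C)/2*(1/uu N)) ----> 0" by simp
 then have evu: "EV N. (1 + C)/2*(1/uu N) < 1/2" by (rule order_tendstoD) simp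
 have "EV N. norm (a N*(LL N + ln (hh N) - ln (\<integral>w. Z N w \<partial>M N))) <= R N"
  using C(2) evU evb evu eventually_ge_at_top[of 1]
 proof eventually_elim
  fix N :: nat
  assume c: "htp2 {1..N} (xx N) (kap N) <= (hh N)^2*(1 + C/(uu N)^2)" and U: "exp (4 * UU N) < 2"
   and b: "bb N < 1" and u2: "(1 + C)/2*(1/uu N) < 1/2" and N: "1 <= N"
  interpret G: random_edges "M N" N "\<theta> N" W "A N" \<beta> by (rule graph[OF N])
  define u where "u = real N*\<theta> N"
  have u: "0 < u" unfolding u_def by (rule Nth(1)[OF N])
  have c1: "coef G.b e <= 1" for e unfolding random_b[OF N] using cc_bounds(2)[OF N, of e] b by simp
  have lY: "\<bar>ln G.EY - LL N\<bar> <= 4 * UU N"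
   using G.ln_EY(1)[OF c1 c1] unfolding random_b[OF N] LL_def UU_def .
  have K: "exp (\<Sum>e\<in>pairs N. G.p e*(exp (coef G.b e)-1)^2) <= 1 + 1"
  proof -
   have "(\<Sum>e\<in>pairs N. G.p e*(exp (coef G.b e)-1)^2) <= 4 * UU N"
    using G.ln_EY(2)[OF c1 c1] unfolding random_b[OF N] UU_def .
   then have "exp (\<Sum>e\<in>pairs N. G.p e*(exp (coef G.b e)-1)^2) <= exp (4 * UU N)" by simp
   then show ?thesis using U by linarith
  qed
  define q where "q = (\<integral>w. YY N w * ZH N w \<partial>M N)/(G.EY * hh N)"
  have "\<bar>q - 1\<bar> <= (1/u*1 + C/u^2/(1/u))/2"
   unfolding q_def
  proof (rule G.covariance_bound[OF ZH_moments(1)[OF N] hh_pos _ _ K])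
   show "(\<integral>w. (ZH N w)^2 \<partial>M N) <= (hh N)^2*(1 + C/u^2)" using c unfolding ZH_moments(2)[OF N] u_def .
  qed (use u in simp)
  also have "\<dots> = (1 + C)/2*(1/u)" using u by (simp add: power2_eq_square field_simps)
  finally have q: "\<bar>q - 1\<bar> <= (1 + C)/2*(1/u)" .
  have lq: "\<bar>ln q\<bar> <= (1 + C)/u"
  proof -
   have "\<bar>q - 1\<bar> <= 1/2" using q u2[folded u_def] by linarith
   then have "\<bar>ln q\<bar> <= 2*\<bar>q - 1\<bar>" by (rule abs_ln_le)
   also have "\<dots> <= 2*((1 + C)/2*(1/u))" by (rule mult_left_mono[OF q]) simp
   also have "\<dots> = (1 + C)/u" using u by (simp add: field_simps)
   finally show ?thesis .
  qed
  have q0: "0 < q" using q u2 unfolding u_def by linarith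
  have EZ: "(\<integral>w. Z N w \<partial>M N) = q*(G.EY * hh N)"
  proof -
   have "(\<integral>w. Z N w \<partial>M N) = (\<integral>w. YY N w * ZH N w \<partial>M N)"
    by (intro Bochner_Integration.integral_cong refl ln_Z(2)[OF N])
   then show ?thesis unfolding q_def using G.EY_pos hh_pos[of N] by simp
  qed
  have "ln (\<integral>w. Z N w \<partial>M N) = ln q + (ln G.EY + ln (hh N))"
   unfolding EZ using q0 G.EY_pos hh_pos[of N] by (simp add: ln_mult)
  then have "\<bar>LL N + ln (hh N) - ln (\<integral>w. Z N w \<partial>M N)\<bar> <= 4 * UU N + (1 + C)/u" using lY lq by linarith
  then have "a N*\<bar>LL N + ln (hh N) - ln (\<integral>w. Z N w \<partial>M N)\<bar> <= a N*(4 * UU N + (1 + C)/u)"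
   using a[OF N] by (rule mult_left_mono)
  also have "\<dots> = R N" unfolding R_def u_def by (simp add: distrib_left mult_ac)
  finally show "norm (a N*(LL N + ln (hh N) - ln (\<integral>w. Z N w \<partial>M N))) <= R N" using a[OF N] by (simp add: abs_mult)
 qed
 then show ?thesis by (rule Lim_null_comparison[OF _ R])
qed

end

section \<open>Centring in the five regimes\<close>

lemma (in riemann_graphon) graphon_integrable:
 "integrable U2 W" "integrable U2 (%p. (W p)^2)"
proof -
 interpret finite_measure "U2" using C2.finite_meas unfolding sq .
 have m: "W \<in> borel_measurable U2" using gW unfolding graphon_def by simp
 have b: "\<bar>W p\<bar> <= 1" "\<bar>(W p)\<^sup>2\<bar> <= 1" if "p \<in> space U2" for p
  using W01[of p] that by (auto simp: space_restrict_space power_le_one)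
 show "integrable U2 W" "integrable U2 (%p. (W p)^2)"
  using m b by (auto intro!: integrable_const_bound[where B=1] AE_I2 borel_measurable_power)
qed

lemma (in riemann_graphon) holder_grid:
 assumes H: "holder_graphon \<alpha> W"
 obtains C where "0 < C" "!!N. N >= 1 ==> \<bar>(\<Sum>i=1..N. \<Sum>j=1..N. W (grid N i j))/(real N)^2 - (\<integral>p. W p \<partial>U2)\<bar> <= C * real N powr (- \<alpha>)"
proof -
 obtain C where C: "0 < C" and Hc: "!!x y x' y'. x \<in> {0..1} ==> y \<in> {0..1} ==> x' \<in> {0..1} ==> y' \<in> {0..1} ==>
   \<bar>W (x, y) - W (x', y')\<bar> <= C * sqrt ((x - x')^2 + (y - y')^2) powr \<alpha>"
  using H unfolding holder_graphon_def by blast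
 have \<alpha>: "0 < \<alpha>" using H unfolding holder_graphon_def by simp
 show ?thesis
 proof (rule that[of "C * sqrt 2 powr \<alpha>"])
  show "0 < C * sqrt 2 powr \<alpha>" using C by simp
  fix N :: nat assume N: "N >= 1"
  let ?S = "U2"
  define K where "K = C*(sqrt 2/real N) powr \<alpha>"
  interpret finite_measure ?S using C2.finite_meas unfolding sq .
  have st: "(\<integral>p. C2.step (%x. x) N p \<partial>?S) = (\<Sum>i=1..N. \<Sum>j=1..N. W (grid N i j))/(real N)^2"
   using C2.integral_step[OF N, of "%x. x"] unfolding sq
   by (simp add: sum.cartesian_product case_prod_unfold measure_hcell2[OF N] sum_divide_distrib)
  have ist: "integrable ?S (C2.step (%x. x) N)" using C2.integrable_step[OF N] unfolding sq .
  have close: "AE p in ?S. norm (C2.step (%x. x) N p - W p) <= K"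
   using C2.AE_cell[OF N] unfolding sq
  proof (rule AE_mp, intro AE_I2 impI)
   fix p assume p: "p \<in> space ?S" and "\<exists>c\<in>{1..N} \<times> {1..N}. p \<in> (case c of (i, j) => hcell N i \<times> hcell N j)"
   then obtain i j where ij: "i \<in> {1..N}" "j \<in> {1..N}" and h: "fst p \<in> hcell N i" "snd p \<in> hcell N j" by (auto simp: mem_Times_iff)
   have e: "C2.step (%x. x) N p = W (grid N i j)"
    using C2.step_eval[OF N, of "(i, j)" p "%x. x"] ij h by (simp add: mem_Times_iff)
   have d: "\<bar>real i/real N - fst p\<bar> <= 1/real N" "\<bar>real j/real N - snd p\<bar> <= 1/real N"
    using h unfolding hcell_def by (auto simp: diff_divide_distrib)
   have pu: "fst p \<in> {0..1}" "snd p \<in> {0..1}" using p by (auto simp: space_restrict_space)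
   have "(real i/real N - fst p)^2 + (real j/real N - snd p)^2 <= (1/real N)^2 + (1/real N)^2"
    using d by (intro add_mono) (auto simp: abs_le_square_iff[symmetric])
   also have "\<dots> = (sqrt 2/real N)^2" by (simp add: power_divide)
   finally have s: "sqrt ((real i/real N - fst p)^2 + (real j/real N - snd p)^2) <= sqrt 2/real N"
    by (intro real_le_lsqrt) auto
   have "\<bar>W (grid N i j) - W (fst p, snd p)\<bar> <= C * sqrt ((real i/real N - fst p)^2 + (real j/real N - snd p)^2) powr \<alpha>"
    by (intro Hc corner01[OF N] ij pu)
   also have "\<dots> <= K" unfolding K_def using C \<alpha> s by (intro mult_left_mono powr_mono2) auto
   finally show "norm (C2.step (%x. x) N p - W p) <= K" unfolding e by simp
  qed
  have m1: "measure ?S (space ?S) = 1"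
  proof -
   have "measure ?S (space ?S) = measure lebesgue (cbox (0,0) (1,1) :: (real \<times> real) set)"
    unfolding sq[symmetric] by (simp add: space_restrict_space measure_restrict_space)
   also have "\<dots> = 1" by (simp add: measure_completion content_Pair)
   finally show ?thesis .
  qed
  have "\<bar>(\<integral>p. C2.step (%x. x) N p \<partial>?S)-(\<integral>p. W p \<partial>?S)\<bar> = \<bar>\<integral>p. C2.step (%x. x) N p - W p \<partial>?S\<bar>"
   using ist graphon_integrable by simp
  also have "\<dots> <= (\<integral>p. norm (C2.step (%x. x) N p - W p) \<partial>?S)" using integral_norm_bound[of ?S "%p. C2.step (%x. x) N p - W p"] by simp
  also have "\<dots> <= (\<integral>p. K \<partial>?S)"
   by (rule integral_mono_AE[OF _ _ close]) (use ist graphon_integrable in auto)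
  also have "\<dots> = K" using m1 by simp
  also have "K = C * sqrt 2 powr \<alpha> * real N powr (- \<alpha>)"
  proof -
   have "(sqrt 2/real N) powr \<alpha> = sqrt 2 powr \<alpha>/real N powr \<alpha>" by (rule powr_divide)
   then show ?thesis unfolding K_def by (simp add: powr_minus divide_inverse)
  qed
  finally show "\<bar>(\<Sum>i=1..N. \<Sum>j=1..N. W (grid N i j))/(real N)^2 - (\<integral>p. W p \<partial>?S)\<bar> <= C * sqrt 2 powr \<alpha> * real N powr (- \<alpha>)"
   unfolding st .
 qed
qed

context sparse_graphs begin

lemma diagonal_integrable:
 "integrable U (%x. W (x, x))" "integrable U (%x. (W (x, x))^2)"
proof -
 interpret C1: cell_family "%x. W (x, x)" 0 1 "%N. {1..N}" icell hcell "%N i. real i/real N"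
  by (rule cell_family_1D[OF RD]) (use W01 in auto)
 have fm: "finite_measure (lebesgue_on {0..1::real})" using C1.finite_meas by (simp add: cbox_interval)
 have m: "(%x. W (x, x)) \<in> borel_measurable U" using C1.meas by (simp add: cbox_interval)
 have b: "\<bar>W (x, x)\<bar> <= 1" "\<bar>(W (x, x))\<^sup>2\<bar> <= 1" if "x \<in> space U" for x
  using W01[of "(x, x)"] that by (auto simp: space_restrict_space power_le_one)
 show "integrable U (%x. W (x, x))" "integrable U (%x. (W (x, x))^2)"
  using m b by (auto intro!: finite_measure.integrable_const_bound[OF fm, where B=1] AE_I2 borel_measurable_power)
qed

lemma diagonal_variance: "(\<integral>x. W (x, x)*(1-t * W (x, x)) \<partial>U) = W1d - t * W2d"
proof -
 have "(\<integral>x. W (x, x)*(1-t * W (x, x)) \<partial>U) = (\<integral>x. W (x, x) - t*(W (x, x))^2 \<partial>U)"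
  by (intro Bochner_Integration.integral_cong) (auto simp: power2_eq_square algebra_simps)
 then show ?thesis using diagonal_integrable by simp
qed

lemma limit_mean_eq: "limit_mean W \<beta> c = \<beta>/2 * W1d - \<beta>^4/(24 * c^3) * W1 + (logdet \<beta> - \<beta>^2/4 * W2)"
proof -
 have "(\<integral>p. W p*(\<beta>^2/(6 * c^3) + W p) \<partial>U2) = (\<integral>p. \<beta>\<^sup>2/(6 * c^3) * W p + (W p)^2 \<partial>U2)"
  by (intro Bochner_Integration.integral_cong) (auto simp: power2_eq_square algebra_simps)
 also have "\<dots> = \<beta>^2/(6 * c^3) * W1 + W2" using graphon_integrable by simp
 finally have e: "(\<integral>p. W p*(\<beta>^2/(6 * c^3) + W p) \<partial>U2) = \<beta>^2/(6 * c^3) * W1 + W2" .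
 have f: "\<beta>^2/4*(\<beta>^2/(6 * c^3) * W1 + W2) = \<beta>^4/(24 * c^3) * W1 + \<beta>^2/4 * W2"
  by (simp add: distrib_left power4_eq_xxxx power2_eq_square)
 show ?thesis unfolding limit_mean_def e f logdet_def by simp
qed

lemma loop_center: "(%N. bb N/2*\<theta> N * D1 N) ----> \<beta>/2 * W1d"
proof (rule Lim_transform_eventually[OF tendsto_mult[OF tendsto_const loop1] eventually_1])
 fix N :: nat assume N: "N >= 1"
 then show "\<beta>/2*(D1 N/real N) = bb N/2*\<theta> N * D1 N"
  using theta[OF N] unfolding bb_def by simp
qed

lemma sqrt_inverse: "0 < u ==> sqrt (1/u) = sqrt u/u"
 by (simp add: real_sqrt_divide field_simps)

lemma ln_Z_dense:
 assumes r: "(%N. 1/(real N*(\<theta> N)^2)) ----> 0" and t: "\<theta> ----> t"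
 shows "converges_to_normal M (%N \<omega>. sqrt (uu N)*(ln (Z N \<omega>) - ln (\<integral>\<omega>'. Z N \<omega>' \<partial>M N))) 0
  (\<beta>^2/4*(\<integral>x. W (x, x)*(1-t * W (x, x)) \<partial>U))"
proof (rule partition_clt[where \<gamma>=1 and \<gamma>'=0 and \<tau>=t])
 show "(%N. (sqrt (uu N))^2/uu N) ----> 1"
 proof (rule Lim_transform_eventually[OF tendsto_const eventually_1])
  fix N :: nat assume N: "N >= 1"
  show "1 = (sqrt (uu N))^2/uu N" using N theta[OF N] by simp
 qed
 show "(%N. (sqrt (uu N))^2/v3 N) ----> 0"
 proof (rule Lim_transform_eventually[OF r eventually_1])
  fix N :: nat assume N: "N >= 1"
  show "1/(real N*(\<theta> N)^2) = (sqrt (uu N))^2/v3 N"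
   using Nth(1)[OF N] N by (simp add: power2_eq_square power3_eq_cube)
 qed
 show "\<theta> ----> t" by (rule t)
 show "\<beta>^2/4*(\<integral>x. W (x, x)*(1-t * W (x, x)) \<partial>U) = 1*\<beta>^2/4*(W1d - t * W2d) + 0*\<beta>^4/4*(W1/2 - t*(W2/2))"
  unfolding diagonal_variance by simp
 have sq0: "(%N. sqrt (1/uu N)) ----> 0" using tendsto_real_sqrt[OF inv_u] by simp
 show "(%N. sqrt (uu N)*(LL N + ln (hh N) - ln (\<integral>\<omega>'. Z N \<omega>' \<partial>M N))) ----> 0"
 proof (rule ln_mean_limit)
  show "(%N. sqrt (uu N)/uu N) ----> 0"
  proof (rule Lim_transform_eventually[OF sq0 eventually_1])
   fix N :: nat assume N: "N >= 1"
   show "sqrt (1/uu N) = sqrt (uu N)/uu N"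
    by (rule sqrt_inverse[OF Nth(1)[OF N]])
  qed
  have "(%N. 1/(real N*(\<theta> N)^2) * sqrt (1/uu N)) ----> 0*0" by (intro tendsto_mult r sq0)
  then have "(%N. 1/(real N*(\<theta> N)^2) * sqrt (1/uu N)) ----> 0" by simp
  then show "(%N. sqrt (uu N)/v3 N) ----> 0"
  proof (rule Lim_transform_eventually[OF _ eventually_1])
   fix N :: nat assume N: "N >= 1"
   define u where "u = real N*\<theta> N"
   have u: "0 < u" unfolding u_def by (rule Nth(1)[OF N])
   have "1/(real N*(\<theta> N)^2) * sqrt (1/u) = 1/(real N*(\<theta> N)^2)*(sqrt u/u)"
    by (simp only: sqrt_inverse[OF u])
   also have "\<dots> = sqrt u/v3 N" unfolding u_def by (simp add: power2_eq_square power3_eq_cube)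
   finally show "1/(real N*(\<theta> N)^2) * sqrt (1/uu N) = sqrt (uu N)/v3 N" unfolding u_def .
  qed
  have "(%N. 1/(real N*(\<theta> N)^2)*(1/uu N)) ----> 0*0" by (intro tendsto_mult r inv_u)
  then show "(%N. 1/v3 N) ----> 0" by (simp add: power2_eq_square power3_eq_cube mult_ac)
  show "0 <= sqrt (uu N)" if "N >= 1" for N using Nth(1)[OF that] by simp
 qed
 show "0 <= sqrt (uu N)" if "N >= 1" for N using Nth(1)[OF that] by simp
qed

definition sc :: "nat => real" where "sc N = real N*\<theta> N powr (3/2)"

lemma sc: assumes N: "N >= 1" shows "0 < sc N" "(sc N)^2 = (real N)^2*\<theta> N^3" "sc N = real N*\<theta> N * sqrt (\<theta> N)"
proof -
 have t: "0 < \<theta> N" using theta[OF N] by simp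
 have "\<theta> N powr (3/2) = \<theta> N powr (1 + 1/2)" by simp
 also have "\<dots> = \<theta> N * sqrt (\<theta> N)" using t by (simp only: powr_add powr_one powr_half_sqrt less_imp_le)
 finally show e: "sc N = real N*\<theta> N * sqrt (\<theta> N)" unfolding sc_def by simp
 show "0 < sc N" unfolding e using Nth(1)[OF N] t by simp
 show "(sc N)^2 = (real N)^2*\<theta> N^3" unfolding e power_mult_distrib using t by (simp add: power2_eq_square power3_eq_cube)
qed

lemma sc_clt:
 assumes g: "(%N. real N*(\<theta> N)^2) ----> g" and t: "\<theta> ----> 0"
  and m: "(%N. sc N*(LL N + ln (hh N) - m N)) ----> 0"
 shows "converges_to_normal M (%N \<omega>. real N*\<theta> N powr (3/2)*(ln (Z N \<omega>) - m N)) 0 (\<beta>^4/8 * W1 + \<beta>^2 * g/4 * W1d)"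
 unfolding sc_def[symmetric]
proof (rule partition_clt[where \<gamma>=g and \<gamma>'=1 and \<tau>=0])
 show "0 <= sc N" if "N >= 1" for N using sc(1)[OF that] by simp
 show "(%N. (sc N)^2/uu N) ----> g"
 proof (rule Lim_transform_eventually[OF g eventually_1])
  fix N :: nat assume N: "N >= 1"
  show "real N*(\<theta> N)^2 = (sc N)^2/uu N"
   unfolding sc(2)[OF N] using N theta[OF N] by (simp add: power2_eq_square power3_eq_cube)
 qed
 show "(%N. (sc N)^2/v3 N) ----> 1"
 proof (rule Lim_transform_eventually[OF tendsto_const eventually_1])
  fix N :: nat assume N: "N >= 1"
  show "1 = (sc N)^2/v3 N" unfolding sc(2)[OF N] using N theta[OF N] by simp
 qed
qed (use t m in simp_all)

lemma sc_over_u: assumes t: "\<theta> ----> 0" shows "(%N. sc N/uu N) ----> 0"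
proof (rule Lim_transform_eventually[OF _ eventually_1])
 show "(%N. sqrt (\<theta> N)) ----> 0" using tendsto_real_sqrt[OF t] by simp
 show "sqrt (\<theta> N) = sc N/uu N" if N: "N >= 1" for N unfolding sc(3)[OF N] using N theta[OF N] by simp
qed

lemma ln_Z_intermediate:
 assumes g: "(%N. real N*(\<theta> N)^2) ----> g" and t: "\<theta> ----> 0" and i3: "(%N. 1/v3 N) ----> 0"
 shows "converges_to_normal M (%N \<omega>. real N*\<theta> N powr (3/2)*(ln (Z N \<omega>) - ln (\<integral>\<omega>'. Z N \<omega>' \<partial>M N))) 0 (\<beta>^4/8 * W1 + \<beta>^2 * g/4 * W1d)"
proof (rule sc_clt[OF g t], rule ln_mean_limit[OF _ sc_over_u[OF t] _ i3])
 show "0 <= sc N" if "N >= 1" for N using sc(1)[OF that] by simp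
 have "(%N. sqrt (1/v3 N)) ----> 0" using tendsto_real_sqrt[OF i3] by simp
 then show "(%N. sc N/v3 N) ----> 0"
 proof (rule Lim_transform_eventually[OF _ eventually_1])
  fix N :: nat assume N: "N >= 1"
  have "sqrt (1/(sc N)^2) = 1/sc N" using sc(1)[OF N] by (simp add: real_sqrt_divide)
  also have "\<dots> = sc N/(sc N)^2" using sc(1)[OF N] by (simp add: power2_eq_square)
  finally show "sqrt (1/v3 N) = sc N/v3 N" unfolding sc(2)[OF N] .
 qed
qed

abbreviation gridsum :: "nat => real" where
 "gridsum N \<equiv> (\<Sum>i=1..N. \<Sum>j=1..N. W (grid N i j))"

lemma lncosh_quartic: "(%N. (lc N - (bb N)^2/2)/bb N^4) ----> - 1/12"
proof -
 have l: "((%x::real. (ln (cosh x) - x^2/2)/x^4) \<longlongrightarrow> - 1/12) (at_right 0)"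
  unfolding cosh_def by simp real_asymp
 show ?thesis by (rule filterlim_compose[OF l bb_at_right])
qed

text \<open>The fourth-order term of \<open>ln cosh b = b\<^sup>2/2 - b\<^sup>4/12 + \<dots>\<close> survives because \<open>N\<^sup>2\<theta>b\<^sup>4\<close> has a positive limit.\<close>

lemma critical_center:
 assumes i3: "(%N. 1/v3 N) ----> 1/c^3"
 shows "(%N. LL N + ln (hh N) - \<beta>^2/(4*(real N)^2*\<theta> N) * gridsum N) ----> limit_mean W \<beta> c"
proof -
 have "(%N. (bb N/2*\<theta> N * D1 N
   + (((lc N - (bb N)^2/2)/bb N^4)*(\<beta>^4*(1/v3 N))*(E1 N/(real N)^2)
     - \<beta>\<^sup>2/4*(D1 N/real N)*(1/uu N))) + ln (hh N))
  ----> (\<beta>/2 * W1d + ((- 1/12)*(\<beta>^4*(1/c^3))*(W1/2) - \<beta>^2/4 * W1d*0)) + (logdet \<beta> - \<beta>^2/4 * W2)"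
  by (intro tendsto_add tendsto_diff tendsto_mult tendsto_const loop_center lncosh_quartic i3 edge1 loop1 inv_u ln_hh_limit)
 then show ?thesis
 proof (rule tendsto_eventually_1', goal_cases)
  case 1 show ?case unfolding limit_mean_eq by simp
  case (2 N)
  note N = 2
  define n D E l where "n = real N" and "D = D1 N" and "E = E1 N" and "l = lc N"
  have n: "0 < n" "0 < \<theta> N" using N theta[OF N] unfolding n_def by auto
  have b: "0 < bb N" by (rule Nth(2)[OF N])
  have bn: "bb N = \<beta>/(n*\<theta> N)" unfolding bb_def n_def ..
  have k: "\<beta>^4*(1/(n^2*\<theta> N^3))*(E/n^2) = bb N^4*(\<theta> N * E)"
   unfolding bn using n by (simp add: power_divide power_mult_distrib divide_simps power2_eq_square power3_eq_cube power4_eq_xxxx)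
  have "(l - (bb N)^2/2)/bb N^4*(\<beta>^4*(1/(n^2*\<theta> N^3)))*(E/n^2) = (l - (bb N)^2/2)/bb N^4*(bb N^4*(\<theta> N * E))"
   unfolding mult.assoc k[unfolded mult.assoc] ..
  also have "\<dots> = (l - (bb N)^2/2)*(\<theta> N * E)" using b by simp
  finally have 1: "(l - (bb N)^2/2)/bb N^4*(\<beta>^4*(1/(n^2*\<theta> N^3)))*(E/n^2) = l*\<theta> N * E - (bb N)^2/2*\<theta> N * E" by (simp add: left_diff_distrib)
  have 2: "(bb N)^2/2*\<theta> N * E + \<beta>^2/4*(D/n)*(1/(n*\<theta> N)) = \<beta>^2/(4 * n^2*\<theta> N)*(D + 2 * E)"
   unfolding bn using n by (simp add: field_simps power2_eq_square)
  have 3: "gridsum N = D + 2 * E" unfolding D_def E_def by (rule edgesum_eq)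
  show ?case
   unfolding 3
   unfolding LL_eq[OF N] D_def[symmetric] E_def[symmetric] n_def[symmetric] l_def[symmetric] 1 using 2 by simp
 qed
qed

lemma ln_Z_critical:
 assumes c: "0 < c" and i3: "(%N. 1/v3 N) ----> 1/c^3" and t: "\<theta> ----> 0"
  and d: "(%N. m N - \<beta>^2/(4*(real N)^2*\<theta> N) * gridsum N) ----> 0"
 shows "converges_to_normal M (%N \<omega>. ln (Z N \<omega>) - m N) (limit_mean W \<beta> c) (\<beta>^4/(8 * c^3) * W1)"
proof -
 have "converges_to_normal M (%N \<omega>. 1*(ln (Z N \<omega>) - m N)) (limit_mean W \<beta> c) (\<beta>^4/(8 * c^3) * W1)"
 proof (rule partition_clt[where \<gamma>=0 and \<gamma>'="1/c^3" and \<tau>=0])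
  have "(%N. (LL N + ln (hh N) - \<beta>^2/(4*(real N)^2*\<theta> N) * gridsum N)-(m N - \<beta>^2/(4*(real N)^2*\<theta> N) * gridsum N)) ----> limit_mean W \<beta> c - 0"
   by (rule tendsto_diff[OF critical_center[OF i3] d])
  then show "(%N. 1*(LL N + ln (hh N) - m N)) ----> limit_mean W \<beta> c" by (simp add: add_diff_eq)
 qed (use i3 inv_u t in \<open>simp_all add: mult.commute\<close>)
 then show ?thesis by simp
qed

lemma upper_sum: "(\<Sum>i=1..N. \<Sum>j\<in>{i<..N}. W (grid N i j)) = E1 N"
proof -
 have "edges {1..N} = Sigma {1..N} (%i. {i<..N})" by (auto simp: edges_def)
 then show ?thesis unfolding edgesum_def by (simp add: sum.Sigma case_prod_unfold)
qed

lemma ln_Z_sparse: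
 assumes n2: "(%N. real N*(\<theta> N)^2) ----> 0" and t: "\<theta> ----> 0" and s: "sc ----> 0"
  and d: "(%N. sc N*(m N - \<theta> N * lc N * E1 N)) ----> 0"
 shows "converges_to_normal M (%N \<omega>. real N*\<theta> N powr (3/2)*(ln (Z N \<omega>) - m N)) 0 (\<beta>^4/8 * W1)"
proof -
 have "(%N. sc N*(LL N + ln (hh N) - m N)) ----> 0"
 proof (rule Lim_transform_eventually[OF _ eventually_1])
  have "(%N. sc N*(bb N/2*\<theta> N * D1 N + ln (hh N)) - sc N*(m N - \<theta> N * lc N * E1 N))
   ----> 0*(\<beta>/2 * W1d + (logdet \<beta> - \<beta>^2/4 * W2)) - 0"
   by (intro tendsto_diff tendsto_mult tendsto_add s loop_center ln_hh_limit d)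
  then show "(%N. sc N*(bb N/2*\<theta> N * D1 N + ln (hh N)) - sc N*(m N - \<theta> N * lc N * E1 N)) ----> 0" by simp
  fix N :: nat assume N: "N >= 1"
  show "sc N*(bb N/2*\<theta> N * D1 N + ln (hh N)) - sc N*(m N - \<theta> N * lc N * E1 N) = sc N*(LL N + ln (hh N) - m N)"
   unfolding LL_eq[OF N] by (simp add: algebra_simps)
 qed
 from sc_clt[OF n2 t this] show ?thesis by simp
qed

text \<open>The error of the Riemann sum is \<open>O(N\<^sup>-\<^sup>\<alpha>)\<close>, and \<open>N \<theta>\<^sup>1\<^sup>/\<^sup>2 N\<^sup>-\<^sup>\<alpha> \<le> (\<theta>N\<^sup>2\<^sup>/\<^sup>3)\<^sup>1\<^sup>/\<^sup>2\<close> tends to 0 for \<open>\<alpha> \<ge> 2/3\<close>.\<close>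

lemma sparse_holder_center:
 assumes H: "holder_graphon \<alpha> W" and \<alpha>: "2/3 <= \<alpha>" and q: "(%N. \<theta> N * real N powr (2/3)) ----> 0" and t: "\<theta> ----> 0"
 shows "(%N. sc N*((real N)^2*\<theta> N/2 * lc N * W1 - \<theta> N * lc N * E1 N)) ----> 0"
proof -
 obtain C where C: "0 < C" "!!N. N >= 1 ==> \<bar>gridsum N/(real N)^2 - W1\<bar> <= C * real N powr (- \<alpha>)"
  by (rule holder_grid[OF H], rule that)
 define X where "X N = real N * sqrt (\<theta> N)*(gridsum N/(real N)^2 - W1)" for N
 have X: "X ----> 0"
 proof (rule Lim_null_comparison[OF eventually_1])
  have "(%N. C * sqrt (\<theta> N * real N powr (2/3))) ----> C * sqrt 0" by (intro tendsto_intros q)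
  then show "(%N. C * sqrt (\<theta> N * real N powr (2/3))) ----> 0" by simp
  fix N :: nat assume N: "N >= 1"
  have "norm (X N) = real N * sqrt (\<theta> N)*\<bar>gridsum N/(real N)^2 - W1\<bar>" unfolding X_def using theta[OF N] by (simp add: abs_mult)
  also have "\<dots> <= real N * sqrt (\<theta> N)*(C * real N powr (- \<alpha>))" using theta[OF N] by (intro mult_left_mono C(2)[OF N]) auto
  also have "\<dots> = C * sqrt (\<theta> N)*(real N powr 1 * real N powr (- \<alpha>))" by simp
  also have "\<dots> = C * sqrt (\<theta> N) * real N powr (1-\<alpha>)" by (simp only: powr_add[symmetric]) simp
  also have "\<dots> <= C * sqrt (\<theta> N) * real N powr (1/3)" using C(1) theta[OF N] \<alpha> N by (intro mult_left_mono powr_mono) auto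
  also have "real N powr (1/3) = sqrt (real N powr (2/3))" using N by (simp add: powr_half_sqrt[symmetric] powr_powr)
  finally show "norm (X N) <= C * sqrt (\<theta> N * real N powr (2/3))" by (simp add: real_sqrt_mult)
 qed
 have "(%N. - (lc N/(bb N)^2)*(\<beta>^2/2)*(X N - sqrt (\<theta> N)*(D1 N/real N))) ----> - (1/2)*(\<beta>^2/2)*(0 - sqrt 0 * W1d)"
  by (intro tendsto_mult tendsto_minus tendsto_diff tendsto_const lncosh_limit X tendsto_real_sqrt t loop1)
 then show ?thesis
 proof (rule tendsto_eventually_1', goal_cases)
  case 1 show ?case by simp
  case (2 N)
  note N = 2
  define n D E l r where "n = real N" and "D = D1 N" and "E = E1 N" and "l = lc N" and "r = sqrt (\<theta> N)"
  have n: "0 < n" "0 < \<theta> N" using N theta[OF N] unfolding n_def by auto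
  have bn: "bb N = \<beta>/(n*\<theta> N)" unfolding bb_def n_def ..
  have 3: "gridsum N = D + 2 * E" unfolding D_def E_def by (rule edgesum_eq)
  have "- (l/(bb N)^2)*(\<beta>^2/2) = - l*(n^2*(\<theta> N)^2/2)" unfolding bn using n beta by (simp add: power_divide power_mult_distrib)
  moreover have "n * r*((D + 2 * E)/n^2 - W1) - r*(D/n) = n * r*(2*(E/n^2) - W1)"
   using n by (simp add: add_divide_distrib power2_eq_square algebra_simps)
  moreover have "- l*(n^2*(\<theta> N)^2/2)*(n * r*(2*(E/n^2) - W1)) = n*\<theta> N * r*(n^2*\<theta> N/2 * l * W1 - \<theta> N * l * E)"
  proof -
   have "n^2*(E/n^2) = E" using n by simp
   then have "- l*(n^2*(\<theta> N)^2/2)*(n * r*(2*(E/n^2) - W1)) = - l*(\<theta> N)^2 * n * r*(E - n^2 * W1/2)"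
    by (simp add: algebra_simps)
   then show ?thesis by (simp add: algebra_simps power2_eq_square)
  qed
  ultimately show ?case
   unfolding X_def 3
   unfolding sc(3)[OF N] n_def[symmetric] D_def[symmetric] E_def[symmetric] l_def[symmetric] r_def[symmetric] by simp
 qed
qed

lemma critical_holder_center:
 assumes H: "holder_graphon \<alpha> W" and \<alpha>: "2/3 < \<alpha>" and q: "(%N. 1/(\<theta> N * real N powr (2/3))) ----> q"
 shows "(%N. \<beta>\<^sup>2/(4*\<theta> N) * W1 - \<beta>^2/(4*(real N)^2*\<theta> N) * gridsum N) ----> 0"
proof -
 obtain C where C: "0 < C" "!!N. N >= 1 ==> \<bar>gridsum N/(real N)^2 - W1\<bar> <= C * real N powr (- \<alpha>)"
  by (rule holder_grid[OF H], rule that)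
 show ?thesis
 proof (rule Lim_null_comparison[OF eventually_1])
  have p0: "(%N. real N powr (2/3 - \<alpha>)) ----> 0" using \<alpha> by real_asymp
  have "(%N. \<beta>\<^sup>2/4 * C*(1/(\<theta> N * real N powr (2/3))) * real N powr (2/3 - \<alpha>)) ----> \<beta>\<^sup>2/4 * C * q*0"
   by (intro tendsto_mult tendsto_const q p0)
  then show "(%N. \<beta>\<^sup>2/4 * C*(1/(\<theta> N * real N powr (2/3))) * real N powr (2/3 - \<alpha>)) ----> 0" by simp
  fix N :: nat assume N: "N >= 1"
  have t: "0 < \<theta> N" using theta[OF N] by simp
  have "\<beta>^2/(4*\<theta> N) * W1 - \<beta>^2/(4*(real N)^2*\<theta> N) * gridsum N = \<beta>^2/(4*\<theta> N)*(W1 - gridsum N/(real N)^2)"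
   by (simp add: right_diff_distrib mult_ac)
  then have "norm (\<beta>^2/(4*\<theta> N) * W1 - \<beta>^2/(4*(real N)^2*\<theta> N) * gridsum N) = \<beta>^2/(4*\<theta> N)*\<bar>gridsum N/(real N)^2 - W1\<bar>"
   using t by (simp add: abs_mult abs_minus_commute)
  also have "\<dots> <= \<beta>^2/(4*\<theta> N)*(C * real N powr (- \<alpha>))" using t by (intro mult_left_mono C(2)[OF N]) auto
  also have "real N powr (- \<alpha>) = real N powr (2/3 - \<alpha>)/real N powr (2/3)" using N by (simp add: powr_diff[symmetric])
  finally show "norm (\<beta>^2/(4*\<theta> N) * W1 - \<beta>^2/(4*(real N)^2*\<theta> N) * gridsum N) <= \<beta>^2/4 * C*(1/(\<theta> N * real N powr (2/3))) * real N powr (2/3 - \<alpha>)"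
   by (simp add: mult_ac)
 qed
qed

end

lemma powr_minus_half: "N >= 1 ==> real N powr - (1/2) = 1/sqrt (real N)"
 by (simp add: powr_minus_divide powr_half_sqrt)

lemma powr_minus_two_thirds: "N >= 1 ==> real N powr - (2/3) = 1/real N powr (2/3)"
 by (simp add: powr_minus_divide)

lemma two_thirds_cubed: assumes "N >= 1" shows "(real N powr (2/3))^3 = (real N)^2"
proof -
 have "(real N powr (2/3))^3 = real N powr (2/3 + (2/3 + 2/3))"
  unfolding power3_eq_cube powr_add by simp
 also have "\<dots> = real N powr 2" by simp
 also have "\<dots> = (real N)^2" using assms by (intro powr_numeral) simp
 finally show ?thesis .
qed

lemma inverse_two_thirds:
 assumes "(%N. 1/(\<theta> N * real N powr (2/3))) ----> l"
 shows "(%N. 1/(real N*\<theta> N)) ----> 0" "(%N. 1/((real N)^2*\<theta> N^3)) ----> l^3"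
proof -
 have "(%N. real N powr - (1/3)) ----> 0" by real_asymp
 from tendsto_mult[OF assms this] have "(%N. 1/(\<theta> N * real N powr (2/3)) * real N powr - (1/3)) ----> 0" by simp
 then show "(%N. 1/(real N*\<theta> N)) ----> 0"
 proof (rule tendsto_eventually_1)
  fix N :: nat assume "N >= 1"
  then have "real N powr (2/3) * real N powr (1/3) = real N" by (simp add: powr_add[symmetric])
  then show "1/(\<theta> N * real N powr (2/3)) * real N powr - (1/3) = 1/(real N*\<theta> N)" by (simp add: powr_minus_divide mult_ac)
 qed
 from tendsto_power[OF assms, of 3] show "(%N. 1/((real N)^2*\<theta> N^3)) ----> l^3"
  by (rule tendsto_eventually_1) (simp add: power_divide power_mult_distrib two_thirds_cubed mult.commute)
qed

lemma two_thirds_zero: assumes "(%N. \<theta> N * real N powr (2/3)) ----> l" shows "\<theta> ----> 0"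
proof -
 have "(%N. real N powr - (2/3)) ----> 0" by real_asymp
 from tendsto_mult[OF assms this] have "(%N. \<theta> N * real N powr (2/3) * real N powr - (2/3)) ----> 0" by simp
 then show ?thesis by (rule tendsto_eventually_1) (simp add: powr_minus_divide)
qed

lemma dense_of_inverse:
 assumes "!!N. N >= 1 ==> 0 < \<theta> N" and "(%N. 1/(real N*\<theta> N)) ----> 0"
 shows "filterlim (%N. real N*\<theta> N) at_top sequentially"
proof -
 have "EV N. 0 < 1/(real N*\<theta> N)"
  using eventually_ge_at_top[of 1] by eventually_elim (use assms(1) in auto)
 from filterlim_inverse_at_top[OF assms(2) this] show ?thesis by simp
qed

lemma lim_power2: "f ----> l ==> (%N. (f N)^2) ----> l\<^sup>2" for f :: "nat => real" by (rule tendsto_power)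

theorem theorem5p2:
  fixes W :: "real \<times> real \<Rightarrow> real"
    and \<beta> :: real
    and \<theta> :: "nat \<Rightarrow> real"
    and M :: "nat \<Rightarrow> 'a measure"
    and A :: "nat \<Rightarrow> nat \<Rightarrow> nat \<Rightarrow> 'a \<Rightarrow> bool"
    and Z :: "nat \<Rightarrow> 'a \<Rightarrow> real"
    and w :: real
  defines "Z \<equiv> (\<lambda>N. partition_fun \<beta> N (\<theta> N) (A N))"
    and "w \<equiv> (\<integral>p. W p \<partial>lebesgue_on unit_square)"
  assumes "graphon W"
    and "W riemann_integrable_on unit_square"
    and "(\<lambda>x. W (x, x)) riemann_integrable_on {0..1}"
    and "w > 0"
    and "0 < \<beta>" and "\<beta> < 1 / graphon_op_norm W"
    and "\<And>N. N \<ge> 1 \<Longrightarrow> 0 < \<theta> N \<and> \<theta> N < 1"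
    and "\<And>N. N \<ge> 1 \<Longrightarrow> random_graph (M N) N (\<theta> N) W (A N)"
  shows
    "(\<forall>t\<in>{0..1}. (\<lambda>N. real N powr (-1/2)) \<lless> \<theta> \<and> \<theta> \<longlonglongrightarrow> t \<longrightarrow>
        converges_to_normal M
          (\<lambda>N \<omega>. sqrt (real N * \<theta> N) * (ln (Z N \<omega>) - ln (\<integral>\<omega>'. Z N \<omega>' \<partial>M N)))
          0 (\<beta>\<^sup>2 / 4 * (\<integral>x. W (x, x) * (1 - t * W (x, x)) \<partial>lebesgue_on {0..1})))
     \<and>
     (\<forall>c>0. \<theta> \<simeq> (\<lambda>N. c * real N powr (-1/2)) \<longrightarrow>
        converges_to_normal M
          (\<lambda>N \<omega>. real N * \<theta> N powr (3/2) * (ln (Z N \<omega>) - ln (\<integral>\<omega>'. Z N \<omega>' \<partial>M N)))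
          0 (\<beta> ^ 4 / 8 * w + \<beta>\<^sup>2 * c\<^sup>2 / 4 * (\<integral>x. W (x, x) \<partial>lebesgue_on {0..1})))
     \<and>
     ((\<lambda>N. real N powr (-2/3)) \<lless> \<theta> \<and> \<theta> \<lless> (\<lambda>N. real N powr (-1/2)) \<longrightarrow>
        converges_to_normal M
          (\<lambda>N \<omega>. real N * \<theta> N powr (3/2) * (ln (Z N \<omega>) - ln (\<integral>\<omega>'. Z N \<omega>' \<partial>M N)))
          0 (\<beta> ^ 4 / 8 * w))
     \<and>
     (\<forall>c>0. \<theta> \<simeq> (\<lambda>N. c * real N powr (-2/3)) \<longrightarrow>
        converges_to_normal M
          (\<lambda>N \<omega>. ln (Z N \<omega>) - \<beta>\<^sup>2 / (4 * (real N)\<^sup>2 * \<theta> N) *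
                   (\<Sum>i=1..N. \<Sum>j=1..N. W (real i / real N, real j / real N)))
          (limit_mean W \<beta> c) (\<beta> ^ 4 / (8 * c ^ 3) * w) \<and>
        (\<forall>\<alpha>>2/3. holder_graphon \<alpha> W \<longrightarrow>
           converges_to_normal M
             (\<lambda>N \<omega>. ln (Z N \<omega>) - \<beta>\<^sup>2 / (4 * \<theta> N) * w)
             (limit_mean W \<beta> c) (\<beta> ^ 4 / (8 * c ^ 3) * w)))
     \<and>
     ((\<lambda>N. real N powr (-1)) \<lless> \<theta> \<and> \<theta> \<lless> (\<lambda>N. real N powr (-2/3)) \<longrightarrow>
        converges_to_normal M
          (\<lambda>N \<omega>. real N * \<theta> N powr (3/2) *
             (ln (Z N \<omega>) - \<theta> N * ln (cosh (\<beta> / (real N * \<theta> N))) *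
                (\<Sum>i=1..N. \<Sum>j\<in>{i<..N}. W (real i / real N, real j / real N))))
          0 (\<beta> ^ 4 / 8 * w) \<and>
        (\<forall>\<alpha>\<ge>2/3. holder_graphon \<alpha> W \<longrightarrow>
           converges_to_normal M
             (\<lambda>N \<omega>. real N * \<theta> N powr (3/2) *
                (ln (Z N \<omega>) - (real N)\<^sup>2 * \<theta> N / 2 * ln (cosh (\<beta> / (real N * \<theta> N))) * w))
             0 (\<beta> ^ 4 / 8 * w)))"
proof -
 note gW = assms(3) and RW = assms(4) and RD = assms(5) and beta = assms(7) and bop = assms(8) and th = assms(9) and RG = assms(10)
 interpret riemann_graphon W by unfold_locales (rule gW RW)+
 have sub: "\<beta> * graphon_op_norm W < 1"
 proof (cases "graphon_op_norm W = 0")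
  case False
  then have "0 < graphon_op_norm W" using graphon_op_norm_nonneg by simp
  then show ?thesis using bop by (simp add: pos_less_divide_eq)
 qed simp
 have loc: "sparse_graphs W \<beta> \<theta> M A" if "(%N. 1/(real N*\<theta> N)) ----> 0"
  by unfold_locales (use beta sub th RG RD dense_of_inverse[OF _ that] in auto)
 have isq: "(%N. 1/sqrt (real N)) ----> 0" by real_asymp
 have case23: "converges_to_normal M (%N \<omega>. real N*\<theta> N powr (3/2)*(ln (Z N \<omega>) - ln (\<integral>\<omega>'. Z N \<omega>' \<partial>M N)))
     0 (\<beta>^4/8 * w + \<beta>^2 * c^2/4*(\<integral>x. W (x, x) \<partial>U))"
  if q: "(%N. \<theta> N * sqrt (real N)) ----> c" and u: "(%N. 1/(real N*\<theta> N)) ----> 0" and i3: "(%N. 1/((real N)^2*\<theta> N^3)) ----> 0" for c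
 proof -
  from tendsto_mult[OF q isq] have "(%N. \<theta> N * sqrt (real N)*(1/sqrt (real N))) ----> 0" by simp
  then have t: "\<theta> ----> 0" by (rule tendsto_eventually_1) simp
  interpret sparse_graphs W \<beta> \<theta> M A by (rule loc[OF u])
  show ?thesis unfolding Z_def w_def
  proof (rule ln_Z_intermediate[OF _ t i3])
   show "(%N. real N*(\<theta> N)^2) ----> c^2" using lim_power2[OF q] by (simp add: power_mult_distrib mult.commute)
  qed
 qed
 show ?thesis
 proof (intro conjI, goal_cases)
  case 1
  show ?case
  proof (intro ballI impI, elim conjE, goal_cases)
   case (1 t)
   from 1(2) have q: "(%N. 1/(sqrt (real N)*\<theta> N)) ----> 0"
    unfolding much_less_def by (rule tendsto_eventually_1) (simp add: powr_minus_half)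
   from tendsto_mult[OF q isq] have "(%N. 1/(sqrt (real N)*\<theta> N)*(1/sqrt (real N))) ----> 0" by simp
   then have u: "(%N. 1/(real N*\<theta> N)) ----> 0" by (rule tendsto_eventually_1) simp
   interpret sparse_graphs W \<beta> \<theta> M A by (rule loc[OF u])
   have "(%N. 1/(real N*(\<theta> N)^2)) ----> 0" using lim_power2[OF q] by (simp add: power_divide power_mult_distrib)
   then show ?case unfolding Z_def by (rule ln_Z_dense[OF _ 1(3)])
  qed
 next
  case 2
  show ?case
  proof (intro allI impI, goal_cases)
   case (1 c)
   from tendsto_mult[OF tendsto_const[of c] 1(2)[unfolded asymp_equal_def]]
   have "(%N. c*(\<theta> N/(c * real N powr - (1/2)))) ----> c" by simp
   then have q: "(%N. \<theta> N * sqrt (real N)) ----> c"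
    by (rule tendsto_eventually_1) (use 1(1) in \<open>simp add: powr_minus_half\<close>)
   have qi: "(%N. 1/(\<theta> N * sqrt (real N))) ----> 1/c" by (intro tendsto_divide tendsto_const q) (use 1(1) in simp)
   from tendsto_mult[OF qi isq] have "(%N. 1/(\<theta> N * sqrt (real N))*(1/sqrt (real N))) ----> 0" by simp
   then have u: "(%N. 1/(real N*\<theta> N)) ----> 0" by (rule tendsto_eventually_1) (simp add: mult.commute)
   from tendsto_mult[OF lim_power2[OF qi] u]
   have "(%N. (1/(\<theta> N * sqrt (real N)))^2*(1/(real N*\<theta> N))) ----> 0" by simp
   then have "(%N. 1/((real N)^2*\<theta> N^3)) ----> 0"
    by (rule tendsto_eventually_1) (simp add: power_divide power_mult_distrib, simp add: power2_eq_square power3_eq_cube mult_ac)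
   then show ?case by (rule case23[OF q u])
  qed
 next
  case 3
  show ?case
  proof (intro impI, elim conjE, goal_cases)
   case 1
   from 1(2) have q: "(%N. \<theta> N * sqrt (real N)) ----> 0"
    unfolding much_less_def by (rule tendsto_eventually_1) (simp add: powr_minus_half)
   from 1(1) have k: "(%N. 1/(\<theta> N * real N powr (2/3))) ----> 0"
    unfolding much_less_def by (rule tendsto_eventually_1) (simp add: powr_minus_two_thirds mult.commute)
   show ?case using case23[OF q inverse_two_thirds(1)[OF k]] inverse_two_thirds(2)[OF k] by simp
  qed
 next
  case 4
  show ?case
  proof (intro allI impI, goal_cases)
   case (1 c)
   from tendsto_mult[OF tendsto_const[of c] 1(2)[unfolded asymp_equal_def]]
   have "(%N. c*(\<theta> N/(c * real N powr - (2/3)))) ----> c" by simp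
   then have q: "(%N. \<theta> N * real N powr (2/3)) ----> c"
    by (rule tendsto_eventually_1) (use 1(1) in \<open>simp add: powr_minus_two_thirds\<close>)
   have k: "(%N. 1/(\<theta> N * real N powr (2/3))) ----> 1/c" by (intro tendsto_divide tendsto_const q) (use 1(1) in simp)
   interpret sparse_graphs W \<beta> \<theta> M A by (rule loc[OF inverse_two_thirds(1)[OF k]])
   note crit = ln_Z_critical[OF 1(1) inverse_two_thirds(2)[OF k, unfolded power_one_over] two_thirds_zero[OF q]]
   show ?case unfolding Z_def w_def
   proof (intro conjI allI impI)
    fix \<alpha> :: real assume "2/3 < \<alpha>" and H: "holder_graphon \<alpha> W"
    then show "converges_to_normal M (%N \<omega>. ln (partition_fun \<beta> N (\<theta> N) (A N) \<omega>) - \<beta>^2/(4*\<theta> N) * W1) (limit_mean W \<beta> c) (\<beta>^4/(8 * c^3) * W1)"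
     by (intro crit critical_holder_center[OF H _ k])
   qed (rule crit, simp)
  qed
 next
  case 5
  show ?case
  proof (intro impI, elim conjE, goal_cases)
   case 1
   from 1(1) have u: "(%N. 1/(real N*\<theta> N)) ----> 0"
    unfolding much_less_def by (rule tendsto_eventually_1) (simp add: powr_minus_divide)
   from 1(2) have q: "(%N. \<theta> N * real N powr (2/3)) ----> 0"
    unfolding much_less_def by (rule tendsto_eventually_1) (simp add: powr_minus_two_thirds)
   note t = two_thirds_zero[OF q]
   have "(%N. real N powr - (1/3)) ----> 0" by real_asymp
   from tendsto_mult[OF lim_power2[OF q] this] have "(%N. (\<theta> N * real N powr (2/3))^2 * real N powr - (1/3)) ----> 0" by simp
   then have n2: "(%N. real N*(\<theta> N)^2) ----> 0"
   proof (rule tendsto_eventually_1)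
    fix N :: nat assume N: "N >= 1"
    have "(real N powr (2/3))\<^sup>2 * real N powr - (1/3) = real N"
     unfolding power2_eq_square powr_add[symmetric] using N by simp
    then show "(\<theta> N * real N powr (2/3))\<^sup>2 * real N powr - (1/3) = real N*(\<theta> N)^2"
     unfolding power_mult_distrib by (simp add: mult_ac)
   qed
   interpret sparse_graphs W \<beta> \<theta> M A by (rule loc[OF u])
   have "(%N. sqrt ((\<theta> N * real N powr (2/3))^3)) ----> 0" using tendsto_real_sqrt[OF tendsto_power[OF q, of 3]] by simp
   then have s: "sc ----> 0"
   proof (rule tendsto_eventually_1)
    fix N :: nat assume N: "N >= 1"
    have "(\<theta> N * real N powr (2/3))^3 = (sc N)^2" unfolding power_mult_distrib two_thirds_cubed[OF N] sc(2)[OF N] by simp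
    then show "sqrt ((\<theta> N * real N powr (2/3))^3) = sc N" using sc(1)[OF N] by simp
   qed
   note sparse = ln_Z_sparse[OF n2 t s]
   show ?case unfolding Z_def w_def upper_sum bb_def[symmetric]
   proof (intro conjI allI impI)
    fix \<alpha> :: real assume "2/3 <= \<alpha>" and H: "holder_graphon \<alpha> W"
    then show "converges_to_normal M (%N \<omega>. real N*\<theta> N powr (3/2)*(ln (partition_fun \<beta> N (\<theta> N) (A N) \<omega>) - (real N)^2*\<theta> N/2 * lc N * W1)) 0 (\<beta>^4/8 * W1)"
     by (intro sparse sparse_holder_center[OF H _ q t])
   qed (rule sparse, simp)
  qed
 qed
qed

end
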